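(* Suppose $\Bbbk$ is a field. Let $\mathcal C$ be a $\mathcal K$-category and let $S:\mathcal C\to\mathcal C$ be a (right) Serre $\mathcal K$-functor. Then $H^\bullet_*(S):H^\bullet_*(\mathcal C)\to H^\bullet_*(\mathcal C)$ is a (right) Serre $\mathbf{gr}$-functor. Moreover, $H^\bullet_*$ reflects (right) Serre functors: for a $\mathcal K$-category $\mathcal C$, if $H^\bullet_*(\mathcal C)$ admits a (right) Serre $\mathbf{gr}$-functor, then $\mathcal C$ admits a (right) Serre $\mathcal K$-functor.
   Context: $\mathcal K$ is the homotopy category of complexes of $\Bbbk$-modules, a closed symmetric monoidal category with tensor product of complexes, unit $\Bbbk$, signed symmetry $x\otimes y\mapsto(-1)^{\deg x\deg y}y\otimes x$, and inner hom $\underline{\mathcal K}(M,N)$ the usual hom-complex. $\mathbf{gr}$ is the closed symmetric monoidal category of $\mathbb Z$-graded $\Bbbk$-modules, with unit $\Bbbk$, signed symmetry, and $\underline{\mathbf{gr}}(X,Y)^n=\prod_d\mathrm{Hom}_{\Bbbk}(X^d,Y^{d+n})$. The cohomology functor $H^\bullet:\mathcal K\to\mathbf{gr}$ is lax symmetric monoidal via the Künneth maps; $H^\bullet_*$ denotes the induced base change from $\mathcal K$-categories and $\mathcal K$-functors to $\mathbf{gr}$-categories and $\mathbf{gr}$-functors: $H^\bullet_*(\mathcal C)$ has the objects of $\mathcal C$ and morphisms $H^\bullet(\mathcal C(X,Y))$. For a closed symmetric monoidal category $\mathcal V$ with unit $\mathbf 1$ and inner hom $\underline{\mathcal V}$,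 a right Serre functor of a $\mathcal V$-category $\mathcal C$ is a $\mathcal V$-functor $S:\mathcal C\to\mathcal C$ (written $Y\mapsto YS$) for which there are isomorphisms $\psi_{X,Y}:\mathcal C(X,YS)\to\underline{\mathcal V}(\mathcal C(Y,X),\mathbf 1)$ in $\mathcal V$, $\mathcal V$-natural in $X$ and $Y$. It is a Serre functor if moreover it is a self-equivalence of the $\mathcal V$-category $\mathcal C$. The statement is asserted both for "right Serre" and for "Serre". *)

theory Defs
  imports "HOL-Algebra.Module" "HOL-Algebra.AbelCoset"
begin

text \<open>
  The ground ring \<open>k\<close> is a ring record, and modules are those of the library locale
  \<open>module\<close>. Tensor products and inner homs of objects with elements of
  type \<open>'a\<close> have elements of other types, so \<open>\<K>\<close> and \<open>gr\<close> are given as families of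
  constructions that are polymorphic in the element types, and not as one monoidal category
  living on a fixed type. Linear maps are extensional (\<open>undefined\<close> off their domain), so that
  equality of morphisms is equality in the logic.

  Conventions: the composition of a \<open>\<V>\<close>-category is a morphism
  \<open>\<C>(Y,Z) \<otimes> \<C>(X,Y) \<rightarrow> \<C>(X,Z)\<close>; differentials have degree \<open>1\<close> and act from the left:
  \<open>d(x \<otimes> y) = dx \<otimes> y + (-1)^(deg x) x \<otimes> dy\<close> and \<open>d f = d \<circ> f - (-1)^(deg f) f \<circ> d\<close>;
  currying turns \<open>M \<otimes> N \<rightarrow> P\<close> into \<open>M \<rightarrow> \<V>(N,P)\<close>.
\<close>

type_synonym ('k, 'a) gmod = "int \<Rightarrow> ('k, 'a) module"

record ('k, 'a) cochain =
  Und :: "('k, 'a) gmod"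
  Diff :: "int \<Rightarrow> 'a \<Rightarrow> 'a"

text \<open>A tensor is a coset of formal combinations of pairs of homogeneous elements;
  \<open>(i, x, j, y)\<close> stands for the pair of \<open>x\<close> in degree \<open>i\<close> and \<open>y\<close> in degree \<open>j\<close>.\<close>

type_synonym ('k, 'a, 'b) tens = "(int \<times> 'a \<times> int \<times> 'b \<Rightarrow> 'k) set"

record ('x, 'y, 'm) arrow =
  Dom :: 'x
  Cod :: 'y
  Map :: 'm

type_synonym ('k, 'a, 'b) gr_arrow =
  "(('k, 'a) gmod, ('k, 'b) gmod, int \<Rightarrow> 'a \<Rightarrow> 'b) arrow"

text \<open>The \<open>Map\<close> of an arrow of \<open>\<K>\<close> is a homotopy class of chain maps.\<close>

type_synonym ('k, 'a, 'b) K_arrow =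
  "(('k, 'a) cochain, ('k, 'b) cochain, (int \<Rightarrow> 'a \<Rightarrow> 'b) set) arrow"

text \<open>The data of an enriched category: \<open>Comp C X Y Z\<close> is the composition
  \<open>Hom C Y Z \<otimes> Hom C X Y \<rightarrow> Hom C X Z\<close>, and \<open>Iden C X\<close> the unit
  \<open>1 \<rightarrow> Hom C X X\<close>.\<close>

record ('o, 'v, 'c, 'i) enriched =
  Obj :: "'o set"
  Hom :: "'o \<Rightarrow> 'o \<Rightarrow> 'v"
  Comp :: "'o \<Rightarrow> 'o \<Rightarrow> 'o \<Rightarrow> 'c"
  Iden :: "'o \<Rightarrow> 'i"

record ('o, 'p, 'm) efunctor =
  OMap :: "'o \<Rightarrow> 'p"
  HMap :: "'o \<Rightarrow> 'o \<Rightarrow> 'm"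

type_synonym ('o, 'k, 'a) gr_cat =
  "('o, ('k, 'a) gmod, ('k, ('k, 'a, 'a) tens, 'a) gr_arrow, ('k, 'k, 'a) gr_arrow) enriched"

type_synonym ('o, 'k, 'a) K_cat =
  "('o, ('k, 'a) cochain, ('k, ('k, 'a, 'a) tens, 'a) K_arrow, ('k, 'k, 'a) K_arrow) enriched"

type_synonym ('o, 'p, 'k, 'a, 'b) gr_fun = "('o, 'p, ('k, 'a, 'b) gr_arrow) efunctor"

type_synonym ('o, 'p, 'k, 'a, 'b) K_fun = "('o, 'p, ('k, 'a, 'b) K_arrow) efunctor"

text \<open>The fields \<open>mult\<close> and \<open>one\<close>, which module records inherit from ring records,
  play no role in a module.\<close>

definition quot_module :: "('k, 'a) module \<Rightarrow> 'a set \<Rightarrow> ('k, 'a set) module" where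
  "quot_module M N =
     \<lparr>carrier = a_rcosets\<^bsub>M\<^esub> N, mult = undefined, one = undefined,
      zero = N, add = (\<lambda>A B. A <+>\<^bsub>M\<^esub> B),
      smult = (\<lambda>a A. \<Union>x\<in>A. N +>\<^bsub>M\<^esub> (a \<odot>\<^bsub>M\<^esub> x))\<rparr>"

definition signed :: "('k, 'a) module \<Rightarrow> int \<Rightarrow> 'a \<Rightarrow> 'a" where
  "signed M n x = (if even n then x else \<ominus>\<^bsub>M\<^esub> x)"

definition gid :: "('k, 'a) gmod \<Rightarrow> int \<Rightarrow> 'a \<Rightarrow> 'a" where
  "gid X n = (\<lambda>x\<in>carrier (X n). x)"

definition gcomp ::
  "('k, 'a) gmod \<Rightarrow> (int \<Rightarrow> 'b \<Rightarrow> 'c) \<Rightarrow> (int \<Rightarrow> 'a \<Rightarrow> 'b) \<Rightarrow> int \<Rightarrow> 'a \<Rightarrow> 'c" where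
  "gcomp X g f n = (\<lambda>x\<in>carrier (X n). g n (f n x))"

definition gr_id :: "('k, 'a) gmod \<Rightarrow> ('k, 'a, 'a) gr_arrow" where
  "gr_id X = \<lparr>Dom = X, Cod = X, Map = gid X\<rparr>"

definition gr_comp ::
  "('k, 'b, 'c) gr_arrow \<Rightarrow> ('k, 'a, 'b) gr_arrow \<Rightarrow> ('k, 'a, 'c) gr_arrow"
  (infixr \<open>\<cdot>\<^sub>g\<close> 65) where
  "G \<cdot>\<^sub>g F = \<lparr>Dom = Dom F, Cod = Cod G, Map = gcomp (Dom F) (Map G) (Map F)\<rparr>"

context
  fixes k :: "'k ring"
begin

section \<open>Modules\<close>

definition linmaps :: "('k, 'a) module \<Rightarrow> ('k, 'b) module \<Rightarrow> ('a \<Rightarrow> 'b) set" where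
  "linmaps M N = {f \<in> carrier M \<rightarrow>\<^sub>E carrier N.
     (\<forall>x\<in>carrier M. \<forall>y\<in>carrier M. f (x \<oplus>\<^bsub>M\<^esub> y) = f x \<oplus>\<^bsub>N\<^esub> f y) \<and>
     (\<forall>a\<in>carrier k. \<forall>x\<in>carrier M. f (a \<odot>\<^bsub>M\<^esub> x) = a \<odot>\<^bsub>N\<^esub> f x)}"

definition free_module :: "'g set \<Rightarrow> ('k, 'g \<Rightarrow> 'k) module" where
  "free_module G =
     \<lparr>carrier = {u. range u \<subseteq> carrier k \<and> finite {g. u g \<noteq> \<zero>\<^bsub>k\<^esub>} \<and> {g. u g \<noteq> \<zero>\<^bsub>k\<^esub>} \<subseteq> G},
      mult = undefined, one = undefined,
      zero = (\<lambda>_. \<zero>\<^bsub>k\<^esub>), add = (\<lambda>u v g. u g \<oplus>\<^bsub>k\<^esub> v g),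
      smult = (\<lambda>a u g. a \<otimes>\<^bsub>k\<^esub> u g)\<rparr>"

definition generator :: "'g \<Rightarrow> 'g \<Rightarrow> 'k" where
  "generator g = (\<lambda>h. if h = g then \<one>\<^bsub>k\<^esub> else \<zero>\<^bsub>k\<^esub>)"

definition generated_submodule :: "('k, 'a) module \<Rightarrow> 'a set \<Rightarrow> 'a set" where
  "generated_submodule M A = \<Inter> {N. submodule N k M \<and> A \<subseteq> N}"


section \<open>Graded modules\<close>

definition gr_obj :: "('k, 'a) gmod \<Rightarrow> bool" where
  "gr_obj X \<longleftrightarrow> (\<forall>n. module k (X n))"

definition gmaps :: "('k, 'a) gmod \<Rightarrow> ('k, 'b) gmod \<Rightarrow> (int \<Rightarrow> 'a \<Rightarrow> 'b) set" where
  "gmaps X Y = {f. \<forall>n. f n \<in> linmaps (X n) (Y n)}"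

definition gunit :: "('k, 'k) gmod" where
  "gunit n =
     \<lparr>carrier = (if n = 0 then carrier k else {\<zero>\<^bsub>k\<^esub>}), mult = mult k, one = one k,
      zero = zero k, add = add k, smult = mult k\<rparr>"

text \<open>\<open>(X \<otimes> Y)\<^sup>n = \<Oplus>\<^bsub>i+j=n\<^esub> X\<^sup>i \<otimes>\<^bsub>k\<^esub> Y\<^sup>j\<close>, presented as a whole by generators and relations.\<close>

definition tens_gens ::
  "('k, 'a) gmod \<Rightarrow> ('k, 'b) gmod \<Rightarrow> int \<Rightarrow> (int \<times> 'a \<times> int \<times> 'b) set" where
  "tens_gens X Y n =
     {(i, x, j, y). i + j = n \<and> x \<in> carrier (X i) \<and> y \<in> carrier (Y j)}"

definition tens_free ::
  "('k, 'a) gmod \<Rightarrow> ('k, 'b) gmod \<Rightarrow> int \<Rightarrow> ('k, int \<times> 'a \<times> int \<times> 'b \<Rightarrow> 'k) module" where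
  "tens_free X Y n = free_module (tens_gens X Y n)"

definition tens_rels ::
  "('k, 'a) gmod \<Rightarrow> ('k, 'b) gmod \<Rightarrow> int \<Rightarrow> (int \<times> 'a \<times> int \<times> 'b \<Rightarrow> 'k) set" where
  "tens_rels X Y n = generated_submodule (tens_free X Y n)
    ({generator (i, x \<oplus>\<^bsub>X i\<^esub> x', j, y) \<ominus>\<^bsub>tens_free X Y n\<^esub>
        (generator (i, x, j, y) \<oplus>\<^bsub>tens_free X Y n\<^esub> generator (i, x', j, y)) | i x x' j y.
        i + j = n \<and> x \<in> carrier (X i) \<and> x' \<in> carrier (X i) \<and> y \<in> carrier (Y j)} \<union>
     {generator (i, x, j, y \<oplus>\<^bsub>Y j\<^esub> y') \<ominus>\<^bsub>tens_free X Y n\<^esub>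
        (generator (i, x, j, y) \<oplus>\<^bsub>tens_free X Y n\<^esub> generator (i, x, j, y')) | i x j y y'.
        i + j = n \<and> x \<in> carrier (X i) \<and> y \<in> carrier (Y j) \<and> y' \<in> carrier (Y j)} \<union>
     {generator (i, a \<odot>\<^bsub>X i\<^esub> x, j, y) \<ominus>\<^bsub>tens_free X Y n\<^esub>
        (a \<odot>\<^bsub>tens_free X Y n\<^esub> generator (i, x, j, y)) | a i x j y.
        i + j = n \<and> a \<in> carrier k \<and> x \<in> carrier (X i) \<and> y \<in> carrier (Y j)} \<union>
     {generator (i, x, j, a \<odot>\<^bsub>Y j\<^esub> y) \<ominus>\<^bsub>tens_free X Y n\<^esub>
        (a \<odot>\<^bsub>tens_free X Y n\<^esub> generator (i, x, j, y)) | a i x j y.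
        i + j = n \<and> a \<in> carrier k \<and> x \<in> carrier (X i) \<and> y \<in> carrier (Y j)})"

definition gtens :: "('k, 'a) gmod \<Rightarrow> ('k, 'b) gmod \<Rightarrow> ('k, ('k, 'a, 'b) tens) gmod" where
  "gtens X Y n = quot_module (tens_free X Y n) (tens_rels X Y n)"

definition ptens ::
  "('k, 'a) gmod \<Rightarrow> ('k, 'b) gmod \<Rightarrow> int \<Rightarrow> 'a \<Rightarrow> int \<Rightarrow> 'b \<Rightarrow> ('k, 'a, 'b) tens" where
  "ptens X Y i x j y =
     tens_rels X Y (i + j) +>\<^bsub>tens_free X Y (i + j)\<^esub> generator (i, x, j, y)"

text \<open>The linear extension to \<open>X \<otimes> Y\<close> of \<open>x \<otimes> y \<mapsto> b i x j y\<close>. It is used only for \<open>b\<close>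
  which are bilinear for each \<open>i\<close>, \<open>j\<close> with values in \<open>P (i + j)\<close>; then the result does not
  depend on the representative chosen by \<open>SOME\<close>.\<close>

definition tens_lift ::
  "('k, 'a) gmod \<Rightarrow> ('k, 'b) gmod \<Rightarrow> ('k, 'c) gmod \<Rightarrow> (int \<Rightarrow> 'a \<Rightarrow> int \<Rightarrow> 'b \<Rightarrow> 'c) \<Rightarrow>
     int \<Rightarrow> ('k, 'a, 'b) tens \<Rightarrow> 'c" where
  "tens_lift X Y P b n = (\<lambda>t\<in>carrier (gtens X Y n).
     let u = SOME u. u \<in> t in
     finsum (P n) (\<lambda>(i, x, j, y). u (i, x, j, y) \<odot>\<^bsub>P n\<^esub> b i x j y) {g. u g \<noteq> \<zero>\<^bsub>k\<^esub>})"

definition tens_map ::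
  "('k, 'a) gmod \<Rightarrow> ('k, 'b) gmod \<Rightarrow> ('k, 'c) gmod \<Rightarrow> ('k, 'd) gmod \<Rightarrow>
     (int \<Rightarrow> 'a \<Rightarrow> 'c) \<Rightarrow> (int \<Rightarrow> 'b \<Rightarrow> 'd) \<Rightarrow>
     int \<Rightarrow> ('k, 'a, 'b) tens \<Rightarrow> ('k, 'c, 'd) tens" where
  "tens_map X Y X' Y' f g =
     tens_lift X Y (gtens X' Y') (\<lambda>i x j y. ptens X' Y' i (f i x) j (g j y))"

definition tens_assoc ::
  "('k, 'a) gmod \<Rightarrow> ('k, 'b) gmod \<Rightarrow> ('k, 'c) gmod \<Rightarrow>
     int \<Rightarrow> ('k, ('k, 'a, 'b) tens, 'c) tens \<Rightarrow> ('k, 'a, ('k, 'b, 'c) tens) tens" where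
  "tens_assoc X Y Z =
     tens_lift (gtens X Y) Z (gtens X (gtens Y Z)) (\<lambda>m t l z.
       tens_lift X Y (\<lambda>m. gtens X (gtens Y Z) (m + l))
         (\<lambda>i x j y. ptens X (gtens Y Z) i x (j + l) (ptens Y Z j y l z)) m t)"

definition tens_sym ::
  "('k, 'a) gmod \<Rightarrow> ('k, 'b) gmod \<Rightarrow> int \<Rightarrow> ('k, 'a, 'b) tens \<Rightarrow> ('k, 'b, 'a) tens" where
  "tens_sym X Y = tens_lift X Y (gtens Y X)
     (\<lambda>i x j y. signed (gtens Y X (i + j)) (i * j) (ptens Y X j y i x))"

text \<open>The inverses \<open>X \<rightarrow> k \<otimes> X\<close> and \<open>X \<rightarrow> X \<otimes> k\<close> of the unit isomorphisms.\<close>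

definition tens_linv :: "('k, 'a) gmod \<Rightarrow> int \<Rightarrow> 'a \<Rightarrow> ('k, 'k, 'a) tens" where
  "tens_linv X n = (\<lambda>x\<in>carrier (X n). ptens gunit X 0 \<one>\<^bsub>k\<^esub> n x)"

definition tens_rinv :: "('k, 'a) gmod \<Rightarrow> int \<Rightarrow> 'a \<Rightarrow> ('k, 'a, 'k) tens" where
  "tens_rinv X n = (\<lambda>x\<in>carrier (X n). ptens X gunit n x 0 \<one>\<^bsub>k\<^esub>)"

definition gihom :: "('k, 'a) gmod \<Rightarrow> ('k, 'b) gmod \<Rightarrow> ('k, int \<Rightarrow> 'a \<Rightarrow> 'b) gmod" where
  "gihom X Y n =
     \<lparr>carrier = {f. \<forall>p. f p \<in> linmaps (X p) (Y (p + n))},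
      mult = undefined, one = undefined,
      zero = (\<lambda>p. \<lambda>x\<in>carrier (X p). \<zero>\<^bsub>Y (p + n)\<^esub>),
      add = (\<lambda>f g p. \<lambda>x\<in>carrier (X p). f p x \<oplus>\<^bsub>Y (p + n)\<^esub> g p x),
      smult = (\<lambda>a f p. \<lambda>x\<in>carrier (X p). a \<odot>\<^bsub>Y (p + n)\<^esub> f p x)\<rparr>"

definition gcurry ::
  "('k, 'a) gmod \<Rightarrow> ('k, 'b) gmod \<Rightarrow> (int \<Rightarrow> ('k, 'a, 'b) tens \<Rightarrow> 'c) \<Rightarrow>
     int \<Rightarrow> 'a \<Rightarrow> int \<Rightarrow> 'b \<Rightarrow> 'c" where
  "gcurry X Y f n = (\<lambda>x\<in>carrier (X n). \<lambda>p. \<lambda>y\<in>carrier (Y p). f (n + p) (ptens X Y n x p y))"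

text \<open>Composition \<open>gihom Y Z \<otimes> gihom X Y \<rightarrow> gihom X Z\<close> of inner homs.\<close>

definition gicomp ::
  "('k, 'a) gmod \<Rightarrow> ('k, 'b) gmod \<Rightarrow> ('k, 'c) gmod \<Rightarrow>
     int \<Rightarrow> ('k, int \<Rightarrow> 'b \<Rightarrow> 'c, int \<Rightarrow> 'a \<Rightarrow> 'b) tens \<Rightarrow> int \<Rightarrow> 'a \<Rightarrow> 'c" where
  "gicomp X Y Z = tens_lift (gihom Y Z) (gihom X Y) (gihom X Z)
     (\<lambda>i g j f p. \<lambda>x\<in>carrier (X p). g (p + j) (f p x))"

text \<open>Functoriality of \<open>gihom X Y\<close> in \<open>Y\<close> (along \<open>g\<close>) and in \<open>X\<close> (along \<open>f\<close>,
  defined on \<open>X'\<close>).\<close>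

definition gipost ::
  "('k, 'a) gmod \<Rightarrow> ('k, 'b) gmod \<Rightarrow> (int \<Rightarrow> 'b \<Rightarrow> 'c) \<Rightarrow>
     int \<Rightarrow> (int \<Rightarrow> 'a \<Rightarrow> 'b) \<Rightarrow> int \<Rightarrow> 'a \<Rightarrow> 'c" where
  "gipost X Y g n =
     (\<lambda>h\<in>carrier (gihom X Y n). \<lambda>p. \<lambda>x\<in>carrier (X p). g (p + n) (h p x))"

definition gipre ::
  "('k, 'c) gmod \<Rightarrow> ('k, 'a) gmod \<Rightarrow> ('k, 'b) gmod \<Rightarrow> (int \<Rightarrow> 'c \<Rightarrow> 'a) \<Rightarrow>
     int \<Rightarrow> (int \<Rightarrow> 'a \<Rightarrow> 'b) \<Rightarrow> int \<Rightarrow> 'c \<Rightarrow> 'b" where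
  "gipre X' X Y f n =
     (\<lambda>h\<in>carrier (gihom X Y n). \<lambda>p. \<lambda>x\<in>carrier (X' p). h p (f p x))"


section \<open>The category \<open>gr\<close>\<close>

definition gr_hom :: "('k, 'a) gmod \<Rightarrow> ('k, 'b) gmod \<Rightarrow> ('k, 'a, 'b) gr_arrow set" where
  "gr_hom X Y = {F. Dom F = X \<and> Cod F = Y \<and> Map F \<in> gmaps X Y}"

definition gr_tens ::
  "('k, 'a, 'c) gr_arrow \<Rightarrow> ('k, 'b, 'd) gr_arrow \<Rightarrow>
     ('k, ('k, 'a, 'b) tens, ('k, 'c, 'd) tens) gr_arrow" (infixr \<open>\<otimes>\<^sub>g\<close> 70) where
  "F \<otimes>\<^sub>g G =
     \<lparr>Dom = gtens (Dom F) (Dom G), Cod = gtens (Cod F) (Cod G),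
      Map = tens_map (Dom F) (Dom G) (Cod F) (Cod G) (Map F) (Map G)\<rparr>"

definition gr_assoc ::
  "('k, 'a) gmod \<Rightarrow> ('k, 'b) gmod \<Rightarrow> ('k, 'c) gmod \<Rightarrow>
     ('k, ('k, ('k, 'a, 'b) tens, 'c) tens, ('k, 'a, ('k, 'b, 'c) tens) tens) gr_arrow" where
  "gr_assoc X Y Z =
     \<lparr>Dom = gtens (gtens X Y) Z, Cod = gtens X (gtens Y Z), Map = tens_assoc X Y Z\<rparr>"

definition gr_sym ::
  "('k, 'a) gmod \<Rightarrow> ('k, 'b) gmod \<Rightarrow> ('k, ('k, 'a, 'b) tens, ('k, 'b, 'a) tens) gr_arrow" where
  "gr_sym X Y = \<lparr>Dom = gtens X Y, Cod = gtens Y X, Map = tens_sym X Y\<rparr>"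

definition gr_linv :: "('k, 'a) gmod \<Rightarrow> ('k, 'a, ('k, 'k, 'a) tens) gr_arrow" where
  "gr_linv X = \<lparr>Dom = X, Cod = gtens gunit X, Map = tens_linv X\<rparr>"

definition gr_rinv :: "('k, 'a) gmod \<Rightarrow> ('k, 'a, ('k, 'a, 'k) tens) gr_arrow" where
  "gr_rinv X = \<lparr>Dom = X, Cod = gtens X gunit, Map = tens_rinv X\<rparr>"

definition gr_curry ::
  "('k, 'a) gmod \<Rightarrow> ('k, 'b) gmod \<Rightarrow> ('k, ('k, 'a, 'b) tens, 'c) gr_arrow \<Rightarrow>
     ('k, 'a, int \<Rightarrow> 'b \<Rightarrow> 'c) gr_arrow" where
  "gr_curry X Y F = \<lparr>Dom = X, Cod = gihom Y (Cod F), Map = gcurry X Y (Map F)\<rparr>"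

definition gr_icomp ::
  "('k, 'a) gmod \<Rightarrow> ('k, 'b) gmod \<Rightarrow> ('k, 'c) gmod \<Rightarrow>
     ('k, ('k, int \<Rightarrow> 'b \<Rightarrow> 'c, int \<Rightarrow> 'a \<Rightarrow> 'b) tens, int \<Rightarrow> 'a \<Rightarrow> 'c) gr_arrow" where
  "gr_icomp X Y Z =
     \<lparr>Dom = gtens (gihom Y Z) (gihom X Y), Cod = gihom X Z, Map = gicomp X Y Z\<rparr>"

definition gr_ipost ::
  "('k, 'a) gmod \<Rightarrow> ('k, 'b, 'c) gr_arrow \<Rightarrow>
     ('k, int \<Rightarrow> 'a \<Rightarrow> 'b, int \<Rightarrow> 'a \<Rightarrow> 'c) gr_arrow" where
  "gr_ipost X G =
     \<lparr>Dom = gihom X (Dom G), Cod = gihom X (Cod G), Map = gipost X (Dom G) (Map G)\<rparr>"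

definition gr_ipre ::
  "('k, 'c, 'a) gr_arrow \<Rightarrow> ('k, 'b) gmod \<Rightarrow>
     ('k, int \<Rightarrow> 'a \<Rightarrow> 'b, int \<Rightarrow> 'c \<Rightarrow> 'b) gr_arrow" where
  "gr_ipre F Y =
     \<lparr>Dom = gihom (Cod F) Y, Cod = gihom (Dom F) Y, Map = gipre (Dom F) (Cod F) Y (Map F)\<rparr>"

definition gr_iso :: "('k, 'a) gmod \<Rightarrow> ('k, 'b) gmod \<Rightarrow> ('k, 'a, 'b) gr_arrow \<Rightarrow> bool" where
  "gr_iso X Y F \<longleftrightarrow> F \<in> gr_hom X Y \<and>
     (\<exists>G\<in>gr_hom Y X. G \<cdot>\<^sub>g F = gr_id X \<and> F \<cdot>\<^sub>g G = gr_id Y)"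


section \<open>\<open>gr\<close>-categories and Serre functors\<close>

definition gr_category :: "('o, 'k, 'a) gr_cat \<Rightarrow> bool" where
  "gr_category C \<longleftrightarrow>
     (\<forall>X\<in>Obj C. \<forall>Y\<in>Obj C. gr_obj (Hom C X Y)) \<and>
     (\<forall>X\<in>Obj C. \<forall>Y\<in>Obj C. \<forall>Z\<in>Obj C.
        Comp C X Y Z \<in> gr_hom (gtens (Hom C Y Z) (Hom C X Y)) (Hom C X Z)) \<and>
     (\<forall>X\<in>Obj C. Iden C X \<in> gr_hom gunit (Hom C X X)) \<and>
     (\<forall>W\<in>Obj C. \<forall>X\<in>Obj C. \<forall>Y\<in>Obj C. \<forall>Z\<in>Obj C.
        Comp C W X Z \<cdot>\<^sub>g (Comp C X Y Z \<otimes>\<^sub>g gr_id (Hom C W X)) =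
        Comp C W Y Z \<cdot>\<^sub>g (gr_id (Hom C Y Z) \<otimes>\<^sub>g Comp C W X Y) \<cdot>\<^sub>g
          gr_assoc (Hom C Y Z) (Hom C X Y) (Hom C W X)) \<and>
     (\<forall>X\<in>Obj C. \<forall>Y\<in>Obj C.
        Comp C X Y Y \<cdot>\<^sub>g (Iden C Y \<otimes>\<^sub>g gr_id (Hom C X Y)) \<cdot>\<^sub>g gr_linv (Hom C X Y) =
          gr_id (Hom C X Y) \<and>
        Comp C X X Y \<cdot>\<^sub>g (gr_id (Hom C X Y) \<otimes>\<^sub>g Iden C X) \<cdot>\<^sub>g gr_rinv (Hom C X Y) =
          gr_id (Hom C X Y))"

definition gr_functor ::
  "('o, 'k, 'a) gr_cat \<Rightarrow> ('p, 'k, 'b) gr_cat \<Rightarrow> ('o, 'p, 'k, 'a, 'b) gr_fun \<Rightarrow> bool" where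
  "gr_functor C D F \<longleftrightarrow> gr_category C \<and> gr_category D \<and>
     (\<forall>X\<in>Obj C. OMap F X \<in> Obj D) \<and>
     (\<forall>X\<in>Obj C. \<forall>Y\<in>Obj C. HMap F X Y \<in> gr_hom (Hom C X Y) (Hom D (OMap F X) (OMap F Y))) \<and>
     (\<forall>X\<in>Obj C. \<forall>Y\<in>Obj C. \<forall>Z\<in>Obj C.
        HMap F X Z \<cdot>\<^sub>g Comp C X Y Z =
        Comp D (OMap F X) (OMap F Y) (OMap F Z) \<cdot>\<^sub>g (HMap F Y Z \<otimes>\<^sub>g HMap F X Y)) \<and>
     (\<forall>X\<in>Obj C. HMap F X X \<cdot>\<^sub>g Iden C X = Iden D (OMap F X))"

definition gr_idfun :: "('o, 'k, 'a) gr_cat \<Rightarrow> ('o, 'o, 'k, 'a, 'a) gr_fun" where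
  "gr_idfun C = \<lparr>OMap = id, HMap = \<lambda>X Y. gr_id (Hom C X Y)\<rparr>"

text \<open>Also used for a functor followed by a functor into graded modules.\<close>

definition gr_funcomp ::
  "('p, 'q, 'k, 'b, 'c) gr_fun \<Rightarrow> ('o, 'p, 'k, 'a, 'b) gr_fun \<Rightarrow> ('o, 'q, 'k, 'a, 'c) gr_fun"
  where
  "gr_funcomp G F =
     \<lparr>OMap = \<lambda>X. OMap G (OMap F X),
      HMap = \<lambda>X Y. HMap G (OMap F X) (OMap F Y) \<cdot>\<^sub>g HMap F X Y\<rparr>"

definition gr_nattrans ::
  "('o, 'k, 'a) gr_cat \<Rightarrow> ('p, 'k, 'b) gr_cat \<Rightarrow> ('o, 'p, 'k, 'a, 'b) gr_fun \<Rightarrow>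
     ('o, 'p, 'k, 'a, 'b) gr_fun \<Rightarrow> ('o \<Rightarrow> ('k, 'k, 'b) gr_arrow) \<Rightarrow> bool" where
  "gr_nattrans C D F G \<alpha> \<longleftrightarrow>
     (\<forall>X\<in>Obj C. \<alpha> X \<in> gr_hom gunit (Hom D (OMap F X) (OMap G X))) \<and>
     (\<forall>X\<in>Obj C. \<forall>Y\<in>Obj C.
        Comp D (OMap F X) (OMap F Y) (OMap G Y) \<cdot>\<^sub>g (\<alpha> Y \<otimes>\<^sub>g HMap F X Y) \<cdot>\<^sub>g gr_linv (Hom C X Y) =
        Comp D (OMap F X) (OMap G X) (OMap G Y) \<cdot>\<^sub>g (HMap G X Y \<otimes>\<^sub>g \<alpha> X) \<cdot>\<^sub>g gr_rinv (Hom C X Y))"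

text \<open>Composition of \<open>f : 1 \<rightarrow> C(X,Y)\<close> and \<open>g : 1 \<rightarrow> C(Y,Z)\<close> in the underlying
  ordinary category.\<close>

definition gr_ucomp ::
  "('o, 'k, 'a) gr_cat \<Rightarrow> 'o \<Rightarrow> 'o \<Rightarrow> 'o \<Rightarrow> ('k, 'k, 'a) gr_arrow \<Rightarrow> ('k, 'k, 'a) gr_arrow \<Rightarrow>
     ('k, 'k, 'a) gr_arrow" where
  "gr_ucomp C X Y Z g f = Comp C X Y Z \<cdot>\<^sub>g (g \<otimes>\<^sub>g f) \<cdot>\<^sub>g gr_linv gunit"

definition gr_uiso :: "('o, 'k, 'a) gr_cat \<Rightarrow> 'o \<Rightarrow> 'o \<Rightarrow> ('k, 'k, 'a) gr_arrow \<Rightarrow> bool" where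
  "gr_uiso C X Y f \<longleftrightarrow> f \<in> gr_hom gunit (Hom C X Y) \<and>
     (\<exists>g\<in>gr_hom gunit (Hom C Y X).
        gr_ucomp C X Y X g f = Iden C X \<and> gr_ucomp C Y X Y f g = Iden C Y)"

definition gr_natiso ::
  "('o, 'k, 'a) gr_cat \<Rightarrow> ('p, 'k, 'b) gr_cat \<Rightarrow> ('o, 'p, 'k, 'a, 'b) gr_fun \<Rightarrow>
     ('o, 'p, 'k, 'a, 'b) gr_fun \<Rightarrow> bool" where
  "gr_natiso C D F G \<longleftrightarrow>
     (\<exists>\<alpha>. gr_nattrans C D F G \<alpha> \<and> (\<forall>X\<in>Obj C. gr_uiso D (OMap F X) (OMap G X) (\<alpha> X)))"

definition gr_equivalence ::
  "('o, 'k, 'a) gr_cat \<Rightarrow> ('p, 'k, 'b) gr_cat \<Rightarrow> ('o, 'p, 'k, 'a, 'b) gr_fun \<Rightarrow> bool" where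
  "gr_equivalence C D F \<longleftrightarrow> gr_functor C D F \<and>
     (\<exists>G. gr_functor D C G \<and>
        gr_natiso C C (gr_funcomp G F) (gr_idfun C) \<and>
        gr_natiso D D (gr_funcomp F G) (gr_idfun D))"

definition gr_op :: "('o, 'k, 'a) gr_cat \<Rightarrow> ('o, 'k, 'a) gr_cat" where
  "gr_op C =
     \<lparr>Obj = Obj C, Hom = \<lambda>X Y. Hom C Y X,
      Comp = \<lambda>X Y Z. Comp C Z Y X \<cdot>\<^sub>g gr_sym (Hom C Z Y) (Hom C Y X),
      Iden = Iden C\<rparr>"

text \<open>The representable functor \<open>C(X,-)\<close> into graded modules, acting on morphisms by
  the transpose of composition; the contravariant one,
  \<open>C(-,X)\<close>, is \<open>gr_rep (gr_op C) X\<close>.\<close>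

definition gr_rep ::
  "('o, 'k, 'a) gr_cat \<Rightarrow> 'o \<Rightarrow>
     ('o, ('k, 'a) gmod, 'k, 'a, int \<Rightarrow> 'a \<Rightarrow> 'a) gr_fun" where
  "gr_rep C X =
     \<lparr>OMap = Hom C X,
      HMap = \<lambda>Y Z. gr_curry (Hom C Y Z) (Hom C X Y) (Comp C X Y Z)\<rparr>"

text \<open>The action \<open>gihom X Y \<rightarrow> gihom (gihom Y 1) (gihom X 1)\<close> on morphisms of the
  dualization functor \<open>gihom _ 1\<close>, and its composite with a functor \<open>F\<close> into graded modules, which is
  contravariant in the argument of \<open>F\<close>.\<close>

definition gr_dualmor ::
  "('k, 'a) gmod \<Rightarrow> ('k, 'b) gmod \<Rightarrow>
     ('k, int \<Rightarrow> 'a \<Rightarrow> 'b, int \<Rightarrow> (int \<Rightarrow> 'b \<Rightarrow> 'k) \<Rightarrow> int \<Rightarrow> 'a \<Rightarrow> 'k) gr_arrow" where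
  "gr_dualmor X Y = gr_curry (gihom X Y) (gihom Y gunit)
     (gr_icomp X Y gunit \<cdot>\<^sub>g gr_sym (gihom X Y) (gihom Y gunit))"

definition gr_dual ::
  "('o, ('k, 'b) gmod, 'k, 'a, int \<Rightarrow> 'b \<Rightarrow> 'b) gr_fun \<Rightarrow>
     ('o, ('k, int \<Rightarrow> 'b \<Rightarrow> 'k) gmod, 'k, 'a,
      int \<Rightarrow> (int \<Rightarrow> 'b \<Rightarrow> 'k) \<Rightarrow> int \<Rightarrow> 'b \<Rightarrow> 'k) gr_fun" where
  "gr_dual F =
     \<lparr>OMap = \<lambda>X. gihom (OMap F X) gunit,
      HMap = \<lambda>X Y. gr_dualmor (OMap F Y) (OMap F X) \<cdot>\<^sub>g HMap F Y X\<rparr>"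

text \<open>Natural transformations between functors into graded modules, with objects in
  \<open>A\<close>. Their components are morphisms of \<open>gr\<close>, and \<open>gr_ipost\<close>, \<open>gr_ipre\<close> are
  composition with such a morphism.\<close>

definition gr_vnat ::
  "'o set \<Rightarrow> ('o, ('k, 'b) gmod, 'k, 'a, int \<Rightarrow> 'b \<Rightarrow> 'b) gr_fun \<Rightarrow>
     ('o, ('k, 'c) gmod, 'k, 'a, int \<Rightarrow> 'c \<Rightarrow> 'c) gr_fun \<Rightarrow>
     ('o \<Rightarrow> ('k, 'b, 'c) gr_arrow) \<Rightarrow> bool" where
  "gr_vnat A F G \<alpha> \<longleftrightarrow>
     (\<forall>X\<in>A. \<alpha> X \<in> gr_hom (OMap F X) (OMap G X)) \<and>
     (\<forall>X\<in>A. \<forall>Y\<in>A.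
        gr_ipost (OMap F X) (\<alpha> Y) \<cdot>\<^sub>g HMap F X Y = gr_ipre (\<alpha> X) (OMap G Y) \<cdot>\<^sub>g HMap G X Y)"

definition gr_right_serre :: "('o, 'k, 'a) gr_cat \<Rightarrow> ('o, 'o, 'k, 'a, 'a) gr_fun \<Rightarrow> bool" where
  "gr_right_serre C S \<longleftrightarrow> gr_functor C C S \<and>
     (\<exists>\<psi>.
       (\<forall>X\<in>Obj C. \<forall>Y\<in>Obj C.
          gr_iso (Hom C X (OMap S Y)) (gihom (Hom C Y X) gunit) (\<psi> X Y)) \<and>
       (\<forall>Y\<in>Obj C.
          gr_vnat (Obj C) (gr_rep (gr_op C) (OMap S Y)) (gr_dual (gr_rep C Y)) (\<lambda>X. \<psi> X Y)) \<and>
       (\<forall>X\<in>Obj C.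
          gr_vnat (Obj C) (gr_funcomp (gr_rep C X) S) (gr_dual (gr_rep (gr_op C) X)) (\<psi> X)))"

definition gr_serre :: "('o, 'k, 'a) gr_cat \<Rightarrow> ('o, 'o, 'k, 'a, 'a) gr_fun \<Rightarrow> bool" where
  "gr_serre C S \<longleftrightarrow> gr_right_serre C S \<and> gr_equivalence C C S"


section \<open>Complexes and the homotopy category\<close>

definition K_obj :: "('k, 'a) cochain \<Rightarrow> bool" where
  "K_obj M \<longleftrightarrow> gr_obj (Und M) \<and>
     (\<forall>n. Diff M n \<in> linmaps (Und M n) (Und M (n + 1))) \<and>
     (\<forall>n. \<forall>x\<in>carrier (Und M n). Diff M (n + 1) (Diff M n x) = \<zero>\<^bsub>Und M (n + 2)\<^esub>)"

definition chain_maps :: "('k, 'a) cochain \<Rightarrow> ('k, 'b) cochain \<Rightarrow> (int \<Rightarrow> 'a \<Rightarrow> 'b) set" where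
  "chain_maps M N = {f \<in> gmaps (Und M) (Und N).
     \<forall>n. \<forall>x\<in>carrier (Und M n). Diff N n (f n x) = f (n + 1) (Diff M n x)}"

definition homotopy ::
  "('k, 'a) cochain \<Rightarrow> ('k, 'b) cochain \<Rightarrow> ((int \<Rightarrow> 'a \<Rightarrow> 'b) \<times> (int \<Rightarrow> 'a \<Rightarrow> 'b)) set" where
  "homotopy M N = {(f, g). f \<in> chain_maps M N \<and> g \<in> chain_maps M N \<and>
     (\<exists>h. (\<forall>n. h n \<in> linmaps (Und M n) (Und N (n - 1))) \<and>
          (\<forall>n. \<forall>x\<in>carrier (Und M n).
             f n x \<ominus>\<^bsub>Und N n\<^esub> g n x =
             Diff N (n - 1) (h n x) \<oplus>\<^bsub>Und N n\<^esub> h (n + 1) (Diff M n x)))}"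

definition ktens ::
  "('k, 'a) cochain \<Rightarrow> ('k, 'b) cochain \<Rightarrow> ('k, ('k, 'a, 'b) tens) cochain" where
  "ktens M N =
     \<lparr>Und = gtens (Und M) (Und N),
      Diff = tens_lift (Und M) (Und N) (\<lambda>n. gtens (Und M) (Und N) (n + 1))
        (\<lambda>i x j y.
           ptens (Und M) (Und N) (i + 1) (Diff M i x) j y
           \<oplus>\<^bsub>gtens (Und M) (Und N) (i + j + 1)\<^esub>
           signed (gtens (Und M) (Und N) (i + j + 1)) i
             (ptens (Und M) (Und N) i x (j + 1) (Diff N j y)))\<rparr>"

definition kunit :: "('k, 'k) cochain" where
  "kunit = \<lparr>Und = gunit, Diff = \<lambda>n. \<lambda>x\<in>carrier (gunit n). \<zero>\<^bsub>k\<^esub>\<rparr>"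

definition kihom :: "('k, 'a) cochain \<Rightarrow> ('k, 'b) cochain \<Rightarrow> ('k, int \<Rightarrow> 'a \<Rightarrow> 'b) cochain" where
  "kihom M N =
     \<lparr>Und = gihom (Und M) (Und N),
      Diff = \<lambda>n. \<lambda>f\<in>carrier (gihom (Und M) (Und N) n). \<lambda>p. \<lambda>x\<in>carrier (Und M p).
        Diff N (p + n) (f p x) \<ominus>\<^bsub>Und N (p + n + 1)\<^esub>
        signed (Und N (p + n + 1)) n (f (p + 1) (Diff M p x))\<rparr>"


definition K_hom :: "('k, 'a) cochain \<Rightarrow> ('k, 'b) cochain \<Rightarrow> ('k, 'a, 'b) K_arrow set" where
  "K_hom M N = {F. Dom F = M \<and> Cod F = N \<and> Map F \<in> chain_maps M N // homotopy M N}"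

definition K_class ::
  "('k, 'a) cochain \<Rightarrow> ('k, 'b) cochain \<Rightarrow> (int \<Rightarrow> 'a \<Rightarrow> 'b) \<Rightarrow> ('k, 'a, 'b) K_arrow" where
  "K_class M N f = \<lparr>Dom = M, Cod = N, Map = homotopy M N `` {f}\<rparr>"

text \<open>Operations on homotopy classes: the class of the result on representatives.\<close>

definition K_lift1 ::
  "('k, 'a) cochain \<Rightarrow> ('k, 'b) cochain \<Rightarrow> ((int \<Rightarrow> 'c \<Rightarrow> 'd) \<Rightarrow> int \<Rightarrow> 'a \<Rightarrow> 'b) \<Rightarrow>
     ('k, 'c, 'd) K_arrow \<Rightarrow> ('k, 'a, 'b) K_arrow" where
  "K_lift1 M N op F =
     \<lparr>Dom = M, Cod = N, Map = \<Union>f\<in>Map F. homotopy M N `` {op f}\<rparr>"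

definition K_lift2 ::
  "('k, 'a) cochain \<Rightarrow> ('k, 'b) cochain \<Rightarrow>
     ((int \<Rightarrow> 'c \<Rightarrow> 'd) \<Rightarrow> (int \<Rightarrow> 'e \<Rightarrow> 'f) \<Rightarrow> int \<Rightarrow> 'a \<Rightarrow> 'b) \<Rightarrow>
     ('k, 'c, 'd) K_arrow \<Rightarrow> ('k, 'e, 'f) K_arrow \<Rightarrow> ('k, 'a, 'b) K_arrow" where
  "K_lift2 M N op F G =
     \<lparr>Dom = M, Cod = N, Map = \<Union>f\<in>Map F. \<Union>g\<in>Map G. homotopy M N `` {op f g}\<rparr>"

definition K_id :: "('k, 'a) cochain \<Rightarrow> ('k, 'a, 'a) K_arrow" where
  "K_id M = K_class M M (gid (Und M))"

definition K_comp ::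
  "('k, 'b, 'c) K_arrow \<Rightarrow> ('k, 'a, 'b) K_arrow \<Rightarrow> ('k, 'a, 'c) K_arrow"
  (infixr \<open>\<cdot>\<^sub>K\<close> 65) where
  "G \<cdot>\<^sub>K F = K_lift2 (Dom F) (Cod G) (gcomp (Und (Dom F))) G F"

definition K_tens ::
  "('k, 'a, 'c) K_arrow \<Rightarrow> ('k, 'b, 'd) K_arrow \<Rightarrow>
     ('k, ('k, 'a, 'b) tens, ('k, 'c, 'd) tens) K_arrow" (infixr \<open>\<otimes>\<^sub>K\<close> 70) where
  "F \<otimes>\<^sub>K G =
     K_lift2 (ktens (Dom F) (Dom G)) (ktens (Cod F) (Cod G))
       (tens_map (Und (Dom F)) (Und (Dom G)) (Und (Cod F)) (Und (Cod G))) F G"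

definition K_assoc ::
  "('k, 'a) cochain \<Rightarrow> ('k, 'b) cochain \<Rightarrow> ('k, 'c) cochain \<Rightarrow>
     ('k, ('k, ('k, 'a, 'b) tens, 'c) tens, ('k, 'a, ('k, 'b, 'c) tens) tens) K_arrow" where
  "K_assoc M N P = K_class (ktens (ktens M N) P) (ktens M (ktens N P))
     (tens_assoc (Und M) (Und N) (Und P))"

definition K_sym ::
  "('k, 'a) cochain \<Rightarrow> ('k, 'b) cochain \<Rightarrow> ('k, ('k, 'a, 'b) tens, ('k, 'b, 'a) tens) K_arrow" where
  "K_sym M N = K_class (ktens M N) (ktens N M) (tens_sym (Und M) (Und N))"

definition K_linv :: "('k, 'a) cochain \<Rightarrow> ('k, 'a, ('k, 'k, 'a) tens) K_arrow" where
  "K_linv M = K_class M (ktens kunit M) (tens_linv (Und M))"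

definition K_rinv :: "('k, 'a) cochain \<Rightarrow> ('k, 'a, ('k, 'a, 'k) tens) K_arrow" where
  "K_rinv M = K_class M (ktens M kunit) (tens_rinv (Und M))"

definition K_curry ::
  "('k, 'a) cochain \<Rightarrow> ('k, 'b) cochain \<Rightarrow> ('k, ('k, 'a, 'b) tens, 'c) K_arrow \<Rightarrow>
     ('k, 'a, int \<Rightarrow> 'b \<Rightarrow> 'c) K_arrow" where
  "K_curry M N F = K_lift1 M (kihom N (Cod F)) (gcurry (Und M) (Und N)) F"

definition K_icomp ::
  "('k, 'a) cochain \<Rightarrow> ('k, 'b) cochain \<Rightarrow> ('k, 'c) cochain \<Rightarrow>
     ('k, ('k, int \<Rightarrow> 'b \<Rightarrow> 'c, int \<Rightarrow> 'a \<Rightarrow> 'b) tens, int \<Rightarrow> 'a \<Rightarrow> 'c) K_arrow" where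
  "K_icomp M N P = K_class (ktens (kihom N P) (kihom M N)) (kihom M P)
     (gicomp (Und M) (Und N) (Und P))"

definition K_ipost ::
  "('k, 'a) cochain \<Rightarrow> ('k, 'b, 'c) K_arrow \<Rightarrow>
     ('k, int \<Rightarrow> 'a \<Rightarrow> 'b, int \<Rightarrow> 'a \<Rightarrow> 'c) K_arrow" where
  "K_ipost M G = K_lift1 (kihom M (Dom G)) (kihom M (Cod G))
     (gipost (Und M) (Und (Dom G))) G"

definition K_ipre ::
  "('k, 'c, 'a) K_arrow \<Rightarrow> ('k, 'b) cochain \<Rightarrow>
     ('k, int \<Rightarrow> 'a \<Rightarrow> 'b, int \<Rightarrow> 'c \<Rightarrow> 'b) K_arrow" where
  "K_ipre F N = K_lift1 (kihom (Cod F) N) (kihom (Dom F) N)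
     (gipre (Und (Dom F)) (Und (Cod F)) (Und N)) F"

definition K_iso :: "('k, 'a) cochain \<Rightarrow> ('k, 'b) cochain \<Rightarrow> ('k, 'a, 'b) K_arrow \<Rightarrow> bool" where
  "K_iso M N F \<longleftrightarrow> F \<in> K_hom M N \<and>
     (\<exists>G\<in>K_hom N M. G \<cdot>\<^sub>K F = K_id M \<and> F \<cdot>\<^sub>K G = K_id N)"


section \<open>\<open>\<K>\<close>-categories and Serre functors\<close>

text \<open>Verbatim the definitions given for \<open>gr\<close>, over \<open>\<K>\<close>: a category enriched in a
  polymorphic family of constructions cannot be defined once for both. All equations are
  equations of homotopy classes.\<close>

definition K_category :: "('o, 'k, 'a) K_cat \<Rightarrow> bool" where
  "K_category C \<longleftrightarrow>
     (\<forall>X\<in>Obj C. \<forall>Y\<in>Obj C. K_obj (Hom C X Y)) \<and>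
     (\<forall>X\<in>Obj C. \<forall>Y\<in>Obj C. \<forall>Z\<in>Obj C.
        Comp C X Y Z \<in> K_hom (ktens (Hom C Y Z) (Hom C X Y)) (Hom C X Z)) \<and>
     (\<forall>X\<in>Obj C. Iden C X \<in> K_hom kunit (Hom C X X)) \<and>
     (\<forall>W\<in>Obj C. \<forall>X\<in>Obj C. \<forall>Y\<in>Obj C. \<forall>Z\<in>Obj C.
        Comp C W X Z \<cdot>\<^sub>K (Comp C X Y Z \<otimes>\<^sub>K K_id (Hom C W X)) =
        Comp C W Y Z \<cdot>\<^sub>K (K_id (Hom C Y Z) \<otimes>\<^sub>K Comp C W X Y) \<cdot>\<^sub>K
          K_assoc (Hom C Y Z) (Hom C X Y) (Hom C W X)) \<and>
     (\<forall>X\<in>Obj C. \<forall>Y\<in>Obj C.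
        Comp C X Y Y \<cdot>\<^sub>K (Iden C Y \<otimes>\<^sub>K K_id (Hom C X Y)) \<cdot>\<^sub>K K_linv (Hom C X Y) =
          K_id (Hom C X Y) \<and>
        Comp C X X Y \<cdot>\<^sub>K (K_id (Hom C X Y) \<otimes>\<^sub>K Iden C X) \<cdot>\<^sub>K K_rinv (Hom C X Y) =
          K_id (Hom C X Y))"

definition K_functor ::
  "('o, 'k, 'a) K_cat \<Rightarrow> ('p, 'k, 'b) K_cat \<Rightarrow> ('o, 'p, 'k, 'a, 'b) K_fun \<Rightarrow> bool" where
  "K_functor C D F \<longleftrightarrow> K_category C \<and> K_category D \<and>
     (\<forall>X\<in>Obj C. OMap F X \<in> Obj D) \<and>
     (\<forall>X\<in>Obj C. \<forall>Y\<in>Obj C. HMap F X Y \<in> K_hom (Hom C X Y) (Hom D (OMap F X) (OMap F Y))) \<and>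
     (\<forall>X\<in>Obj C. \<forall>Y\<in>Obj C. \<forall>Z\<in>Obj C.
        HMap F X Z \<cdot>\<^sub>K Comp C X Y Z =
        Comp D (OMap F X) (OMap F Y) (OMap F Z) \<cdot>\<^sub>K (HMap F Y Z \<otimes>\<^sub>K HMap F X Y)) \<and>
     (\<forall>X\<in>Obj C. HMap F X X \<cdot>\<^sub>K Iden C X = Iden D (OMap F X))"

definition K_idfun :: "('o, 'k, 'a) K_cat \<Rightarrow> ('o, 'o, 'k, 'a, 'a) K_fun" where
  "K_idfun C = \<lparr>OMap = id, HMap = \<lambda>X Y. K_id (Hom C X Y)\<rparr>"

definition K_funcomp ::
  "('p, 'q, 'k, 'b, 'c) K_fun \<Rightarrow> ('o, 'p, 'k, 'a, 'b) K_fun \<Rightarrow> ('o, 'q, 'k, 'a, 'c) K_fun"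
  where
  "K_funcomp G F =
     \<lparr>OMap = \<lambda>X. OMap G (OMap F X),
      HMap = \<lambda>X Y. HMap G (OMap F X) (OMap F Y) \<cdot>\<^sub>K HMap F X Y\<rparr>"

definition K_nattrans ::
  "('o, 'k, 'a) K_cat \<Rightarrow> ('p, 'k, 'b) K_cat \<Rightarrow> ('o, 'p, 'k, 'a, 'b) K_fun \<Rightarrow>
     ('o, 'p, 'k, 'a, 'b) K_fun \<Rightarrow> ('o \<Rightarrow> ('k, 'k, 'b) K_arrow) \<Rightarrow> bool" where
  "K_nattrans C D F G \<alpha> \<longleftrightarrow>
     (\<forall>X\<in>Obj C. \<alpha> X \<in> K_hom kunit (Hom D (OMap F X) (OMap G X))) \<and>
     (\<forall>X\<in>Obj C. \<forall>Y\<in>Obj C.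
        Comp D (OMap F X) (OMap F Y) (OMap G Y) \<cdot>\<^sub>K (\<alpha> Y \<otimes>\<^sub>K HMap F X Y) \<cdot>\<^sub>K K_linv (Hom C X Y) =
        Comp D (OMap F X) (OMap G X) (OMap G Y) \<cdot>\<^sub>K (HMap G X Y \<otimes>\<^sub>K \<alpha> X) \<cdot>\<^sub>K K_rinv (Hom C X Y))"

definition K_ucomp ::
  "('o, 'k, 'a) K_cat \<Rightarrow> 'o \<Rightarrow> 'o \<Rightarrow> 'o \<Rightarrow> ('k, 'k, 'a) K_arrow \<Rightarrow> ('k, 'k, 'a) K_arrow \<Rightarrow>
     ('k, 'k, 'a) K_arrow" where
  "K_ucomp C X Y Z g f = Comp C X Y Z \<cdot>\<^sub>K (g \<otimes>\<^sub>K f) \<cdot>\<^sub>K K_linv kunit"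

definition K_uiso :: "('o, 'k, 'a) K_cat \<Rightarrow> 'o \<Rightarrow> 'o \<Rightarrow> ('k, 'k, 'a) K_arrow \<Rightarrow> bool" where
  "K_uiso C X Y f \<longleftrightarrow> f \<in> K_hom kunit (Hom C X Y) \<and>
     (\<exists>g\<in>K_hom kunit (Hom C Y X).
        K_ucomp C X Y X g f = Iden C X \<and> K_ucomp C Y X Y f g = Iden C Y)"

definition K_natiso ::
  "('o, 'k, 'a) K_cat \<Rightarrow> ('p, 'k, 'b) K_cat \<Rightarrow> ('o, 'p, 'k, 'a, 'b) K_fun \<Rightarrow>
     ('o, 'p, 'k, 'a, 'b) K_fun \<Rightarrow> bool" where
  "K_natiso C D F G \<longleftrightarrow>
     (\<exists>\<alpha>. K_nattrans C D F G \<alpha> \<and> (\<forall>X\<in>Obj C. K_uiso D (OMap F X) (OMap G X) (\<alpha> X)))"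

definition K_equivalence ::
  "('o, 'k, 'a) K_cat \<Rightarrow> ('p, 'k, 'b) K_cat \<Rightarrow> ('o, 'p, 'k, 'a, 'b) K_fun \<Rightarrow> bool" where
  "K_equivalence C D F \<longleftrightarrow> K_functor C D F \<and>
     (\<exists>G. K_functor D C G \<and>
        K_natiso C C (K_funcomp G F) (K_idfun C) \<and>
        K_natiso D D (K_funcomp F G) (K_idfun D))"

definition K_op :: "('o, 'k, 'a) K_cat \<Rightarrow> ('o, 'k, 'a) K_cat" where
  "K_op C =
     \<lparr>Obj = Obj C, Hom = \<lambda>X Y. Hom C Y X,
      Comp = \<lambda>X Y Z. Comp C Z Y X \<cdot>\<^sub>K K_sym (Hom C Z Y) (Hom C Y X),
      Iden = Iden C\<rparr>"

definition K_rep ::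
  "('o, 'k, 'a) K_cat \<Rightarrow> 'o \<Rightarrow>
     ('o, ('k, 'a) cochain, 'k, 'a, int \<Rightarrow> 'a \<Rightarrow> 'a) K_fun" where
  "K_rep C X =
     \<lparr>OMap = Hom C X,
      HMap = \<lambda>Y Z. K_curry (Hom C Y Z) (Hom C X Y) (Comp C X Y Z)\<rparr>"

definition K_dualmor ::
  "('k, 'a) cochain \<Rightarrow> ('k, 'b) cochain \<Rightarrow>
     ('k, int \<Rightarrow> 'a \<Rightarrow> 'b, int \<Rightarrow> (int \<Rightarrow> 'b \<Rightarrow> 'k) \<Rightarrow> int \<Rightarrow> 'a \<Rightarrow> 'k) K_arrow" where
  "K_dualmor X Y = K_curry (kihom X Y) (kihom Y kunit)
     (K_icomp X Y kunit \<cdot>\<^sub>K K_sym (kihom X Y) (kihom Y kunit))"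

definition K_dual ::
  "('o, ('k, 'b) cochain, 'k, 'a, int \<Rightarrow> 'b \<Rightarrow> 'b) K_fun \<Rightarrow>
     ('o, ('k, int \<Rightarrow> 'b \<Rightarrow> 'k) cochain, 'k, 'a,
      int \<Rightarrow> (int \<Rightarrow> 'b \<Rightarrow> 'k) \<Rightarrow> int \<Rightarrow> 'b \<Rightarrow> 'k) K_fun" where
  "K_dual F =
     \<lparr>OMap = \<lambda>X. kihom (OMap F X) kunit,
      HMap = \<lambda>X Y. K_dualmor (OMap F Y) (OMap F X) \<cdot>\<^sub>K HMap F Y X\<rparr>"

definition K_vnat ::
  "'o set \<Rightarrow> ('o, ('k, 'b) cochain, 'k, 'a, int \<Rightarrow> 'b \<Rightarrow> 'b) K_fun \<Rightarrow>
     ('o, ('k, 'c) cochain, 'k, 'a, int \<Rightarrow> 'c \<Rightarrow> 'c) K_fun \<Rightarrow>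
     ('o \<Rightarrow> ('k, 'b, 'c) K_arrow) \<Rightarrow> bool" where
  "K_vnat A F G \<alpha> \<longleftrightarrow>
     (\<forall>X\<in>A. \<alpha> X \<in> K_hom (OMap F X) (OMap G X)) \<and>
     (\<forall>X\<in>A. \<forall>Y\<in>A.
        K_ipost (OMap F X) (\<alpha> Y) \<cdot>\<^sub>K HMap F X Y = K_ipre (\<alpha> X) (OMap G Y) \<cdot>\<^sub>K HMap G X Y)"

definition K_right_serre :: "('o, 'k, 'a) K_cat \<Rightarrow> ('o, 'o, 'k, 'a, 'a) K_fun \<Rightarrow> bool" where
  "K_right_serre C S \<longleftrightarrow> K_functor C C S \<and>
     (\<exists>\<psi>.
       (\<forall>X\<in>Obj C. \<forall>Y\<in>Obj C.
          K_iso (Hom C X (OMap S Y)) (kihom (Hom C Y X) kunit) (\<psi> X Y)) \<and>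
       (\<forall>Y\<in>Obj C.
          K_vnat (Obj C) (K_rep (K_op C) (OMap S Y)) (K_dual (K_rep C Y)) (\<lambda>X. \<psi> X Y)) \<and>
       (\<forall>X\<in>Obj C.
          K_vnat (Obj C) (K_funcomp (K_rep C X) S) (K_dual (K_rep (K_op C) X)) (\<psi> X)))"

definition K_serre :: "('o, 'k, 'a) K_cat \<Rightarrow> ('o, 'o, 'k, 'a, 'a) K_fun \<Rightarrow> bool" where
  "K_serre C S \<longleftrightarrow> K_right_serre C S \<and> K_equivalence C C S"


section \<open>Cohomology\<close>

definition cocycles :: "('k, 'a) cochain \<Rightarrow> int \<Rightarrow> 'a set" where
  "cocycles M n = {x \<in> carrier (Und M n). Diff M n x = \<zero>\<^bsub>Und M (n + 1)\<^esub>}"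

definition coboundaries :: "('k, 'a) cochain \<Rightarrow> int \<Rightarrow> 'a set" where
  "coboundaries M n = Diff M (n - 1) ` carrier (Und M (n - 1))"

definition cohomology :: "('k, 'a) cochain \<Rightarrow> ('k, 'a set) gmod" where
  "cohomology M n = quot_module (Und M n\<lparr>carrier := cocycles M n\<rparr>) (coboundaries M n)"

definition coclass :: "('k, 'a) cochain \<Rightarrow> int \<Rightarrow> 'a \<Rightarrow> 'a set" where
  "coclass M n x = coboundaries M n +>\<^bsub>Und M n\<^esub> x"

definition H_map :: "('k, 'a, 'b) K_arrow \<Rightarrow> ('k, 'a set, 'b set) gr_arrow" where
  "H_map F =
     \<lparr>Dom = cohomology (Dom F), Cod = cohomology (Cod F),
      Map = \<lambda>n. \<lambda>c\<in>carrier (cohomology (Dom F) n).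
        \<Union>f\<in>Map F. \<Union>x\<in>c. coclass (Cod F) n (f n x)\<rparr>"

text \<open>The Kuenneth map \<open>[x] \<otimes> [y] \<mapsto> [x \<otimes> y]\<close> and its unit counterpart, the lax monoidal
  structure of cohomology.\<close>

definition kunneth ::
  "('k, 'a) cochain \<Rightarrow> ('k, 'b) cochain \<Rightarrow>
     ('k, ('k, 'a set, 'b set) tens, ('k, 'a, 'b) tens set) gr_arrow" where
  "kunneth M N =
     \<lparr>Dom = gtens (cohomology M) (cohomology N), Cod = cohomology (ktens M N),
      Map = tens_lift (cohomology M) (cohomology N) (cohomology (ktens M N))
        (\<lambda>i c j e. \<Union>x\<in>c. \<Union>y\<in>e. coclass (ktens M N) (i + j) (ptens (Und M) (Und N) i x j y))\<rparr>"

definition kunneth_unit :: "('k, 'k, 'k set) gr_arrow" where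
  "kunneth_unit =
     \<lparr>Dom = gunit, Cod = cohomology kunit,
      Map = \<lambda>n. \<lambda>a\<in>carrier (gunit n). coclass kunit n a\<rparr>"

definition H_cat :: "('o, 'k, 'a) K_cat \<Rightarrow> ('o, 'k, 'a set) gr_cat" where
  "H_cat C =
     \<lparr>Obj = Obj C, Hom = \<lambda>X Y. cohomology (Hom C X Y),
      Comp = \<lambda>X Y Z. H_map (Comp C X Y Z) \<cdot>\<^sub>g kunneth (Hom C Y Z) (Hom C X Y),
      Iden = \<lambda>X. H_map (Iden C X) \<cdot>\<^sub>g kunneth_unit\<rparr>"

definition H_fun :: "('o, 'p, 'k, 'a, 'b) K_fun \<Rightarrow> ('o, 'p, 'k, 'a set, 'b set) gr_fun" where
  "H_fun F = \<lparr>OMap = OMap F, HMap = \<lambda>X Y. H_map (HMap F X Y)\<rparr>"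

end

end

theory Submission
  imports Defs
begin

text \<open>
  Over a field every complex has a map \<open>h\<close> of degree \<open>-1\<close> with \<open>d h d = d\<close>. The projection
  \<open>1 - (d h + h d)\<close> is homotopic to the identity, takes values in the cocycles and kills the
  boundaries, so every graded map between cohomologies is induced by a chain map, and a chain map that
  is zero on cohomology is null-homotopic. The same holds in every degree: the cohomology of the inner hom
  complex is the graded inner hom of the cohomologies. Moreover the Kuenneth maps are onto. Hence
  cohomology is full and faithful, and an equation between morphisms of the homotopy category out of a tensor product,
  out of the unit or into an inner hom holds if and only if its image under cohomology holds after
  composition with these comparison maps. The axioms for functors, natural isomorphisms,
  equivalences and Serre functors are such equations, so all of them are both preserved and reflected.
\<close>

section \<open>Modules over the ground ring\<close>

text \<open>Vector spaces enter through one fact: kernels and images have complements, whence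
  \<open>h\<close>. Homotopy of chain maps is thereby decided on cocycles, and the operations on
  homotopy classes are shown to be well defined there. An equation out of a tensor product is
  cancelled on the right, so the Kuenneth maps act as epimorphisms; tensors are cosets of formal
  sums and come without bases, so surjectivity is obtained from an explicit homotopy on the whole
  tensor product. An equation into an inner hom is cancelled on the left, and isomorphisms are
  pulled back along the comparison, so \<open>theta\<close> must be bijective in every degree. Duals
  need one correction: the cohomology of \<open>kunit\<close> consists of singleton classes and is
  only isomorphic to \<open>gunit\<close>. \<open>delta_arrow\<close> absorbs this, and the partner
  of a Serre isomorphism \<open>\<psi>\<close> is \<open>delta_arrow\<close> after
  \<open>H_map\<close> of \<open>\<psi>\<close>. The \<open>\<K>\<close>-category is given
  throughout; what is lifted are functors, natural isomorphisms and \<open>\<psi>\<close>. A lift is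
  chosen on objects only, so a functor on cohomology is recovered up to
  \<open>fun_agree\<close>.\<close>

locale ground_ring = cring k for k :: "'k ring" (structure)

locale ground_field = ground_ring k + field k for k :: "'k ring" (structure)

context ground_ring
begin

lemma module_abelian_group: "module k M \<Longrightarrow> abelian_group M"
  by (simp add: module_def)

lemma module_abelian_monoid: "module k M \<Longrightarrow> abelian_monoid M"
  by (simp add: module_def abelian_group_def)

text \<open>The facts are restated under the hypothesis \<open>module k M\<close>, which the
  simplifier discharges itself: one term often mixes many modules, such as
  \<open>Und N (p + n)\<close> in several degrees, and an interpretation for each of them would be
  unwieldy.\<close>

lemmas m_add_closed [simp] = abelian_monoid.a_closed[OF module_abelian_monoid]
lemmas m_zero_closed [simp] = abelian_monoid.zero_closed[OF module_abelian_monoid]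
lemmas m_neg_closed [simp] = abelian_group.a_inv_closed[OF module_abelian_group]
lemmas m_minus_closed [simp] = abelian_group.minus_closed[OF module_abelian_group]
lemmas m_smult_closed [simp] = module.smult_closed[of k]
lemmas m_l_zero [simp] = abelian_monoid.l_zero[OF module_abelian_monoid]
lemmas m_r_zero [simp] = abelian_monoid.r_zero[OF module_abelian_monoid]
lemmas m_neg_neg [simp] = abelian_group.minus_minus[OF module_abelian_group]
lemmas m_neg_add = abelian_group.minus_add[OF module_abelian_group]
lemmas m_add_assoc = abelian_monoid.a_assoc[OF module_abelian_monoid]
lemmas m_add_comm = abelian_monoid.a_comm[OF module_abelian_monoid]
lemmas m_add_left_comm = abelian_monoid.a_lcomm[OF module_abelian_monoid]
lemmas m_r_neg [simp] = abelian_group.r_neg[OF module_abelian_group]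
lemmas m_l_neg [simp] = abelian_group.l_neg[OF module_abelian_group]
lemmas m_r_neg2 [simp] = abelian_group.r_neg2[OF module_abelian_group]
lemmas m_minus_def = a_minus_def
lemmas m_ac = m_add_assoc m_add_comm m_add_left_comm
lemmas m_group = m_minus_def m_neg_add m_ac

lemma m_neg_zero [simp]: "module k M \<Longrightarrow> \<ominus>\<^bsub>M\<^esub> \<zero>\<^bsub>M\<^esub> = \<zero>\<^bsub>M\<^esub>"
  using m_l_neg[of M "\<zero>\<^bsub>M\<^esub>"] m_r_zero[of M "\<ominus>\<^bsub>M\<^esub> \<zero>\<^bsub>M\<^esub>"] by simp

lemma m_minus_self [simp]: "module k M \<Longrightarrow> x \<in> carrier M \<Longrightarrow> x \<ominus>\<^bsub>M\<^esub> x = \<zero>\<^bsub>M\<^esub>"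
  by (simp add: m_minus_def)

lemma m_minus_zero [simp]: "module k M \<Longrightarrow> x \<in> carrier M \<Longrightarrow> x \<ominus>\<^bsub>M\<^esub> \<zero>\<^bsub>M\<^esub> = x"
  by (simp add: m_minus_def)

lemma m_minus_eq_zero:
  assumes "module k M" "x \<in> carrier M" "y \<in> carrier M"
  shows "x \<ominus>\<^bsub>M\<^esub> y = \<zero>\<^bsub>M\<^esub> \<longleftrightarrow> x = y"
proof -
  have "x = (x \<ominus>\<^bsub>M\<^esub> y) \<oplus>\<^bsub>M\<^esub> y" using assms by (simp add: m_minus_def m_add_assoc)
  then show ?thesis using assms by auto
qed

section \<open>Linear maps\<close>

lemma linmapsI:
  assumes "\<And>x. x \<in> carrier M \<Longrightarrow> f x \<in> carrier N"
    and "\<And>x. x \<notin> carrier M \<Longrightarrow> f x = undefined"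
    and "\<And>x y. x \<in> carrier M \<Longrightarrow> y \<in> carrier M \<Longrightarrow> f (x \<oplus>\<^bsub>M\<^esub> y) = f x \<oplus>\<^bsub>N\<^esub> f y"
    and "\<And>a x. a \<in> carrier k \<Longrightarrow> x \<in> carrier M \<Longrightarrow> f (a \<odot>\<^bsub>M\<^esub> x) = a \<odot>\<^bsub>N\<^esub> f x"
  shows "f \<in> linmaps k M N"
  using assms by (auto simp: linmaps_def PiE_def extensional_def)

lemma linmaps_restrictI:
  assumes "module k M" "\<And>x. x \<in> carrier M \<Longrightarrow> f x \<in> carrier N"
    and "\<And>x y. x \<in> carrier M \<Longrightarrow> y \<in> carrier M \<Longrightarrow> f (x \<oplus>\<^bsub>M\<^esub> y) = f x \<oplus>\<^bsub>N\<^esub> f y"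
    and "\<And>a x. a \<in> carrier k \<Longrightarrow> x \<in> carrier M \<Longrightarrow> f (a \<odot>\<^bsub>M\<^esub> x) = a \<odot>\<^bsub>N\<^esub> f x"
  shows "(\<lambda>x\<in>carrier M. f x) \<in> linmaps k M N"
  using assms by (intro linmapsI) auto

lemma lin_closed: "f \<in> linmaps k M N \<Longrightarrow> x \<in> carrier M \<Longrightarrow> f x \<in> carrier N"
  and lin_undef: "f \<in> linmaps k M N \<Longrightarrow> x \<notin> carrier M \<Longrightarrow> f x = undefined"
  and lin_add: "f \<in> linmaps k M N \<Longrightarrow> x \<in> carrier M \<Longrightarrow> y \<in> carrier M \<Longrightarrow> f (x \<oplus>\<^bsub>M\<^esub> y) = f x \<oplus>\<^bsub>N\<^esub> f y"
  and lin_smult: "f \<in> linmaps k M N \<Longrightarrow> a \<in> carrier k \<Longrightarrow> x \<in> carrier M \<Longrightarrow> f (a \<odot>\<^bsub>M\<^esub> x) = a \<odot>\<^bsub>N\<^esub> f x"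
  by (auto simp: linmaps_def PiE_def extensional_def)

lemma linmaps_eqI:
  assumes "f \<in> linmaps k M N" "g \<in> linmaps k M N" "\<And>x. x \<in> carrier M \<Longrightarrow> f x = g x"
  shows "f = g"
  using assms by (intro ext) (metis lin_undef)

lemma lin_zero:
  assumes "f \<in> linmaps k M N" "module k M" "module k N"
  shows "f \<zero>\<^bsub>M\<^esub> = \<zero>\<^bsub>N\<^esub>"
proof -
  interpret M: module k M by fact
  interpret N: module k N by fact
  have "f (\<zero> \<odot>\<^bsub>M\<^esub> \<zero>\<^bsub>M\<^esub>) = \<zero> \<odot>\<^bsub>N\<^esub> f \<zero>\<^bsub>M\<^esub>" using assms by (intro lin_smult) auto
  then show ?thesis using lin_closed[OF assms(1)] by simp
qed

lemma lin_neg: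
  assumes "f \<in> linmaps k M N" "module k M" "module k N" "x \<in> carrier M"
  shows "f (\<ominus>\<^bsub>M\<^esub> x) = \<ominus>\<^bsub>N\<^esub> f x"
proof -
  interpret M: module k M by fact
  interpret N: module k N by fact
  have "f ((\<ominus> \<one>) \<odot>\<^bsub>M\<^esub> x) = (\<ominus> \<one>) \<odot>\<^bsub>N\<^esub> f x" using assms by (intro lin_smult) auto
  then show ?thesis using lin_closed[OF assms(1)] assms
    by (simp add: M.smult_l_minus N.smult_l_minus)
qed

lemma lin_minus:
  assumes "f \<in> linmaps k M N" "module k M" "module k N" "x \<in> carrier M" "y \<in> carrier M"
  shows "f (x \<ominus>\<^bsub>M\<^esub> y) = f x \<ominus>\<^bsub>N\<^esub> f y"
  using assms by (simp add: m_minus_def lin_add[of f M N] lin_neg[of f M N])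

lemma lin_comp:
  assumes "module k M" "f \<in> linmaps k M N" "g \<in> linmaps k N P"
  shows "(\<lambda>x\<in>carrier M. g (f x)) \<in> linmaps k M P"
proof (rule linmaps_restrictI[OF assms(1)])
  fix x y assume "x \<in> carrier M" "y \<in> carrier M"
  then show "g (f (x \<oplus>\<^bsub>M\<^esub> y)) = g (f x) \<oplus>\<^bsub>P\<^esub> g (f y)"
    using lin_add[OF assms(2)] lin_add[OF assms(3)] lin_closed[OF assms(2)] by simp
next
  fix a x assume "a \<in> carrier k" "x \<in> carrier M"
  then show "g (f (a \<odot>\<^bsub>M\<^esub> x)) = a \<odot>\<^bsub>P\<^esub> g (f x)"
    using lin_smult[OF assms(2)] lin_smult[OF assms(3)] lin_closed[OF assms(2)] by simp
qed (use lin_closed[OF assms(2)] lin_closed[OF assms(3)] in auto)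

lemma smult_neg_one: "module k M \<Longrightarrow> x \<in> carrier M \<Longrightarrow> (\<ominus> \<one>) \<odot>\<^bsub>M\<^esub> x = \<ominus>\<^bsub>M\<^esub> x"
  by (simp add: module.smult_l_minus module.smult_one)

section \<open>Submodules\<close>

text \<open>Closure under negatives comes from the scalar \<open>\<ominus> \<one>\<close>.\<close>

lemma submodule_intro:
  assumes "module k M" "H \<subseteq> carrier M" "\<zero>\<^bsub>M\<^esub> \<in> H"
    and "\<And>x y. x \<in> H \<Longrightarrow> y \<in> H \<Longrightarrow> x \<oplus>\<^bsub>M\<^esub> y \<in> H"
    and sm: "\<And>a x. a \<in> carrier k \<Longrightarrow> x \<in> H \<Longrightarrow> a \<odot>\<^bsub>M\<^esub> x \<in> H"
  shows "submodule H k M"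
proof (rule module.submoduleI[OF assms(1)])
  fix x assume "x \<in> H"
  then show "\<ominus>\<^bsub>M\<^esub> x \<in> H" using sm[of "\<ominus> \<one>" x] smult_neg_one[OF assms(1), of x] assms(2) by auto
qed (use assms in auto)

lemma submodule_subset: "submodule N k M \<Longrightarrow> x \<in> N \<Longrightarrow> x \<in> carrier M"
  using subgroup.mem_carrier[of N "add_monoid M" x] by (auto simp: submodule_def)

lemma submodule_add: "submodule N k M \<Longrightarrow> x \<in> N \<Longrightarrow> y \<in> N \<Longrightarrow> x \<oplus>\<^bsub>M\<^esub> y \<in> N"
  using subgroup.m_closed[of N "add_monoid M" x] by (auto simp: submodule_def)

lemma submodule_zero: "submodule N k M \<Longrightarrow> \<zero>\<^bsub>M\<^esub> \<in> N"
  using subgroup.one_closed[of N "add_monoid M"] by (auto simp: submodule_def)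

lemma submodule_smult: "submodule N k M \<Longrightarrow> a \<in> carrier k \<Longrightarrow> x \<in> N \<Longrightarrow> a \<odot>\<^bsub>M\<^esub> x \<in> N"
  by (rule submodule.smult_closed)

lemma submodule_neg: "module k M \<Longrightarrow> submodule N k M \<Longrightarrow> x \<in> N \<Longrightarrow> \<ominus>\<^bsub>M\<^esub> x \<in> N"
  by (rule module.submoduleE(3))

lemma submodule_minus: "module k M \<Longrightarrow> submodule N k M \<Longrightarrow> x \<in> N \<Longrightarrow> y \<in> N \<Longrightarrow> x \<ominus>\<^bsub>M\<^esub> y \<in> N"
  by (simp add: m_minus_def submodule_add submodule_neg)

lemma kernel_submodule:
  assumes "module k M" "module k N" "f \<in> linmaps k M N"
  shows "submodule {x \<in> carrier M. f x = \<zero>\<^bsub>N\<^esub>} k M"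
proof -
  interpret N: module k N by fact
  show ?thesis using assms
    by (intro submodule_intro) (auto simp: lin_zero[OF assms(3)] lin_add[OF assms(3)] lin_smult[OF assms(3)])
qed

lemma image_submodule:
  assumes "module k M" "module k N" "f \<in> linmaps k M N"
  shows "submodule (f ` carrier M) k N"
proof (rule submodule_intro)
  show "\<zero>\<^bsub>N\<^esub> \<in> f ` carrier M" using assms by (intro image_eqI[of _ _ "\<zero>\<^bsub>M\<^esub>"]) (simp_all add: lin_zero[OF assms(3)])
next
  fix x y assume "x \<in> f ` carrier M" "y \<in> f ` carrier M"
  then obtain u v where "u \<in> carrier M" "v \<in> carrier M" "x = f u" "y = f v" by auto
  then show "x \<oplus>\<^bsub>N\<^esub> y \<in> f ` carrier M"
    using assms by (intro image_eqI[of _ _ "u \<oplus>\<^bsub>M\<^esub> v"]) (auto simp: lin_add[OF assms(3)])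
next
  fix a x assume "a \<in> carrier k" "x \<in> f ` carrier M"
  then obtain u where "u \<in> carrier M" "x = f u" by auto
  then show "a \<odot>\<^bsub>N\<^esub> x \<in> f ` carrier M"
    using assms \<open>a \<in> carrier k\<close> by (intro image_eqI[of _ _ "a \<odot>\<^bsub>M\<^esub> u"]) (auto simp: lin_smult[OF assms(3)])
qed (use assms lin_closed in auto)

section \<open>Cosets and quotient modules\<close>

lemma submodule_abelian_subgroup:
  assumes "module k M" "submodule N k M"
  shows "abelian_subgroup N M"
proof -
  have "additive_subgroup N M" using assms(2) by (simp add: additive_subgroup_def submodule_def)
  then show ?thesis using module_abelian_group[OF assms(1)] by (rule abelian_subgroupI3)
qed

lemma a_coset_eq_iff:
  assumes "module k M" "submodule N k M" "x \<in> carrier M" "y \<in> carrier M"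
  shows "N +>\<^bsub>M\<^esub> x = N +>\<^bsub>M\<^esub> y \<longleftrightarrow> x \<ominus>\<^bsub>M\<^esub> y \<in> N"
proof -
  interpret abelian_subgroup N M using assms by (intro submodule_abelian_subgroup)
  show ?thesis
    using assms a_rcos_module[of y x] a_rcos_self a_repr_independence[of x N y] 
    by (metis a_minus_def a_subgroup)
qed

lemma a_coset_mem_iff:
  assumes "module k M" "submodule N k M" "x \<in> carrier M"
  shows "y \<in> N +>\<^bsub>M\<^esub> x \<longleftrightarrow> y \<in> carrier M \<and> N +>\<^bsub>M\<^esub> y = N +>\<^bsub>M\<^esub> x"
proof -
  interpret abelian_subgroup N M using assms by (intro submodule_abelian_subgroup)
  show ?thesis
    using assms a_rcos_self a_repr_independence[of y N x] 
    by (metis a_elemrcos_carrier a_subgroup)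
qed

lemma quot_carrier: "carrier (quot_module M N) = {N +>\<^bsub>M\<^esub> x | x. x \<in> carrier M}"
  by (auto simp: quot_module_def A_RCOSETS_def' a_r_coset_def')

lemma quot_add:
  assumes "module k M" "submodule N k M" "x \<in> carrier M" "y \<in> carrier M"
  shows "(N +>\<^bsub>M\<^esub> x) \<oplus>\<^bsub>quot_module M N\<^esub> (N +>\<^bsub>M\<^esub> y) = N +>\<^bsub>M\<^esub> (x \<oplus>\<^bsub>M\<^esub> y)"
proof -
  interpret abelian_subgroup N M using assms by (intro submodule_abelian_subgroup)
  show ?thesis using assms by (simp add: quot_module_def a_rcos_sum)
qed

text \<open>The union in \<open>quot_module\<close> runs over all representatives \<open>y\<close>
  of the coset. Each contributes the same coset, because \<open>a \<odot> y - a \<odot> x\<close> is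
  \<open>a\<close> times an element of \<open>N\<close>; and the index set is nonempty.\<close>

lemma quot_smult:
  assumes "module k M" "submodule N k M" "a \<in> carrier k" "x \<in> carrier M"
  shows "a \<odot>\<^bsub>quot_module M N\<^esub> (N +>\<^bsub>M\<^esub> x) = N +>\<^bsub>M\<^esub> (a \<odot>\<^bsub>M\<^esub> x)"
proof -
  interpret M: module k M by fact
  interpret N: abelian_subgroup N M using assms by (intro submodule_abelian_subgroup)
  have "N +>\<^bsub>M\<^esub> (a \<odot>\<^bsub>M\<^esub> y) = N +>\<^bsub>M\<^esub> (a \<odot>\<^bsub>M\<^esub> x)" if "y \<in> N +>\<^bsub>M\<^esub> x" for y
  proof -
    have y: "y \<in> carrier M" "y \<ominus>\<^bsub>M\<^esub> x \<in> N"
      using that assms a_coset_mem_iff[of M N x y] a_coset_eq_iff[of M N y x] by auto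
    have "a \<odot>\<^bsub>M\<^esub> y \<ominus>\<^bsub>M\<^esub> a \<odot>\<^bsub>M\<^esub> x = a \<odot>\<^bsub>M\<^esub> (y \<ominus>\<^bsub>M\<^esub> x)"
      using y assms by (simp add: m_minus_def M.smult_r_distr M.smult_r_minus)
    then show ?thesis
      using y assms by (subst a_coset_eq_iff) (auto intro: submodule_smult)
  qed
  moreover have "x \<in> N +>\<^bsub>M\<^esub> x" using assms N.a_rcos_self by simp
  ultimately have "(\<Union>y\<in>N +>\<^bsub>M\<^esub> x. N +>\<^bsub>M\<^esub> (a \<odot>\<^bsub>M\<^esub> y)) = N +>\<^bsub>M\<^esub> (a \<odot>\<^bsub>M\<^esub> x)" by blast
  then show ?thesis by (simp add: quot_module_def)
qed

lemma quot_zero: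
  assumes "module k M" "submodule N k M"
  shows "\<zero>\<^bsub>quot_module M N\<^esub> = N +>\<^bsub>M\<^esub> \<zero>\<^bsub>M\<^esub>"
proof -
  interpret abelian_subgroup N M using assms by (intro submodule_abelian_subgroup)
  show ?thesis by (simp add: quot_module_def a_subset)
qed

text \<open>Every element is a coset of a representative, and on representatives the operations are
  those of \<open>M\<close>; each axiom is then inherited.\<close>

lemma quot_module:
  assumes M: "module k M" and N: "submodule N k M"
  shows "module k (quot_module M N)"
proof -
  let ?Q = "quot_module M N"
  interpret M: module k M by fact
  note q [simp] = quot_add[OF assms] quot_smult[OF assms] quot_zero[OF assms]
  have c: "N +>\<^bsub>M\<^esub> x \<in> carrier ?Q" if "x \<in> carrier M" for x using that by (auto simp: quot_carrier)
  have r: "\<exists>x. X = N +>\<^bsub>M\<^esub> x \<and> x \<in> carrier M" if "X \<in> carrier ?Q" for X using that by (auto simp: quot_carrier)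
  show ?thesis
  proof (rule moduleI)
    show "abelian_group ?Q"
    proof (rule abelian_groupI)
      fix X Y assume "X \<in> carrier ?Q" "Y \<in> carrier ?Q"
      with r obtain x y where "X = N +>\<^bsub>M\<^esub> x" "Y = N +>\<^bsub>M\<^esub> y" "x \<in> carrier M" "y \<in> carrier M" by metis
      then show "X \<oplus>\<^bsub>?Q\<^esub> Y \<in> carrier ?Q" "X \<oplus>\<^bsub>?Q\<^esub> Y = Y \<oplus>\<^bsub>?Q\<^esub> X"
        by (simp_all add: c M.a_comm)
    next
      fix X Y Z assume "X \<in> carrier ?Q" "Y \<in> carrier ?Q" "Z \<in> carrier ?Q"
      with r obtain x y z where "X = N +>\<^bsub>M\<^esub> x" "Y = N +>\<^bsub>M\<^esub> y" "Z = N +>\<^bsub>M\<^esub> z"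
        "x \<in> carrier M" "y \<in> carrier M" "z \<in> carrier M" by metis
      then show "X \<oplus>\<^bsub>?Q\<^esub> Y \<oplus>\<^bsub>?Q\<^esub> Z = X \<oplus>\<^bsub>?Q\<^esub> (Y \<oplus>\<^bsub>?Q\<^esub> Z)"
        by (simp add: M.a_assoc)
    next
      fix X assume "X \<in> carrier ?Q"
      with r obtain x where x: "X = N +>\<^bsub>M\<^esub> x" "x \<in> carrier M" by metis
      then show "\<zero>\<^bsub>?Q\<^esub> \<oplus>\<^bsub>?Q\<^esub> X = X" by simp
      have "(N +>\<^bsub>M\<^esub> (\<ominus>\<^bsub>M\<^esub> x)) \<oplus>\<^bsub>?Q\<^esub> X = \<zero>\<^bsub>?Q\<^esub>" using x by (simp add: M.l_neg)
      then show "\<exists>Y\<in>carrier ?Q. Y \<oplus>\<^bsub>?Q\<^esub> X = \<zero>\<^bsub>?Q\<^esub>" using c x by blast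
    qed (simp add: c)
  next
    fix a X Y assume "a \<in> carrier k" "X \<in> carrier ?Q" "Y \<in> carrier ?Q"
    with r obtain x y where "a \<in> carrier k" "X = N +>\<^bsub>M\<^esub> x" "Y = N +>\<^bsub>M\<^esub> y" "x \<in> carrier M" "y \<in> carrier M" by metis
    then show "a \<odot>\<^bsub>?Q\<^esub> (X \<oplus>\<^bsub>?Q\<^esub> Y) = (a \<odot>\<^bsub>?Q\<^esub> X) \<oplus>\<^bsub>?Q\<^esub> (a \<odot>\<^bsub>?Q\<^esub> Y)"
      by (simp add: M.smult_r_distr)
  next
    fix a b X assume "a \<in> carrier k" "b \<in> carrier k" "X \<in> carrier ?Q"
    with r obtain x where "a \<in> carrier k" "b \<in> carrier k" "X = N +>\<^bsub>M\<^esub> x" "x \<in> carrier M" by metis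
    then show "(a \<oplus> b) \<odot>\<^bsub>?Q\<^esub> X = (a \<odot>\<^bsub>?Q\<^esub> X) \<oplus>\<^bsub>?Q\<^esub> (b \<odot>\<^bsub>?Q\<^esub> X)" "(a \<otimes> b) \<odot>\<^bsub>?Q\<^esub> X = a \<odot>\<^bsub>?Q\<^esub> (b \<odot>\<^bsub>?Q\<^esub> X)"
      by (simp_all add: M.smult_l_distr M.smult_assoc1)
  next
    fix a X assume "a \<in> carrier k" "X \<in> carrier ?Q"
    with r obtain x where "a \<in> carrier k" "X = N +>\<^bsub>M\<^esub> x" "x \<in> carrier M" by metis
    then show "a \<odot>\<^bsub>?Q\<^esub> X \<in> carrier ?Q" by (simp add: c)
  next
    fix X assume "X \<in> carrier ?Q"
    with r obtain x where "X = N +>\<^bsub>M\<^esub> x" "x \<in> carrier M" by metis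
    then show "\<one> \<odot>\<^bsub>?Q\<^esub> X = X" by simp
  qed (rule is_cring)
qed

end

section \<open>Complements and generalized inverses over a field\<close>

context ground_field
begin

text \<open>By Zorn there is a maximal submodule \<open>U\<close> that meets \<open>W\<close> only
  in zero. If some \<open>v\<close> were outside of \<open>U + W\<close>, then
  \<open>U + k v\<close> would still meet \<open>W\<close> only in zero, against maximality.\<close>

lemma submodule_complement:
  assumes V: "module k V" and W: "submodule W k V"
  obtains U where "submodule U k V" "U \<inter> W = {\<zero>\<^bsub>V\<^esub>}"
    "\<And>v. v \<in> carrier V \<Longrightarrow> \<exists>u\<in>U. \<exists>w\<in>W. v = u \<oplus>\<^bsub>V\<^esub> w"
proof -
  interpret V: module k V by fact
  let ?A = "{U. submodule U k V \<and> U \<inter> W = {\<zero>\<^bsub>V\<^esub>}}"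
  have "\<exists>U\<in>?A. \<forall>X\<in>?A. U \<subseteq> X \<longrightarrow> X = U"
  proof (rule subset_Zorn_nonempty)
    have "submodule {\<zero>\<^bsub>V\<^esub>} k V" by (rule submodule_intro) (auto simp: V)
    then show "?A \<noteq> {}" using submodule_zero[OF W] by blast
  next
    fix \<C> assume ne: "\<C> \<noteq> {}" and ch: "subset.chain ?A \<C>"
    have A: "submodule U k V" and AW: "U \<inter> W = {\<zero>\<^bsub>V\<^esub>}" if "U \<in> \<C>" for U
      using ch that by (auto simp: subset.chain_def)
    have "submodule (\<Union>\<C>) k V"
    proof (rule submodule_intro[OF V])
      show "\<Union>\<C> \<subseteq> carrier V" using submodule_subset[OF A] by auto
      show "\<zero>\<^bsub>V\<^esub> \<in> \<Union>\<C>" using submodule_zero[OF A] ne by auto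
      fix x y assume "x \<in> \<Union>\<C>" "y \<in> \<Union>\<C>"
      then obtain X Y where XY: "X \<in> \<C>" "Y \<in> \<C>" "x \<in> X" "y \<in> Y" by auto
      then have "X \<subseteq> Y \<or> Y \<subseteq> X" using ch by (auto simp: subset_chain_def)
      then obtain Z where "Z \<in> \<C>" "x \<in> Z" "y \<in> Z" using XY by auto
      then show "x \<oplus>\<^bsub>V\<^esub> y \<in> \<Union>\<C>" using submodule_add[OF A] by auto
    next
      fix a x assume "a \<in> carrier k" "x \<in> \<Union>\<C>"
      then show "a \<odot>\<^bsub>V\<^esub> x \<in> \<Union>\<C>" using submodule_smult[OF A] by auto
    qed
    moreover have "\<Union>\<C> \<inter> W = {\<zero>\<^bsub>V\<^esub>}"
    proof -
      have "\<Union>\<C> \<inter> W = (\<Union>U\<in>\<C>. U \<inter> W)" by auto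
      then show ?thesis using AW ne by auto
    qed
    ultimately show "\<Union>\<C> \<in> ?A" by simp
  qed
  then obtain U where "U \<in> ?A" and m: "\<forall>X\<in>?A. U \<subseteq> X \<longrightarrow> X = U" by (rule bexE)
  then have U: "submodule U k V" and UW: "U \<inter> W = {\<zero>\<^bsub>V\<^esub>}" by auto
  have max: "X = U" if "submodule X k V" "X \<inter> W = {\<zero>\<^bsub>V\<^esub>}" "U \<subseteq> X" for X
    using m that by auto
  have "\<exists>u\<in>U. \<exists>w\<in>W. v = u \<oplus>\<^bsub>V\<^esub> w" if v: "v \<in> carrier V" for v
  proof (rule ccontr)
    assume nv: "\<not> (\<exists>u\<in>U. \<exists>w\<in>W. v = u \<oplus>\<^bsub>V\<^esub> w)"
    define U' where "U' = {u \<oplus>\<^bsub>V\<^esub> a \<odot>\<^bsub>V\<^esub> v | u a. u \<in> U \<and> a \<in> carrier k}"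
    have Uc: "u \<in> U \<Longrightarrow> u \<in> carrier V" for u using submodule_subset[OF U] .
    have Wc: "w \<in> W \<Longrightarrow> w \<in> carrier V" for w using submodule_subset[OF W] .
    have "submodule U' k V"
    proof (rule submodule_intro[OF V])
      show "U' \<subseteq> carrier V" using Uc v by (auto simp: U'_def)
      have "\<zero>\<^bsub>V\<^esub> = \<zero>\<^bsub>V\<^esub> \<oplus>\<^bsub>V\<^esub> \<zero> \<odot>\<^bsub>V\<^esub> v" using v by simp
      then show "\<zero>\<^bsub>V\<^esub> \<in> U'" unfolding U'_def using submodule_zero[OF U] zero_closed by blast
      fix x y assume "x \<in> U'" "y \<in> U'"
      then obtain u a u' a' where *: "x = u \<oplus>\<^bsub>V\<^esub> a \<odot>\<^bsub>V\<^esub> v" "y = u' \<oplus>\<^bsub>V\<^esub> a' \<odot>\<^bsub>V\<^esub> v"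
        "u \<in> U" "u' \<in> U" "a \<in> carrier k" "a' \<in> carrier k" by (auto simp: U'_def)
      then have "x \<oplus>\<^bsub>V\<^esub> y = (u \<oplus>\<^bsub>V\<^esub> u') \<oplus>\<^bsub>V\<^esub> (a \<oplus> a') \<odot>\<^bsub>V\<^esub> v"
        using v Uc by (simp add: V.smult_l_distr V.a_ac)
      then show "x \<oplus>\<^bsub>V\<^esub> y \<in> U'" unfolding U'_def using * submodule_add[OF U] by blast
    next
      fix b x assume b: "b \<in> carrier k" and "x \<in> U'"
      then obtain u a where *: "x = u \<oplus>\<^bsub>V\<^esub> a \<odot>\<^bsub>V\<^esub> v" "u \<in> U" "a \<in> carrier k" by (auto simp: U'_def)
      then have "b \<odot>\<^bsub>V\<^esub> x = b \<odot>\<^bsub>V\<^esub> u \<oplus>\<^bsub>V\<^esub> (b \<otimes> a) \<odot>\<^bsub>V\<^esub> v"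
        using v Uc b by (simp add: V.smult_r_distr V.smult_assoc1)
      then show "b \<odot>\<^bsub>V\<^esub> x \<in> U'" unfolding U'_def using * b submodule_smult[OF U] by blast
    qed
    moreover have "U' \<inter> W = {\<zero>\<^bsub>V\<^esub>}"
    proof (intro equalityI subsetI)
      fix w assume "w \<in> U' \<inter> W"
      then obtain u a where *: "w = u \<oplus>\<^bsub>V\<^esub> a \<odot>\<^bsub>V\<^esub> v" "u \<in> U" "a \<in> carrier k" "w \<in> W" by (auto simp: U'_def)
      show "w \<in> {\<zero>\<^bsub>V\<^esub>}"
      proof (cases "a = \<zero>")
        case True
        then show ?thesis using * v Uc UW by auto
      next
        case False
        \<comment> \<open>Here the field is used: \<open>a\<close> can be divided out, and this
          writes \<open>v\<close> as an element of \<open>U\<close> plus an element of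
          \<open>W\<close>, which was excluded.\<close>
        then have a: "a \<in> Units k" using * field_Units by blast
        have "a \<odot>\<^bsub>V\<^esub> v = \<ominus>\<^bsub>V\<^esub> u \<oplus>\<^bsub>V\<^esub> w" using * v Uc by (simp add: V.r_neg1)
        then have "inv a \<odot>\<^bsub>V\<^esub> (a \<odot>\<^bsub>V\<^esub> v) = inv a \<odot>\<^bsub>V\<^esub> (\<ominus>\<^bsub>V\<^esub> u \<oplus>\<^bsub>V\<^esub> w)" by simp
        also have "\<dots> = inv a \<odot>\<^bsub>V\<^esub> (\<ominus>\<^bsub>V\<^esub> u) \<oplus>\<^bsub>V\<^esub> inv a \<odot>\<^bsub>V\<^esub> w"
          using a Uc[OF *(2)] Wc[OF *(4)] by (intro V.smult_r_distr) auto
        finally have "v = inv a \<odot>\<^bsub>V\<^esub> (\<ominus>\<^bsub>V\<^esub> u) \<oplus>\<^bsub>V\<^esub> inv a \<odot>\<^bsub>V\<^esub> w"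
          using a v * by (simp flip: V.smult_assoc1)
        moreover have "inv a \<odot>\<^bsub>V\<^esub> (\<ominus>\<^bsub>V\<^esub> u) \<in> U" "inv a \<odot>\<^bsub>V\<^esub> w \<in> W"
          using * a submodule_smult[OF U] submodule_smult[OF W] submodule_neg[OF V U] by auto
        ultimately have False using nv by auto
        then show ?thesis ..
      qed
    next
      fix w assume "w \<in> {\<zero>\<^bsub>V\<^esub>}"
      then show "w \<in> U' \<inter> W" using submodule_zero[OF \<open>submodule U' k V\<close>] submodule_zero[OF W] by simp
    qed
    moreover have "U \<subseteq> U'"
    proof
      fix u assume "u \<in> U"
      then have "u = u \<oplus>\<^bsub>V\<^esub> \<zero> \<odot>\<^bsub>V\<^esub> v" using v Uc by simp
      then show "u \<in> U'" unfolding U'_def using \<open>u \<in> U\<close> zero_closed by blast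
    qed
    ultimately have "U' = U" by (rule max)
    moreover have "v = \<zero>\<^bsub>V\<^esub> \<oplus>\<^bsub>V\<^esub> \<one> \<odot>\<^bsub>V\<^esub> v" using v by simp
    then have "v \<in> U'" unfolding U'_def using submodule_zero[OF U] one_closed by blast
    ultimately have "v \<in> U" "v = v \<oplus>\<^bsub>V\<^esub> \<zero>\<^bsub>V\<^esub>" using v by auto
    then show False using nv submodule_zero[OF W] by blast
  qed
  with U UW show ?thesis using that by blast
qed

text \<open>Let \<open>U\<close> be a complement of the kernel of \<open>d\<close> and
  \<open>J\<close> one of its image. Every \<open>y\<close> is \<open>j + d u\<close> with
  \<open>j \<in> J\<close> and a unique \<open>u \<in> U\<close>, and \<open>s y\<close> is this
  \<open>u\<close>. For \<open>y = d x\<close> the component \<open>j\<close> is in \<open>J\<close>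
  and in the image, so it vanishes and \<open>d (s y) = y\<close>.\<close>

lemma generalized_inverse:
  assumes M: "module k M" and N: "module k N" and d: "d \<in> linmaps k M N"
  obtains s where "s \<in> linmaps k N M" "\<And>x. x \<in> carrier M \<Longrightarrow> d (s (d x)) = d x"
proof -
  interpret M: module k M by fact
  interpret N: module k N by fact
  note dl = lin_add[OF d] lin_smult[OF d] lin_minus[OF d M N] lin_neg[OF d M N] lin_zero[OF d M N]
  have dc [simp]: "x \<in> carrier M \<Longrightarrow> d x \<in> carrier N" for x using lin_closed[OF d] .
  let ?K = "{x \<in> carrier M. d x = \<zero>\<^bsub>N\<^esub>}"
  obtain U where U: "submodule U k M" and UK: "U \<inter> ?K = {\<zero>\<^bsub>M\<^esub>}"
    and Ug: "\<And>v. v \<in> carrier M \<Longrightarrow> \<exists>u\<in>U. \<exists>w\<in>?K. v = u \<oplus>\<^bsub>M\<^esub> w"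
    using submodule_complement[OF M kernel_submodule[OF M N d]] by blast
  obtain J where J: "submodule J k N" and JI: "J \<inter> (d ` carrier M) = {\<zero>\<^bsub>N\<^esub>}"
    and Jg: "\<And>v. v \<in> carrier N \<Longrightarrow> \<exists>u\<in>J. \<exists>w\<in>(d ` carrier M). v = u \<oplus>\<^bsub>N\<^esub> w"
    using submodule_complement[OF N image_submodule[OF M N d]] by blast
  have Uc [simp]: "u \<in> U \<Longrightarrow> u \<in> carrier M" for u using submodule_subset[OF U] .
  have Jc [simp]: "u \<in> J \<Longrightarrow> u \<in> carrier N" for u using submodule_subset[OF J] .
  \<comment> \<open>The image component of \<open>y\<close> is \<open>d m\<close>; replacing
    \<open>m\<close> by its component in \<open>U\<close> leaves \<open>d m\<close>
    unchanged.\<close>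
  have ex: "\<exists>u\<in>U. y \<ominus>\<^bsub>N\<^esub> d u \<in> J" if y: "y \<in> carrier N" for y
  proof -
    obtain j m where jm: "j \<in> J" "m \<in> carrier M" "y = j \<oplus>\<^bsub>N\<^esub> d m" using Jg[OF y] by blast
    obtain u w where uw: "u \<in> U" "w \<in> carrier M" "d w = \<zero>\<^bsub>N\<^esub>" "m = u \<oplus>\<^bsub>M\<^esub> w" using Ug[OF jm(2)] by blast
    then have "d m = d u" by (simp add: dl)
    then have "y \<ominus>\<^bsub>N\<^esub> d u = j" using jm uw by (simp add: m_minus_def N.a_assoc N.r_neg)
    then show ?thesis using jm uw by blast
  qed
  \<comment> \<open>The difference of the two remainders is \<open>d (u - u')\<close> and lies in
    \<open>J\<close>, so it is zero; then \<open>u - u'\<close> is in \<open>U\<close> and in the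
    kernel. Linearity of \<open>s\<close> rests on this uniqueness.\<close>
  have un: "u = u'" if "y \<in> carrier N" "u \<in> U" "u' \<in> U" "y \<ominus>\<^bsub>N\<^esub> d u \<in> J" "y \<ominus>\<^bsub>N\<^esub> d u' \<in> J" for y u u'
  proof -
    have "(y \<ominus>\<^bsub>N\<^esub> d u') \<ominus>\<^bsub>N\<^esub> (y \<ominus>\<^bsub>N\<^esub> d u) \<in> J" using that submodule_minus[OF N J] by blast
    moreover have "(y \<ominus>\<^bsub>N\<^esub> d u') \<ominus>\<^bsub>N\<^esub> (y \<ominus>\<^bsub>N\<^esub> d u) = d (u \<ominus>\<^bsub>M\<^esub> u')"
      using that N by (simp add: dl m_group)
    moreover have "u \<ominus>\<^bsub>M\<^esub> u' \<in> carrier M" using that by simp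
    ultimately have "d (u \<ominus>\<^bsub>M\<^esub> u') = \<zero>\<^bsub>N\<^esub>" using JI by (metis IntI imageI singletonD)
    moreover have "u \<ominus>\<^bsub>M\<^esub> u' \<in> U" using that submodule_minus[OF M U] by blast
    ultimately have "u \<ominus>\<^bsub>M\<^esub> u' \<in> U \<inter> ?K" using \<open>u \<ominus>\<^bsub>M\<^esub> u' \<in> carrier M\<close> by simp
    then have "u \<ominus>\<^bsub>M\<^esub> u' = \<zero>\<^bsub>M\<^esub>" unfolding UK by simp
    then show ?thesis using that M by (simp add: m_minus_eq_zero)
  qed
  define s where "s = (\<lambda>y\<in>carrier N. SOME u. u \<in> U \<and> y \<ominus>\<^bsub>N\<^esub> d u \<in> J)"
  have s: "s y \<in> U \<and> y \<ominus>\<^bsub>N\<^esub> d (s y) \<in> J" if "y \<in> carrier N" for y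
    using someI_ex[of "\<lambda>u. u \<in> U \<and> y \<ominus>\<^bsub>N\<^esub> d u \<in> J"] ex[OF that] that by (auto simp: s_def)
  have seq: "s y = u" if "y \<in> carrier N" "u \<in> U" "y \<ominus>\<^bsub>N\<^esub> d u \<in> J" for y u
    using s[OF that(1)] that by (intro un) auto
  show ?thesis
  proof (rule that)
    show "s \<in> linmaps k N M"
    proof (rule linmapsI)
      show "s y \<in> carrier M" if "y \<in> carrier N" for y using s[OF that] by simp
      show "s y = undefined" if "y \<notin> carrier N" for y using that by (simp add: s_def)
    next
      fix x y assume xy: "x \<in> carrier N" "y \<in> carrier N"
      show "s (x \<oplus>\<^bsub>N\<^esub> y) = s x \<oplus>\<^bsub>M\<^esub> s y"
      proof (rule seq)
        have "x \<oplus>\<^bsub>N\<^esub> y \<ominus>\<^bsub>N\<^esub> d (s x \<oplus>\<^bsub>M\<^esub> s y) = (x \<ominus>\<^bsub>N\<^esub> d (s x)) \<oplus>\<^bsub>N\<^esub> (y \<ominus>\<^bsub>N\<^esub> d (s y))"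
          using xy s N by (simp add: dl m_group)
        then show "x \<oplus>\<^bsub>N\<^esub> y \<ominus>\<^bsub>N\<^esub> d (s x \<oplus>\<^bsub>M\<^esub> s y) \<in> J" using s xy submodule_add[OF J] by simp
      qed (use xy s submodule_add[OF U] in auto)
    next
      fix a x assume ax: "a \<in> carrier k" "x \<in> carrier N"
      show "s (a \<odot>\<^bsub>N\<^esub> x) = a \<odot>\<^bsub>M\<^esub> s x"
      proof (rule seq)
        have "a \<odot>\<^bsub>N\<^esub> x \<ominus>\<^bsub>N\<^esub> d (a \<odot>\<^bsub>M\<^esub> s x) = a \<odot>\<^bsub>N\<^esub> (x \<ominus>\<^bsub>N\<^esub> d (s x))"
          using ax s by (simp add: dl m_minus_def N.smult_r_distr N.smult_r_minus)
        then show "a \<odot>\<^bsub>N\<^esub> x \<ominus>\<^bsub>N\<^esub> d (a \<odot>\<^bsub>M\<^esub> s x) \<in> J" using s ax submodule_smult[OF J] by simp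
      qed (use ax s submodule_smult[OF U] in auto)
    qed
  next
    fix x assume x: "x \<in> carrier M"
    \<comment> \<open>The remainder of \<open>d x\<close> lies in \<open>J\<close> by the choice of
      \<open>s\<close>, and is itself a value of \<open>d\<close>.\<close>
    then have "d x \<ominus>\<^bsub>N\<^esub> d (s (d x)) \<in> J" "s (d x) \<in> carrier M" using s by auto
    moreover have "d x \<ominus>\<^bsub>N\<^esub> d (s (d x)) = d (x \<ominus>\<^bsub>M\<^esub> s (d x))" using x s by (simp add: dl)
    ultimately have "d x \<ominus>\<^bsub>N\<^esub> d (s (d x)) = \<zero>\<^bsub>N\<^esub>" using JI x by (metis IntI M.minus_closed imageI singletonD)
    then show "d (s (d x)) = d x" using x s N by (simp add: m_minus_eq_zero)
  qed
qed

end

section \<open>Graded tensor products\<close>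

text \<open>The degrees are arguments of \<open>b\<close>, so this is a family of bilinear maps, one
  for each pair of degrees. A map of degree \<open>r\<close> is covered by taking the shifted module
  \<open>\<lambda>n. P (n + r)\<close> as target.\<close>

definition bilinear ::
  "'k ring \<Rightarrow> ('k, 'a) gmod \<Rightarrow> ('k, 'b) gmod \<Rightarrow> ('k, 'c) gmod \<Rightarrow> (int \<Rightarrow> 'a \<Rightarrow> int \<Rightarrow> 'b \<Rightarrow> 'c) \<Rightarrow> bool" where
  "bilinear k X Y P b \<longleftrightarrow>
     (\<forall>i j. \<forall>x\<in>carrier (X i). \<forall>y\<in>carrier (Y j).
        b i x j y \<in> carrier (P (i + j)) \<and>
        (\<forall>x'\<in>carrier (X i). b i (x \<oplus>\<^bsub>X i\<^esub> x') j y = b i x j y \<oplus>\<^bsub>P (i + j)\<^esub> b i x' j y) \<and>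
        (\<forall>y'\<in>carrier (Y j). b i x j (y \<oplus>\<^bsub>Y j\<^esub> y') = b i x j y \<oplus>\<^bsub>P (i + j)\<^esub> b i x j y') \<and>
        (\<forall>a\<in>carrier k. b i (a \<odot>\<^bsub>X i\<^esub> x) j y = a \<odot>\<^bsub>P (i + j)\<^esub> b i x j y \<and>
                       b i x j (a \<odot>\<^bsub>Y j\<^esub> y) = a \<odot>\<^bsub>P (i + j)\<^esub> b i x j y))"

lemma bilinearI:
  assumes "\<And>i x j y. x \<in> carrier (X i) \<Longrightarrow> y \<in> carrier (Y j) \<Longrightarrow> b i x j y \<in> carrier (P (i + j))"
    and "\<And>i x x' j y. x \<in> carrier (X i) \<Longrightarrow> x' \<in> carrier (X i) \<Longrightarrow> y \<in> carrier (Y j) \<Longrightarrow>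
      b i (x \<oplus>\<^bsub>X i\<^esub> x') j y = b i x j y \<oplus>\<^bsub>P (i + j)\<^esub> b i x' j y"
    and "\<And>i x j y y'. x \<in> carrier (X i) \<Longrightarrow> y \<in> carrier (Y j) \<Longrightarrow> y' \<in> carrier (Y j) \<Longrightarrow>
      b i x j (y \<oplus>\<^bsub>Y j\<^esub> y') = b i x j y \<oplus>\<^bsub>P (i + j)\<^esub> b i x j y'"
    and "\<And>a i x j y. a \<in> carrier k \<Longrightarrow> x \<in> carrier (X i) \<Longrightarrow> y \<in> carrier (Y j) \<Longrightarrow>
      b i (a \<odot>\<^bsub>X i\<^esub> x) j y = a \<odot>\<^bsub>P (i + j)\<^esub> b i x j y"
    and "\<And>a i x j y. a \<in> carrier k \<Longrightarrow> x \<in> carrier (X i) \<Longrightarrow> y \<in> carrier (Y j) \<Longrightarrow>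
      b i x j (a \<odot>\<^bsub>Y j\<^esub> y) = a \<odot>\<^bsub>P (i + j)\<^esub> b i x j y"
  shows "bilinear k X Y P b"
  using assms by (simp add: bilinear_def)

text \<open>The sum inside \<open>tens_lift\<close>, separated from the choice of a
  representative.\<close>

definition free_lift :: "'k ring \<Rightarrow> ('k, 'c) module \<Rightarrow> ('g \<Rightarrow> 'c) \<Rightarrow> ('g \<Rightarrow> 'k) \<Rightarrow> 'c" where
  "free_lift k P b u = finsum P (\<lambda>g. u g \<odot>\<^bsub>P\<^esub> b g) {g. u g \<noteq> \<zero>\<^bsub>k\<^esub>}"

context ground_ring
begin

section \<open>Free modules\<close>

lemma free_module_carrier:
  "u \<in> carrier (free_module k G) \<longleftrightarrow>
     (\<forall>g. u g \<in> carrier k) \<and> finite {g. u g \<noteq> \<zero>} \<and> {g. u g \<noteq> \<zero>} \<subseteq> G"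
  by (auto simp: free_module_def)

lemma free_module_ops [simp]:
  "(u \<oplus>\<^bsub>free_module k G\<^esub> v) g = u g \<oplus> v g"
  "(a \<odot>\<^bsub>free_module k G\<^esub> u) g = a \<otimes> u g"
  "\<zero>\<^bsub>free_module k G\<^esub> g = \<zero>"
  by (simp_all add: free_module_def)

lemma free_module_add_supp: "{g. (u \<oplus>\<^bsub>free_module k G\<^esub> v) g \<noteq> \<zero>} \<subseteq> {g. u g \<noteq> \<zero>} \<union> {g. v g \<noteq> \<zero>}"
  by auto

lemma free_module_smult_supp:
  "a \<in> carrier k \<Longrightarrow> {g. (a \<odot>\<^bsub>free_module k G\<^esub> v) g \<noteq> \<zero>} \<subseteq> {g. v g \<noteq> \<zero>}"
  by auto

lemma free_module_module: "module k (free_module k G)"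
proof -
  let ?F = "free_module k G"
  have add: "u \<oplus>\<^bsub>?F\<^esub> v \<in> carrier ?F" if "u \<in> carrier ?F" "v \<in> carrier ?F" for u v
  proof -
    have "finite ({g. u g \<noteq> \<zero>} \<union> {g. v g \<noteq> \<zero>})" "{g. u g \<noteq> \<zero>} \<union> {g. v g \<noteq> \<zero>} \<subseteq> G"
      using that by (auto simp: free_module_carrier)
    with free_module_add_supp[of G u v] have "finite {g. (u \<oplus>\<^bsub>?F\<^esub> v) g \<noteq> \<zero>}" "{g. (u \<oplus>\<^bsub>?F\<^esub> v) g \<noteq> \<zero>} \<subseteq> G"
      by (auto intro: finite_subset)
    then show ?thesis using that unfolding free_module_carrier by simp
  qed
  have smult: "a \<odot>\<^bsub>?F\<^esub> v \<in> carrier ?F" if "a \<in> carrier k" "v \<in> carrier ?F" for a v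
  proof -
    have "finite {g. (a \<odot>\<^bsub>?F\<^esub> v) g \<noteq> \<zero>}" "{g. (a \<odot>\<^bsub>?F\<^esub> v) g \<noteq> \<zero>} \<subseteq> G"
      using free_module_smult_supp[OF that(1), of G v] that
      by (auto simp: free_module_carrier intro: finite_subset)
    then show ?thesis using that unfolding free_module_carrier by simp
  qed
  have c: "u g \<in> carrier k" if "u \<in> carrier ?F" for u g using that by (simp add: free_module_carrier)
  show ?thesis
  proof (rule moduleI)
    show "abelian_group ?F"
    proof (rule abelian_groupI)
      show "\<zero>\<^bsub>?F\<^esub> \<in> carrier ?F" by (simp add: free_module_carrier)
    next
      fix u assume u: "u \<in> carrier ?F"
      have "((\<ominus> \<one>) \<odot>\<^bsub>?F\<^esub> u) \<oplus>\<^bsub>?F\<^esub> u = \<zero>\<^bsub>?F\<^esub>"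
        using c[OF u] by (intro ext) (simp add: l_minus l_neg)
      then show "\<exists>v\<in>carrier ?F. v \<oplus>\<^bsub>?F\<^esub> u = \<zero>\<^bsub>?F\<^esub>" using smult[of "\<ominus> \<one>" u] u by auto
      show "\<zero>\<^bsub>?F\<^esub> \<oplus>\<^bsub>?F\<^esub> u = u" using c[OF u] by (intro ext) simp
    next
      fix u v assume "u \<in> carrier ?F" "v \<in> carrier ?F"
      then show "u \<oplus>\<^bsub>?F\<^esub> v = v \<oplus>\<^bsub>?F\<^esub> u" by (intro ext) (simp add: c a_comm)
    next
      fix u v w assume "u \<in> carrier ?F" "v \<in> carrier ?F" "w \<in> carrier ?F"
      then show "u \<oplus>\<^bsub>?F\<^esub> v \<oplus>\<^bsub>?F\<^esub> w = u \<oplus>\<^bsub>?F\<^esub> (v \<oplus>\<^bsub>?F\<^esub> w)" by (intro ext) (simp add: c a_assoc)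
    qed (rule add)
  next
    fix a b u assume "a \<in> carrier k" "b \<in> carrier k" "u \<in> carrier ?F"
    then show "(a \<oplus> b) \<odot>\<^bsub>?F\<^esub> u = a \<odot>\<^bsub>?F\<^esub> u \<oplus>\<^bsub>?F\<^esub> b \<odot>\<^bsub>?F\<^esub> u" "(a \<otimes> b) \<odot>\<^bsub>?F\<^esub> u = a \<odot>\<^bsub>?F\<^esub> (b \<odot>\<^bsub>?F\<^esub> u)"
      by (simp_all add: fun_eq_iff c l_distr m_assoc)
  next
    fix a u v assume "a \<in> carrier k" "u \<in> carrier ?F" "v \<in> carrier ?F"
    then show "a \<odot>\<^bsub>?F\<^esub> (u \<oplus>\<^bsub>?F\<^esub> v) = a \<odot>\<^bsub>?F\<^esub> u \<oplus>\<^bsub>?F\<^esub> a \<odot>\<^bsub>?F\<^esub> v" by (simp add: fun_eq_iff c r_distr)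
  next
    fix u assume "u \<in> carrier ?F"
    then show "\<one> \<odot>\<^bsub>?F\<^esub> u = u" by (simp add: fun_eq_iff c)
  qed (use smult is_cring in auto)
qed

lemma generator_closed [simp]: "g \<in> G \<Longrightarrow> generator k g \<in> carrier (free_module k G)"
  by (auto simp: free_module_carrier generator_def)

text \<open>Induction on the finite support. Formulated with a submodule in place of a predicate,
  since the properties to be propagated are closed under sums and scalars.\<close>

lemma free_module_induct:
  assumes N: "submodule N k (free_module k G)" and gen: "\<And>g. g \<in> G \<Longrightarrow> generator k g \<in> N"
    and u: "u \<in> carrier (free_module k G)"
  shows "u \<in> N"
proof -
  let ?F = "free_module k G"
  have "\<forall>u\<in>carrier ?F. {g. u g \<noteq> \<zero>} = S \<longrightarrow> u \<in> N" if "finite S" for S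
    using that
  proof (induction S rule: finite_induct)
    case empty
    show ?case
    proof (intro ballI impI)
      fix u assume "u \<in> carrier ?F" "{g. u g \<noteq> \<zero>} = {}"
      then have "u = \<zero>\<^bsub>?F\<^esub>" by (intro ext) simp
      then show "u \<in> N" using submodule_zero[OF N] by simp
    qed
  next
    case (insert g S)
    show ?case
    proof (intro ballI impI)
      fix u assume u: "u \<in> carrier ?F" and s: "{g. u g \<noteq> \<zero>} = insert g S"
      have uc: "u h \<in> carrier k" for h using u by (simp add: free_module_carrier)
      have g: "g \<in> G" using u s by (auto simp: free_module_carrier)
      \<comment> \<open>\<open>u\<close> is \<open>?v\<close> plus the multiple of the generator at
        \<open>g\<close> by \<open>u g\<close>, and the support of \<open>?v\<close> is smaller by
        one point.\<close>
      let ?v = "u(g := \<zero>)"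
      have vs: "{g. ?v g \<noteq> \<zero>} = S" using s insert.hyps by auto
      have "?v \<in> carrier ?F" using u uc vs insert.hyps s by (auto simp: free_module_carrier)
      then have "?v \<in> N" using insert.IH vs by blast
      moreover have "u g \<odot>\<^bsub>?F\<^esub> generator k g \<in> N" using gen[OF g] uc submodule_smult[OF N] by simp
      moreover have "u = ?v \<oplus>\<^bsub>?F\<^esub> (u g \<odot>\<^bsub>?F\<^esub> generator k g)"
        using uc by (intro ext) (simp add: generator_def)
      ultimately show "u \<in> N" using submodule_add[OF N] by metis
    qed
  qed
  then show ?thesis using u by (auto simp: free_module_carrier)
qed

text \<open>Points outside the support contribute zero. With this freedom the sums for
  \<open>u\<close>, \<open>v\<close> and \<open>u + v\<close>, whose supports differ, are taken over
  one index set.\<close>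

lemma free_lift_superset:
  assumes P: "module k P" and u: "u \<in> carrier (free_module k G)" and b: "b \<in> G \<rightarrow> carrier P"
    and A: "finite A" "{g. u g \<noteq> \<zero>} \<subseteq> A" "A \<subseteq> G"
  shows "free_lift k P b u = finsum P (\<lambda>g. u g \<odot>\<^bsub>P\<^esub> b g) A"
proof -
  interpret P: module k P by fact
  have uc: "u h \<in> carrier k" for h using u by (simp add: free_module_carrier)
  show ?thesis unfolding free_lift_def
  proof (rule P.add.finprod_mono_neutral_cong_left)
    have bA: "g \<in> A \<Longrightarrow> b g \<in> carrier P" for g using b A by auto
    then show "(\<lambda>g. u g \<odot>\<^bsub>P\<^esub> b g) \<in> A \<rightarrow> carrier P" using uc by auto
    show "u i \<odot>\<^bsub>P\<^esub> b i = \<zero>\<^bsub>P\<^esub>" if "i \<in> A - {g. u g \<noteq> \<zero>}" for i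
      using that bA by auto
  qed (use A in auto)
qed

lemma free_lift_linear:
  assumes P: "module k P" and b: "b \<in> G \<rightarrow> carrier P"
  shows "(\<lambda>u\<in>carrier (free_module k G). free_lift k P b u) \<in> linmaps k (free_module k G) P"
proof (rule linmaps_restrictI[OF free_module_module])
  interpret P: module k P by fact
  let ?F = "free_module k G"
  have uc: "u h \<in> carrier k" if "u \<in> carrier ?F" for u h using that by (simp add: free_module_carrier)
  show "free_lift k P b u \<in> carrier P" if "u \<in> carrier ?F" for u
  proof -
    have "b g \<in> carrier P" if "u g \<noteq> \<zero>" for g
      using that b \<open>u \<in> carrier ?F\<close> by (auto simp: free_module_carrier)
    then show ?thesis unfolding free_lift_def using uc[OF that] by (intro P.finsum_closed) auto
  qed
  fix u v assume u: "u \<in> carrier ?F" and v: "v \<in> carrier ?F"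
  \<comment> \<open>The support of \<open>u + v\<close> can be smaller than this union, as values
    may cancel.\<close>
  let ?A = "{g. u g \<noteq> \<zero>} \<union> {g. v g \<noteq> \<zero>}"
  have A: "finite ?A" "?A \<subseteq> G" using u v by (auto simp: free_module_carrier)
  have bA [simp]: "u g \<noteq> \<zero> \<Longrightarrow> b g \<in> carrier P" "v g \<noteq> \<zero> \<Longrightarrow> b g \<in> carrier P" for g using b A by auto
  have uv: "u \<oplus>\<^bsub>?F\<^esub> v \<in> carrier ?F" using u v by (simp add: free_module_module)
  have "free_lift k P b (u \<oplus>\<^bsub>?F\<^esub> v) = finsum P (\<lambda>g. (u \<oplus>\<^bsub>?F\<^esub> v) g \<odot>\<^bsub>P\<^esub> b g) ?A"
    by (rule free_lift_superset[OF P uv b A(1) free_module_add_supp A(2)])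
  also have "\<dots> = finsum P (\<lambda>g. (u g \<oplus> v g) \<odot>\<^bsub>P\<^esub> b g) ?A" by simp
  also have "\<dots> = finsum P (\<lambda>g. u g \<odot>\<^bsub>P\<^esub> b g \<oplus>\<^bsub>P\<^esub> v g \<odot>\<^bsub>P\<^esub> b g) ?A"
    using uc[OF u] uc[OF v] bA by (intro P.finsum_cong') (auto intro!: P.smult_l_distr)
  also have "\<dots> = finsum P (\<lambda>g. u g \<odot>\<^bsub>P\<^esub> b g) ?A \<oplus>\<^bsub>P\<^esub> finsum P (\<lambda>g. v g \<odot>\<^bsub>P\<^esub> b g) ?A"
    using uc[OF u] uc[OF v] bA by (intro P.finsum_addf) (auto)
  also have "\<dots> = free_lift k P b u \<oplus>\<^bsub>P\<^esub> free_lift k P b v"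
    using free_lift_superset[OF P u b A(1) _ A(2)] free_lift_superset[OF P v b A(1) _ A(2)] by simp
  finally show "free_lift k P b (u \<oplus>\<^bsub>?F\<^esub> v) = free_lift k P b u \<oplus>\<^bsub>P\<^esub> free_lift k P b v" .
next
  interpret P: module k P by fact
  let ?F = "free_module k G"
  fix a u assume a: "a \<in> carrier k" and u: "u \<in> carrier ?F"
  have uc: "u h \<in> carrier k" for h using u by (simp add: free_module_carrier)
  let ?A = "{g. u g \<noteq> \<zero>}"
  have A: "finite ?A" "?A \<subseteq> G" using u by (auto simp: free_module_carrier)
  have bA [simp]: "u g \<noteq> \<zero> \<Longrightarrow> b g \<in> carrier P" for g using b A by auto
  have au: "a \<odot>\<^bsub>?F\<^esub> u \<in> carrier ?F" using u a by (simp add: free_module_module)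
  have "free_lift k P b (a \<odot>\<^bsub>?F\<^esub> u) = finsum P (\<lambda>g. (a \<odot>\<^bsub>?F\<^esub> u) g \<odot>\<^bsub>P\<^esub> b g) ?A"
    by (rule free_lift_superset[OF P au b A(1) free_module_smult_supp[OF a] A(2)])
  also have "\<dots> = finsum P (\<lambda>g. (a \<otimes> u g) \<odot>\<^bsub>P\<^esub> b g) ?A" by simp
  also have "\<dots> = finsum P (\<lambda>g. a \<odot>\<^bsub>P\<^esub> (u g \<odot>\<^bsub>P\<^esub> b g)) ?A"
    using bA uc a by (intro P.finsum_cong') (auto intro!: P.smult_assoc1)
  also have "\<dots> = a \<odot>\<^bsub>P\<^esub> finsum P (\<lambda>g. u g \<odot>\<^bsub>P\<^esub> b g) ?A"
    using bA A uc a by (intro P.finsum_smult_ldistr[symmetric]) auto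
  finally show "free_lift k P b (a \<odot>\<^bsub>?F\<^esub> u) = a \<odot>\<^bsub>P\<^esub> free_lift k P b u"
    by (simp add: free_lift_def)
qed

lemma free_lift_generator:
  assumes P: "module k P" and b: "b \<in> G \<rightarrow> carrier P" and g: "g \<in> G"
  shows "free_lift k P b (generator k g) = b g"
proof -
  interpret P: module k P by fact
  have bg: "b g \<in> carrier P" using b g by auto
  have "free_lift k P b (generator k g) = finsum P (\<lambda>h. generator k g h \<odot>\<^bsub>P\<^esub> b h) {g}"
    using g by (intro free_lift_superset[OF P generator_closed[OF g] b]) (auto simp: generator_def)
  also have "\<dots> = b g" using bg by (subst P.add.finprod_insert) (auto simp: generator_def)
  finally show ?thesis .
qed

section \<open>Generated submodules, and tensors as cosets\<close>

lemma generated_submodule_submodule: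
  assumes M: "module k M" and A: "A \<subseteq> carrier M"
  shows "submodule (generated_submodule k M A) k M"
proof -
  have c: "submodule (carrier M) k M" using M by (rule module.carrier_is_submodule)
  show ?thesis unfolding generated_submodule_def
  proof (rule submodule_intro[OF M])
    show "\<Inter>{N. submodule N k M \<and> A \<subseteq> N} \<subseteq> carrier M" using c A by auto
  qed (auto intro: submodule_zero submodule_add submodule_smult)
qed

lemma generated_submodule_superset: "A \<subseteq> generated_submodule k M A"
  by (auto simp: generated_submodule_def)

lemma generated_submodule_least: "submodule N k M \<Longrightarrow> A \<subseteq> N \<Longrightarrow> generated_submodule k M A \<subseteq> N"
  by (auto simp: generated_submodule_def)

lemma gr_objD [simp]: "gr_obj k X \<Longrightarrow> module k (X n)"
  by (simp add: gr_obj_def)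

lemma tens_free_module [simp]: "module k (tens_free k X Y n)"
  by (simp add: tens_free_def free_module_module)

lemma generator_tens_free [simp]:
  "i + j = n \<Longrightarrow> x \<in> carrier (X i) \<Longrightarrow> y \<in> carrier (Y j) \<Longrightarrow> generator k (i, x, j, y) \<in> carrier (tens_free k X Y n)"
  by (simp add: tens_free_def tens_gens_def)

lemma tens_rels_submodule:
  assumes "gr_obj k X" "gr_obj k Y"
  shows "submodule (tens_rels k X Y n) k (tens_free k X Y n)"
  unfolding tens_rels_def
  by (rule generated_submodule_submodule[OF tens_free_module]) (use assms in auto)

lemma gtens_module [simp]: "gr_obj k X \<Longrightarrow> gr_obj k Y \<Longrightarrow> module k (gtens k X Y n)"
  by (simp add: gtens_def quot_module tens_rels_submodule)

lemma gtens_obj [simp]: "gr_obj k X \<Longrightarrow> gr_obj k Y \<Longrightarrow> gr_obj k (gtens k X Y)"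
  by (simp add: gr_obj_def[of k "gtens k X Y"])

text \<open>The total degree is a variable \<open>n\<close> with the premise
  \<open>i + j = n\<close>. Degrees such as \<open>i + 1 + j\<close> and \<open>i + j + 1\<close>
  are equal but not identical as terms, and a module indexed by one of them is not rewritten to the
  other; the premise lets each use name the degree it wants.\<close>

lemma ptens_closed [simp]:
  assumes "i + j = n" "x \<in> carrier (X i)" "y \<in> carrier (Y j)"
  shows "ptens k X Y i x j y \<in> carrier (gtens k X Y n)"
  using generator_tens_free[of i j n x X y Y, OF assms] assms(1) unfolding ptens_def gtens_def quot_carrier by auto

lemma gtens_carrier:
  "carrier (gtens k X Y n) =
     {tens_rels k X Y n +>\<^bsub>tens_free k X Y n\<^esub> u | u. u \<in> carrier (tens_free k X Y n)}"
  by (simp add: gtens_def quot_carrier)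

lemma ptens_coset:
  "i + j = n \<Longrightarrow> ptens k X Y i x j y = tens_rels k X Y n +>\<^bsub>tens_free k X Y n\<^esub> generator k (i, x, j, y)"
  by (auto simp: ptens_def)

context
  fixes X :: "('k, 'a) gmod" and Y :: "('k, 'b) gmod"
  assumes XY [simp]: "gr_obj k X" "gr_obj k Y"
begin

text \<open>The difference of representatives of the two sides is one of the generators of
  \<open>tens_rels\<close>. The same reason gives the three rules that follow.\<close>

lemma ptens_add_left:
  assumes n: "i + j = n" and "x \<in> carrier (X i)" "x' \<in> carrier (X i)" "y \<in> carrier (Y j)"
  shows "ptens k X Y i (x \<oplus>\<^bsub>X i\<^esub> x') j y = ptens k X Y i x j y \<oplus>\<^bsub>gtens k X Y n\<^esub> ptens k X Y i x' j y"
  unfolding ptens_coset[OF n] gtens_def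
  using assms tens_rels_submodule[OF XY, of n]
  by (subst quot_add, simp_all, subst a_coset_eq_iff, simp_all)
    (auto simp: tens_rels_def intro!: subsetD[OF generated_submodule_superset])

lemma ptens_add_right:
  assumes n: "i + j = n" and "x \<in> carrier (X i)" "y \<in> carrier (Y j)" "y' \<in> carrier (Y j)"
  shows "ptens k X Y i x j (y \<oplus>\<^bsub>Y j\<^esub> y') = ptens k X Y i x j y \<oplus>\<^bsub>gtens k X Y n\<^esub> ptens k X Y i x j y'"
  unfolding ptens_coset[OF n] gtens_def
  using assms tens_rels_submodule[OF XY, of n]
  by (subst quot_add, simp_all, subst a_coset_eq_iff, simp_all)
    (auto simp: tens_rels_def intro!: subsetD[OF generated_submodule_superset])

lemma ptens_smult_left:
  assumes n: "i + j = n" and "a \<in> carrier k" "x \<in> carrier (X i)" "y \<in> carrier (Y j)"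
  shows "ptens k X Y i (a \<odot>\<^bsub>X i\<^esub> x) j y = a \<odot>\<^bsub>gtens k X Y n\<^esub> ptens k X Y i x j y"
  unfolding ptens_coset[OF n] gtens_def
  using assms tens_rels_submodule[OF XY, of n]
  by (subst quot_smult, simp_all, subst a_coset_eq_iff, simp_all)
    (auto simp: tens_rels_def intro!: subsetD[OF generated_submodule_superset])

lemma ptens_smult_right:
  assumes n: "i + j = n" and "a \<in> carrier k" "x \<in> carrier (X i)" "y \<in> carrier (Y j)"
  shows "ptens k X Y i x j (a \<odot>\<^bsub>Y j\<^esub> y) = a \<odot>\<^bsub>gtens k X Y n\<^esub> ptens k X Y i x j y"
  unfolding ptens_coset[OF n] gtens_def
  using assms tens_rels_submodule[OF XY, of n]
  by (subst quot_smult, simp_all, subst a_coset_eq_iff, simp_all)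
    (auto simp: tens_rels_def intro!: subsetD[OF generated_submodule_superset])

text \<open>There is no case for scalars, because
  \<open>a \<odot> (x \<otimes> y) = (a \<odot> x) \<otimes> y\<close> is again a pure tensor, and
  none for zero, which is a pure tensor too. Hence every tensor is a sum of pure ones.\<close>

lemma gtens_induct [consumes 1, case_names ptens add]:
  assumes t: "t \<in> carrier (gtens k X Y n)"
    and pt: "\<And>i x j y. i + j = n \<Longrightarrow> x \<in> carrier (X i) \<Longrightarrow> y \<in> carrier (Y j) \<Longrightarrow> Q (ptens k X Y i x j y)"
    and add: "\<And>s t. s \<in> carrier (gtens k X Y n) \<Longrightarrow> t \<in> carrier (gtens k X Y n) \<Longrightarrow> Q s \<Longrightarrow> Q t \<Longrightarrow>
      Q (s \<oplus>\<^bsub>gtens k X Y n\<^esub> t)"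
  shows "Q t"
proof -
  let ?T = "gtens k X Y n" and ?F = "tens_free k X Y n" and ?R = "tens_rels k X Y n"
  interpret T: module k ?T by simp
  \<comment> \<open>\<open>Q\<close> is demanded of all multiples: \<open>N\<close> has to be closed
    under scalars, while nothing of the kind is known of \<open>Q\<close>.\<close>
  define N where "N = {u \<in> carrier ?F. \<forall>a\<in>carrier k. Q (a \<odot>\<^bsub>?T\<^esub> (?R +>\<^bsub>?F\<^esub> u))}"
  have c: "?R +>\<^bsub>?F\<^esub> u \<in> carrier ?T" if "u \<in> carrier ?F" for u using that by (auto simp: gtens_carrier)
  \<comment> \<open>Zero is \<open>0 \<otimes> 0\<close>; any pair of degrees with sum
    \<open>n\<close> would do.\<close>
  have z: "Q \<zero>\<^bsub>?T\<^esub>"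
  proof -
    have "Q (ptens k X Y n (\<zero> \<odot>\<^bsub>X n\<^esub> \<zero>\<^bsub>X n\<^esub>) 0 \<zero>\<^bsub>Y 0\<^esub>)" by (rule pt) auto
    then show ?thesis by (subst (asm) ptens_smult_left[of n 0 n]) auto
  qed
  note q = quot_add[OF tens_free_module tens_rels_submodule[OF XY], folded gtens_def]
    quot_smult[OF tens_free_module tens_rels_submodule[OF XY], folded gtens_def]
    quot_zero[OF tens_free_module tens_rels_submodule[OF XY], folded gtens_def]
  have "submodule N k ?F"
  proof (rule submodule_intro)
    show "N \<subseteq> carrier ?F" by (auto simp: N_def)
    show "\<zero>\<^bsub>?F\<^esub> \<in> N" using z by (simp add: N_def flip: q(3))
    show "u \<oplus>\<^bsub>?F\<^esub> v \<in> N" if "u \<in> N" "v \<in> N" for u v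
      using that add c by (simp add: N_def T.smult_r_distr flip: q(1))
    show "a \<odot>\<^bsub>?F\<^esub> u \<in> N" if "a \<in> carrier k" "u \<in> N" for a u
      using that c by (simp add: N_def flip: q(2) T.smult_assoc1)
  qed simp
  moreover have "generator k g \<in> N" if "g \<in> tens_gens X Y n" for g
  proof -
    obtain i x j y where g: "g = (i, x, j, y)" "i + j = n" "x \<in> carrier (X i)" "y \<in> carrier (Y j)"
      using \<open>g \<in> tens_gens X Y n\<close> unfolding tens_gens_def by (cases g) auto
    have "Q (a \<odot>\<^bsub>?T\<^esub> ptens k X Y i x j y)" if "a \<in> carrier k" for a
      using pt[of i j "a \<odot>\<^bsub>X i\<^esub> x" y] that g ptens_smult_left[OF g(2) that g(3,4)] by simp
    then show ?thesis using g by (simp add: N_def ptens_coset)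
  qed
  ultimately have "u \<in> N" if "u \<in> carrier ?F" for u
    using free_module_induct that unfolding tens_free_def by metis
  moreover obtain u where u: "u \<in> carrier ?F" "t = ?R +>\<^bsub>?F\<^esub> u" using t by (auto simp: gtens_carrier)
  ultimately have "Q (\<one> \<odot>\<^bsub>?T\<^esub> t)" unfolding N_def using one_closed by blast
  then show ?thesis using t by simp
qed

lemma gtens_linmaps_eqI:
  assumes "f \<in> linmaps k (gtens k X Y n) P" "g \<in> linmaps k (gtens k X Y n) P"
    and "\<And>i x j y. i + j = n \<Longrightarrow> x \<in> carrier (X i) \<Longrightarrow> y \<in> carrier (Y j) \<Longrightarrow>
      f (ptens k X Y i x j y) = g (ptens k X Y i x j y)"
  shows "f = g"
proof (rule linmaps_eqI[OF assms(1,2)])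
  fix t assume "t \<in> carrier (gtens k X Y n)"
  then show "f t = g t"
    by (induction rule: gtens_induct) (simp_all add: assms(3) lin_add[OF assms(1)] lin_add[OF assms(2)])
qed

section \<open>Universal property of the tensor product\<close>

context
  fixes P :: "('k, 'c) gmod" and b
  assumes P [simp]: "gr_obj k P" and b: "bilinear k X Y P b"
begin

text \<open>The linear extension \<open>L\<close> to the free module kills \<open>tens_rels\<close>,
  so it is constant on cosets, and \<open>tens_lift\<close> has the value of \<open>L\<close> at any
  representative, whichever one \<open>SOME\<close> picks.\<close>

lemma tens_lift_free:
  fixes n :: int
  defines "L \<equiv> (\<lambda>u\<in>carrier (tens_free k X Y n). free_lift k (P n) (\<lambda>(i, x, j, y). b i x j y) u)"
  shows tens_lift_free_linear: "L \<in> linmaps k (tens_free k X Y n) (P n)"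
    and tens_lift_free_generator:
      "i + j = n \<Longrightarrow> x \<in> carrier (X i) \<Longrightarrow> y \<in> carrier (Y j) \<Longrightarrow> L (generator k (i, x, j, y)) = b i x j y"
    and tens_lift_free_coset:
      "u \<in> carrier (tens_free k X Y n) \<Longrightarrow> tens_lift k X Y P b n (tens_rels k X Y n +>\<^bsub>tens_free k X Y n\<^esub> u) = L u"
proof -
  let ?F = "tens_free k X Y n" and ?R = "tens_rels k X Y n"
  have bc: "(\<lambda>(i, x, j, y). b i x j y) \<in> tens_gens X Y n \<rightarrow> carrier (P n)"
    using b by (auto simp: tens_gens_def bilinear_def)
  show lin: "L \<in> linmaps k ?F (P n)"
    unfolding L_def tens_free_def by (rule free_lift_linear[OF _ bc]) simp
  have gen: "L (generator k (i, x, j, y)) = b i x j y"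
    if "i + j = n" "x \<in> carrier (X i)" "y \<in> carrier (Y j)" for i x j y
    using that free_lift_generator[OF _ bc, of "(i, x, j, y)"] by (simp add: L_def tens_gens_def)
  then show "i + j = n \<Longrightarrow> x \<in> carrier (X i) \<Longrightarrow> y \<in> carrier (Y j) \<Longrightarrow> L (generator k (i, x, j, y)) = b i x j y" .
  have bl: "b i x j y \<in> carrier (P n)"
      "x' \<in> carrier (X i) \<Longrightarrow> b i (x \<oplus>\<^bsub>X i\<^esub> x') j y = b i x j y \<oplus>\<^bsub>P n\<^esub> b i x' j y"
      "y' \<in> carrier (Y j) \<Longrightarrow> b i x j (y \<oplus>\<^bsub>Y j\<^esub> y') = b i x j y \<oplus>\<^bsub>P n\<^esub> b i x j y'"
      "a \<in> carrier k \<Longrightarrow> b i (a \<odot>\<^bsub>X i\<^esub> x) j y = a \<odot>\<^bsub>P n\<^esub> b i x j y"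
      "a \<in> carrier k \<Longrightarrow> b i x j (a \<odot>\<^bsub>Y j\<^esub> y) = a \<odot>\<^bsub>P n\<^esub> b i x j y"
    if "i + j = n" "x \<in> carrier (X i)" "y \<in> carrier (Y j)" for i x x' j y y' a
    using that b by (auto simp: bilinear_def)
  \<comment> \<open>The kernel of \<open>L\<close> is a submodule, so it suffices that it contains
    the four families of generating relations; this is the bilinearity of \<open>b\<close>.\<close>
  have "?R \<subseteq> {u \<in> carrier ?F. L u = \<zero>\<^bsub>P n\<^esub>}"
    unfolding tens_rels_def
  proof (rule generated_submodule_least[OF kernel_submodule[OF _ _ lin]], goal_cases)
    case 3
    show ?case
      apply (intro Un_least subsetI)
         apply (elim CollectE exE conjE, simp add: lin_minus[OF lin] lin_add[OF lin] lin_smult[OF lin] gen bl)+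
      done
  qed simp_all
  then have ker: "L u = \<zero>\<^bsub>P n\<^esub>" if "u \<in> ?R" for u using that by auto
  assume u: "u \<in> carrier ?F"
  define v where "v = (SOME v. v \<in> ?R +>\<^bsub>?F\<^esub> u)"
  have "u \<in> ?R +>\<^bsub>?F\<^esub> u" using u a_coset_mem_iff[OF tens_free_module tens_rels_submodule[OF XY] u] by simp
  then have "v \<in> ?R +>\<^bsub>?F\<^esub> u" unfolding v_def by (rule someI[where P = "\<lambda>v. v \<in> ?R +>\<^bsub>?F\<^esub> u"])
  then have v: "v \<in> carrier ?F" "v \<ominus>\<^bsub>?F\<^esub> u \<in> ?R"
    using u a_coset_mem_iff[OF tens_free_module tens_rels_submodule[OF XY], of u n v]
      a_coset_eq_iff[OF tens_free_module tens_rels_submodule[OF XY], of v n u] by auto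
  then have "L v \<ominus>\<^bsub>P n\<^esub> L u = \<zero>\<^bsub>P n\<^esub>" using u ker lin_minus[OF lin, of v u] by simp
  then have "L v = L u" using u v lin_closed[OF lin] by (simp add: m_minus_eq_zero)
  moreover have "?R +>\<^bsub>?F\<^esub> u \<in> carrier (gtens k X Y n)" using u by (auto simp: gtens_carrier)
  moreover have "(\<lambda>(i, x, j, y). v (i, x, j, y) \<odot>\<^bsub>P n\<^esub> b i x j y) =
      (\<lambda>g. v g \<odot>\<^bsub>P n\<^esub> (case g of (i, x, j, y) \<Rightarrow> b i x j y))" by auto
  ultimately show "tens_lift k X Y P b n (?R +>\<^bsub>?F\<^esub> u) = L u"
    using v by (simp add: tens_lift_def L_def free_lift_def flip: v_def)
qed

lemma tens_lift_ptens:
  assumes "i + j = n" "x \<in> carrier (X i)" "y \<in> carrier (Y j)"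
  shows "tens_lift k X Y P b n (ptens k X Y i x j y) = b i x j y"
  using tens_lift_free_coset[OF generator_tens_free[of i j n x X y Y, OF assms]] tens_lift_free_generator[OF assms]
  by (simp add: ptens_coset[OF assms(1)])

lemma tens_lift_linear: "tens_lift k X Y P b n \<in> linmaps k (gtens k X Y n) (P n)"
proof -
  let ?T = "gtens k X Y n" and ?F = "tens_free k X Y n" and ?R = "tens_rels k X Y n"
  define L where "L = (\<lambda>u\<in>carrier ?F. free_lift k (P n) (\<lambda>(i, x, j, y). b i x j y) u)"
  note lin = tens_lift_free_linear[of n, folded L_def] and cos = tens_lift_free_coset[of _ n, folded L_def]
  note q = quot_add[OF tens_free_module tens_rels_submodule[OF XY], folded gtens_def]
    quot_smult[OF tens_free_module tens_rels_submodule[OF XY], folded gtens_def]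
  show ?thesis
  proof (rule linmapsI)
    show "tens_lift k X Y P b n t \<in> carrier (P n)" if "t \<in> carrier ?T" for t
      using that cos lin_closed[OF lin] by (auto simp: gtens_carrier)
    show "tens_lift k X Y P b n t = undefined" if "t \<notin> carrier ?T" for t
      using that by (simp add: tens_lift_def)
    show "tens_lift k X Y P b n (s \<oplus>\<^bsub>?T\<^esub> t) = tens_lift k X Y P b n s \<oplus>\<^bsub>P n\<^esub> tens_lift k X Y P b n t"
      if "s \<in> carrier ?T" "t \<in> carrier ?T" for s t
      using that cos lin_add[OF lin] by (auto simp: gtens_carrier q)
    show "tens_lift k X Y P b n (a \<odot>\<^bsub>?T\<^esub> t) = a \<odot>\<^bsub>P n\<^esub> tens_lift k X Y P b n t"
      if "a \<in> carrier k" "t \<in> carrier ?T" for a t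
      using that cos lin_smult[OF lin] by (auto simp: gtens_carrier q)
  qed
qed

end

end

end

section \<open>Structure maps of graded modules\<close>

context ground_ring
begin

lemma m_zero_minus [simp]: "module k M \<Longrightarrow> x \<in> carrier M \<Longrightarrow> \<zero>\<^bsub>M\<^esub> \<ominus>\<^bsub>M\<^esub> x = \<ominus>\<^bsub>M\<^esub> x"
  by (simp add: m_minus_def)

lemmas m_smult_one [simp] = module.smult_one[of k]
lemmas m_smult_zero [simp] = module.smult_r_null[of k]
lemmas m_zero_smult [simp] = module.smult_l_null[of k]

lemma smult_left_commute:
  assumes "module k M" "a \<in> carrier k" "b \<in> carrier k" "x \<in> carrier M"
  shows "a \<odot>\<^bsub>M\<^esub> (b \<odot>\<^bsub>M\<^esub> x) = b \<odot>\<^bsub>M\<^esub> (a \<odot>\<^bsub>M\<^esub> x)"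
  using assms by (simp add: m_comm flip: module.smult_assoc1)

section \<open>Signs\<close>

lemma signed_closed [simp]: "module k M \<Longrightarrow> x \<in> carrier M \<Longrightarrow> signed M n x \<in> carrier M"
  by (simp add: signed_def)

lemma signed_add:
  "module k M \<Longrightarrow> x \<in> carrier M \<Longrightarrow> y \<in> carrier M \<Longrightarrow>
   signed M n (x \<oplus>\<^bsub>M\<^esub> y) = signed M n x \<oplus>\<^bsub>M\<^esub> signed M n y"
  by (simp add: signed_def m_group)

lemma signed_smult:
  "module k M \<Longrightarrow> a \<in> carrier k \<Longrightarrow> x \<in> carrier M \<Longrightarrow> signed M n (a \<odot>\<^bsub>M\<^esub> x) = a \<odot>\<^bsub>M\<^esub> signed M n x"
  by (simp add: signed_def module.smult_r_minus)

lemma signed_signed: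
  "module k M \<Longrightarrow> x \<in> carrier M \<Longrightarrow> signed M m (signed M n x) = signed M (m + n) x"
  by (simp add: signed_def)

lemma signed_zero [simp]: "module k M \<Longrightarrow> signed M n \<zero>\<^bsub>M\<^esub> = \<zero>\<^bsub>M\<^esub>"
  by (simp add: signed_def)

lemma lin_signed:
  "f \<in> linmaps k M N \<Longrightarrow> module k M \<Longrightarrow> module k N \<Longrightarrow> x \<in> carrier M \<Longrightarrow>
   f (signed M n x) = signed N n (f x)"
  by (simp add: signed_def lin_neg)

lemma smult_neg:
  "module k M \<Longrightarrow> a \<in> carrier k \<Longrightarrow> x \<in> carrier M \<Longrightarrow> a \<odot>\<^bsub>M\<^esub> (\<ominus>\<^bsub>M\<^esub> x) = \<ominus>\<^bsub>M\<^esub> (a \<odot>\<^bsub>M\<^esub> x)"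
  by (rule module.smult_r_minus)

lemma smult_add:
  "module k M \<Longrightarrow> a \<in> carrier k \<Longrightarrow> x \<in> carrier M \<Longrightarrow> y \<in> carrier M \<Longrightarrow>
   a \<odot>\<^bsub>M\<^esub> (x \<oplus>\<^bsub>M\<^esub> y) = a \<odot>\<^bsub>M\<^esub> x \<oplus>\<^bsub>M\<^esub> a \<odot>\<^bsub>M\<^esub> y"
  by (rule module.smult_r_distr)

lemma smult_minus:
  "module k M \<Longrightarrow> a \<in> carrier k \<Longrightarrow> x \<in> carrier M \<Longrightarrow> y \<in> carrier M \<Longrightarrow>
   a \<odot>\<^bsub>M\<^esub> (x \<ominus>\<^bsub>M\<^esub> y) = a \<odot>\<^bsub>M\<^esub> x \<ominus>\<^bsub>M\<^esub> a \<odot>\<^bsub>M\<^esub> y"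
  by (simp add: m_minus_def smult_add smult_neg)

text \<open>Lifts of nonzero degree have a shifted target: the differential of a tensor product, and
  the inner lift of the associativity map.\<close>

lemma shift_obj [simp]: "gr_obj k P \<Longrightarrow> gr_obj k (\<lambda>m. P (m + (l::int)))"
  by (simp add: gr_obj_def)

lemma ptens_neg:
  assumes "gr_obj k X" "gr_obj k Y" "i + j = n" "x \<in> carrier (X i)" "y \<in> carrier (Y j)"
  shows ptens_neg_left: "ptens k X Y i (\<ominus>\<^bsub>X i\<^esub> x) j y = \<ominus>\<^bsub>gtens k X Y n\<^esub> ptens k X Y i x j y"
    and ptens_neg_right: "ptens k X Y i x j (\<ominus>\<^bsub>Y j\<^esub> y) = \<ominus>\<^bsub>gtens k X Y n\<^esub> ptens k X Y i x j y"
proof -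
  show "ptens k X Y i (\<ominus>\<^bsub>X i\<^esub> x) j y = \<ominus>\<^bsub>gtens k X Y n\<^esub> ptens k X Y i x j y"
    using ptens_smult_left[OF assms(1,2,3) _ assms(4,5), of "\<ominus> \<one>"] assms by (simp add: smult_neg_one)
  show "ptens k X Y i x j (\<ominus>\<^bsub>Y j\<^esub> y) = \<ominus>\<^bsub>gtens k X Y n\<^esub> ptens k X Y i x j y"
    using ptens_smult_right[OF assms(1,2,3) _ assms(4,5), of "\<ominus> \<one>"] assms by (simp add: smult_neg_one)
qed

lemma ptens_signed:
  assumes "gr_obj k X" "gr_obj k Y" "i + j = n" "x \<in> carrier (X i)" "y \<in> carrier (Y j)"
  shows ptens_signed_left: "ptens k X Y i (signed (X i) m x) j y = signed (gtens k X Y n) m (ptens k X Y i x j y)"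
    and ptens_signed_right: "ptens k X Y i x j (signed (Y j) m y) = signed (gtens k X Y n) m (ptens k X Y i x j y)"
  using assms by (simp_all add: signed_def ptens_neg)

lemma ptens_zero:
  assumes "gr_obj k X" "gr_obj k Y" "i + j = n"
  shows ptens_zero_left: "y \<in> carrier (Y j) \<Longrightarrow> ptens k X Y i \<zero>\<^bsub>X i\<^esub> j y = \<zero>\<^bsub>gtens k X Y n\<^esub>"
    and ptens_zero_right: "x \<in> carrier (X i) \<Longrightarrow> ptens k X Y i x j \<zero>\<^bsub>Y j\<^esub> = \<zero>\<^bsub>gtens k X Y n\<^esub>"
proof -
  show "ptens k X Y i \<zero>\<^bsub>X i\<^esub> j y = \<zero>\<^bsub>gtens k X Y n\<^esub>" if "y \<in> carrier (Y j)"
    using ptens_smult_left[OF assms, of \<zero> "\<zero>\<^bsub>X i\<^esub>" y] that assms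
    by (simp add: module.smult_l_null[of k])
  show "ptens k X Y i x j \<zero>\<^bsub>Y j\<^esub> = \<zero>\<^bsub>gtens k X Y n\<^esub>" if "x \<in> carrier (X i)"
    using ptens_smult_right[OF assms, of \<zero> x "\<zero>\<^bsub>Y j\<^esub>"] that assms
    by (simp add: module.smult_l_null[of k])
qed

section \<open>Graded maps\<close>

lemma gmapsD: "f \<in> gmaps k X Y \<Longrightarrow> f n \<in> linmaps k (X n) (Y n)"
  by (simp add: gmaps_def)

lemma gmapsI: "(\<And>n. f n \<in> linmaps k (X n) (Y n)) \<Longrightarrow> f \<in> gmaps k X Y"
  by (simp add: gmaps_def)

lemma gmaps_closed: "f \<in> gmaps k X Y \<Longrightarrow> x \<in> carrier (X n) \<Longrightarrow> f n x \<in> carrier (Y n)"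
  by (rule lin_closed[OF gmapsD])

lemma gmaps_eqI:
  assumes "f \<in> gmaps k X Y" "g \<in> gmaps k X Y" "\<And>n x. x \<in> carrier (X n) \<Longrightarrow> f n x = g n x"
  shows "f = g"
  using assms by (intro ext[of f g]) (rule linmaps_eqI[OF gmapsD gmapsD])

lemma gtens_gmaps_eqI:
  assumes "gr_obj k X" "gr_obj k Y" "f \<in> gmaps k (gtens k X Y) Z" "g \<in> gmaps k (gtens k X Y) Z"
    and "\<And>i x j y. x \<in> carrier (X i) \<Longrightarrow> y \<in> carrier (Y j) \<Longrightarrow>
      f (i + j) (ptens k X Y i x j y) = g (i + j) (ptens k X Y i x j y)"
  shows "f = g"
proof
  fix n show "f n = g n"
    by (rule gtens_linmaps_eqI[OF assms(1,2) gmapsD[OF assms(3)] gmapsD[OF assms(4)]]) (use assms(5) in auto)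
qed

lemma gid_gmaps: "gr_obj k X \<Longrightarrow> gid X \<in> gmaps k X X"
  by (rule gmapsI) (simp add: gid_def linmaps_restrictI)

lemma gcomp_gmaps:
  "gr_obj k X \<Longrightarrow> f \<in> gmaps k X Y \<Longrightarrow> g \<in> gmaps k Y Z \<Longrightarrow> gcomp X g f \<in> gmaps k X Z"
  by (rule gmapsI) (simp add: gcomp_def lin_comp[OF _ gmapsD gmapsD])

lemma tens_lift_gmaps:
  assumes "gr_obj k X" "gr_obj k Y" "gr_obj k P" "bilinear k X Y P b"
  shows "tens_lift k X Y P b \<in> gmaps k (gtens k X Y) P"
  using tens_lift_linear[OF assms] by (rule gmapsI)

section \<open>Functoriality, associativity, symmetry and units of the tensor product\<close>

context
  fixes X :: "('k, 'a) gmod" and Y :: "('k, 'b) gmod" and X' :: "('k, 'c) gmod" and Y' :: "('k, 'd) gmod"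
    and f g
  assumes obj [simp]: "gr_obj k X" "gr_obj k Y" "gr_obj k X'" "gr_obj k Y'"
    and f: "f \<in> gmaps k X X'" and g: "g \<in> gmaps k Y Y'"
begin

lemma tens_map_bilinear: "bilinear k X Y (gtens k X' Y') (\<lambda>i x j y. ptens k X' Y' i (f i x) j (g j y))"
  by (rule bilinearI)
    (simp_all add: lin_add[OF gmapsD[OF f]] lin_add[OF gmapsD[OF g]] lin_smult[OF gmapsD[OF f]]
      lin_smult[OF gmapsD[OF g]] gmaps_closed[OF f] gmaps_closed[OF g]
      ptens_add_left ptens_add_right ptens_smult_left ptens_smult_right)

lemma tens_map_gmaps: "tens_map k X Y X' Y' f g \<in> gmaps k (gtens k X Y) (gtens k X' Y')"
  unfolding tens_map_def by (rule tens_lift_gmaps) (simp_all add: tens_map_bilinear)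

lemma tens_map_ptens:
  assumes "i + j = n" "x \<in> carrier (X i)" "y \<in> carrier (Y j)"
  shows "tens_map k X Y X' Y' f g n (ptens k X Y i x j y) = ptens k X' Y' i (f i x) j (g j y)"
  unfolding tens_map_def by (subst tens_lift_ptens[OF _ _ _ tens_map_bilinear]) (simp_all add: assms)

end

context
  fixes X :: "('k, 'a) gmod" and Y :: "('k, 'b) gmod" and Z :: "('k, 'c) gmod"
  assumes obj [simp]: "gr_obj k X" "gr_obj k Y" "gr_obj k Z"
begin

text \<open>Associativity is a lift of lifts. Here \<open>z\<close> is fixed and the map is bilinear
  in \<open>x\<close> and \<open>y\<close>, with values shifted by the degree of \<open>z\<close>.
  The equation \<open>e\<close> in the proof reconciles the two bracketings of the total
  degree.\<close>

lemma tens_assoc_inner: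
  assumes z: "z \<in> carrier (Z l)"
  shows "bilinear k X Y (\<lambda>m. gtens k X (gtens k Y Z) (m + l))
    (\<lambda>i x j y. ptens k X (gtens k Y Z) i x (j + l) (ptens k Y Z j y l z))"
proof (rule bilinearI)
  note a = add.assoc[symmetric]
  have e: "i + (j + l) = i + j + l" for i j by simp
  note s = z ptens_add_left[OF _ _ refl] ptens_smult_left[OF _ _ refl] ptens_add_left[OF _ _ e]
    ptens_add_right[OF _ _ e] ptens_smult_left[OF _ _ e] ptens_smult_right[OF _ _ e]
  fix i j x y assume xy: "x \<in> carrier (X i)" "y \<in> carrier (Y j)"
  then show "ptens k X (gtens k Y Z) i x (j + l) (ptens k Y Z j y l z)
      \<in> carrier (gtens k X (gtens k Y Z) (i + j + l))" using z by simp
  {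
    fix x' assume "x' \<in> carrier (X i)"
    with xy show "ptens k X (gtens k Y Z) i (x \<oplus>\<^bsub>X i\<^esub> x') (j + l) (ptens k Y Z j y l z) =
       ptens k X (gtens k Y Z) i x (j + l) (ptens k Y Z j y l z) \<oplus>\<^bsub>gtens k X (gtens k Y Z) (i + j + l)\<^esub>
       ptens k X (gtens k Y Z) i x' (j + l) (ptens k Y Z j y l z)"
      using z by (intro ptens_add_left) simp_all
  next
    fix y' assume "y' \<in> carrier (Y j)"
    with xy show "ptens k X (gtens k Y Z) i x (j + l) (ptens k Y Z j (y \<oplus>\<^bsub>Y j\<^esub> y') l z) =
       ptens k X (gtens k Y Z) i x (j + l) (ptens k Y Z j y l z) \<oplus>\<^bsub>gtens k X (gtens k Y Z) (i + j + l)\<^esub>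
       ptens k X (gtens k Y Z) i x (j + l) (ptens k Y Z j y' l z)"
      using z by (simp add: ptens_add_left[of Y Z j l "j + l"] ptens_add_right[OF _ _ e])
  next
    fix a assume "a \<in> carrier k"
    with xy show "ptens k X (gtens k Y Z) i (a \<odot>\<^bsub>X i\<^esub> x) (j + l) (ptens k Y Z j y l z) =
       a \<odot>\<^bsub>gtens k X (gtens k Y Z) (i + j + l)\<^esub> ptens k X (gtens k Y Z) i x (j + l) (ptens k Y Z j y l z)"
      and "ptens k X (gtens k Y Z) i x (j + l) (ptens k Y Z j (a \<odot>\<^bsub>Y j\<^esub> y) l z) =
       a \<odot>\<^bsub>gtens k X (gtens k Y Z) (i + j + l)\<^esub> ptens k X (gtens k Y Z) i x (j + l) (ptens k Y Z j y l z)"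
      using z
      by (simp_all add: ptens_smult_left[of Y Z j l "j + l"] ptens_smult_left[OF _ _ e] ptens_smult_right[OF _ _ e])
  }
qed

abbreviation (input) assoc_inner where
  "assoc_inner l z \<equiv> tens_lift k X Y (\<lambda>m. gtens k X (gtens k Y Z) (m + l))
         (\<lambda>i x j y. ptens k X (gtens k Y Z) i x (j + l) (ptens k Y Z j y l z))"

lemma assoc_inner_linear:
  "z \<in> carrier (Z l) \<Longrightarrow> assoc_inner l z m \<in> linmaps k (gtens k X Y m) (gtens k X (gtens k Y Z) (m + l))"
  by (rule tens_lift_linear[OF obj(1,2) _ tens_assoc_inner]) simp_all

lemma assoc_inner_ptens:
  "i + j = m \<Longrightarrow> x \<in> carrier (X i) \<Longrightarrow> y \<in> carrier (Y j) \<Longrightarrow> z \<in> carrier (Z l) \<Longrightarrow>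
   assoc_inner l z m (ptens k X Y i x j y) = ptens k X (gtens k Y Z) i x (j + l) (ptens k Y Z j y l z)"
  by (subst tens_lift_ptens[OF obj(1,2) _ tens_assoc_inner]) simp_all

text \<open>Linearity in the tensor \<open>t\<close> is built into the inner lift. Linearity in
  \<open>z\<close> holds on pure tensors \<open>t\<close> and spreads to all by induction.\<close>

lemma tens_assoc_bilinear:
  "bilinear k (gtens k X Y) Z (gtens k X (gtens k Y Z)) (\<lambda>m t l z. assoc_inner l z m t)"
proof (rule bilinearI)
  fix m l t z assume t: "t \<in> carrier (gtens k X Y m)" and z: "z \<in> carrier (Z l)"
  note lin = assoc_inner_linear[OF z, of m]
  show "assoc_inner l z m t \<in> carrier (gtens k X (gtens k Y Z) (m + l))"
    using lin_closed[OF lin t] .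
  show "assoc_inner l z m (t \<oplus>\<^bsub>gtens k X Y m\<^esub> t') =
      assoc_inner l z m t \<oplus>\<^bsub>gtens k X (gtens k Y Z) (m + l)\<^esub> assoc_inner l z m t'"
    if "t' \<in> carrier (gtens k X Y m)" for t'
    using lin_add[OF lin t that] .
  show "assoc_inner l z m (a \<odot>\<^bsub>gtens k X Y m\<^esub> t) = a \<odot>\<^bsub>gtens k X (gtens k Y Z) (m + l)\<^esub> assoc_inner l z m t"
    if "a \<in> carrier k" for a
    using lin_smult[OF lin that t] .
  show "assoc_inner l (z \<oplus>\<^bsub>Z l\<^esub> z') m t =
      assoc_inner l z m t \<oplus>\<^bsub>gtens k X (gtens k Y Z) (m + l)\<^esub> assoc_inner l z' m t"
    if z': "z' \<in> carrier (Z l)" for z'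
    using t
  proof (induction rule: gtens_induct[OF obj(1,2), consumes 1])
    case (1 i x j y)
    have e: "i + (j + l) = m + l" using 1 by simp
    show ?case using 1 z z'
      by (simp add: assoc_inner_ptens ptens_add_right[of Y Z j l "j + l"] ptens_add_right[OF _ _ e])
  next
    case (2 s t)
    have "z \<oplus>\<^bsub>Z l\<^esub> z' \<in> carrier (Z l)" using z z' by simp
    note l = assoc_inner_linear[OF z, of m] assoc_inner_linear[OF z', of m] assoc_inner_linear[OF this, of m]
    show ?case using 2 lin_closed[OF l(1)] lin_closed[OF l(2)]
      by (simp add: lin_add[OF l(1)] lin_add[OF l(2)] lin_add[OF l(3)] m_ac)
  qed
  show "assoc_inner l (a \<odot>\<^bsub>Z l\<^esub> z) m t = a \<odot>\<^bsub>gtens k X (gtens k Y Z) (m + l)\<^esub> assoc_inner l z m t"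
    if a: "a \<in> carrier k" for a
    using t
  proof (induction rule: gtens_induct[OF obj(1,2), consumes 1])
    case (1 i x j y)
    have e: "i + (j + l) = m + l" using 1 by simp
    show ?case using 1 z a
      by (simp add: assoc_inner_ptens ptens_smult_right[of Y Z j l "j + l"] ptens_smult_right[OF _ _ e])
  next
    case (2 s t)
    have "a \<odot>\<^bsub>Z l\<^esub> z \<in> carrier (Z l)" using z a by simp
    note l = assoc_inner_linear[OF z, of m] assoc_inner_linear[OF this, of m]
    show ?case using 2 lin_closed[OF l(1)] lin_closed[OF l(2)] a
      by (simp add: lin_add[OF l(1)] lin_add[OF l(2)] smult_add)
  qed
qed

lemma tens_assoc_gmaps:
  "tens_assoc k X Y Z \<in> gmaps k (gtens k (gtens k X Y) Z) (gtens k X (gtens k Y Z))"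
  unfolding tens_assoc_def by (rule tens_lift_gmaps) (simp_all add: tens_assoc_bilinear)

lemma tens_assoc_ptens:
  assumes "i + j = m" "m + l = n" "x \<in> carrier (X i)" "y \<in> carrier (Y j)" "z \<in> carrier (Z l)"
  shows "tens_assoc k X Y Z n (ptens k (gtens k X Y) Z m (ptens k X Y i x j y) l z) =
    ptens k X (gtens k Y Z) i x (j + l) (ptens k Y Z j y l z)"
  unfolding tens_assoc_def
  by (subst tens_lift_ptens[OF _ _ _ tens_assoc_bilinear]) (simp_all add: assms assoc_inner_ptens)

end

context
  fixes X :: "('k, 'a) gmod" and Y :: "('k, 'b) gmod"
  assumes obj [simp]: "gr_obj k X" "gr_obj k Y"
begin

text \<open>The sign depends on the degrees alone, so it commutes with sums and scalars.\<close>

lemma tens_sym_bilinear: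
  "bilinear k X Y (gtens k Y X) (\<lambda>i x j y. signed (gtens k Y X (i + j)) (i * j) (ptens k Y X j y i x))"
proof (rule bilinearI)
  have e: "j + i = i + j" for i j :: int by simp
  note s = ptens_add_left[OF _ _ e] ptens_add_right[OF _ _ e] ptens_smult_left[OF _ _ e]
    ptens_smult_right[OF _ _ e] signed_add signed_smult
  fix i j x y assume xy: "x \<in> carrier (X i)" "y \<in> carrier (Y j)"
  show "signed (gtens k Y X (i + j)) (i * j) (ptens k Y X j y i x) \<in> carrier (gtens k Y X (i + j))"
    using xy by simp
  show "signed (gtens k Y X (i + j)) (i * j) (ptens k Y X j y i (x \<oplus>\<^bsub>X i\<^esub> x')) =
      signed (gtens k Y X (i + j)) (i * j) (ptens k Y X j y i x) \<oplus>\<^bsub>gtens k Y X (i + j)\<^esub>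
      signed (gtens k Y X (i + j)) (i * j) (ptens k Y X j y i x')" if "x' \<in> carrier (X i)" for x'
    using xy that by (simp add: s)
  show "signed (gtens k Y X (i + j)) (i * j) (ptens k Y X j (y \<oplus>\<^bsub>Y j\<^esub> y') i x) =
      signed (gtens k Y X (i + j)) (i * j) (ptens k Y X j y i x) \<oplus>\<^bsub>gtens k Y X (i + j)\<^esub>
      signed (gtens k Y X (i + j)) (i * j) (ptens k Y X j y' i x)" if "y' \<in> carrier (Y j)" for y'
    using xy that by (simp add: s)
  fix a assume "a \<in> carrier k"
  with xy show "signed (gtens k Y X (i + j)) (i * j) (ptens k Y X j y i (a \<odot>\<^bsub>X i\<^esub> x)) =
      a \<odot>\<^bsub>gtens k Y X (i + j)\<^esub> signed (gtens k Y X (i + j)) (i * j) (ptens k Y X j y i x)"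
    "signed (gtens k Y X (i + j)) (i * j) (ptens k Y X j (a \<odot>\<^bsub>Y j\<^esub> y) i x) =
      a \<odot>\<^bsub>gtens k Y X (i + j)\<^esub> signed (gtens k Y X (i + j)) (i * j) (ptens k Y X j y i x)"
    by (simp_all add: s)
qed

lemma tens_sym_gmaps: "tens_sym k X Y \<in> gmaps k (gtens k X Y) (gtens k Y X)"
  unfolding tens_sym_def by (rule tens_lift_gmaps) (simp_all add: tens_sym_bilinear)

lemma tens_sym_ptens:
  assumes "i + j = n" "x \<in> carrier (X i)" "y \<in> carrier (Y j)"
  shows "tens_sym k X Y n (ptens k X Y i x j y) = signed (gtens k Y X n) (i * j) (ptens k Y X j y i x)"
  unfolding tens_sym_def by (subst tens_lift_ptens[OF _ _ _ tens_sym_bilinear]) (use assms in auto)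

end

lemma gunit_obj [simp]: "gr_obj k (gunit k)"
  unfolding gr_obj_def gunit_def
proof
  fix n :: int
  show "module k \<lparr>carrier = if n = 0 then carrier k else {\<zero>}, mult = (\<otimes>), one = \<one>, zero = \<zero>, add = (\<oplus>),
      smult = (\<otimes>)\<rparr>"
  proof (rule moduleI, rule is_cring, rule abelian_groupI, goal_cases)
    \<comment> \<open>The existence of additive inverses, the one axiom that asks for a
      witness.\<close>
    case (6 x)
    then show ?case by (auto split: if_splits intro!: bexI[of _ "\<ominus> x"] simp: l_neg)
  qed (auto split: if_splits simp: a_ac l_distr r_distr m_assoc)
qed

lemma gunit_simps [simp]:
  "carrier (gunit k 0) = carrier k" "n \<noteq> 0 \<Longrightarrow> carrier (gunit k n) = {\<zero>}" "\<zero>\<^bsub>gunit k n\<^esub> = \<zero>"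
  "x \<oplus>\<^bsub>gunit k n\<^esub> y = x \<oplus> y" "a \<odot>\<^bsub>gunit k n\<^esub> y = a \<otimes> y"
  by (simp_all add: gunit_def)

lemma gunit_carrier_subset: "x \<in> carrier (gunit k n) \<Longrightarrow> x \<in> carrier k"
  by (auto simp: gunit_def split: if_splits)

context
  fixes X :: "('k, 'a) gmod"
  assumes obj [simp]: "gr_obj k X"
begin

lemma tens_linv_gmaps: "tens_linv k X \<in> gmaps k X (gtens k (gunit k) X)"
proof (rule gmapsI)
  have e: "0 + n = n" for n :: int by simp
  show "tens_linv k X n \<in> linmaps k (X n) (gtens k (gunit k) X n)" for n
    unfolding tens_linv_def
    by (rule linmaps_restrictI) (simp_all add: ptens_add_right[OF _ _ e] ptens_smult_right[OF _ _ e])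
qed

lemma tens_rinv_gmaps: "tens_rinv k X \<in> gmaps k X (gtens k X (gunit k))"
proof (rule gmapsI)
  have e: "n + 0 = n" for n :: int by simp
  show "tens_rinv k X n \<in> linmaps k (X n) (gtens k X (gunit k) n)" for n
    unfolding tens_rinv_def
    by (rule linmaps_restrictI) (simp_all add: ptens_add_left[OF _ _ e] ptens_smult_left[OF _ _ e])
qed

lemma tens_linv_apply [simp]: "x \<in> carrier (X n) \<Longrightarrow> tens_linv k X n x = ptens k (gunit k) X 0 \<one> n x"
  and tens_rinv_apply [simp]: "x \<in> carrier (X n) \<Longrightarrow> tens_rinv k X n x = ptens k X (gunit k) n x 0 \<one>"
  by (simp_all add: tens_linv_def tens_rinv_def)

end

section \<open>Inner homs\<close>

lemma gihom_carrier: "f \<in> carrier (gihom k X Y n) \<longleftrightarrow> (\<forall>p. f p \<in> linmaps k (X p) (Y (p + n)))"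
  by (simp add: gihom_def)

lemma gihomD: "f \<in> carrier (gihom k X Y n) \<Longrightarrow> f p \<in> linmaps k (X p) (Y (p + n))"
  by (simp add: gihom_carrier)

lemma gihom_closed: "f \<in> carrier (gihom k X Y n) \<Longrightarrow> x \<in> carrier (X p) \<Longrightarrow> q = p + n \<Longrightarrow> f p x \<in> carrier (Y q)"
  using lin_closed[OF gihomD] by metis

text \<open>Components are \<open>undefined\<close> off their domains, so agreement on the carriers
  is equality of families.\<close>

lemma gihom_eqI:
  assumes "f \<in> carrier (gihom k X Y n)" "g \<in> carrier (gihom k X Y n)"
    "\<And>p x. x \<in> carrier (X p) \<Longrightarrow> f p x = g p x"
  shows "f = g"
  using assms by (intro ext[of f g]) (rule linmaps_eqI[OF gihomD gihomD])

lemma gihom_apply [simp]: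
  "x \<in> carrier (X p) \<Longrightarrow> (f \<oplus>\<^bsub>gihom k X Y n\<^esub> g) p x = f p x \<oplus>\<^bsub>Y (p + n)\<^esub> g p x"
  "x \<in> carrier (X p) \<Longrightarrow> (a \<odot>\<^bsub>gihom k X Y n\<^esub> f) p x = a \<odot>\<^bsub>Y (p + n)\<^esub> f p x"
  "x \<in> carrier (X p) \<Longrightarrow> \<zero>\<^bsub>gihom k X Y n\<^esub> p x = \<zero>\<^bsub>Y (p + n)\<^esub>"
  by (simp_all add: gihom_def)

lemma gihom_obj [simp]:
  assumes [simp]: "gr_obj k X" "gr_obj k Y"
  shows "gr_obj k (gihom k X Y)"
  unfolding gr_obj_def
proof
  fix n
  let ?H = "gihom k X Y n"
  have lin: "f p (x \<oplus>\<^bsub>X p\<^esub> y) = f p x \<oplus>\<^bsub>Y (p + n)\<^esub> f p y" "f p (a \<odot>\<^bsub>X p\<^esub> x) = a \<odot>\<^bsub>Y (p + n)\<^esub> f p x"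
    "f p x \<in> carrier (Y (p + n))"
    if "f \<in> carrier ?H" "x \<in> carrier (X p)" "y \<in> carrier (X p)" "a \<in> carrier k" for f p x y a
    using lin_add[OF gihomD[OF that(1)] that(2,3)] lin_smult[OF gihomD[OF that(1)] that(4,2)]
      lin_closed[OF gihomD[OF that(1)] that(2)] by auto
  have cl: "f p x \<in> carrier (Y (p + n))" if "f \<in> carrier ?H" "x \<in> carrier (X p)" for f p x
    using gihom_closed[OF that refl] .
  have add: "f \<oplus>\<^bsub>?H\<^esub> g \<in> carrier ?H" if "f \<in> carrier ?H" "g \<in> carrier ?H" for f g
    unfolding gihom_carrier
  proof
    fix p show "(f \<oplus>\<^bsub>?H\<^esub> g) p \<in> linmaps k (X p) (Y (p + n))"
      using that cl by (intro linmapsI)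
        (simp_all add: lin lin_add[OF gihomD] lin_smult[OF gihomD] smult_add m_ac, simp add: gihom_def)
  qed
  have smult: "a \<odot>\<^bsub>?H\<^esub> f \<in> carrier ?H" if "f \<in> carrier ?H" "a \<in> carrier k" for f a
    unfolding gihom_carrier
  proof
    fix p show "(a \<odot>\<^bsub>?H\<^esub> f) p \<in> linmaps k (X p) (Y (p + n))"
      using that cl by (intro linmapsI)
        (simp_all add: lin lin_add[OF gihomD] lin_smult[OF gihomD] smult_add smult_left_commute,
         simp add: gihom_def)
  qed
  have zero: "\<zero>\<^bsub>?H\<^esub> \<in> carrier ?H"
    unfolding gihom_carrier
  proof
    fix p show "\<zero>\<^bsub>?H\<^esub> p \<in> linmaps k (X p) (Y (p + n))"
      by (intro linmapsI) (simp_all, simp add: gihom_def)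
  qed
  show "module k ?H"
  proof (rule moduleI, rule is_cring, rule abelian_groupI, goal_cases)
    \<comment> \<open>The additive inverse is multiplication by \<open>\<ominus> \<one>\<close>,
      already known to stay in the carrier.\<close>
    case (6 f)
    then show ?case using smult[of f "\<ominus> \<one>"] cl
      by (intro bexI[of _ "\<ominus> \<one> \<odot>\<^bsub>?H\<^esub> f"] gihom_eqI[of _ X Y n]) (simp_all add: smult_neg_one add zero)
  next
    case (3 f g h)
    then show ?case by (intro gihom_eqI[of _ X Y n]) (simp_all add: add cl m_ac)
  next
    case (4 f g)
    then show ?case by (intro gihom_eqI[of _ X Y n]) (simp_all add: add cl m_ac)
  next
    case (5 f)
    then show ?case by (intro gihom_eqI[of _ X Y n]) (simp_all add: add zero cl)
  next
    case (8 a b f)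
    then show ?case by (intro gihom_eqI[of _ X Y n]) (simp_all add: add smult cl module.smult_l_distr)
  next
    case (9 a f g)
    then show ?case by (intro gihom_eqI[of _ X Y n]) (simp_all add: add smult cl smult_add)
  next
    case (10 a b f)
    then show ?case by (intro gihom_eqI[of _ X Y n]) (simp_all add: add smult cl module.smult_assoc1)
  next
    case (11 f)
    then show ?case by (intro gihom_eqI[of _ X Y n]) (simp_all add: add smult cl)
  qed (use add smult zero in auto)
qed

text \<open>The record prescribes sums and multiples pointwise, but the negative is only
  characterised as an inverse; its values are found through the scalar
  \<open>\<ominus> \<one>\<close>.\<close>

lemma gihom_neg_apply [simp]:
  assumes "gr_obj k X" "gr_obj k Y" "f \<in> carrier (gihom k X Y n)" "x \<in> carrier (X p)"
  shows "(\<ominus>\<^bsub>gihom k X Y n\<^esub> f) p x = \<ominus>\<^bsub>Y (p + n)\<^esub> f p x"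
proof -
  have "\<ominus>\<^bsub>gihom k X Y n\<^esub> f = (\<ominus> \<one>) \<odot>\<^bsub>gihom k X Y n\<^esub> f" using assms by (simp add: smult_neg_one)
  then have "(\<ominus>\<^bsub>gihom k X Y n\<^esub> f) p x = ((\<ominus> \<one>) \<odot>\<^bsub>gihom k X Y n\<^esub> f) p x" by (rule arg_cong)
  also have "\<dots> = (\<ominus> \<one>) \<odot>\<^bsub>Y (p + n)\<^esub> f p x" using assms by (intro gihom_apply)
  finally show ?thesis using assms gihom_closed[OF assms(3,4) refl] by (simp add: smult_neg_one)
qed

lemma gihom_signed_apply [simp]:
  assumes "gr_obj k X" "gr_obj k Y" "f \<in> carrier (gihom k X Y n)" "x \<in> carrier (X p)"
  shows "(signed (gihom k X Y n) m f) p x = signed (Y (p + n)) m (f p x)"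
  using assms by (simp add: signed_def)

lemma gihom_minus_apply [simp]:
  assumes "gr_obj k X" "gr_obj k Y" "f \<in> carrier (gihom k X Y n)" "g \<in> carrier (gihom k X Y n)" "x \<in> carrier (X p)"
  shows "(f \<ominus>\<^bsub>gihom k X Y n\<^esub> g) p x = f p x \<ominus>\<^bsub>Y (p + n)\<^esub> g p x"
  using assms by (simp add: m_minus_def)

lemma gcurry_apply [simp]:
  "x \<in> carrier (X n) \<Longrightarrow> y \<in> carrier (Y p) \<Longrightarrow> gcurry k X Y f n x p y = f (n + p) (ptens k X Y n x p y)"
  by (simp add: gcurry_def)

lemma gipost_apply [simp]:
  "h \<in> carrier (gihom k X Y n) \<Longrightarrow> x \<in> carrier (X p) \<Longrightarrow> gipost k X Y g n h p x = g (p + n) (h p x)"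
  by (simp add: gipost_def)

lemma gipre_apply [simp]:
  "h \<in> carrier (gihom k Y Z n) \<Longrightarrow> x \<in> carrier (X p) \<Longrightarrow> gipre k X Y Z f n h p x = h p (f p x)"
  by (simp add: gipre_def)

context
  fixes X :: "('k, 'a) gmod" and Y :: "('k, 'b) gmod" and Z :: "('k, 'c) gmod" and f
  assumes obj [simp]: "gr_obj k X" "gr_obj k Y" "gr_obj k Z" and f: "f \<in> gmaps k (gtens k X Y) Z"
begin

lemma gcurry_gmaps: "gcurry k X Y f \<in> gmaps k X (gihom k Y Z)"
proof (rule gmapsI)
  fix n
  \<comment> \<open>A tensor \<open>x \<otimes> y\<close> sits in degree \<open>n + p\<close>,
    whereas an element of degree \<open>n\<close> of an inner hom maps degree \<open>p\<close> to
    \<open>p + n\<close>.\<close>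
  have ad: "p + n = n + p" for p :: int by simp
  note l = lin_add[OF gmapsD[OF f]] lin_smult[OF gmapsD[OF f]] gmaps_closed[OF f]
    ptens_add_left ptens_add_right ptens_smult_left ptens_smult_right
  have c: "gcurry k X Y f n x \<in> carrier (gihom k Y Z n)" if x: "x \<in> carrier (X n)" for x
    unfolding gihom_carrier
  proof
    fix p show "gcurry k X Y f n x p \<in> linmaps k (Y p) (Z (p + n))"
      unfolding ad[of p]
    proof (rule linmapsI)
      show "gcurry k X Y f n x p y = undefined" if "y \<notin> carrier (Y p)" for y
        using that x by (simp add: gcurry_def)
    qed (use x in \<open>simp_all add: l\<close>)
  qed
  show "gcurry k X Y f n \<in> linmaps k (X n) (gihom k Y Z n)"
  proof (rule linmapsI)
    fix x assume "x \<in> carrier (X n)" then show "gcurry k X Y f n x \<in> carrier (gihom k Y Z n)" by (rule c)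
  next
    fix x y assume "x \<in> carrier (X n)" "y \<in> carrier (X n)"
    then show "gcurry k X Y f n (x \<oplus>\<^bsub>X n\<^esub> y) = gcurry k X Y f n x \<oplus>\<^bsub>gihom k Y Z n\<^esub> gcurry k X Y f n y"
      by (intro gihom_eqI[of _ Y Z n]) (simp_all add: c l ad)
  next
    fix a x assume "x \<in> carrier (X n)" "a \<in> carrier k"
    then show "gcurry k X Y f n (a \<odot>\<^bsub>X n\<^esub> x) = a \<odot>\<^bsub>gihom k Y Z n\<^esub> gcurry k X Y f n x"
      by (intro gihom_eqI[of _ Y Z n]) (simp_all add: c l ad)
  qed (simp add: gcurry_def)
qed

end

context
  fixes X :: "('k, 'a) gmod" and Y :: "('k, 'b) gmod" and Z :: "('k, 'c) gmod"
  assumes obj [simp]: "gr_obj k X" "gr_obj k Y" "gr_obj k Z"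
begin

lemma gihom_comp_closed:
  assumes "g \<in> carrier (gihom k Y Z i)" "f \<in> carrier (gihom k X Y j)" "n = i + j"
  shows "(\<lambda>p. \<lambda>x\<in>carrier (X p). g (p + j) (f p x)) \<in> carrier (gihom k X Z n)"
  unfolding gihom_carrier
proof
  fix p
  have "p + j + i = p + n" using assms by simp
  then show "(\<lambda>x\<in>carrier (X p). g (p + j) (f p x)) \<in> linmaps k (X p) (Z (p + n))"
    using lin_comp[OF gr_objD[OF obj(1)] gihomD[OF assms(2), of p] gihomD[OF assms(1), of "p + j"]]
    by (simp only:)
qed

lemma gicomp_bilinear:
  "bilinear k (gihom k Y Z) (gihom k X Y) (gihom k X Z) (\<lambda>i g j f p. \<lambda>x\<in>carrier (X p). g (p + j) (f p x))"
proof (rule bilinearI)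
  have e: "p + (i + j) = p + j + i" for p i j :: int by simp
  fix i j g f assume g: "g \<in> carrier (gihom k Y Z i)" and f: "f \<in> carrier (gihom k X Y j)"
  have cl: "f p x \<in> carrier (Y (p + j))" if "x \<in> carrier (X p)" for p x
    using gihom_closed[OF f that refl] .
  show "(\<lambda>p. \<lambda>x\<in>carrier (X p). g (p + j) (f p x)) \<in> carrier (gihom k X Z (i + j))"
    by (rule gihom_comp_closed[OF g f refl])
  show "(\<lambda>p. \<lambda>x\<in>carrier (X p). (g \<oplus>\<^bsub>gihom k Y Z i\<^esub> g') (p + j) (f p x)) =
     (\<lambda>p. \<lambda>x\<in>carrier (X p). g (p + j) (f p x)) \<oplus>\<^bsub>gihom k X Z (i + j)\<^esub>
     (\<lambda>p. \<lambda>x\<in>carrier (X p). g' (p + j) (f p x))" if "g' \<in> carrier (gihom k Y Z i)" for g'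
    using that g f by (intro gihom_eqI[of _ X Z "i + j"] gihom_comp_closed m_add_closed) (simp_all add: cl e)
  show "(\<lambda>p. \<lambda>x\<in>carrier (X p). g (p + j) ((f \<oplus>\<^bsub>gihom k X Y j\<^esub> f') p x)) =
     (\<lambda>p. \<lambda>x\<in>carrier (X p). g (p + j) (f p x)) \<oplus>\<^bsub>gihom k X Z (i + j)\<^esub>
     (\<lambda>p. \<lambda>x\<in>carrier (X p). g (p + j) (f' p x))" if f': "f' \<in> carrier (gihom k X Y j)" for f'
    using f' g f gihom_closed[OF f' _ refl]
    by (intro gihom_eqI[of _ X Z "i + j"] gihom_comp_closed m_add_closed) (simp_all add: cl e lin_add[OF gihomD[OF g]])
  fix a assume a: "a \<in> carrier k"
  show "(\<lambda>p. \<lambda>x\<in>carrier (X p). (a \<odot>\<^bsub>gihom k Y Z i\<^esub> g) (p + j) (f p x)) =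
      a \<odot>\<^bsub>gihom k X Z (i + j)\<^esub> (\<lambda>p. \<lambda>x\<in>carrier (X p). g (p + j) (f p x))"
    using a g f by (intro gihom_eqI[of _ X Z "i + j"] gihom_comp_closed m_smult_closed) (simp_all add: cl e)
  show "(\<lambda>p. \<lambda>x\<in>carrier (X p). g (p + j) ((a \<odot>\<^bsub>gihom k X Y j\<^esub> f) p x)) =
      a \<odot>\<^bsub>gihom k X Z (i + j)\<^esub> (\<lambda>p. \<lambda>x\<in>carrier (X p). g (p + j) (f p x))"
    using a g f
    by (intro gihom_eqI[of _ X Z "i + j"] gihom_comp_closed m_smult_closed) (simp_all add: cl e lin_smult[OF gihomD[OF g]])
qed

lemma gicomp_gmaps: "gicomp k X Y Z \<in> gmaps k (gtens k (gihom k Y Z) (gihom k X Y)) (gihom k X Z)"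
  unfolding gicomp_def by (rule tens_lift_gmaps) (simp_all add: gicomp_bilinear)

lemma gicomp_ptens:
  assumes "i + j = n" "g \<in> carrier (gihom k Y Z i)" "f \<in> carrier (gihom k X Y j)"
  shows "gicomp k X Y Z n (ptens k (gihom k Y Z) (gihom k X Y) i g j f) = (\<lambda>p. \<lambda>x\<in>carrier (X p). g (p + j) (f p x))"
  unfolding gicomp_def by (subst tens_lift_ptens[OF _ _ _ gicomp_bilinear]) (simp_all add: assms)

lemma gipost_gmaps:
  assumes g: "g \<in> gmaps k Y Z"
  shows "gipost k X Y g \<in> gmaps k (gihom k X Y) (gihom k X Z)"
proof (rule gmapsI)
  fix n
  have c: "(\<lambda>p. \<lambda>x\<in>carrier (X p). g (p + n) (h p x)) \<in> carrier (gihom k X Z n)"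
    if "h \<in> carrier (gihom k X Y n)" for h
    unfolding gihom_carrier using lin_comp[OF _ gihomD[OF that] gmapsD[OF g]] by simp
  show "gipost k X Y g n \<in> linmaps k (gihom k X Y n) (gihom k X Z n)"
    unfolding gipost_def
  proof (rule linmaps_restrictI)
    fix h h' assume h: "h \<in> carrier (gihom k X Y n)" "h' \<in> carrier (gihom k X Y n)"
    then show "(\<lambda>p. \<lambda>x\<in>carrier (X p). g (p + n) ((h \<oplus>\<^bsub>gihom k X Y n\<^esub> h') p x)) =
       (\<lambda>p. \<lambda>x\<in>carrier (X p). g (p + n) (h p x)) \<oplus>\<^bsub>gihom k X Z n\<^esub> (\<lambda>p. \<lambda>x\<in>carrier (X p). g (p + n) (h' p x))"
      using gihom_closed[OF h(1) _ refl] gihom_closed[OF h(2) _ refl]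
      by (intro gihom_eqI[of _ X Z n] c m_add_closed) (simp_all add: lin_add[OF gmapsD[OF g]])
  next
    fix a h assume h: "a \<in> carrier k" "h \<in> carrier (gihom k X Y n)"
    then show "(\<lambda>p. \<lambda>x\<in>carrier (X p). g (p + n) ((a \<odot>\<^bsub>gihom k X Y n\<^esub> h) p x)) =
       a \<odot>\<^bsub>gihom k X Z n\<^esub> (\<lambda>p. \<lambda>x\<in>carrier (X p). g (p + n) (h p x))"
      using gihom_closed[OF h(2) _ refl]
      by (intro gihom_eqI[of _ X Z n] c m_smult_closed) (simp_all add: lin_smult[OF gmapsD[OF g]])
  qed (simp_all add: c)
qed

lemma gipre_gmaps:
  assumes f: "f \<in> gmaps k X Y"
  shows "gipre k X Y Z f \<in> gmaps k (gihom k Y Z) (gihom k X Z)"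
proof (rule gmapsI)
  fix n
  have c: "(\<lambda>p. \<lambda>x\<in>carrier (X p). h p (f p x)) \<in> carrier (gihom k X Z n)"
    if "h \<in> carrier (gihom k Y Z n)" for h
    unfolding gihom_carrier using lin_comp[OF _ gmapsD[OF f] gihomD[OF that]] by simp
  note fc = gmaps_closed[OF f]
  show "gipre k X Y Z f n \<in> linmaps k (gihom k Y Z n) (gihom k X Z n)"
    unfolding gipre_def
  proof (rule linmaps_restrictI)
    fix h h' assume h: "h \<in> carrier (gihom k Y Z n)" "h' \<in> carrier (gihom k Y Z n)"
    then show "(\<lambda>p. \<lambda>x\<in>carrier (X p). (h \<oplus>\<^bsub>gihom k Y Z n\<^esub> h') p (f p x)) =
       (\<lambda>p. \<lambda>x\<in>carrier (X p). h p (f p x)) \<oplus>\<^bsub>gihom k X Z n\<^esub> (\<lambda>p. \<lambda>x\<in>carrier (X p). h' p (f p x))"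
      by (intro gihom_eqI[of _ X Z n] c m_add_closed) (simp_all add: fc)
  next
    fix a h assume h: "a \<in> carrier k" "h \<in> carrier (gihom k Y Z n)"
    then show "(\<lambda>p. \<lambda>x\<in>carrier (X p). (a \<odot>\<^bsub>gihom k Y Z n\<^esub> h) p (f p x)) =
       a \<odot>\<^bsub>gihom k X Z n\<^esub> (\<lambda>p. \<lambda>x\<in>carrier (X p). h p (f p x))"
      by (intro gihom_eqI[of _ X Z n] c m_smult_closed) (simp_all add: fc)
  qed (simp_all add: c)
qed

end

end

section \<open>Complexes\<close>

context ground_ring
begin

text \<open>For equations that involve \<open>tens_assoc\<close>: a tensor in the first factor is
  itself a sum of pure tensors, so threefold pure tensors suffice.\<close>

lemma gtens_gtens_linmaps_eqI:
  assumes X: "gr_obj k X" and Y: "gr_obj k Y" and Z: "gr_obj k Z" and P: "module k P"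
    and f: "f \<in> linmaps k (gtens k (gtens k X Y) Z n) P" and g: "g \<in> linmaps k (gtens k (gtens k X Y) Z n) P"
    and eq: "\<And>i x j y l z. i + j + l = n \<Longrightarrow> x \<in> carrier (X i) \<Longrightarrow> y \<in> carrier (Y j) \<Longrightarrow> z \<in> carrier (Z l) \<Longrightarrow>
      f (ptens k (gtens k X Y) Z (i + j) (ptens k X Y i x j y) l z) =
      g (ptens k (gtens k X Y) Z (i + j) (ptens k X Y i x j y) l z)"
  shows "f = g"
proof (rule gtens_linmaps_eqI[OF _ Z f g])
  show "gr_obj k (gtens k X Y)" using X Y by simp
  fix m t l z assume ml: "m + l = n" and t: "t \<in> carrier (gtens k X Y m)" and z: "z \<in> carrier (Z l)"
  note [simp] = X Y Z P
  show "f (ptens k (gtens k X Y) Z m t l z) = g (ptens k (gtens k X Y) Z m t l z)"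
    using t
  proof (induction rule: gtens_induct[OF X Y, consumes 1])
    case (1 i x j y)
    then show ?case using eq[of i j l x y z] ml z by simp
  next
    case (2 s t)
    then show ?case using z ml
      by (simp add: ptens_add_left[OF _ _ ml] lin_add[OF f] lin_add[OF g])
  qed
qed

section \<open>Differentials\<close>

lemma K_obj_gr [simp]: "K_obj k M \<Longrightarrow> gr_obj k (Und M)"
  by (simp add: K_obj_def)

lemma K_obj_Diff: "K_obj k M \<Longrightarrow> Diff M n \<in> linmaps k (Und M n) (Und M (n + 1))"
  by (simp add: K_obj_def)

lemma Diff_closed [simp]:
  "K_obj k M \<Longrightarrow> x \<in> carrier (Und M n) \<Longrightarrow> m = n + 1 \<Longrightarrow> Diff M n x \<in> carrier (Und M m)"
  using lin_closed[OF K_obj_Diff] by simp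

lemma Diff_add:
  "K_obj k M \<Longrightarrow> x \<in> carrier (Und M n) \<Longrightarrow> y \<in> carrier (Und M n) \<Longrightarrow> m = n + 1 \<Longrightarrow>
   Diff M n (x \<oplus>\<^bsub>Und M n\<^esub> y) = Diff M n x \<oplus>\<^bsub>Und M m\<^esub> Diff M n y"
  by (simp add: lin_add[OF K_obj_Diff])

lemma Diff_smult:
  "K_obj k M \<Longrightarrow> a \<in> carrier k \<Longrightarrow> x \<in> carrier (Und M n) \<Longrightarrow> m = n + 1 \<Longrightarrow>
   Diff M n (a \<odot>\<^bsub>Und M n\<^esub> x) = a \<odot>\<^bsub>Und M m\<^esub> Diff M n x"
  by (simp add: lin_smult[OF K_obj_Diff])

lemma Diff_signed:
  "K_obj k M \<Longrightarrow> x \<in> carrier (Und M n) \<Longrightarrow> m = n + 1 \<Longrightarrow>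
   Diff M n (signed (Und M n) i x) = signed (Und M m) i (Diff M n x)"
  by (simp add: lin_signed[OF K_obj_Diff])

lemma Diff_minus:
  "K_obj k M \<Longrightarrow> x \<in> carrier (Und M n) \<Longrightarrow> y \<in> carrier (Und M n) \<Longrightarrow> m = n + 1 \<Longrightarrow>
   Diff M n (x \<ominus>\<^bsub>Und M n\<^esub> y) = Diff M n x \<ominus>\<^bsub>Und M m\<^esub> Diff M n y"
  by (simp add: lin_minus[OF K_obj_Diff])

lemma Diff_Diff:
  "K_obj k M \<Longrightarrow> x \<in> carrier (Und M n) \<Longrightarrow> m = n + 1 \<Longrightarrow> q = n + 2 \<Longrightarrow> Diff M m (Diff M n x) = \<zero>\<^bsub>Und M q\<^esub>"
  by (simp add: K_obj_def)

lemma K_objI: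
  assumes "gr_obj k (Und M)" "\<And>n. Diff M n \<in> linmaps k (Und M n) (Und M (n + 1))"
    "\<And>n x. x \<in> carrier (Und M n) \<Longrightarrow> Diff M (n + 1) (Diff M n x) = \<zero>\<^bsub>Und M (n + 2)\<^esub>"
  shows "K_obj k M"
  using assms by (simp add: K_obj_def)

lemma ktens_Und [simp]: "Und (ktens k M N) = gtens k (Und M) (Und N)"
  and kihom_Und [simp]: "Und (kihom k M N) = gihom k (Und M) (Und N)"
  and kunit_Und [simp]: "Und (kunit k) = gunit k"
  by (simp_all add: ktens_def kihom_def kunit_def)

lemma gunit_zero_closed [simp]: "\<zero> \<in> carrier (gunit k n)"
  by (simp add: gunit_def)

lemma kunit_obj [simp]: "K_obj k (kunit k)"
  by (rule K_objI) (auto simp: kunit_def intro!: linmaps_restrictI)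

lemma kunit_Diff [simp]: "x \<in> carrier (gunit k n) \<Longrightarrow> Diff (kunit k) n x = \<zero>"
  by (simp add: kunit_def)

section \<open>Tensor products of complexes\<close>

context
  fixes M :: "('k, 'a) cochain" and N :: "('k, 'b) cochain"
  assumes obj [simp]: "K_obj k M" "K_obj k N"
begin

abbreviation (input) "MN \<equiv> gtens k (Und M) (Und N)"

lemma ktens_bilinear:
  "bilinear k (Und M) (Und N) (\<lambda>n. MN (n + 1)) (\<lambda>i x j y.
     ptens k (Und M) (Und N) (i + 1) (Diff M i x) j y \<oplus>\<^bsub>MN (i + j + 1)\<^esub>
     signed (MN (i + j + 1)) i (ptens k (Und M) (Und N) i x (j + 1) (Diff N j y)))"
proof (rule bilinearI)
  fix i j x y assume x: "x \<in> carrier (Und M i)" and y: "y \<in> carrier (Und N j)"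
  have e: "i + 1 + j = i + j + 1" "i + (j + 1) = i + j + 1" by simp_all
  note p = ptens_add_left[OF _ _ e(1)] ptens_add_left[OF _ _ e(2)] ptens_add_right[OF _ _ e(1)] ptens_add_right[OF _ _ e(2)]
    ptens_smult_left[OF _ _ e(1)] ptens_smult_left[OF _ _ e(2)] ptens_smult_right[OF _ _ e(1)] ptens_smult_right[OF _ _ e(2)]
    Diff_add[OF obj(1) _ _ refl] Diff_add[OF obj(2) _ _ refl] Diff_smult[OF obj(1) _ _ refl] Diff_smult[OF obj(2) _ _ refl]
    signed_add signed_smult smult_add m_ac
  show "ptens k (Und M) (Und N) (i + 1) (Diff M i x) j y \<oplus>\<^bsub>MN (i + j + 1)\<^esub>
     signed (MN (i + j + 1)) i (ptens k (Und M) (Und N) i x (j + 1) (Diff N j y)) \<in> carrier (MN (i + j + 1))"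
    using x y by simp
  show "ptens k (Und M) (Und N) (i + 1) (Diff M i (x \<oplus>\<^bsub>Und M i\<^esub> x')) j y \<oplus>\<^bsub>MN (i + j + 1)\<^esub>
     signed (MN (i + j + 1)) i (ptens k (Und M) (Und N) i (x \<oplus>\<^bsub>Und M i\<^esub> x') (j + 1) (Diff N j y)) =
     (ptens k (Und M) (Und N) (i + 1) (Diff M i x) j y \<oplus>\<^bsub>MN (i + j + 1)\<^esub>
     signed (MN (i + j + 1)) i (ptens k (Und M) (Und N) i x (j + 1) (Diff N j y))) \<oplus>\<^bsub>MN (i + j + 1)\<^esub>
     (ptens k (Und M) (Und N) (i + 1) (Diff M i x') j y \<oplus>\<^bsub>MN (i + j + 1)\<^esub>
     signed (MN (i + j + 1)) i (ptens k (Und M) (Und N) i x' (j + 1) (Diff N j y)))"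
    if "x' \<in> carrier (Und M i)" for x' using x y that by (simp add: p)
  show "ptens k (Und M) (Und N) (i + 1) (Diff M i x) j (y \<oplus>\<^bsub>Und N j\<^esub> y') \<oplus>\<^bsub>MN (i + j + 1)\<^esub>
     signed (MN (i + j + 1)) i (ptens k (Und M) (Und N) i x (j + 1) (Diff N j (y \<oplus>\<^bsub>Und N j\<^esub> y'))) =
     (ptens k (Und M) (Und N) (i + 1) (Diff M i x) j y \<oplus>\<^bsub>MN (i + j + 1)\<^esub>
     signed (MN (i + j + 1)) i (ptens k (Und M) (Und N) i x (j + 1) (Diff N j y))) \<oplus>\<^bsub>MN (i + j + 1)\<^esub>
     (ptens k (Und M) (Und N) (i + 1) (Diff M i x) j y' \<oplus>\<^bsub>MN (i + j + 1)\<^esub>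
     signed (MN (i + j + 1)) i (ptens k (Und M) (Und N) i x (j + 1) (Diff N j y')))"
    if "y' \<in> carrier (Und N j)" for y' using x y that by (simp add: p)
  fix a assume "a \<in> carrier k"
  with x y show "ptens k (Und M) (Und N) (i + 1) (Diff M i (a \<odot>\<^bsub>Und M i\<^esub> x)) j y \<oplus>\<^bsub>MN (i + j + 1)\<^esub>
     signed (MN (i + j + 1)) i (ptens k (Und M) (Und N) i (a \<odot>\<^bsub>Und M i\<^esub> x) (j + 1) (Diff N j y)) =
     a \<odot>\<^bsub>MN (i + j + 1)\<^esub> (ptens k (Und M) (Und N) (i + 1) (Diff M i x) j y \<oplus>\<^bsub>MN (i + j + 1)\<^esub>
     signed (MN (i + j + 1)) i (ptens k (Und M) (Und N) i x (j + 1) (Diff N j y)))"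
   "ptens k (Und M) (Und N) (i + 1) (Diff M i x) j (a \<odot>\<^bsub>Und N j\<^esub> y) \<oplus>\<^bsub>MN (i + j + 1)\<^esub>
     signed (MN (i + j + 1)) i (ptens k (Und M) (Und N) i x (j + 1) (Diff N j (a \<odot>\<^bsub>Und N j\<^esub> y))) =
     a \<odot>\<^bsub>MN (i + j + 1)\<^esub> (ptens k (Und M) (Und N) (i + 1) (Diff M i x) j y \<oplus>\<^bsub>MN (i + j + 1)\<^esub>
     signed (MN (i + j + 1)) i (ptens k (Und M) (Und N) i x (j + 1) (Diff N j y)))"
    by (simp_all add: p)
qed

lemma ktens_Diff_linear: "Diff (ktens k M N) n \<in> linmaps k (MN n) (MN (n + 1))"
  using tens_lift_linear[OF _ _ _ ktens_bilinear, of n] by (simp add: ktens_def)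

lemma ktens_Diff_ptens:
  assumes "i + j = n" "n' = n + 1" "i' = i + 1" "j' = j + 1" "x \<in> carrier (Und M i)" "y \<in> carrier (Und N j)"
  shows "Diff (ktens k M N) n (ptens k (Und M) (Und N) i x j y) =
    ptens k (Und M) (Und N) i' (Diff M i x) j y \<oplus>\<^bsub>MN n'\<^esub>
    signed (MN n') i (ptens k (Und M) (Und N) i x j' (Diff N j y))"
  using tens_lift_ptens[OF _ _ _ ktens_bilinear, of i j n x y] assms by (simp add: ktens_def)

text \<open>In \<open>d (d (x \<otimes> y))\<close> the mixed term \<open>dx \<otimes> dy\<close>
  occurs with the signs \<open>(-1)^(i+1)\<close> and \<open>(-1)^i\<close>, and the other two terms
  contain \<open>d d\<close>.\<close>

lemma ktens_obj [simp]: "K_obj k (ktens k M N)"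
proof (rule K_objI)
  show "Diff (ktens k M N) n \<in> linmaps k (Und (ktens k M N) n) (Und (ktens k M N) (n + 1))" for n
    using ktens_Diff_linear by simp
  fix n t assume "t \<in> carrier (Und (ktens k M N) n)"
  then have "t \<in> carrier (MN n)" by simp
  then show "Diff (ktens k M N) (n + 1) (Diff (ktens k M N) n t) = \<zero>\<^bsub>Und (ktens k M N) (n + 2)\<^esub>"
  proof (induction rule: gtens_induct[OF K_obj_gr[OF obj(1)] K_obj_gr[OF obj(2)], consumes 1])
    case (1 i x j y)
    note l = ktens_Diff_linear[of "n + 1", simplified]
    have e: "i + 1 + j = n + 1" "i + (j + 1) = n + 1" "i + 2 + j = n + 2" "i + (j + 2) = n + 2"
      "i + 1 + (j + 1) = n + 2" "n + 1 + 1 = n + 2" using 1 by simp_all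
    note d = ktens_Diff_ptens[OF e(1), of "n + 2" "i + 2" "j + 1"] ktens_Diff_ptens[OF e(2), of "n + 2" "i + 1" "j + 2"]
    have dd: "Diff M (i + 1) (Diff M i x) = \<zero>\<^bsub>Und M (i + 2)\<^esub>" "Diff N (j + 1) (Diff N j y) = \<zero>\<^bsub>Und N (j + 2)\<^esub>"
      using 1 by (auto intro: Diff_Diff)
    show ?case using 1
      by (simp add: ktens_Diff_ptens[OF 1(1) refl refl refl] lin_add[OF l] lin_signed[OF l] d dd e
         ptens_zero_left[OF _ _ e(3)] ptens_zero_right[OF _ _ e(4)])
        (simp add: signed_def e add.commute[of 2])
  next
    case (2 s t)
    note l = ktens_Diff_linear[of n] ktens_Diff_linear[of "n + 1", simplified]
    show ?case using 2 lin_closed[OF l(1)]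
      by (simp add: lin_add[OF l(1)] lin_add[OF l(2)] add.commute[of 2])
  qed
qed simp

section \<open>Inner hom complexes\<close>

lemma kihom_Diff_apply:
  "f \<in> carrier (gihom k (Und M) (Und N) n) \<Longrightarrow> x \<in> carrier (Und M p) \<Longrightarrow>
   Diff (kihom k M N) n f p x = Diff N (p + n) (f p x) \<ominus>\<^bsub>Und N (p + n + 1)\<^esub>
     signed (Und N (p + n + 1)) n (f (p + 1) (Diff M p x))"
  by (simp add: kihom_def)

lemma kihom_Diff_closed:
  assumes f: "f \<in> carrier (gihom k (Und M) (Und N) n)"
  shows "Diff (kihom k M N) n f \<in> carrier (gihom k (Und M) (Und N) (n + 1))"
  unfolding gihom_carrier
proof
  fix p
  have e: "p + 1 + n = p + n + 1" "p + (n + 1) = p + n + 1" by simp_all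
  note l = gihomD[OF f, of p] gihomD[OF f, of "p + 1", unfolded e]
  show "Diff (kihom k M N) n f p \<in> linmaps k (Und M p) (Und N (p + (n + 1)))"
    unfolding e
    by (rule linmapsI)
      (simp_all add: kihom_Diff_apply f lin_closed[OF l(1)] lin_closed[OF l(2)] lin_add[OF l(1)]
        lin_add[OF l(2)] lin_smult[OF l(1)] lin_smult[OF l(2)] Diff_add[OF _ _ _ refl] Diff_smult[OF _ _ _ refl]
        signed_add signed_smult m_group smult_add smult_neg, simp add: f kihom_def)
qed

lemma kihom_obj [simp]: "K_obj k (kihom k M N)"
proof (rule K_objI)
  fix n
  have cl: "f (p + 1) (Diff M p x) \<in> carrier (Und N (p + n + 1))"
     "f p x \<in> carrier (Und N (p + n))"
    if "f \<in> carrier (gihom k (Und M) (Und N) n)" "x \<in> carrier (Und M p)" for f p x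
    by (rule gihom_closed[OF that(1), of _ "p + 1"], use that in simp_all)
      (rule gihom_closed[OF that refl])
  have e: "p + (n + 1) = p + n + 1" and e': "p + 1 + n = p + n + 1" for p by simp_all
  show "Diff (kihom k M N) n \<in> linmaps k (Und (kihom k M N) n) (Und (kihom k M N) (n + 1))"
  proof (rule linmapsI)
    fix f assume "f \<in> carrier (Und (kihom k M N) n)"
    then show "Diff (kihom k M N) n f \<in> carrier (Und (kihom k M N) (n + 1))"
      using kihom_Diff_closed by simp
  next
    fix f assume "f \<notin> carrier (Und (kihom k M N) n)"
    then show "Diff (kihom k M N) n f = undefined" by (simp add: kihom_def)
  next
    fix f g assume f: "f \<in> carrier (Und (kihom k M N) n)" and g: "g \<in> carrier (Und (kihom k M N) n)"
    then show "Diff (kihom k M N) n (f \<oplus>\<^bsub>Und (kihom k M N) n\<^esub> g) =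
        Diff (kihom k M N) n f \<oplus>\<^bsub>Und (kihom k M N) (n + 1)\<^esub> Diff (kihom k M N) n g"
      unfolding kihom_Und
    proof (intro gihom_eqI[of _ "Und M" "Und N" "n + 1"])
      fix p x assume "x \<in> carrier (Und M p)"
      with f g show "Diff (kihom k M N) n (f \<oplus>\<^bsub>gihom k (Und M) (Und N) n\<^esub> g) p x =
          (Diff (kihom k M N) n f \<oplus>\<^bsub>gihom k (Und M) (Und N) (n + 1)\<^esub> Diff (kihom k M N) n g) p x"
        by (simp add: kihom_Diff_apply cl Diff_add[OF _ _ _ refl] e signed_add m_group add.commute[of 1]
            add.assoc[of _ 1] add.left_commute[of 1])
    qed (use f g kihom_Diff_closed in simp_all)
  next
    fix a f assume a: "a \<in> carrier k" and f: "f \<in> carrier (Und (kihom k M N) n)"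
    then show "Diff (kihom k M N) n (a \<odot>\<^bsub>Und (kihom k M N) n\<^esub> f) =
        a \<odot>\<^bsub>Und (kihom k M N) (n + 1)\<^esub> Diff (kihom k M N) n f"
      unfolding kihom_Und
    proof (intro gihom_eqI[of _ "Und M" "Und N" "n + 1"])
      fix p x assume "x \<in> carrier (Und M p)"
      with a f show "Diff (kihom k M N) n (a \<odot>\<^bsub>gihom k (Und M) (Und N) n\<^esub> f) p x =
          (a \<odot>\<^bsub>gihom k (Und M) (Und N) (n + 1)\<^esub> Diff (kihom k M N) n f) p x"
        by (simp add: kihom_Diff_apply cl Diff_smult[OF _ _ _ refl] e e' signed_smult smult_minus)
    qed (use a f kihom_Diff_closed in simp_all)
  qed
  fix f assume "f \<in> carrier (Und (kihom k M N) n)"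
  then have f: "f \<in> carrier (gihom k (Und M) (Und N) n)" by simp
  then have df: "Diff (kihom k M N) n f \<in> carrier (gihom k (Und M) (Und N) (n + 1))" by (rule kihom_Diff_closed)
  then have ddf: "Diff (kihom k M N) (n + 1) (Diff (kihom k M N) n f) \<in> carrier (gihom k (Und M) (Und N) (n + 2))"
    using kihom_Diff_closed[OF df] by (simp add: add.assoc)
  show "Diff (kihom k M N) (n + 1) (Diff (kihom k M N) n f) = \<zero>\<^bsub>Und (kihom k M N) (n + 2)\<^esub>"
  proof (rule gihom_eqI[OF ddf])
    fix p x assume x: "x \<in> carrier (Und M p)"
    have e: "p + (n + 1) = p + n + 1" "p + n + 1 + 1 = p + n + 2" "p + 1 + n = p + n + 1" "p + 1 + 1 = p + 2"
      "p + (n + 2) = p + n + 2" by simp_all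
    note l = gihomD[OF f, of "p + 2"]
    have c: "f (p + 1) (Diff M p x) \<in> carrier (Und N (p + n + 1))" "f p x \<in> carrier (Und N (p + n))"
      using cl[OF f x] by simp_all
    have z: "f (p + 2) (Diff M (p + 1) (Diff M p x)) = \<zero>\<^bsub>Und N (p + n + 2)\<^esub>"
      using lin_zero[OF l] x Diff_Diff[of M x p "p + 1" "p + 2"] by (simp add: ac_simps)
    have dd: "Diff N (p + n + 1) (Diff N (p + n) (f p x)) = \<zero>\<^bsub>Und N (p + n + 2)\<^esub>"
      using c by (intro Diff_Diff) simp_all
    have dx: "Diff M p x \<in> carrier (Und M (p + 1))" using x by simp
    \<comment> \<open>The terms with \<open>d d f\<close> and \<open>f d d\<close> vanish. The term
      \<open>d f d\<close> occurs with \<open>- (-1)^n\<close> and with \<open>- (-1)^(n+1)\<close>,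
      so it cancels.\<close>
    have "Diff (kihom k M N) (n + 1) (Diff (kihom k M N) n f) p x =
      Diff N (p + n + 1) (Diff (kihom k M N) n f p x) \<ominus>\<^bsub>Und N (p + n + 2)\<^esub>
      signed (Und N (p + n + 2)) (n + 1) (Diff (kihom k M N) n f (p + 1) (Diff M p x))"
      using kihom_Diff_apply[OF df x] by (simp add: e)
    also have "Diff (kihom k M N) n f p x = Diff N (p + n) (f p x) \<ominus>\<^bsub>Und N (p + n + 1)\<^esub>
      signed (Und N (p + n + 1)) n (f (p + 1) (Diff M p x))"
      by (rule kihom_Diff_apply[OF f x])
    also have "Diff (kihom k M N) n f (p + 1) (Diff M p x) = Diff N (p + n + 1) (f (p + 1) (Diff M p x))"
      using kihom_Diff_apply[OF f dx] c z by (simp only: e signed_zero) simp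
    also have "Diff N (p + n + 1) (Diff N (p + n) (f p x) \<ominus>\<^bsub>Und N (p + n + 1)\<^esub>
      signed (Und N (p + n + 1)) n (f (p + 1) (Diff M p x))) =
      \<ominus>\<^bsub>Und N (p + n + 2)\<^esub> signed (Und N (p + n + 2)) n (Diff N (p + n + 1) (f (p + 1) (Diff M p x)))"
      using c by (simp add: Diff_minus[of N _ "p + n + 1" _ "p + n + 2"] Diff_signed[of N _ "p + n + 1" "p + n + 2"] dd)
    also have "(\<ominus>\<^bsub>Und N (p + n + 2)\<^esub> signed (Und N (p + n + 2)) n (Diff N (p + n + 1) (f (p + 1) (Diff M p x))))
      \<ominus>\<^bsub>Und N (p + n + 2)\<^esub> signed (Und N (p + n + 2)) (n + 1) (Diff N (p + n + 1) (f (p + 1) (Diff M p x))) =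
      \<zero>\<^bsub>Und N (p + n + 2)\<^esub>"
      using c by (simp add: signed_def m_minus_def)
    also have "\<dots> = \<zero>\<^bsub>Und (kihom k M N) (n + 2)\<^esub> p x" using x by (simp add: e)
    finally show "Diff (kihom k M N) (n + 1) (Diff (kihom k M N) n f) p x = \<zero>\<^bsub>Und (kihom k M N) (n + 2)\<^esub> p x" .
  qed simp
qed simp

end

section \<open>Chain maps\<close>

lemma chain_mapsI:
  "f \<in> gmaps k (Und M) (Und N) \<Longrightarrow>
   (\<And>n x. x \<in> carrier (Und M n) \<Longrightarrow> Diff N n (f n x) = f (n + 1) (Diff M n x)) \<Longrightarrow> f \<in> chain_maps k M N"
  by (simp add: chain_maps_def)

lemma chain_maps_gmaps: "f \<in> chain_maps k M N \<Longrightarrow> f \<in> gmaps k (Und M) (Und N)"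
  by (simp add: chain_maps_def)

lemma chain_maps_Diff:
  "f \<in> chain_maps k M N \<Longrightarrow> x \<in> carrier (Und M n) \<Longrightarrow> m = n + 1 \<Longrightarrow> Diff N n (f n x) = f m (Diff M n x)"
  by (simp add: chain_maps_def)

lemma chain_maps_closed: "f \<in> chain_maps k M N \<Longrightarrow> x \<in> carrier (Und M n) \<Longrightarrow> f n x \<in> carrier (Und N n)"
  by (rule gmaps_closed[OF chain_maps_gmaps])

lemmas chain_maps_lin = gmapsD[OF chain_maps_gmaps]

lemma gid_chain_map: "K_obj k M \<Longrightarrow> gid (Und M) \<in> chain_maps k M M"
  by (rule chain_mapsI) (simp_all add: gid_gmaps, simp add: gid_def)

lemma gcomp_chain_map:
  assumes "K_obj k M" "f \<in> chain_maps k M N" "g \<in> chain_maps k N P"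
  shows "gcomp (Und M) g f \<in> chain_maps k M P"
proof (rule chain_mapsI)
  show "gcomp (Und M) g f \<in> gmaps k (Und M) (Und P)"
    using assms by (simp add: gcomp_gmaps[OF _ chain_maps_gmaps chain_maps_gmaps])
  fix n x assume "x \<in> carrier (Und M n)"
  then show "Diff P n (gcomp (Und M) g f n x) = gcomp (Und M) g f (n + 1) (Diff M n x)"
    using assms by (simp add: gcomp_def chain_maps_Diff[OF assms(2)] chain_maps_Diff[OF assms(3)] chain_maps_closed[OF assms(2)])
qed

text \<open>Commuting with the differential is additive in the tensor, so it is tested on pure
  tensors, where the differential is the Leibniz rule.\<close>

lemma ktens_chain_mapI:
  assumes obj [simp]: "K_obj k M" "K_obj k N" "K_obj k P"
    and f: "f \<in> gmaps k (gtens k (Und M) (Und N)) (Und P)"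
    and eq: "\<And>i x j y n. i + j = n \<Longrightarrow> x \<in> carrier (Und M i) \<Longrightarrow> y \<in> carrier (Und N j) \<Longrightarrow>
      Diff P n (f n (ptens k (Und M) (Und N) i x j y)) =
      f (n + 1) (ptens k (Und M) (Und N) (i + 1) (Diff M i x) j y) \<oplus>\<^bsub>Und P (n + 1)\<^esub>
      signed (Und P (n + 1)) i (f (n + 1) (ptens k (Und M) (Und N) i x (j + 1) (Diff N j y)))"
  shows "f \<in> chain_maps k (ktens k M N) P"
proof (rule chain_mapsI)
  fix n t assume "t \<in> carrier (Und (ktens k M N) n)"
  then have "t \<in> carrier (gtens k (Und M) (Und N) n)" by simp
  then show "Diff P n (f n t) = f (n + 1) (Diff (ktens k M N) n t)"
  proof (induction rule: gtens_induct[OF K_obj_gr[OF obj(1)] K_obj_gr[OF obj(2)], consumes 1])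
    case (1 i x j y)
    have e: "i + 1 + j = n + 1" "i + (j + 1) = n + 1" using 1 by simp_all
    show ?case using 1
      by (simp add: eq[OF 1] ktens_Diff_ptens[OF obj(1,2) 1(1) refl refl refl] lin_add[OF gmapsD[OF f]] lin_signed[OF gmapsD[OF f]] e)
  next
    case (2 s t)
    note l = ktens_Diff_linear[OF obj(1,2), of n]
    show ?case using 2 lin_closed[OF l]
      by (simp add: lin_add[OF gmapsD[OF f]] lin_add[OF l] Diff_add[OF _ _ _ refl] gmaps_closed[OF f])
  qed
qed (simp add: f)

lemma tens_map_chain_map:
  assumes obj [simp]: "K_obj k M" "K_obj k N" "K_obj k M'" "K_obj k N'"
    and f: "f \<in> chain_maps k M M'" and g: "g \<in> chain_maps k N N'"
  shows "tens_map k (Und M) (Und N) (Und M') (Und N') f g \<in> chain_maps k (ktens k M N) (ktens k M' N')"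
proof (rule ktens_chain_mapI)
  note fg = chain_maps_gmaps[OF f] chain_maps_gmaps[OF g]
  show "tens_map k (Und M) (Und N) (Und M') (Und N') f g
      \<in> gmaps k (gtens k (Und M) (Und N)) (Und (ktens k M' N'))"
    using tens_map_gmaps[OF _ _ _ _ fg] by simp
  fix i x j y n assume n: "i + j = n" and x: "x \<in> carrier (Und M i)" and y: "y \<in> carrier (Und N j)"
  have e: "i + 1 + j = n + 1" "i + (j + 1) = n + 1" using n by simp_all
  show "Diff (ktens k M' N') n (tens_map k (Und M) (Und N) (Und M') (Und N') f g n (ptens k (Und M) (Und N) i x j y)) =
      tens_map k (Und M) (Und N) (Und M') (Und N') f g (n + 1) (ptens k (Und M) (Und N) (i + 1) (Diff M i x) j y)
      \<oplus>\<^bsub>Und (ktens k M' N') (n + 1)\<^esub> signed (Und (ktens k M' N') (n + 1)) i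
       (tens_map k (Und M) (Und N) (Und M') (Und N') f g (n + 1) (ptens k (Und M) (Und N) i x (j + 1) (Diff N j y)))"
    using x y chain_maps_closed[OF f] chain_maps_closed[OF g]
    by (simp add: tens_map_ptens[OF _ _ _ _ fg n] tens_map_ptens[OF _ _ _ _ fg e(1)] tens_map_ptens[OF _ _ _ _ fg e(2)]
       ktens_Diff_ptens[OF obj(3,4) n refl refl refl] chain_maps_Diff[OF f _ refl] chain_maps_Diff[OF g _ refl])
qed simp_all

text \<open>On \<open>(x \<otimes> y) \<otimes> z\<close> both ways round give three terms, one for
  each factor that is differentiated, with the signs \<open>1\<close>, \<open>(-1)^i\<close> and
  \<open>(-1)^(i+j)\<close>.\<close>

lemma tens_assoc_chain_map:
  assumes obj [simp]: "K_obj k M" "K_obj k N" "K_obj k P"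
  shows "tens_assoc k (Und M) (Und N) (Und P) \<in> chain_maps k (ktens k (ktens k M N) P) (ktens k M (ktens k N P))"
proof (rule chain_mapsI)
  let ?a = "tens_assoc k (Und M) (Und N) (Und P)" and ?S = "ktens k (ktens k M N) P" and ?T = "ktens k M (ktens k N P)"
  have a: "?a \<in> gmaps k (Und ?S) (Und ?T)" by (simp add: tens_assoc_gmaps)
  then show "?a \<in> gmaps k (Und ?S) (Und ?T)" .
  fix n t assume t: "t \<in> carrier (Und ?S n)"
  \<comment> \<open>Both composites are packed as extensional linear maps, so that equality on
    threefold pure tensors extends to all \<open>t\<close>.\<close>
  have "(\<lambda>t\<in>carrier (Und ?S n). Diff ?T n (?a n t)) = (\<lambda>t\<in>carrier (Und ?S n). ?a (n + 1) (Diff ?S n t))"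
  proof (rule gtens_gtens_linmaps_eqI)
    have o: "module k (Und ?S n)" by simp
    show "(\<lambda>t\<in>carrier (Und ?S n). Diff ?T n (?a n t)) \<in> linmaps k (gtens k (gtens k (Und M) (Und N)) (Und P) n) (Und ?T (n + 1))"
      using lin_comp[OF o gmapsD[OF a] K_obj_Diff[of ?T n]] by simp
    show "(\<lambda>t\<in>carrier (Und ?S n). ?a (n + 1) (Diff ?S n t)) \<in> linmaps k (gtens k (gtens k (Und M) (Und N)) (Und P) n) (Und ?T (n + 1))"
      using lin_comp[OF o K_obj_Diff[of ?S n] gmapsD[OF a]] by simp
    fix i x j y l z assume n: "i + j + l = n" and x: "x \<in> carrier (Und M i)" and y: "y \<in> carrier (Und N j)"
      and z: "z \<in> carrier (Und P l)"
    let ?p = "ptens k (gtens k (Und M) (Und N)) (Und P) (i + j) (ptens k (Und M) (Und N) i x j y) l z"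
    have e: "i + 1 + j = i + j + 1" "i + (j + 1) = i + j + 1" "i + j + 1 + l = n + 1" "i + j + (l + 1) = n + 1"
      "i + (j + l) = n" "i + 1 + (j + l) = n + 1" "i + (j + l + 1) = n + 1" "j + 1 + l = j + l + 1" "j + (l + 1) = j + l + 1"
      using n by simp_all
    have "Diff ?S n ?p = ptens k (gtens k (Und M) (Und N)) (Und P) (i + j + 1) (Diff (ktens k M N) (i + j) (ptens k (Und M) (Und N) i x j y)) l z
       \<oplus>\<^bsub>Und ?S (n + 1)\<^esub> signed (Und ?S (n + 1)) (i + j) (ptens k (gtens k (Und M) (Und N)) (Und P) (i + j) (ptens k (Und M) (Und N) i x j y) (l + 1) (Diff P l z))"
      using x y z by (simp add: ktens_Diff_ptens[OF _ _ n refl refl refl, of "ktens k M N" P, simplified])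
    then have L: "?a (n + 1) (Diff ?S n ?p) =
       ptens k (Und M) (gtens k (Und N) (Und P)) (i + 1) (Diff M i x) (j + l) (ptens k (Und N) (Und P) j y l z)
       \<oplus>\<^bsub>Und ?T (n + 1)\<^esub> signed (Und ?T (n + 1)) i (ptens k (Und M) (gtens k (Und N) (Und P)) i x (j + l + 1) (ptens k (Und N) (Und P) (j + 1) (Diff N j y) l z))
       \<oplus>\<^bsub>Und ?T (n + 1)\<^esub> signed (Und ?T (n + 1)) (i + j) (ptens k (Und M) (gtens k (Und N) (Und P)) i x (j + l + 1) (ptens k (Und N) (Und P) j y (l + 1) (Diff P l z)))"
      using x y z
      by (simp add: ktens_Diff_ptens[OF obj(1,2) refl refl refl refl] ptens_add_left[OF _ _ e(3)] ptens_signed_left[OF _ _ e(3)]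
          lin_add[OF gmapsD[OF a[simplified]]] lin_signed[OF gmapsD[OF a[simplified]]] signed_add signed_signed
          tens_assoc_ptens[OF _ _ _ e(1) e(3)] tens_assoc_ptens[OF _ _ _ e(2) e(3)] tens_assoc_ptens[OF _ _ _ refl e(4)] e m_ac)
    have R: "Diff ?T n (?a n ?p) =
       ptens k (Und M) (gtens k (Und N) (Und P)) (i + 1) (Diff M i x) (j + l) (ptens k (Und N) (Und P) j y l z)
       \<oplus>\<^bsub>Und ?T (n + 1)\<^esub> signed (Und ?T (n + 1)) i (ptens k (Und M) (gtens k (Und N) (Und P)) i x (j + l + 1) (ptens k (Und N) (Und P) (j + 1) (Diff N j y) l z))
       \<oplus>\<^bsub>Und ?T (n + 1)\<^esub> signed (Und ?T (n + 1)) (i + j) (ptens k (Und M) (gtens k (Und N) (Und P)) i x (j + l + 1) (ptens k (Und N) (Und P) j y (l + 1) (Diff P l z)))"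
      using x y z
      by (simp add: tens_assoc_ptens[OF _ _ _ refl n] ktens_Diff_ptens[OF _ _ e(5) refl refl refl, of M "ktens k N P", simplified]
         ktens_Diff_ptens[OF obj(2,3) refl refl refl refl] ptens_add_right[OF _ _ e(7)] ptens_signed_right[OF _ _ e(7)] signed_add signed_signed e m_ac)
    show "(\<lambda>t\<in>carrier (Und ?S n). Diff ?T n (?a n t)) ?p = (\<lambda>t\<in>carrier (Und ?S n). ?a (n + 1) (Diff ?S n t)) ?p"
      using x y z n L R by simp
  qed simp_all
  from fun_cong[OF this, of t] show "Diff ?T n (?a n t) = ?a (n + 1) (Diff ?S n t)" using t by simp
qed

text \<open>The sign \<open>(-1)^(i j)\<close> of the symmetry becomes \<open>(-1)^((i+1) j)\<close>
  at \<open>dx \<otimes> y\<close> and \<open>(-1)^(i (j+1))\<close> at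
  \<open>x \<otimes> dy\<close>. The surplus \<open>(-1)^j\<close> is the Leibniz sign of
  \<open>d (y \<otimes> x)\<close>, and the surplus \<open>(-1)^i\<close> cancels that of
  \<open>d (x \<otimes> y)\<close>.\<close>

lemma tens_sym_chain_map:
  assumes obj [simp]: "K_obj k M" "K_obj k N"
  shows "tens_sym k (Und M) (Und N) \<in> chain_maps k (ktens k M N) (ktens k N M)"
proof (rule ktens_chain_mapI)
  show "tens_sym k (Und M) (Und N) \<in> gmaps k (gtens k (Und M) (Und N)) (Und (ktens k N M))"
    by (simp add: tens_sym_gmaps)
  fix i x j y n assume n: "i + j = n" and x: "x \<in> carrier (Und M i)" and y: "y \<in> carrier (Und N j)"
  have e: "j + i = n" "i + 1 + j = n + 1" "i + (j + 1) = n + 1" "j + 1 + i = n + 1" "j + (i + 1) = n + 1" using n by simp_all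
  have ds: "Diff (ktens k N M) n (signed (gtens k (Und N) (Und M) n) (i * j) z) =
      signed (gtens k (Und N) (Und M) (n + 1)) (i * j) (Diff (ktens k N M) n z)"
    if "z \<in> carrier (gtens k (Und N) (Und M) n)" for z
    using Diff_signed[of "ktens k N M" z n "n + 1" "i * j"] that by simp
  show "Diff (ktens k N M) n (tens_sym k (Und M) (Und N) n (ptens k (Und M) (Und N) i x j y)) =
      tens_sym k (Und M) (Und N) (n + 1) (ptens k (Und M) (Und N) (i + 1) (Diff M i x) j y)
      \<oplus>\<^bsub>Und (ktens k N M) (n + 1)\<^esub> signed (Und (ktens k N M) (n + 1)) i
       (tens_sym k (Und M) (Und N) (n + 1) (ptens k (Und M) (Und N) i x (j + 1) (Diff N j y)))"
    using x y
    by (simp add: ds tens_sym_ptens[OF _ _ n] tens_sym_ptens[OF _ _ e(2)] tens_sym_ptens[OF _ _ e(3)]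
       ktens_Diff_ptens[OF obj(2,1) e(1) refl refl refl] signed_add signed_signed e)
      (simp add: signed_def e m_ac)
qed simp_all

lemma tens_linv_chain_map:
  assumes obj [simp]: "K_obj k M"
  shows "tens_linv k (Und M) \<in> chain_maps k M (ktens k (kunit k) M)"
proof (rule chain_mapsI)
  show "tens_linv k (Und M) \<in> gmaps k (Und M) (Und (ktens k (kunit k) M))" by (simp add: tens_linv_gmaps)
  fix n x assume x: "x \<in> carrier (Und M n)"
  have e: "0 + n = n" "1 + n = n + 1" "0 + (n + 1) = n + 1" by simp_all
  show "Diff (ktens k (kunit k) M) n (tens_linv k (Und M) n x) = tens_linv k (Und M) (n + 1) (Diff M n x)"
    using x ktens_Diff_ptens[of "kunit k" M 0 n n "n + 1" 1 "n + 1" \<one> x] ptens_zero_left[OF _ _ e(2), of "gunit k" "Und M" x]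
    by (simp add: signed_def)
qed

lemma tens_rinv_chain_map:
  assumes obj [simp]: "K_obj k M"
  shows "tens_rinv k (Und M) \<in> chain_maps k M (ktens k M (kunit k))"
proof (rule chain_mapsI)
  show "tens_rinv k (Und M) \<in> gmaps k (Und M) (Und (ktens k M (kunit k)))" by (simp add: tens_rinv_gmaps)
  fix n x assume x: "x \<in> carrier (Und M n)"
  show "Diff (ktens k M (kunit k)) n (tens_rinv k (Und M) n x) = tens_rinv k (Und M) (n + 1) (Diff M n x)"
    using x ktens_Diff_ptens[of M "kunit k" n 0 n "n + 1" "n + 1" 1 x \<one>] ptens_zero_right[of "Und M" "gunit k" n 1 "n + 1" x]
    by simp
qed

text \<open>A chain map out of the tensor product satisfies \<open>d (f (x \<otimes> y)) = f (dx
  \<otimes> y) + (-1)^n f (x \<otimes> dy)\<close>. Solved for the first summand on the right, this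
  is the differential of the inner hom at the curried \<open>x\<close>.\<close>

lemma gcurry_chain_map:
  assumes obj [simp]: "K_obj k M" "K_obj k N" "K_obj k P" and f: "f \<in> chain_maps k (ktens k M N) P"
  shows "gcurry k (Und M) (Und N) f \<in> chain_maps k M (kihom k N P)"
proof (rule chain_mapsI)
  have fg: "f \<in> gmaps k (gtens k (Und M) (Und N)) (Und P)" using chain_maps_gmaps[OF f] by simp
  have g: "gcurry k (Und M) (Und N) f \<in> gmaps k (Und M) (gihom k (Und N) (Und P))"
    by (rule gcurry_gmaps[OF _ _ _ fg]) simp_all
  then show "gcurry k (Und M) (Und N) f \<in> gmaps k (Und M) (Und (kihom k N P))" by simp
  fix n x assume x: "x \<in> carrier (Und M n)"
  show "Diff (kihom k N P) n (gcurry k (Und M) (Und N) f n x) = gcurry k (Und M) (Und N) f (n + 1) (Diff M n x)"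
  proof (rule gihom_eqI[of _ "Und N" "Und P" "n + 1"])
    show "Diff (kihom k N P) n (gcurry k (Und M) (Und N) f n x) \<in> carrier (gihom k (Und N) (Und P) (n + 1))"
      using gmaps_closed[OF g] x by (intro kihom_Diff_closed) simp_all
    show "gcurry k (Und M) (Und N) f (n + 1) (Diff M n x) \<in> carrier (gihom k (Und N) (Und P) (n + 1))"
      using gmaps_closed[OF g] x by simp
    fix p y assume y: "y \<in> carrier (Und N p)"
    let ?x = "ptens k (Und M) (Und N)"
    have e: "p + n = n + p" "n + (p + 1) = n + p + 1" "n + 1 + p = n + p + 1" by simp_all
    have c: "?x n x p y \<in> carrier (gtens k (Und M) (Und N) (n + p))" using x y by simp
    have "Diff P (n + p) (f (n + p) (?x n x p y)) = f (n + p + 1) (Diff (ktens k M N) (n + p) (?x n x p y))"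
      using c by (intro chain_maps_Diff[OF f]) simp_all
    also have "\<dots> = f (n + p + 1) (?x (n + 1) (Diff M n x) p y) \<oplus>\<^bsub>Und P (n + p + 1)\<^esub>
       signed (Und P (n + p + 1)) n (f (n + p + 1) (?x n x (p + 1) (Diff N p y)))"
      using x y by (simp add: ktens_Diff_ptens[OF _ _ refl refl refl refl] lin_add[OF gmapsD[OF fg]] lin_signed[OF gmapsD[OF fg]] e)
    finally have *: "Diff P (n + p) (f (n + p) (?x n x p y)) = \<dots>" .
    have cc: "f (n + p + 1) (?x (n + 1) (Diff M n x) p y) \<in> carrier (Und P (n + p + 1))"
      "f (n + p + 1) (?x n x (p + 1) (Diff N p y)) \<in> carrier (Und P (n + p + 1))"
      using x y by (auto intro!: gmaps_closed[OF fg] simp: e)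
    show "Diff (kihom k N P) n (gcurry k (Und M) (Und N) f n x) p y = gcurry k (Und M) (Und N) f (n + 1) (Diff M n x) p y"
      using x y gmaps_closed[OF g x] cc * by (simp add: kihom_Diff_apply e m_minus_def m_ac)
  qed
qed

text \<open>The Leibniz rule \<open>d (g f) = (d g) f + (-1)^i g (d f)\<close>: the term
  \<open>g d f\<close> comes from both summands with opposite signs, and
  \<open>(-1)^i (-1)^j\<close> is the sign for degree \<open>i + j\<close>.\<close>

lemma gicomp_chain_map:
  assumes obj [simp]: "K_obj k M" "K_obj k N" "K_obj k P"
  shows "gicomp k (Und M) (Und N) (Und P) \<in> chain_maps k (ktens k (kihom k N P) (kihom k M N)) (kihom k M P)"
proof (rule ktens_chain_mapI)
  let ?c = "gicomp k (Und M) (Und N) (Und P)"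
  show gm: "?c \<in> gmaps k (gtens k (Und (kihom k N P)) (Und (kihom k M N))) (Und (kihom k M P))"
    by (simp add: gicomp_gmaps)
  fix i g j f n assume n: "i + j = n" and "g \<in> carrier (Und (kihom k N P) i)" "f \<in> carrier (Und (kihom k M N) j)"
  then have g: "g \<in> carrier (gihom k (Und N) (Und P) i)" and f: "f \<in> carrier (gihom k (Und M) (Und N) j)" by simp_all
  have dg: "Diff (kihom k N P) i g \<in> carrier (gihom k (Und N) (Und P) (i + 1))"
    and df: "Diff (kihom k M N) j f \<in> carrier (gihom k (Und M) (Und N) (j + 1))"
    using g f by (simp_all add: kihom_Diff_closed)
  have e: "i + 1 + j = n + 1" "i + (j + 1) = n + 1" using n by simp_all
  note cp = gicomp_ptens[of "Und M" "Und N" "Und P", OF _ _ _ n g f, simplified]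
    gicomp_ptens[of "Und M" "Und N" "Und P", OF _ _ _ e(1) dg f, simplified]
    gicomp_ptens[of "Und M" "Und N" "Und P", OF _ _ _ e(2) g df, simplified]
  have cl: "(\<lambda>p. \<lambda>x\<in>carrier (Und M p). g (p + j) (f p x)) \<in> carrier (gihom k (Und M) (Und P) n)"
    "(\<lambda>p. \<lambda>x\<in>carrier (Und M p). Diff (kihom k N P) i g (p + j) (f p x)) \<in> carrier (gihom k (Und M) (Und P) (n + 1))"
    "(\<lambda>p. \<lambda>x\<in>carrier (Und M p). g (p + (j + 1)) (Diff (kihom k M N) j f p x)) \<in> carrier (gihom k (Und M) (Und P) (n + 1))"
    using gihom_comp_closed[of "Und M" "Und N" "Und P", OF _ _ _ g f] gihom_comp_closed[of "Und M" "Und N" "Und P", OF _ _ _ dg f]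
      gihom_comp_closed[of "Und M" "Und N" "Und P", OF _ _ _ g df] e n by auto
  show "Diff (kihom k M P) n (?c n (ptens k (Und (kihom k N P)) (Und (kihom k M N)) i g j f)) =
      ?c (n + 1) (ptens k (Und (kihom k N P)) (Und (kihom k M N)) (i + 1) (Diff (kihom k N P) i g) j f)
      \<oplus>\<^bsub>Und (kihom k M P) (n + 1)\<^esub> signed (Und (kihom k M P) (n + 1)) i
       (?c (n + 1) (ptens k (Und (kihom k N P)) (Und (kihom k M N)) i g (j + 1) (Diff (kihom k M N) j f)))"
    unfolding kihom_Und cp
  proof (rule gihom_eqI[of _ "Und M" "Und P" "n + 1"])
    fix p x assume x: "x \<in> carrier (Und M p)"
    have q: "p + n = p + j + i" "p + (n + 1) = p + j + i + 1" "p + (j + 1) = p + j + 1" "p + 1 + j = p + j + 1" "p + j + 1 + i = p + j + i + 1"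
      using n by simp_all
    have fx: "f p x \<in> carrier (Und N (p + j))" "f (p + 1) (Diff M p x) \<in> carrier (Und N (p + j + 1))"
      using x by (auto intro!: gihom_closed[OF f])
    have gl: "g (p + j + 1) \<in> linmaps k (Und N (p + j + 1)) (Und P (p + j + i + 1))"
      using gihomD[OF g, of "p + j + 1"] by (simp only: q)
    have gx: "g (p + j) (f p x) \<in> carrier (Und P (p + j + i))"
      using fx by (auto intro!: gihom_closed[OF g])
    have dfx: "Diff N (p + j) (f p x) \<in> carrier (Und N (p + j + 1))" using fx by simp
    show "Diff (kihom k M P) n (\<lambda>p. \<lambda>x\<in>carrier (Und M p). g (p + j) (f p x)) p x =
       ((\<lambda>p. \<lambda>x\<in>carrier (Und M p). Diff (kihom k N P) i g (p + j) (f p x)) \<oplus>\<^bsub>gihom k (Und M) (Und P) (n + 1)\<^esub>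
        signed (gihom k (Und M) (Und P) (n + 1)) i (\<lambda>p. \<lambda>x\<in>carrier (Und M p). g (p + (j + 1)) (Diff (kihom k M N) j f p x))) p x"
      using x fx gx cl dfx g f lin_closed[OF gl]
      apply (simp add: kihom_Diff_apply gihom_signed_apply[of "Und M" "Und P"] q lin_minus[OF gl] lin_signed[OF gl])
      apply (simp add: n[symmetric] signed_def m_group)
      done
  qed (use cl in \<open>simp_all add: kihom_Diff_closed\<close>)
qed simp_all

lemma gipost_chain_map:
  assumes obj [simp]: "K_obj k M" "K_obj k N" "K_obj k P" and g: "g \<in> chain_maps k N P"
  shows "gipost k (Und M) (Und N) g \<in> chain_maps k (kihom k M N) (kihom k M P)"
proof (rule chain_mapsI)
  note gg = chain_maps_gmaps[OF g]
  have gm: "gipost k (Und M) (Und N) g \<in> gmaps k (gihom k (Und M) (Und N)) (gihom k (Und M) (Und P))"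
    by (rule gipost_gmaps[OF _ _ _ gg]) simp_all
  then show "gipost k (Und M) (Und N) g \<in> gmaps k (Und (kihom k M N)) (Und (kihom k M P))" by simp
  fix n f assume "f \<in> carrier (Und (kihom k M N) n)"
  then have f: "f \<in> carrier (gihom k (Und M) (Und N) n)" by simp
  have df: "Diff (kihom k M N) n f \<in> carrier (gihom k (Und M) (Und N) (n + 1))" using f by (simp add: kihom_Diff_closed)
  show "Diff (kihom k M P) n (gipost k (Und M) (Und N) g n f) = gipost k (Und M) (Und N) g (n + 1) (Diff (kihom k M N) n f)"
  proof (rule gihom_eqI[of _ "Und M" "Und P" "n + 1"])
    fix p x assume x: "x \<in> carrier (Und M p)"
    have q: "p + (n + 1) = p + n + 1" "p + 1 + n = p + n + 1" by simp_all
    have fx: "f p x \<in> carrier (Und N (p + n))" "f (p + 1) (Diff M p x) \<in> carrier (Und N (p + n + 1))"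
      using x by (auto intro!: gihom_closed[OF f])
    show "Diff (kihom k M P) n (gipost k (Und M) (Und N) g n f) p x = gipost k (Und M) (Und N) g (n + 1) (Diff (kihom k M N) n f) p x"
      using x fx f df gmaps_closed[OF gm f]
      by (simp add: kihom_Diff_apply q lin_minus[OF gmapsD[OF gg]] lin_signed[OF gmapsD[OF gg]] chain_maps_Diff[OF g _ refl])
  qed (use f df in \<open>simp_all add: kihom_Diff_closed gmaps_closed[OF gm]\<close>)
qed

lemma gipre_chain_map:
  assumes obj [simp]: "K_obj k M" "K_obj k N" "K_obj k P" and f: "f \<in> chain_maps k M N"
  shows "gipre k (Und M) (Und N) (Und P) f \<in> chain_maps k (kihom k N P) (kihom k M P)"
proof (rule chain_mapsI)
  note ff = chain_maps_gmaps[OF f]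
  have gm: "gipre k (Und M) (Und N) (Und P) f \<in> gmaps k (gihom k (Und N) (Und P)) (gihom k (Und M) (Und P))"
    by (rule gipre_gmaps[OF _ _ _ ff]) simp_all
  then show "gipre k (Und M) (Und N) (Und P) f \<in> gmaps k (Und (kihom k N P)) (Und (kihom k M P))" by simp
  fix n h assume "h \<in> carrier (Und (kihom k N P) n)"
  then have h: "h \<in> carrier (gihom k (Und N) (Und P) n)" by simp
  have dh: "Diff (kihom k N P) n h \<in> carrier (gihom k (Und N) (Und P) (n + 1))" using h by (simp add: kihom_Diff_closed)
  show "Diff (kihom k M P) n (gipre k (Und M) (Und N) (Und P) f n h) = gipre k (Und M) (Und N) (Und P) f (n + 1) (Diff (kihom k N P) n h)"
  proof (rule gihom_eqI[of _ "Und M" "Und P" "n + 1"])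
    fix p x assume x: "x \<in> carrier (Und M p)"
    show "Diff (kihom k M P) n (gipre k (Und M) (Und N) (Und P) f n h) p x = gipre k (Und M) (Und N) (Und P) f (n + 1) (Diff (kihom k N P) n h) p x"
      using x h dh gmaps_closed[OF gm h] gmaps_closed[OF ff x]
      by (simp add: kihom_Diff_apply chain_maps_Diff[OF f _ refl])
  qed (use h dh in \<open>simp_all add: kihom_Diff_closed gmaps_closed[OF gm]\<close>)
qed

end

section \<open>Cohomology, the inner hom comparison and the Kuenneth map\<close>

text \<open>
  Only \<open>d h d = d\<close> is demanded. For the projection \<open>1 - (d h + h d)\<close> to kill boundaries and
  to have values in the cocycles it is not necessary that \<open>h h = 0\<close> or \<open>h d h = h\<close>.
\<close>

definition contraction :: "'k ring \<Rightarrow> ('k, 'a) cochain \<Rightarrow> (int \<Rightarrow> 'a \<Rightarrow> 'a) \<Rightarrow> bool" where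
  "contraction k M h \<longleftrightarrow> (\<forall>n. h n \<in> linmaps k (Und M n) (Und M (n - 1))) \<and>
     (\<forall>n. \<forall>x\<in>carrier (Und M n). Diff M n (h (n + 1) (Diff M n x)) = Diff M n x)"

definition harm :: "('k, 'a) cochain \<Rightarrow> (int \<Rightarrow> 'a \<Rightarrow> 'a) \<Rightarrow> int \<Rightarrow> 'a \<Rightarrow> 'a" where
  "harm M h n = (\<lambda>x\<in>carrier (Und M n).
     x \<ominus>\<^bsub>Und M n\<^esub> (Diff M (n - 1) (h n x) \<oplus>\<^bsub>Und M n\<^esub> h (n + 1) (Diff M n x)))"

text \<open>
  \<open>theta\<close> sends the class of \<open>f\<close> to the map \<open>[x] \<mapsto> [f x]\<close>; since the class of \<open>f x\<close> depends
  neither on \<open>f\<close> nor on \<open>x\<close>, the union over all representatives is that single class.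
\<close>

definition theta ::
  "'k ring \<Rightarrow> ('k, 'a) cochain \<Rightarrow> ('k, 'b) cochain \<Rightarrow> int \<Rightarrow> (int \<Rightarrow> 'a \<Rightarrow> 'b) set \<Rightarrow> int \<Rightarrow> 'a set \<Rightarrow> 'b set" where
  "theta k M N n = (\<lambda>\<phi>\<in>carrier (cohomology (kihom k M N) n). \<lambda>p. \<lambda>c\<in>carrier (cohomology M p).
     \<Union>f\<in>\<phi>. \<Union>x\<in>c. coclass N (p + n) (f p x))"

context ground_ring
begin

section \<open>Cocycles, coboundaries and classes\<close>

lemma cocycles_submodule: "K_obj k M \<Longrightarrow> submodule (cocycles M n) k (Und M n)"
  unfolding cocycles_def by (rule kernel_submodule) (simp_all add: K_obj_Diff)

lemma coboundaries_submodule: "K_obj k M \<Longrightarrow> submodule (coboundaries M n) k (Und M n)"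
  unfolding coboundaries_def
  by (rule image_submodule) (simp_all add: K_obj_Diff[of M "n - 1", simplified])

lemma cocycles_closed: "x \<in> cocycles M n \<Longrightarrow> x \<in> carrier (Und M n)"
  by (simp add: cocycles_def)

lemma cocycles_Diff: "x \<in> cocycles M n \<Longrightarrow> m = n + 1 \<Longrightarrow> Diff M n x = \<zero>\<^bsub>Und M m\<^esub>"
  by (simp add: cocycles_def)

lemma cocyclesI: "x \<in> carrier (Und M n) \<Longrightarrow> m = n + 1 \<Longrightarrow> Diff M n x = \<zero>\<^bsub>Und M m\<^esub> \<Longrightarrow> x \<in> cocycles M n"
  by (simp add: cocycles_def)

declare cocycles_closed [simp]

lemma coboundariesI: "y \<in> carrier (Und M m) \<Longrightarrow> n = m + 1 \<Longrightarrow> Diff M m y \<in> coboundaries M n"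
  by (auto simp: coboundaries_def)

lemma coboundariesE:
  assumes "b \<in> coboundaries M n" "m = n - 1"
  obtains y where "y \<in> carrier (Und M m)" "b = Diff M m y"
  using assms by (auto simp: coboundaries_def)

lemma coboundaries_cocycles: "K_obj k M \<Longrightarrow> x \<in> coboundaries M n \<Longrightarrow> x \<in> cocycles M n"
  by (erule coboundariesE[OF _ refl]) (auto intro!: cocyclesI[OF _ refl] Diff_Diff)

lemma cocycles_module: "K_obj k M \<Longrightarrow> module k (Und M n\<lparr>carrier := cocycles M n\<rparr>)"
  by (rule submodule.submodule_is_module[OF cocycles_submodule]) simp_all

lemma cob_submodule_coc: "K_obj k M \<Longrightarrow> submodule (coboundaries M n) k (Und M n\<lparr>carrier := cocycles M n\<rparr>)"
  by (rule submodule_intro[OF cocycles_module])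
    (auto simp: coboundaries_cocycles submodule_zero[OF coboundaries_submodule]
      submodule_add[OF coboundaries_submodule] submodule_smult[OF coboundaries_submodule])

text \<open>Cosets are formed with the addition alone, which the passage to the smaller carrier of
  cocycles does not touch. This makes the general facts on quotient modules available for
  \<open>coclass\<close>.\<close>

lemma coclass_altdef: "coclass M n x = coboundaries M n +>\<^bsub>Und M n\<lparr>carrier := cocycles M n\<rparr>\<^esub> x"
  by (simp add: coclass_def a_r_coset_def')

lemma cohomology_carrier: "carrier (cohomology M n) = {coclass M n x | x. x \<in> cocycles M n}"
  by (simp add: cohomology_def quot_carrier coclass_altdef)

lemma coclass_closed [simp]: "x \<in> cocycles M n \<Longrightarrow> coclass M n x \<in> carrier (cohomology M n)"
  by (auto simp: cohomology_carrier)

lemma cohomologyE: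
  assumes "c \<in> carrier (cohomology M n)"
  obtains x where "x \<in> cocycles M n" "c = coclass M n x"
  using assms by (auto simp: cohomology_carrier)

context
  fixes M :: "('k, 'a) cochain"
  assumes obj [simp]: "K_obj k M"
begin

lemma coc_add [simp]: "x \<in> cocycles M n \<Longrightarrow> y \<in> cocycles M n \<Longrightarrow> x \<oplus>\<^bsub>Und M n\<^esub> y \<in> cocycles M n"
  and coc_minus [simp]: "x \<in> cocycles M n \<Longrightarrow> y \<in> cocycles M n \<Longrightarrow> x \<ominus>\<^bsub>Und M n\<^esub> y \<in> cocycles M n"
  and coc_smult [simp]: "a \<in> carrier k \<Longrightarrow> x \<in> cocycles M n \<Longrightarrow> a \<odot>\<^bsub>Und M n\<^esub> x \<in> cocycles M n"
  and coc_neg [simp]: "x \<in> cocycles M n \<Longrightarrow> \<ominus>\<^bsub>Und M n\<^esub> x \<in> cocycles M n"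
  and coc_zero [simp]: "\<zero>\<^bsub>Und M n\<^esub> \<in> cocycles M n"
  using cocycles_submodule[OF obj, of n]
  by (auto intro: submodule_add submodule_minus[OF gr_objD[OF K_obj_gr[OF obj]]] submodule_smult
      submodule_neg[OF gr_objD[OF K_obj_gr[OF obj]]] submodule_zero)

lemma coclass_add:
  "x \<in> cocycles M n \<Longrightarrow> y \<in> cocycles M n \<Longrightarrow>
   coclass M n (x \<oplus>\<^bsub>Und M n\<^esub> y) = coclass M n x \<oplus>\<^bsub>cohomology M n\<^esub> coclass M n y"
  using quot_add[OF cocycles_module[OF obj] cob_submodule_coc[OF obj], of x n y]
  by (simp add: coclass_altdef cohomology_def)

lemma coclass_smult:
  "a \<in> carrier k \<Longrightarrow> x \<in> cocycles M n \<Longrightarrow> coclass M n (a \<odot>\<^bsub>Und M n\<^esub> x) = a \<odot>\<^bsub>cohomology M n\<^esub> coclass M n x"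
  using quot_smult[OF cocycles_module[OF obj] cob_submodule_coc[OF obj], of a x n]
  by (simp add: coclass_altdef cohomology_def)

lemma coclass_zero: "coclass M n \<zero>\<^bsub>Und M n\<^esub> = \<zero>\<^bsub>cohomology M n\<^esub>"
  using quot_zero[OF cocycles_module[OF obj] cob_submodule_coc[OF obj], of n]
  by (simp add: coclass_altdef cohomology_def)

lemma cohomology_module [simp]: "module k (cohomology M n)"
  unfolding cohomology_def by (rule quot_module[OF cocycles_module[OF obj] cob_submodule_coc[OF obj]])

lemma cohomology_obj [simp]: "gr_obj k (cohomology M)"
  by (simp add: gr_obj_def)

lemma coclass_neg: "x \<in> cocycles M n \<Longrightarrow> coclass M n (\<ominus>\<^bsub>Und M n\<^esub> x) = \<ominus>\<^bsub>cohomology M n\<^esub> coclass M n x"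
  using coclass_smult[of "\<ominus> \<one>" x n] by (simp add: smult_neg_one)

lemma coclass_signed: "x \<in> cocycles M n \<Longrightarrow> coclass M n (signed (Und M n) m x) = signed (cohomology M n) m (coclass M n x)"
  by (simp add: signed_def coclass_neg)

lemma coclass_eq_iff:
  assumes "x \<in> cocycles M n" "y \<in> cocycles M n"
  shows "coclass M n x = coclass M n y \<longleftrightarrow> x \<ominus>\<^bsub>Und M n\<^esub> y \<in> coboundaries M n"
  using assms unfolding coclass_def
  by (intro a_coset_eq_iff coboundaries_submodule) simp_all

lemma coclass_eqI:
  assumes "x \<in> cocycles M n" "y \<in> cocycles M n" "w \<in> carrier (Und M m)" "n = m + 1"
    "x \<ominus>\<^bsub>Und M n\<^esub> y = Diff M m w"
  shows "coclass M n x = coclass M n y"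
  using assms coboundariesI[OF assms(3,4)] by (simp add: coclass_eq_iff)

lemma coclass_mem:
  assumes "x \<in> cocycles M n"
  shows "y \<in> coclass M n x \<longleftrightarrow> y \<in> cocycles M n \<and> coclass M n y = coclass M n x"
  using a_coset_mem_iff[OF cocycles_module[OF obj] cob_submodule_coc[OF obj], of x n y] assms
  by (simp add: coclass_altdef)

lemma coclass_self [simp]: "x \<in> cocycles M n \<Longrightarrow> x \<in> coclass M n x"
  by (simp add: coclass_mem)

text \<open>Unions over a class are how \<open>H_map\<close>, \<open>theta\<close> and
  \<open>kunneth\<close> avoid choosing representatives. If every representative gives the same set,
  the union over the nonempty class is that set.\<close>

lemma UN_coclass:
  assumes "x \<in> cocycles M n"
    "\<And>y. y \<in> cocycles M n \<Longrightarrow> coclass M n y = coclass M n x \<Longrightarrow> G y = G x"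
  shows "(\<Union>y\<in>coclass M n x. G y) = G x"
proof -
  have "(\<Union>y\<in>coclass M n x. G y) = (\<Union>y\<in>coclass M n x. G x)"
  proof (rule SUP_cong[OF refl])
    fix y assume "y \<in> coclass M n x"
    then have "y \<in> cocycles M n" "coclass M n y = coclass M n x" using assms(1) by (simp_all add: coclass_mem)
    then show "G y = G x" by (rule assms(2))
  qed
  moreover have "x \<in> coclass M n x" using assms(1) by simp
  ultimately show ?thesis by auto
qed

end

section \<open>Cohomology of the inner hom complex\<close>

context
  fixes M :: "('k, 'a) cochain" and N :: "('k, 'b) cochain"
  assumes obj [simp]: "K_obj k M" "K_obj k N"
begin

lemma cocycles_kihom_Diff:
  assumes f: "f \<in> cocycles (kihom k M N) n" and x: "x \<in> carrier (Und M p)" and q: "q = p + n" "p' = p + 1" "q' = q + 1"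
  shows "Diff N q (f p x) = signed (Und N q') n (f p' (Diff M p x))"
proof -
  have f': "f \<in> carrier (gihom k (Und M) (Und N) n)" using cocycles_closed[OF f] by simp
  have c: "f p x \<in> carrier (Und N q)" "f p' (Diff M p x) \<in> carrier (Und N q')"
    using x q by (auto intro!: gihom_closed[OF f'])
  have "Diff (kihom k M N) n f p x = \<zero>\<^bsub>Und (kihom k M N) (n + 1)\<^esub> p x"
    using cocycles_Diff[OF f refl] by simp
  then have "Diff N q (f p x) \<ominus>\<^bsub>Und N q'\<^esub> signed (Und N q') n (f p' (Diff M p x)) = \<zero>\<^bsub>Und N q'\<^esub>"
    using x f' q by (simp add: kihom_Diff_apply add.assoc)
  then show ?thesis using c q by (simp add: m_minus_eq_zero)
qed

lemma cocycles_kihomI: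
  assumes f: "f \<in> carrier (gihom k (Und M) (Und N) n)"
    and d: "\<And>p x. x \<in> carrier (Und M p) \<Longrightarrow>
      Diff N (p + n) (f p x) = signed (Und N (p + n + 1)) n (f (p + 1) (Diff M p x))"
  shows "f \<in> cocycles (kihom k M N) n"
proof (rule cocyclesI[OF _ refl])
  show "f \<in> carrier (Und (kihom k M N) n)" using f by simp
  show "Diff (kihom k M N) n f = \<zero>\<^bsub>Und (kihom k M N) (n + 1)\<^esub>"
    unfolding kihom_Und
  proof (rule gihom_eqI[of _ "Und M" "Und N" "n + 1"])
    fix p x assume x: "x \<in> carrier (Und M p)"
    then have c: "f (p + 1) (Diff M p x) \<in> carrier (Und N (p + n + 1))"
      by (auto intro!: gihom_closed[OF f])
    then show "Diff (kihom k M N) n f p x = \<zero>\<^bsub>gihom k (Und M) (Und N) (n + 1)\<^esub> p x"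
      using x f by (simp add: kihom_Diff_apply d add.assoc[symmetric])
  qed (use f in \<open>simp_all add: kihom_Diff_closed\<close>)
qed

lemma kihom_cocycle_cocycle:
  assumes f: "f \<in> cocycles (kihom k M N) n" and x: "x \<in> cocycles M p" and q: "q = p + n"
  shows "f p x \<in> cocycles N q"
proof (rule cocyclesI[OF _ refl])
  have f': "f \<in> carrier (gihom k (Und M) (Und N) n)" using cocycles_closed[OF f] by simp
  show "f p x \<in> carrier (Und N q)" using x q by (auto intro!: gihom_closed[OF f'])
  have "p + 1 + n = q + 1" using q by simp
  then have l: "f (p + 1) \<in> linmaps k (Und M (p + 1)) (Und N (q + 1))" using gihomD[OF f', of "p + 1"] by (simp only:)
  have "Diff N q (f p x) = signed (Und N (q + 1)) n (f (p + 1) (Diff M p x))"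
    using x q by (intro cocycles_kihom_Diff[OF f]) simp_all
  then show "Diff N q (f p x) = \<zero>\<^bsub>Und N (q + 1)\<^esub>"
    using lin_zero[OF l] by (simp add: cocycles_Diff[OF x refl])
qed

text \<open>If \<open>x = d y\<close>, then \<open>f x\<close> is the differential of
  \<open>(-1)^n f y\<close>.\<close>

lemma kihom_cocycle_coboundary:
  assumes f: "f \<in> cocycles (kihom k M N) n" and x: "x \<in> coboundaries M p" and q: "q = p + n"
  shows "f p x \<in> coboundaries N q"
proof -
  have f': "f \<in> carrier (gihom k (Und M) (Und N) n)" using cocycles_closed[OF f] by simp
  obtain y where y: "y \<in> carrier (Und M (p - 1))" "x = Diff M (p - 1) y"
    using coboundariesE[OF x refl] .
  have c: "f (p - 1) y \<in> carrier (Und N (q - 1))" "f p x \<in> carrier (Und N q)"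
    using y q by (auto intro!: gihom_closed[OF f'])
  have "Diff N (q - 1) (f (p - 1) y) = signed (Und N q) n (f p x)"
    unfolding y(2) using y q by (intro cocycles_kihom_Diff[OF f]) simp_all
  then have "Diff N (q - 1) (signed (Und N (q - 1)) n (f (p - 1) y)) = f p x"
    using c by (simp add: Diff_signed[of N _ "q - 1" q] signed_signed) (simp add: signed_def)
  then show ?thesis using coboundariesI[of "signed (Und N (q - 1)) n (f (p - 1) y)" N "q - 1" q] c by simp
qed

text \<open>If \<open>f = d h\<close>, the term of \<open>f x\<close> in which \<open>h\<close> is
  applied to \<open>d x\<close> vanishes for a cocycle \<open>x\<close>, and
  \<open>f x = d (h x)\<close> remains.\<close>

lemma kihom_coboundary_apply:
  assumes f: "f \<in> coboundaries (kihom k M N) n" and x: "x \<in> cocycles M p" and q: "q = p + n"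
  shows "f p x \<in> coboundaries N q"
proof -
  obtain h where h: "h \<in> carrier (gihom k (Und M) (Und N) (n - 1))" "f = Diff (kihom k M N) (n - 1) h"
    using coboundariesE[OF f refl] by auto
  have e: "p + (n - 1) = q - 1" "p + 1 + (n - 1) = q" using q by simp_all
  have l: "h (p + 1) \<in> linmaps k (Und M (p + 1)) (Und N q)" using gihomD[OF h(1), of "p + 1"] by (simp only: e)
  have hx: "h p x \<in> carrier (Und N (q - 1))" using x q by (auto intro!: gihom_closed[OF h(1)])
  have "f p x = Diff N (q - 1) (h p x)"
    unfolding h(2) using x hx lin_zero[OF l]
    by (simp add: kihom_Diff_apply[OF obj h(1)] e cocycles_Diff[OF x refl])
  then show ?thesis using coboundariesI[OF hx, of q] by simp
qed

lemma theta_apply: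
  assumes f: "f \<in> cocycles (kihom k M N) n" and x: "x \<in> cocycles M p" and q: "q = p + n"
  shows "theta k M N n (coclass (kihom k M N) n f) p (coclass M p x) = coclass N q (f p x)"
proof -
  \<comment> \<open>The representative of the class of \<open>f\<close> is changed at the fixed
    cocycle \<open>x\<close>, and that of \<open>x\<close> under the fixed map \<open>f'\<close>;
    the two preceding lemmas treat one change each.\<close>
  have *: "coclass N q (f' p x') = coclass N q (f p x)"
    if f': "f' \<in> cocycles (kihom k M N) n" "coclass (kihom k M N) n f' = coclass (kihom k M N) n f"
      and x': "x' \<in> cocycles M p" "coclass M p x' = coclass M p x" for f' x'
  proof -
    have c: "f \<in> carrier (gihom k (Und M) (Und N) n)" "f' \<in> carrier (gihom k (Und M) (Und N) n)"
      using f f'(1) cocycles_closed[of _ "kihom k M N" n] by auto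
    note z = kihom_cocycle_cocycle[OF f x q] kihom_cocycle_cocycle[OF f'(1) x'(1) q]
      kihom_cocycle_cocycle[OF f'(1) x q]
    have "f' \<ominus>\<^bsub>gihom k (Und M) (Und N) n\<^esub> f \<in> coboundaries (kihom k M N) n"
      using coclass_eq_iff[of "kihom k M N", OF _ f'(1) f] f'(2) by simp
    then have "(f' \<ominus>\<^bsub>gihom k (Und M) (Und N) n\<^esub> f) p x \<in> coboundaries N q"
      by (rule kihom_coboundary_apply[OF _ x q])
    then have "coclass N q (f' p x) = coclass N q (f p x)"
      using z c x q by (subst coclass_eq_iff) simp_all
    moreover have "x' \<ominus>\<^bsub>Und M p\<^esub> x \<in> coboundaries M p" using coclass_eq_iff[of M x' p x] x x' by simp
    then have "f' p (x' \<ominus>\<^bsub>Und M p\<^esub> x) \<in> coboundaries N q" by (rule kihom_cocycle_coboundary[OF f'(1) _ q])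
    then have "coclass N q (f' p x') = coclass N q (f' p x)"
      using z x x' q by (subst coclass_eq_iff) (simp_all add: lin_minus[OF gihomD[OF c(2)]])
    ultimately show ?thesis by simp
  qed
  have "theta k M N n (coclass (kihom k M N) n f) p (coclass M p x) =
      (\<Union>f'\<in>coclass (kihom k M N) n f. \<Union>x'\<in>coclass M p x. coclass N q (f' p x'))"
    using f x q by (simp add: theta_def)
  also have "\<dots> = (\<Union>f'\<in>coclass (kihom k M N) n f. coclass N q (f p x))"
  proof (rule SUP_cong[OF refl])
    fix f' assume "f' \<in> coclass (kihom k M N) n f"
    then have "f' \<in> cocycles (kihom k M N) n" "coclass (kihom k M N) n f' = coclass (kihom k M N) n f"
      using coclass_mem[of "kihom k M N", OF _ f] by simp_all
    note * [OF this]
    then show "(\<Union>x'\<in>coclass M p x. coclass N q (f' p x')) = coclass N q (f p x)"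
      using UN_coclass[of M x p "\<lambda>x'. coclass N q (f' p x')"] x by simp
  qed
  also have "\<dots> = coclass N q (f p x)" using coclass_self[of "kihom k M N", OF _ f] by auto
  finally show ?thesis .
qed

lemma theta_closed:
  assumes "\<phi> \<in> carrier (cohomology (kihom k M N) n)"
  shows "theta k M N n \<phi> \<in> carrier (gihom k (cohomology M) (cohomology N) n)"
proof -
  obtain f where f: "f \<in> cocycles (kihom k M N) n" "\<phi> = coclass (kihom k M N) n f"
    using cohomologyE[OF assms] .
  have f': "f \<in> carrier (gihom k (Und M) (Und N) n)" using cocycles_closed[OF f(1)] by simp
  note cz = kihom_cocycle_cocycle[OF f(1) _ refl]
  show ?thesis unfolding gihom_carrier f(2)
  proof
    fix p
    note t = theta_apply[OF f(1) _ refl, of _ p]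
    show "theta k M N n (coclass (kihom k M N) n f) p \<in> linmaps k (cohomology M p) (cohomology N (p + n))"
    proof (rule linmapsI)
      fix c assume "c \<in> carrier (cohomology M p)"
      then obtain x where x: "x \<in> cocycles M p" "c = coclass M p x" by (rule cohomologyE)
      then show "theta k M N n (coclass (kihom k M N) n f) p c \<in> carrier (cohomology N (p + n))"
        by (simp add: t cz)
      fix c' assume "c' \<in> carrier (cohomology M p)"
      then obtain x' where x': "x' \<in> cocycles M p" "c' = coclass M p x'" by (rule cohomologyE)
      show "theta k M N n (coclass (kihom k M N) n f) p (c \<oplus>\<^bsub>cohomology M p\<^esub> c') =
         theta k M N n (coclass (kihom k M N) n f) p c \<oplus>\<^bsub>cohomology N (p + n)\<^esub> theta k M N n (coclass (kihom k M N) n f) p c'"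
        using x x' by (simp add: t cz lin_add[OF gihomD[OF f']] flip: coclass_add)
    next
      fix a c assume a: "a \<in> carrier k" and "c \<in> carrier (cohomology M p)"
      then obtain x where x: "x \<in> cocycles M p" "c = coclass M p x" by (elim cohomologyE)
      show "theta k M N n (coclass (kihom k M N) n f) p (a \<odot>\<^bsub>cohomology M p\<^esub> c) =
         a \<odot>\<^bsub>cohomology N (p + n)\<^esub> theta k M N n (coclass (kihom k M N) n f) p c"
        using x a by (simp add: t cz lin_smult[OF gihomD[OF f']] flip: coclass_smult)
    qed (use f in \<open>simp add: theta_def\<close>)
  qed
qed

lemma theta_gmaps: "theta k M N \<in> gmaps k (cohomology (kihom k M N)) (gihom k (cohomology M) (cohomology N))"
proof (rule gmapsI)
  fix n
  show "theta k M N n \<in> linmaps k (cohomology (kihom k M N) n) (gihom k (cohomology M) (cohomology N) n)"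
  proof (rule linmapsI)
    fix \<phi> \<psi> assume "\<phi> \<in> carrier (cohomology (kihom k M N) n)" "\<psi> \<in> carrier (cohomology (kihom k M N) n)"
    then obtain f g where f: "f \<in> cocycles (kihom k M N) n" "\<phi> = coclass (kihom k M N) n f"
      and g: "g \<in> cocycles (kihom k M N) n" "\<psi> = coclass (kihom k M N) n g" by (elim cohomologyE)
    have fg: "f \<oplus>\<^bsub>gihom k (Und M) (Und N) n\<^esub> g \<in> cocycles (kihom k M N) n" using f g coc_add[of "kihom k M N" f n g] by simp
    have eq: "\<phi> \<oplus>\<^bsub>cohomology (kihom k M N) n\<^esub> \<psi> = coclass (kihom k M N) n (f \<oplus>\<^bsub>gihom k (Und M) (Und N) n\<^esub> g)"
      using f g coclass_add[of "kihom k M N" f n g] by simp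
    show "theta k M N n (\<phi> \<oplus>\<^bsub>cohomology (kihom k M N) n\<^esub> \<psi>) =
        theta k M N n \<phi> \<oplus>\<^bsub>gihom k (cohomology M) (cohomology N) n\<^esub> theta k M N n \<psi>"
    proof (rule gihom_eqI[of _ "cohomology M" "cohomology N" n])
      fix p c assume "c \<in> carrier (cohomology M p)"
      then obtain x where x: "x \<in> cocycles M p" "c = coclass M p x" by (rule cohomologyE)
      then show "theta k M N n (\<phi> \<oplus>\<^bsub>cohomology (kihom k M N) n\<^esub> \<psi>) p c =
          (theta k M N n \<phi> \<oplus>\<^bsub>gihom k (cohomology M) (cohomology N) n\<^esub> theta k M N n \<psi>) p c"
        using f g x theta_apply[OF fg x(1) refl] kihom_cocycle_cocycle[OF f(1) x(1) refl] kihom_cocycle_cocycle[OF g(1) x(1) refl]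
        unfolding eq by (simp add: theta_apply[OF _ _ refl] coclass_add)
    qed (use f g fg eq theta_closed in simp_all)
  next
    fix a \<phi> assume a: "a \<in> carrier k" and "\<phi> \<in> carrier (cohomology (kihom k M N) n)"
    then obtain f where f: "f \<in> cocycles (kihom k M N) n" "\<phi> = coclass (kihom k M N) n f" by (elim cohomologyE)
    have af: "a \<odot>\<^bsub>gihom k (Und M) (Und N) n\<^esub> f \<in> cocycles (kihom k M N) n" using a f coc_smult[of "kihom k M N" a f n] by simp
    have eq: "a \<odot>\<^bsub>cohomology (kihom k M N) n\<^esub> \<phi> = coclass (kihom k M N) n (a \<odot>\<^bsub>gihom k (Und M) (Und N) n\<^esub> f)"
      using a f coclass_smult[of "kihom k M N" a f n] by simp
    show "theta k M N n (a \<odot>\<^bsub>cohomology (kihom k M N) n\<^esub> \<phi>) = a \<odot>\<^bsub>gihom k (cohomology M) (cohomology N) n\<^esub> theta k M N n \<phi>"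
    proof (rule gihom_eqI[of _ "cohomology M" "cohomology N" n])
      fix p c assume "c \<in> carrier (cohomology M p)"
      then obtain x where x: "x \<in> cocycles M p" "c = coclass M p x" by (rule cohomologyE)
      then show "theta k M N n (a \<odot>\<^bsub>cohomology (kihom k M N) n\<^esub> \<phi>) p c = (a \<odot>\<^bsub>gihom k (cohomology M) (cohomology N) n\<^esub> theta k M N n \<phi>) p c"
        using a f x theta_apply[OF af x(1) refl] kihom_cocycle_cocycle[OF f(1) x(1) refl]
        unfolding eq by (simp add: theta_apply[OF _ _ refl] coclass_smult)
    qed (use a f af eq theta_closed in simp_all)
  qed (simp_all add: theta_closed, simp add: theta_def)
qed

text \<open>In degree \<open>0\<close> the sign in the cocycle condition is \<open>1\<close>. With
  the next lemma this identifies the arrows of the homotopy category with the cohomology of the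
  inner hom complex in degree \<open>0\<close>.\<close>

lemma chain_maps_cocycles: "f \<in> chain_maps k M N \<longleftrightarrow> f \<in> cocycles (kihom k M N) 0"
proof
  assume f: "f \<in> chain_maps k M N"
  show "f \<in> cocycles (kihom k M N) 0"
    by (rule cocycles_kihomI)
      (simp_all add: gihom_carrier gmapsD[OF chain_maps_gmaps[OF f]] chain_maps_Diff[OF f _ refl] signed_def)
next
  assume f: "f \<in> cocycles (kihom k M N) 0"
  then have "f \<in> carrier (gihom k (Und M) (Und N) 0)" using cocycles_closed[OF f] by simp
  then have "f \<in> gmaps k (Und M) (Und N)" using gihomD[of f "Und M" "Und N" 0] by (auto intro: gmapsI)
  then show "f \<in> chain_maps k M N"
    using cocycles_kihom_Diff[OF f _ refl refl refl] by (auto intro!: chain_mapsI simp: signed_def)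
qed

text \<open>A homotopy is an element \<open>h\<close> of degree \<open>-1\<close> of the inner hom
  complex with \<open>f - g = d h\<close>: in this degree the differential is
  \<open>d h + h d\<close>, because \<open>- (-1)^(-1) = 1\<close>.\<close>

lemma homotopy_coclass:
  "(f, g) \<in> homotopy k M N \<longleftrightarrow> f \<in> chain_maps k M N \<and> g \<in> chain_maps k M N \<and>
     coclass (kihom k M N) 0 f = coclass (kihom k M N) 0 g"
proof -
  have "coclass (kihom k M N) 0 f = coclass (kihom k M N) 0 g \<longleftrightarrow>
      (\<exists>h. (\<forall>n. h n \<in> linmaps k (Und M n) (Und N (n - 1))) \<and>
          (\<forall>n. \<forall>x\<in>carrier (Und M n).
             f n x \<ominus>\<^bsub>Und N n\<^esub> g n x =
             Diff N (n - 1) (h n x) \<oplus>\<^bsub>Und N n\<^esub> h (n + 1) (Diff M n x)))" (is "?L \<longleftrightarrow> (\<exists>h. ?R h)")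
    if fg: "f \<in> chain_maps k M N" "g \<in> chain_maps k M N"
  proof -
    have z: "f \<in> cocycles (kihom k M N) 0" "g \<in> cocycles (kihom k M N) 0" using fg chain_maps_cocycles by auto
    then have c: "f \<in> carrier (gihom k (Und M) (Und N) 0)" "g \<in> carrier (gihom k (Und M) (Und N) 0)"
      using cocycles_closed[OF z(1)] cocycles_closed[OF z(2)] by simp_all
    have H: "h \<in> carrier (gihom k (Und M) (Und N) (-1)) \<longleftrightarrow> (\<forall>n. h n \<in> linmaps k (Und M n) (Und N (n - 1)))" for h
      by (simp add: gihom_carrier)
    have D: "f \<ominus>\<^bsub>gihom k (Und M) (Und N) 0\<^esub> g = Diff (kihom k M N) (-1) h \<longleftrightarrow>
       (\<forall>n. \<forall>x\<in>carrier (Und M n). f n x \<ominus>\<^bsub>Und N n\<^esub> g n x =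
             Diff N (n - 1) (h n x) \<oplus>\<^bsub>Und N n\<^esub> h (n + 1) (Diff M n x))"
      if h: "h \<in> carrier (gihom k (Und M) (Und N) (-1))" for h
    proof -
      have Dh: "Diff (kihom k M N) (-1) h p x = Diff N (p - 1) (h p x) \<oplus>\<^bsub>Und N p\<^esub> h (p + 1) (Diff M p x)"
        if x: "x \<in> carrier (Und M p)" for p x
      proof -
        have "h (p + 1) (Diff M p x) \<in> carrier (Und N p)" using x by (auto intro!: gihom_closed[OF h])
        then show ?thesis using x h by (simp add: kihom_Diff_apply signed_def m_minus_def)
      qed
      have fgx: "(f \<ominus>\<^bsub>gihom k (Und M) (Und N) 0\<^esub> g) p x = f p x \<ominus>\<^bsub>Und N p\<^esub> g p x"
        if x: "x \<in> carrier (Und M p)" for p x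
        using c x by simp
      show ?thesis
      proof (intro iffI allI ballI)
        fix n x assume eq: "f \<ominus>\<^bsub>gihom k (Und M) (Und N) 0\<^esub> g = Diff (kihom k M N) (-1) h" and x: "x \<in> carrier (Und M n)"
        show "f n x \<ominus>\<^bsub>Und N n\<^esub> g n x = Diff N (n - 1) (h n x) \<oplus>\<^bsub>Und N n\<^esub> h (n + 1) (Diff M n x)"
          unfolding Dh[OF x, symmetric] fgx[OF x, symmetric] eq ..
      next
        assume eq: "\<forall>n. \<forall>x\<in>carrier (Und M n). f n x \<ominus>\<^bsub>Und N n\<^esub> g n x =
             Diff N (n - 1) (h n x) \<oplus>\<^bsub>Und N n\<^esub> h (n + 1) (Diff M n x)"
        show "f \<ominus>\<^bsub>gihom k (Und M) (Und N) 0\<^esub> g = Diff (kihom k M N) (-1) h"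
        proof (rule gihom_eqI[of _ "Und M" "Und N" 0])
          show "Diff (kihom k M N) (-1) h \<in> carrier (gihom k (Und M) (Und N) 0)"
            using kihom_Diff_closed[OF obj h] by simp
          show "f \<ominus>\<^bsub>gihom k (Und M) (Und N) 0\<^esub> g \<in> carrier (gihom k (Und M) (Und N) 0)" using c by simp
          fix p x assume x: "x \<in> carrier (Und M p)"
          show "(f \<ominus>\<^bsub>gihom k (Und M) (Und N) 0\<^esub> g) p x = Diff (kihom k M N) (-1) h p x"
            unfolding Dh[OF x] fgx[OF x] using eq x by blast
        qed
      qed
    qed
    have "?L \<longleftrightarrow> f \<ominus>\<^bsub>gihom k (Und M) (Und N) 0\<^esub> g \<in> coboundaries (kihom k M N) 0"
      using coclass_eq_iff[of "kihom k M N", OF _ z] by simp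
    also have "\<dots> \<longleftrightarrow> (\<exists>h. h \<in> carrier (gihom k (Und M) (Und N) (-1)) \<and> f \<ominus>\<^bsub>gihom k (Und M) (Und N) 0\<^esub> g = Diff (kihom k M N) (-1) h)"
      by (auto simp: coboundaries_def)
    also have "\<dots> \<longleftrightarrow> (\<exists>h. ?R h)" unfolding H[symmetric] using D by (intro ex_cong1 conj_cong refl)
    finally show ?thesis .
  qed
  then show ?thesis unfolding homotopy_def by blast
qed

end

section \<open>The Kuenneth map\<close>

lemma ptens_cocycle:
  assumes "K_obj k M" "K_obj k N" "x \<in> cocycles M i" "y \<in> cocycles N j" "i + j = n"
  shows "ptens k (Und M) (Und N) i x j y \<in> cocycles (ktens k M N) n"
proof (rule cocyclesI[OF _ refl])
  note [simp] = assms(1,2)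
  have e: "i + 1 + j = n + 1" "i + (j + 1) = n + 1" using assms by simp_all
  show "Diff (ktens k M N) n (ptens k (Und M) (Und N) i x j y) = \<zero>\<^bsub>Und (ktens k M N) (n + 1)\<^esub>"
    using assms(3,4)
    by (simp add: ktens_Diff_ptens[OF assms(1,2,5) refl refl refl] cocycles_Diff[OF _ refl]
        ptens_zero_left[OF _ _ e(1)] ptens_zero_right[OF _ _ e(2)])
qed (use assms in simp)

context
  fixes M :: "('k, 'a) cochain" and N :: "('k, 'b) cochain"
  assumes obj [simp]: "K_obj k M" "K_obj k N"
begin

text \<open>If \<open>x - x' = d w\<close>, then
  \<open>(x - x') \<otimes> y = d (w \<otimes> y)\<close> since \<open>y\<close> is a cocycle. If
  \<open>y - y' = d v\<close>, then \<open>x' \<otimes> (y - y')\<close> is the differential of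
  \<open>(-1)^i (x' \<otimes> v)\<close> since \<open>x'\<close> is one.\<close>

lemma ptens_coclass_cong:
  assumes n: "i + j = n" and x: "x \<in> cocycles M i" "x' \<in> cocycles M i" "coclass M i x = coclass M i x'"
    and y: "y \<in> cocycles N j" "y' \<in> cocycles N j" "coclass N j y = coclass N j y'"
  shows "coclass (ktens k M N) n (ptens k (Und M) (Und N) i x j y) = coclass (ktens k M N) n (ptens k (Und M) (Und N) i x' j y')"
proof -
  note z = ptens_cocycle[OF obj _ _ n]
  have "x \<ominus>\<^bsub>Und M i\<^esub> x' \<in> coboundaries M i" using x coclass_eq_iff[of M x i x'] by simp
  then obtain w where w: "w \<in> carrier (Und M (i - 1))" "x \<ominus>\<^bsub>Und M i\<^esub> x' = Diff M (i - 1) w" by (elim coboundariesE[OF _ refl])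
  have "y \<ominus>\<^bsub>Und N j\<^esub> y' \<in> coboundaries N j" using y coclass_eq_iff[of N y j y'] by simp
  then obtain v where v: "v \<in> carrier (Und N (j - 1))" "y \<ominus>\<^bsub>Und N j\<^esub> y' = Diff N (j - 1) v" by (elim coboundariesE[OF _ refl])
  have e: "i - 1 + j = n - 1" "i + (j - 1) = n - 1" "i - 1 + (j + 1) = n" "i + 1 + (j - 1) = n" using n by simp_all
  have "coclass (ktens k M N) n (ptens k (Und M) (Und N) i x j y) = coclass (ktens k M N) n (ptens k (Und M) (Und N) i x' j y)"
  proof (rule coclass_eqI[of "ktens k M N" _ n _ "ptens k (Und M) (Und N) (i - 1) w j y" "n - 1"])
    have "ptens k (Und M) (Und N) i x j y \<ominus>\<^bsub>gtens k (Und M) (Und N) n\<^esub> ptens k (Und M) (Und N) i x' j y =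
       ptens k (Und M) (Und N) i (x \<ominus>\<^bsub>Und M i\<^esub> x') j y"
      using x y by (simp add: m_minus_def ptens_add_left[OF _ _ n] ptens_neg_left[OF _ _ n])
    also have "\<dots> = Diff (ktens k M N) (n - 1) (ptens k (Und M) (Und N) (i - 1) w j y)"
      using w y by (simp add: ktens_Diff_ptens[OF obj e(1), of n i "j + 1"] cocycles_Diff[OF y(1) refl] ptens_zero_right[OF _ _ e(3)] n)
    finally show "ptens k (Und M) (Und N) i x j y \<ominus>\<^bsub>Und (ktens k M N) n\<^esub> ptens k (Und M) (Und N) i x' j y =
       Diff (ktens k M N) (n - 1) (ptens k (Und M) (Und N) (i - 1) w j y)" by simp
  qed (use w x y z e in simp_all)
  also have "\<dots> = coclass (ktens k M N) n (ptens k (Und M) (Und N) i x' j y')"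
  proof (rule coclass_eqI[of "ktens k M N" _ n _ "signed (gtens k (Und M) (Und N) (n - 1)) i (ptens k (Und M) (Und N) i x' (j - 1) v)" "n - 1"])
    have c: "ptens k (Und M) (Und N) i x' (j - 1) v \<in> carrier (Und (ktens k M N) (n - 1))" using x v e by simp
    have "ptens k (Und M) (Und N) i x' j y \<ominus>\<^bsub>gtens k (Und M) (Und N) n\<^esub> ptens k (Und M) (Und N) i x' j y' =
       ptens k (Und M) (Und N) i x' j (y \<ominus>\<^bsub>Und N j\<^esub> y')"
      using x y by (simp add: m_minus_def ptens_add_right[OF _ _ n] ptens_neg_right[OF _ _ n])
    also have "\<dots> = Diff (ktens k M N) (n - 1) (signed (gtens k (Und M) (Und N) (n - 1)) i (ptens k (Und M) (Und N) i x' (j - 1) v))"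
      using v x Diff_signed[OF ktens_obj[OF obj] c, of n i]
      by (simp add: ktens_Diff_ptens[OF obj e(2), of n "i + 1" j] cocycles_Diff[OF x(2) refl] ptens_zero_left[OF _ _ e(4)] n signed_signed)
        (simp add: signed_def)
    finally show "ptens k (Und M) (Und N) i x' j y \<ominus>\<^bsub>Und (ktens k M N) n\<^esub> ptens k (Und M) (Und N) i x' j y' =
       Diff (ktens k M N) (n - 1) (signed (gtens k (Und M) (Und N) (n - 1)) i (ptens k (Und M) (Und N) i x' (j - 1) v))" by simp
  qed (use v x y z e in simp_all)
  finally show ?thesis .
qed

abbreviation (input) kunneth_fun where
  "kunneth_fun \<equiv> (\<lambda>i c j e. \<Union>x\<in>c. \<Union>y\<in>e. coclass (ktens k M N) (i + j) (ptens k (Und M) (Und N) i x j y))"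

lemma kunneth_fun_apply:
  assumes "x \<in> cocycles M i" "y \<in> cocycles N j"
  shows "kunneth_fun i (coclass M i x) j (coclass N j y) = coclass (ktens k M N) (i + j) (ptens k (Und M) (Und N) i x j y)"
proof -
  have "(\<Union>y'\<in>coclass N j y. coclass (ktens k M N) (i + j) (ptens k (Und M) (Und N) i x' j y')) =
      coclass (ktens k M N) (i + j) (ptens k (Und M) (Und N) i x j y)" if "x' \<in> coclass M i x" for x'
  proof -
    have x': "x' \<in> cocycles M i" "coclass M i x' = coclass M i x" using that assms coclass_mem[of M x i x'] by simp_all
    have "(\<Union>y'\<in>coclass N j y. coclass (ktens k M N) (i + j) (ptens k (Und M) (Und N) i x' j y')) =
       coclass (ktens k M N) (i + j) (ptens k (Und M) (Und N) i x' j y)"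
    proof (rule UN_coclass[OF obj(2) assms(2)])
      fix y' assume "y' \<in> cocycles N j" "coclass N j y' = coclass N j y"
      then show "coclass (ktens k M N) (i + j) (ptens k (Und M) (Und N) i x' j y') =
         coclass (ktens k M N) (i + j) (ptens k (Und M) (Und N) i x' j y)"
        by (intro ptens_coclass_cong[OF refl x'(1,1) refl _ assms(2)])
    qed
    also have "\<dots> = coclass (ktens k M N) (i + j) (ptens k (Und M) (Und N) i x j y)"
      using assms by (intro ptens_coclass_cong[OF refl x'(1) _ x'(2)]) simp_all
    finally show ?thesis .
  qed
  then have "kunneth_fun i (coclass M i x) j (coclass N j y) =
      (\<Union>x'\<in>coclass M i x. coclass (ktens k M N) (i + j) (ptens k (Und M) (Und N) i x j y))"
    by (intro SUP_cong refl)
  moreover have "x \<in> coclass M i x" using assms by simp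
  ultimately show ?thesis by auto
qed

lemma kunneth_bilinear: "bilinear k (cohomology M) (cohomology N) (cohomology (ktens k M N)) kunneth_fun"
proof (rule bilinearI)
  fix i c j e assume "c \<in> carrier (cohomology M i)" "e \<in> carrier (cohomology N j)"
  then obtain x y where x: "x \<in> cocycles M i" "c = coclass M i x" and y: "y \<in> cocycles N j" "e = coclass N j y"
    by (elim cohomologyE)
  note z = ptens_cocycle[OF obj _ _ refl]
  show "kunneth_fun i c j e \<in> carrier (cohomology (ktens k M N) (i + j))"
    unfolding x(2) y(2) kunneth_fun_apply[OF x(1) y(1)] using z[OF x(1) y(1)] by simp
  {
    fix c' assume "c' \<in> carrier (cohomology M i)"
    then obtain x' where x': "x' \<in> cocycles M i" "c' = coclass M i x'" by (elim cohomologyE)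
    have "c \<oplus>\<^bsub>cohomology M i\<^esub> c' = coclass M i (x \<oplus>\<^bsub>Und M i\<^esub> x')" using x x' by (simp add: coclass_add)
    then show "kunneth_fun i (c \<oplus>\<^bsub>cohomology M i\<^esub> c') j e =
        kunneth_fun i c j e \<oplus>\<^bsub>cohomology (ktens k M N) (i + j)\<^esub> kunneth_fun i c' j e"
      using x y x' kunneth_fun_apply[of "x \<oplus>\<^bsub>Und M i\<^esub> x'" i y j] coclass_add[of "ktens k M N", OF _ z z, OF _ x(1) y(1) x'(1) y(1)]
      by (simp add: kunneth_fun_apply ptens_add_left[OF _ _ refl])
  next
    fix e' assume "e' \<in> carrier (cohomology N j)"
    then obtain y' where y': "y' \<in> cocycles N j" "e' = coclass N j y'" by (elim cohomologyE)
    have "e \<oplus>\<^bsub>cohomology N j\<^esub> e' = coclass N j (y \<oplus>\<^bsub>Und N j\<^esub> y')" using y y' by (simp add: coclass_add)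
    then show "kunneth_fun i c j (e \<oplus>\<^bsub>cohomology N j\<^esub> e') =
        kunneth_fun i c j e \<oplus>\<^bsub>cohomology (ktens k M N) (i + j)\<^esub> kunneth_fun i c j e'"
      using x y y' kunneth_fun_apply[of x i "y \<oplus>\<^bsub>Und N j\<^esub> y'" j] coclass_add[of "ktens k M N", OF _ z z, OF _ x(1) y(1) x(1) y'(1)]
      by (simp add: kunneth_fun_apply ptens_add_right[OF _ _ refl])
  next
    fix a assume a: "a \<in> carrier k"
    have "a \<odot>\<^bsub>cohomology M i\<^esub> c = coclass M i (a \<odot>\<^bsub>Und M i\<^esub> x)" using x a by (simp add: coclass_smult)
    then show "kunneth_fun i (a \<odot>\<^bsub>cohomology M i\<^esub> c) j e = a \<odot>\<^bsub>cohomology (ktens k M N) (i + j)\<^esub> kunneth_fun i c j e"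
      using a x y kunneth_fun_apply[of "a \<odot>\<^bsub>Und M i\<^esub> x" i y j] coclass_smult[of "ktens k M N", OF _ a z, OF _ x(1) y(1)]
      by (simp add: kunneth_fun_apply ptens_smult_left[OF _ _ refl])
    have "a \<odot>\<^bsub>cohomology N j\<^esub> e = coclass N j (a \<odot>\<^bsub>Und N j\<^esub> y)" using y a by (simp add: coclass_smult)
    then show "kunneth_fun i c j (a \<odot>\<^bsub>cohomology N j\<^esub> e) = a \<odot>\<^bsub>cohomology (ktens k M N) (i + j)\<^esub> kunneth_fun i c j e"
      using a x y kunneth_fun_apply[of x i "a \<odot>\<^bsub>Und N j\<^esub> y" j] coclass_smult[of "ktens k M N", OF _ a z, OF _ x(1) y(1)]
      by (simp add: kunneth_fun_apply ptens_smult_right[OF _ _ refl])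
  }
qed

lemma kunneth_gmaps: "Map (kunneth k M N) \<in> gmaps k (gtens k (cohomology M) (cohomology N)) (cohomology (ktens k M N))"
  unfolding kunneth_def using tens_lift_gmaps[OF _ _ _ kunneth_bilinear] by simp

lemma kunneth_ptens:
  assumes "x \<in> cocycles M i" "y \<in> cocycles N j" "i + j = n"
  shows "Map (kunneth k M N) n (ptens k (cohomology M) (cohomology N) i (coclass M i x) j (coclass N j y)) =
    coclass (ktens k M N) n (ptens k (Und M) (Und N) i x j y)"
  unfolding kunneth_def using assms kunneth_fun_apply[OF assms(1,2)]
  by (simp add: tens_lift_ptens[OF _ _ _ kunneth_bilinear])

end

end

section \<open>Complexes over a field\<close>

lemma (in ground_field) contraction_exists:
  assumes M: "K_obj k M"
  obtains h where "contraction k M h"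
proof -
  have "\<exists>s. s \<in> linmaps k (Und M (n + 1)) (Und M n) \<and> (\<forall>x\<in>carrier (Und M n). Diff M n (s (Diff M n x)) = Diff M n x)" for n
  proof -
    obtain s where "s \<in> linmaps k (Und M (n + 1)) (Und M n)" "\<And>x. x \<in> carrier (Und M n) \<Longrightarrow> Diff M n (s (Diff M n x)) = Diff M n x"
      using generalized_inverse[OF _ _ K_obj_Diff[OF M, of n]] M by auto
    then show ?thesis by auto
  qed
  then have "\<exists>s. \<forall>n. s n \<in> linmaps k (Und M (n + 1)) (Und M n) \<and> (\<forall>x\<in>carrier (Und M n). Diff M n (s n (Diff M n x)) = Diff M n x)"
    by (intro choice allI)
  then obtain s where s: "\<And>n. s n \<in> linmaps k (Und M (n + 1)) (Und M n)"
    "\<And>n x. x \<in> carrier (Und M n) \<Longrightarrow> Diff M n (s n (Diff M n x)) = Diff M n x" by auto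
  \<comment> \<open>\<open>s n\<close> starts in degree \<open>n + 1\<close>, whereas a contraction
    is indexed by the degree in which it starts.\<close>
  have "contraction k M (\<lambda>n. s (n - 1))"
    unfolding contraction_def using s(1)[of "_ - 1"] s(2) by simp
  then show ?thesis by (rule that)
qed

context ground_ring
begin

lemma m_cancel_left:
  assumes "module k M" "a \<in> carrier M" "b \<in> carrier M" "c \<in> carrier M"
  shows "((a \<oplus>\<^bsub>M\<^esub> b) \<oplus>\<^bsub>M\<^esub> c) \<ominus>\<^bsub>M\<^esub> a = b \<oplus>\<^bsub>M\<^esub> c"
proof -
  have "((a \<oplus>\<^bsub>M\<^esub> b) \<oplus>\<^bsub>M\<^esub> c) \<ominus>\<^bsub>M\<^esub> a = (b \<oplus>\<^bsub>M\<^esub> c) \<oplus>\<^bsub>M\<^esub> (a \<oplus>\<^bsub>M\<^esub> \<ominus>\<^bsub>M\<^esub> a)"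
    using assms by (simp add: m_minus_def m_ac del: m_r_neg m_l_neg m_r_neg2)
  then show ?thesis using assms by simp
qed

text \<open>The rearrangement that closes the case of pure tensors in
  \<open>harm_tens_homotopy\<close>; \<open>s\<close> is the mixed term, present with both
  signs.\<close>

lemma m_cancel_inner:
  assumes "module k M" "b \<in> carrier M" "c \<in> carrier M" "d \<in> carrier M" "e \<in> carrier M" "s \<in> carrier M"
  shows "((d \<oplus>\<^bsub>M\<^esub> \<ominus>\<^bsub>M\<^esub> s) \<oplus>\<^bsub>M\<^esub> b) \<oplus>\<^bsub>M\<^esub> (e \<oplus>\<^bsub>M\<^esub> (s \<oplus>\<^bsub>M\<^esub> c)) = (b \<oplus>\<^bsub>M\<^esub> c) \<oplus>\<^bsub>M\<^esub> (d \<oplus>\<^bsub>M\<^esub> e)"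
proof -
  have "((d \<oplus>\<^bsub>M\<^esub> \<ominus>\<^bsub>M\<^esub> s) \<oplus>\<^bsub>M\<^esub> b) \<oplus>\<^bsub>M\<^esub> (e \<oplus>\<^bsub>M\<^esub> (s \<oplus>\<^bsub>M\<^esub> c)) = ((b \<oplus>\<^bsub>M\<^esub> c) \<oplus>\<^bsub>M\<^esub> (d \<oplus>\<^bsub>M\<^esub> e)) \<oplus>\<^bsub>M\<^esub> (s \<oplus>\<^bsub>M\<^esub> \<ominus>\<^bsub>M\<^esub> s)"
    using assms by (simp add: m_ac del: m_r_neg m_l_neg m_r_neg2)
  then show ?thesis using assms by simp
qed

section \<open>The projection that belongs to a contraction\<close>

context
  fixes M :: "('k, 'a) cochain" and h
  assumes obj [simp]: "K_obj k M" and contr: "contraction k M h"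
begin

lemma contraction_linear: "m = n - 1 \<Longrightarrow> h n \<in> linmaps k (Und M n) (Und M m)"
  using contr by (simp add: contraction_def)

lemma contraction_closed: "x \<in> carrier (Und M n) \<Longrightarrow> m = n - 1 \<Longrightarrow> h n x \<in> carrier (Und M m)"
  by (rule lin_closed[OF contraction_linear])

lemma contraction_Diff: "x \<in> carrier (Und M n) \<Longrightarrow> m = n + 1 \<Longrightarrow> Diff M n (h m (Diff M n x)) = Diff M n x"
  using contr by (simp add: contraction_def)

text \<open>The form in which \<open>d h d = d\<close> is mostly used: \<open>h\<close> selects a
  preimage for every boundary.\<close>

lemma contraction_coboundary:
  assumes "b \<in> coboundaries M n" "m = n - 1"
  shows "Diff M m (h n b) = b"
proof -
  obtain y where "y \<in> carrier (Und M m)" "b = Diff M m y" using coboundariesE[OF assms] .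
  moreover have "Diff M m (h n (Diff M m y)) = Diff M m y"
    using \<open>y \<in> carrier (Und M m)\<close> assms(2) by (intro contraction_Diff) simp_all
  ultimately show ?thesis by simp
qed

lemma harm_linear: "harm M h n \<in> linmaps k (Und M n) (Und M n)"
proof -
  have c: "Diff M (n - 1) (h n x) \<in> carrier (Und M n)" "h (n + 1) (Diff M n x) \<in> carrier (Und M n)"
    if "x \<in> carrier (Und M n)" for x
    using that by (auto intro!: Diff_closed contraction_closed)
  note l = contraction_linear[OF refl, of n] contraction_linear[of n "n + 1", simplified]
  note dl = Diff_add[OF obj, of _ "n - 1" _ n] Diff_smult[OF obj, of _ _ "n - 1" n] contraction_closed[OF _ refl, of _ n]
  show ?thesis unfolding harm_def
    by (rule linmaps_restrictI)
      (simp_all add: c dl lin_add[OF l(1)] lin_add[OF l(2)] lin_smult[OF l(1)] lin_smult[OF l(2)]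
       Diff_add[OF obj _ _ refl] Diff_smult[OF obj _ _ refl] smult_minus smult_add smult_neg m_group)
qed

lemma harm_gmaps: "harm M h \<in> gmaps k (Und M) (Und M)"
  by (rule gmapsI) (rule harm_linear)

lemma harm_decomp:
  assumes x: "x \<in> carrier (Und M n)" and m: "m = n - 1" "n' = n + 1"
  shows "x = harm M h n x \<oplus>\<^bsub>Und M n\<^esub> (Diff M m (h n x) \<oplus>\<^bsub>Und M n\<^esub> h n' (Diff M n x))"
proof -
  have "Diff M (n - 1) (h n x) \<in> carrier (Und M n)" "h (n + 1) (Diff M n x) \<in> carrier (Und M n)"
    using x by (auto intro!: Diff_closed contraction_closed)
  then show ?thesis using x m by (simp add: harm_def m_minus_def m_add_assoc)
qed

text \<open>\<open>d\<close> of \<open>x - d h x - h d x\<close> is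
  \<open>dx - 0 - d h d x\<close>.\<close>

lemma harm_cocycle:
  assumes x: "x \<in> carrier (Und M n)"
  shows "harm M h n x \<in> cocycles M n"
proof (rule cocyclesI[OF _ refl])
  show "harm M h n x \<in> carrier (Und M n)" using lin_closed[OF harm_linear x] .
  have c: "Diff M (n - 1) (h n x) \<in> carrier (Und M n)" "h (n + 1) (Diff M n x) \<in> carrier (Und M n)" "h n x \<in> carrier (Und M (n - 1))"
    using x by (auto intro!: Diff_closed contraction_closed)
  have "Diff M n (Diff M (n - 1) (h n x)) = \<zero>\<^bsub>Und M (n + 1)\<^esub>" using c by (intro Diff_Diff) simp_all
  then show "Diff M n (harm M h n x) = \<zero>\<^bsub>Und M (n + 1)\<^esub>"
    using x c by (simp add: harm_def Diff_minus[OF _ _ _ refl] Diff_add[OF _ _ _ refl] contraction_Diff)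
qed

text \<open>\<open>d y - d h d y\<close> vanishes by the contraction, and \<open>h d d y\<close>
  because \<open>d d = 0\<close>.\<close>

lemma harm_Diff:
  assumes x: "x \<in> carrier (Und M n)" and m: "m = n + 1"
  shows "harm M h m (Diff M n x) = \<zero>\<^bsub>Und M m\<^esub>"
proof -
  have "Diff M m (Diff M n x) = \<zero>\<^bsub>Und M (m + 1)\<^esub>" using x m by (intro Diff_Diff) simp_all
  moreover have "h (m + 1) \<zero>\<^bsub>Und M (m + 1)\<^esub> = \<zero>\<^bsub>Und M m\<^esub>" by (rule lin_zero[OF contraction_linear]) simp_all
  ultimately show ?thesis using x m by (simp add: harm_def contraction_Diff)
qed

lemma harm_coclass:
  assumes x: "x \<in> cocycles M n"
  shows "coclass M n (harm M h n x) = coclass M n x"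
proof -
  have "h (n + 1) \<zero>\<^bsub>Und M (n + 1)\<^esub> = \<zero>\<^bsub>Und M n\<^esub>" by (rule lin_zero[OF contraction_linear]) simp_all
  moreover have c: "h n x \<in> carrier (Und M (n - 1))" "Diff M (n - 1) (h n x) \<in> carrier (Und M n)"
    using x by (auto intro!: Diff_closed contraction_closed)
  ultimately have "x \<ominus>\<^bsub>Und M n\<^esub> harm M h n x = Diff M (n - 1) (h n x)"
    using x by (simp add: harm_def cocycles_Diff[OF x refl] m_group)
  then have "coclass M n x = coclass M n (harm M h n x)"
    using x c harm_cocycle by (intro coclass_eqI[OF obj, of _ n _ "h n x" "n - 1"]) simp_all
  then show ?thesis ..
qed

text \<open>Hence \<open>harm\<close>, applied to any cocycle of a class, yields one and the same
  representative of it, and this representative depends linearly on the class.\<close>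

lemma harm_coclass_cong:
  assumes "x \<in> cocycles M n" "y \<in> cocycles M n" "coclass M n x = coclass M n y"
  shows "harm M h n x = harm M h n y"
proof -
  have "x \<ominus>\<^bsub>Und M n\<^esub> y \<in> coboundaries M n" using assms by (simp add: coclass_eq_iff)
  then obtain w where w: "w \<in> carrier (Und M (n - 1))" "x \<ominus>\<^bsub>Und M n\<^esub> y = Diff M (n - 1) w" by (elim coboundariesE[OF _ refl])
  have "harm M h n (x \<ominus>\<^bsub>Und M n\<^esub> y) = \<zero>\<^bsub>Und M n\<^esub>" unfolding w(2) using w by (simp add: harm_Diff)
  then show ?thesis using assms lin_closed[OF harm_linear, of _ n] by (simp add: lin_minus[OF harm_linear] m_minus_eq_zero)
qed

end

end

section \<open>Bijectivity of the comparison for inner homs\<close>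

context ground_field
begin

text \<open>Injectivity of \<open>theta\<close>. Split \<open>x = u + v + w\<close> with
  \<open>u = harm x\<close>, \<open>v = d h x\<close> and \<open>w = h d x\<close>. The map
  \<open>t = h' f harm + (-1)^n f h\<close> satisfies \<open>d (t x) = f u + f v\<close> and
  \<open>t (d x) = (-1)^n f w\<close>; as \<open>t\<close> has degree \<open>n - 1\<close>, its
  differential at \<open>x\<close> is \<open>f u + f v + f w\<close>.\<close>

lemma kihom_coboundaryI:
  assumes M [simp]: "K_obj k M" and N [simp]: "K_obj k N" and f: "f \<in> cocycles (kihom k M N) n"
    and b: "\<And>p x. x \<in> cocycles M p \<Longrightarrow> f p x \<in> coboundaries N (p + n)"
  shows "f \<in> coboundaries (kihom k M N) n"
proof -
  obtain h where h: "contraction k M h" using contraction_exists[OF M] .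
  obtain h' where h': "contraction k N h'" using contraction_exists[OF N] .
  have f': "f \<in> carrier (gihom k (Und M) (Und N) n)" using cocycles_closed[OF f] by simp
  \<comment> \<open>The first summand finds a preimage of the boundary \<open>f (harm x)\<close>.
    The sign of the second makes up for \<open>d f = (-1)^n f d\<close>.\<close>
  define t where "t = (\<lambda>p. \<lambda>x\<in>carrier (Und M p). h' (p + n) (f p (harm M h p x)) \<oplus>\<^bsub>Und N (p + n - 1)\<^esub>
      signed (Und N (p + n - 1)) n (f (p - 1) (h p x)))"
  have c: "harm M h p x \<in> carrier (Und M p)" "f p x \<in> carrier (Und N (p + n))"
    "h' (p + n) (f p (harm M h p x)) \<in> carrier (Und N (p + n - 1))"
    "h p x \<in> carrier (Und M (p - 1))" "f (p - 1) (h p x) \<in> carrier (Und N (p + n - 1))"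
    if "x \<in> carrier (Und M p)" for p x
  proof -
    show 1: "harm M h p x \<in> carrier (Und M p)" "f p x \<in> carrier (Und N (p + n))" "h p x \<in> carrier (Und M (p - 1))"
      using that lin_closed[OF harm_linear[OF M h]] gihom_closed[OF f' that refl] contraction_closed[OF M h] by auto
    show "f (p - 1) (h p x) \<in> carrier (Und N (p + n - 1))" using 1 by (auto intro!: gihom_closed[OF f'])
    show "h' (p + n) (f p (harm M h p x)) \<in> carrier (Und N (p + n - 1))"
      using 1 gihom_closed[OF f' 1(1) refl] by (auto intro!: contraction_closed[OF N h'])
  qed
  have t: "t \<in> carrier (gihom k (Und M) (Und N) (n - 1))"
    unfolding gihom_carrier
  proof
    fix p
    have e: "p + (n - 1) = p + n - 1" "p - 1 + n = p + n - 1" by simp_all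
    note l = harm_linear[OF M h, of p] gihomD[OF f', of p] gihomD[OF f', of "p - 1", unfolded e]
      contraction_linear[OF M h refl, of p] contraction_linear[OF N h' refl, of "p + n"]
    show "t p \<in> linmaps k (Und M p) (Und N (p + (n - 1)))"
      unfolding e t_def
    proof (rule linmaps_restrictI)
      fix x y assume xy: "x \<in> carrier (Und M p)" "y \<in> carrier (Und M p)"
      then have "f p (harm M h p x) \<in> carrier (Und N (p + n))" "f p (harm M h p y) \<in> carrier (Und N (p + n))" using c by auto
      with xy show "h' (p + n) (f p (harm M h p (x \<oplus>\<^bsub>Und M p\<^esub> y))) \<oplus>\<^bsub>Und N (p + n - 1)\<^esub>
          signed (Und N (p + n - 1)) n (f (p - 1) (h p (x \<oplus>\<^bsub>Und M p\<^esub> y))) =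
         (h' (p + n) (f p (harm M h p x)) \<oplus>\<^bsub>Und N (p + n - 1)\<^esub> signed (Und N (p + n - 1)) n (f (p - 1) (h p x))) \<oplus>\<^bsub>Und N (p + n - 1)\<^esub>
         (h' (p + n) (f p (harm M h p y)) \<oplus>\<^bsub>Und N (p + n - 1)\<^esub> signed (Und N (p + n - 1)) n (f (p - 1) (h p y)))"
        using c by (simp add: lin_add[OF l(1)] lin_add[OF l(2)] lin_add[OF l(3)] lin_add[OF l(4)] lin_add[OF l(5)] signed_add m_ac)
    next
      fix a x assume ax: "a \<in> carrier k" "x \<in> carrier (Und M p)"
      then have "f p (harm M h p x) \<in> carrier (Und N (p + n))" using c by auto
      with ax show "h' (p + n) (f p (harm M h p (a \<odot>\<^bsub>Und M p\<^esub> x))) \<oplus>\<^bsub>Und N (p + n - 1)\<^esub>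
          signed (Und N (p + n - 1)) n (f (p - 1) (h p (a \<odot>\<^bsub>Und M p\<^esub> x))) =
         a \<odot>\<^bsub>Und N (p + n - 1)\<^esub> (h' (p + n) (f p (harm M h p x)) \<oplus>\<^bsub>Und N (p + n - 1)\<^esub> signed (Und N (p + n - 1)) n (f (p - 1) (h p x)))"
        using c by (simp add: lin_smult[OF l(1)] lin_smult[OF l(2)] lin_smult[OF l(3)] lin_smult[OF l(4)] lin_smult[OF l(5)] signed_smult smult_add)
    qed (use c in simp_all)
  qed
  have "f = Diff (kihom k M N) (n - 1) t"
  proof (rule gihom_eqI[OF f'])
    show "Diff (kihom k M N) (n - 1) t \<in> carrier (gihom k (Und M) (Und N) n)"
      using kihom_Diff_closed[OF M N t] by simp
    fix p x assume x: "x \<in> carrier (Und M p)"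
    define q where "q = p + n"
    have q: "p + n = q" "p + (n - 1) = q - 1" "p + 1 + n = q + 1" "p + 1 + (n - 1) = q" "p + 1 - 1 = p" "q + 1 - 1 = q" "q - 1 + 1 = q" "p - 1 + 1 = p"
      by (simp_all add: q_def)
    note lf = gihomD[OF f', of p, unfolded q] gihomD[OF f', of "p + 1", unfolded q]
    let ?u = "harm M h p x" and ?v = "Diff M (p - 1) (h p x)" and ?w = "h (p + 1) (Diff M p x)"
    have uvw: "?u \<in> carrier (Und M p)" "?v \<in> carrier (Und M p)" "?w \<in> carrier (Und M p)"
      using c x by (auto intro!: contraction_closed[OF M h])
    note fc = lin_closed[OF lf(1)]
    \<comment> \<open>\<open>harm\<close> kills \<open>d x\<close>, so only the second summand of
      \<open>t\<close> contributes.\<close>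
    have tdx: "t (p + 1) (Diff M p x) = signed (Und N q) n (f p ?w)"
    proof -
      have "f (p + 1) (harm M h (p + 1) (Diff M p x)) = \<zero>\<^bsub>Und N (q + 1)\<^esub>"
        using x by (simp add: harm_Diff[OF M h _ refl] lin_zero[OF lf(2)])
      then have "h' (q + 1) (f (p + 1) (harm M h (p + 1) (Diff M p x))) = \<zero>\<^bsub>Und N q\<^esub>"
        by (simp add: lin_zero[OF contraction_linear[OF N h', of q "q + 1"]])
      then show ?thesis using x uvw fc by (simp add: t_def q)
    qed
    \<comment> \<open>The only appeal to the hypothesis on \<open>f\<close>: \<open>?u\<close> is a
      cocycle, so \<open>f p ?u\<close> is a boundary and \<open>h'\<close> gives a
      preimage.\<close>
    have "Diff N (q - 1) (h' q (f p ?u)) = f p ?u"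
      using b[OF harm_cocycle[OF M h x]] by (intro contraction_coboundary[OF N h']) (simp_all add: q)
    moreover have "Diff N (q - 1) (f (p - 1) (h p x)) = signed (Und N q) n (f p ?v)"
      using c x by (intro cocycles_kihom_Diff[OF M N f]) (simp_all add: q_def)
    ultimately have dtx: "Diff N (q - 1) (t p x) = f p ?u \<oplus>\<^bsub>Und N q\<^esub> f p ?v"
      using x c[OF x] uvw fc unfolding t_def q
      by (simp add: Diff_add[of N _ "q - 1" _ q] Diff_signed[of N _ "q - 1" q] signed_signed q) (simp add: signed_def)
    have "Diff (kihom k M N) (n - 1) t p x = (f p ?u \<oplus>\<^bsub>Und N q\<^esub> f p ?v) \<ominus>\<^bsub>Und N q\<^esub> signed (Und N q) (n - 1) (signed (Und N q) n (f p ?w))"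
      unfolding kihom_Diff_apply[OF M N t x] q dtx tdx ..
    also have "\<dots> = f p (?u \<oplus>\<^bsub>Und M p\<^esub> (?v \<oplus>\<^bsub>Und M p\<^esub> ?w))"
      using uvw fc by (simp add: lin_add[OF lf(1)] signed_signed m_group) (simp add: signed_def m_group)
    also have "?u \<oplus>\<^bsub>Und M p\<^esub> (?v \<oplus>\<^bsub>Und M p\<^esub> ?w) = x" using harm_decomp[OF M h x refl refl] ..
    finally show "f p x = Diff (kihom k M N) (n - 1) t p x" ..
  qed
  then show ?thesis using coboundariesI[of t "kihom k M N" "n - 1" n] t by simp
qed

lemma theta_inj:
  assumes M [simp]: "K_obj k M" and N [simp]: "K_obj k N"
    and f: "f \<in> cocycles (kihom k M N) n" and g: "g \<in> cocycles (kihom k M N) n"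
    and eq: "\<And>p x. x \<in> cocycles M p \<Longrightarrow> coclass N (p + n) (f p x) = coclass N (p + n) (g p x)"
  shows "coclass (kihom k M N) n f = coclass (kihom k M N) n g"
proof -
  have c: "f \<in> carrier (gihom k (Und M) (Und N) n)" "g \<in> carrier (gihom k (Und M) (Und N) n)"
    using cocycles_closed[OF f] cocycles_closed[OF g] by simp_all
  have "f \<ominus>\<^bsub>gihom k (Und M) (Und N) n\<^esub> g \<in> cocycles (kihom k M N) n" using coc_minus[of "kihom k M N" f n g] f g by simp
  moreover have "(f \<ominus>\<^bsub>gihom k (Und M) (Und N) n\<^esub> g) p x \<in> coboundaries N (p + n)" if x: "x \<in> cocycles M p" for p x
    using eq[OF x] c x kihom_cocycle_cocycle[OF M N f x refl] kihom_cocycle_cocycle[OF M N g x refl] by (simp add: coclass_eq_iff)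
  ultimately have "f \<ominus>\<^bsub>gihom k (Und M) (Und N) n\<^esub> g \<in> coboundaries (kihom k M N) n" by (rule kihom_coboundaryI[OF M N])
  then show ?thesis using coclass_eq_iff[of "kihom k M N", OF _ f g] by simp
qed

text \<open>Project \<open>x\<close> to a cocycle, pass to its class, apply \<open>\<phi>\<close>
  and take the canonical representative of the result. The map obtained has values in cocycles and
  kills boundaries, so both sides of the cocycle condition are zero.\<close>

lemma theta_surj:
  assumes M [simp]: "K_obj k M" and N [simp]: "K_obj k N" and \<phi>: "\<phi> \<in> carrier (gihom k (cohomology M) (cohomology N) n)"
  obtains f where "f \<in> cocycles (kihom k M N) n" "theta k M N n (coclass (kihom k M N) n f) = \<phi>"
proof -
  obtain h where h: "contraction k M h" using contraction_exists[OF M] .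
  obtain h' where h': "contraction k N h'" using contraction_exists[OF N] .
  \<comment> \<open>A linear section of the projection from cocycles to cohomology:
    \<open>harm\<close> makes the outcome independent of the cocycle that \<open>SOME\<close>
    picks.\<close>
  define \<rho> where "\<rho> q c = harm N h' q (SOME z. z \<in> c)" for q c
  have \<rho>: "\<rho> q (coclass N q z) = harm N h' q z" if z: "z \<in> cocycles N q" for q z
  proof -
    have "(SOME y. y \<in> coclass N q z) \<in> coclass N q z" using coclass_self[OF N z] by (rule someI[where P = "\<lambda>y. y \<in> coclass N q z"])
    then show ?thesis unfolding \<rho>_def using z coclass_mem[OF N z] by (intro harm_coclass_cong[OF N h']) simp_all
  qed
  have \<rho>c: "\<rho> q c \<in> cocycles N q" "coclass N q (\<rho> q c) = c" if "c \<in> carrier (cohomology N q)" for q c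
    using cohomologyE[OF that] \<rho> harm_cocycle[OF N h'] harm_coclass[OF N h'] cocycles_closed by metis+
  have \<rho>add: "\<rho> q (c \<oplus>\<^bsub>cohomology N q\<^esub> c') = \<rho> q c \<oplus>\<^bsub>Und N q\<^esub> \<rho> q c'"
    if c: "c \<in> carrier (cohomology N q)" "c' \<in> carrier (cohomology N q)" for q c c'
  proof -
    obtain z z' where z: "z \<in> cocycles N q" "c = coclass N q z" "z' \<in> cocycles N q" "c' = coclass N q z'"
      using cohomologyE[OF c(1)] cohomologyE[OF c(2)] by metis
    then show ?thesis using \<rho>[of "z \<oplus>\<^bsub>Und N q\<^esub> z'" q] by (simp add: \<rho> coclass_add lin_add[OF harm_linear[OF N h']])
  qed
  have \<rho>smult: "\<rho> q (a \<odot>\<^bsub>cohomology N q\<^esub> c) = a \<odot>\<^bsub>Und N q\<^esub> \<rho> q c"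
    if a: "a \<in> carrier k" and c: "c \<in> carrier (cohomology N q)" for q a c
  proof -
    obtain z where z: "z \<in> cocycles N q" "c = coclass N q z" using cohomologyE[OF c] .
    then show ?thesis using a \<rho>[of "a \<odot>\<^bsub>Und N q\<^esub> z" q] by (simp add: \<rho> coclass_smult lin_smult[OF harm_linear[OF N h']])
  qed
  have \<rho>zero: "\<rho> q \<zero>\<^bsub>cohomology N q\<^esub> = \<zero>\<^bsub>Und N q\<^esub>" for q
    using \<rho>[of "\<zero>\<^bsub>Und N q\<^esub>" q] by (simp add: coclass_zero lin_zero[OF harm_linear[OF N h']])
  define f where "f p = (\<lambda>x\<in>carrier (Und M p). \<rho> (p + n) (\<phi> p (coclass M p (harm M h p x))))" for p
  note l\<phi> = gihomD[OF \<phi>]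
  have cl: "\<phi> p (coclass M p (harm M h p x)) \<in> carrier (cohomology N (p + n))" if "x \<in> carrier (Und M p)" for p x
    using that by (intro lin_closed[OF l\<phi>] coclass_closed harm_cocycle[OF M h])
  have fg: "f \<in> carrier (gihom k (Und M) (Und N) n)"
    unfolding gihom_carrier
  proof
    fix p show "f p \<in> linmaps k (Und M p) (Und N (p + n))"
      unfolding f_def
      by (rule linmaps_restrictI)
        (simp_all add: cl \<rho>c lin_add[OF harm_linear[OF M h]] lin_smult[OF harm_linear[OF M h]] coclass_add coclass_smult
          harm_cocycle[OF M h] lin_add[OF l\<phi>] lin_smult[OF l\<phi>] \<rho>add \<rho>smult)
  qed
  have f: "f \<in> cocycles (kihom k M N) n"
  proof (rule cocycles_kihomI[OF M N fg])
    fix p x assume x: "x \<in> carrier (Und M p)"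
    have "Diff N (p + n) (f p x) = \<zero>\<^bsub>Und N (p + n + 1)\<^esub>"
      using x by (simp add: f_def cocycles_Diff[OF \<rho>c(1)[OF cl] refl])
    moreover have "f (p + 1) (Diff M p x) = \<zero>\<^bsub>Und N (p + n + 1)\<^esub>"
    proof -
      have e: "p + 1 + n = p + n + 1" by simp
      have "coclass M (p + 1) (harm M h (p + 1) (Diff M p x)) = \<zero>\<^bsub>cohomology M (p + 1)\<^esub>"
        using x by (simp add: harm_Diff[OF M h _ refl] coclass_zero)
      moreover have "\<phi> (p + 1) \<zero>\<^bsub>cohomology M (p + 1)\<^esub> = \<zero>\<^bsub>cohomology N (p + n + 1)\<^esub>"
        using lin_zero[OF l\<phi>[of "p + 1"]] unfolding e by simp
      ultimately show ?thesis using x by (simp add: f_def \<rho>zero e)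
    qed
    ultimately show "Diff N (p + n) (f p x) = signed (Und N (p + n + 1)) n (f (p + 1) (Diff M p x))" by simp
  qed
  moreover have "theta k M N n (coclass (kihom k M N) n f) = \<phi>"
  proof (rule gihom_eqI[OF theta_closed[OF M N] \<phi>])
    show "coclass (kihom k M N) n f \<in> carrier (cohomology (kihom k M N) n)" using f by simp
    fix p c assume "c \<in> carrier (cohomology M p)"
    then obtain x where x: "x \<in> cocycles M p" "c = coclass M p x" by (rule cohomologyE)
    show "theta k M N n (coclass (kihom k M N) n f) p c = \<phi> p c"
      using x lin_closed[OF l\<phi> coclass_closed[OF x(1)]]
      by (simp add: theta_apply[OF M N f _ refl] f_def \<rho>c harm_coclass[OF M h])
  qed
  ultimately show ?thesis by (rule that)
qed

section \<open>Surjectivity of the Kuenneth map\<close>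

context
  fixes M :: "('k, 'a) cochain" and N :: "('k, 'b) cochain" and h h'
  assumes M [simp]: "K_obj k M" and N [simp]: "K_obj k N" and h: "contraction k M h" and h': "contraction k N h'"
begin

abbreviation (input) "XY \<equiv> gtens k (Und M) (Und N)"

text \<open>The homotopy behind \<open>1 \<otimes> 1 - \<pi> \<otimes> \<pi>' = (1 - \<pi>)
  \<otimes> 1 + \<pi> \<otimes> (1 - \<pi>')\<close>, where \<open>\<pi>\<close> and
  \<open>\<pi>'\<close> are the two projections: \<open>h \<otimes> 1\<close> contracts the first
  summand and \<open>\<pi> \<otimes> h'\<close> the second. The sign arises when \<open>h'\<close>
  of degree \<open>-1\<close> moves past \<open>x\<close>.\<close>

abbreviation (input) htpy_fun where
  "htpy_fun \<equiv> (\<lambda>i x j y. ptens k (Und M) (Und N) (i - 1) (h i x) j y \<oplus>\<^bsub>XY (i + j - 1)\<^esub>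
     signed (XY (i + j - 1)) i (ptens k (Und M) (Und N) i (harm M h i x) (j - 1) (h' j y)))"

lemma htpy_bilinear: "bilinear k (Und M) (Und N) (\<lambda>n. XY (n - 1)) htpy_fun"
proof (rule bilinearI)
  fix i j x y assume x: "x \<in> carrier (Und M i)" and y: "y \<in> carrier (Und N j)"
  have e: "i - 1 + j = i + j - 1" "i + (j - 1) = i + j - 1" by simp_all
  note lm = contraction_linear[OF M h refl, of i] harm_linear[OF M h, of i] contraction_linear[OF N h' refl, of j]
  note p = ptens_add_left[OF _ _ e(1)] ptens_add_left[OF _ _ e(2)] ptens_add_right[OF _ _ e(1)] ptens_add_right[OF _ _ e(2)]
    ptens_smult_left[OF _ _ e(1)] ptens_smult_left[OF _ _ e(2)] ptens_smult_right[OF _ _ e(1)] ptens_smult_right[OF _ _ e(2)]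
    lin_add[OF lm(1)] lin_add[OF lm(2)] lin_add[OF lm(3)] lin_smult[OF lm(1)] lin_smult[OF lm(2)] lin_smult[OF lm(3)]
    lin_closed[OF lm(1)] lin_closed[OF lm(2)] lin_closed[OF lm(3)]
    signed_add signed_smult smult_add m_ac
  show "htpy_fun i x j y \<in> carrier (XY (i + j - 1))"
    using x y by (simp add: p)
  show "htpy_fun i (x \<oplus>\<^bsub>Und M i\<^esub> x') j y = htpy_fun i x j y \<oplus>\<^bsub>XY (i + j - 1)\<^esub> htpy_fun i x' j y"
    if "x' \<in> carrier (Und M i)" for x' using x y that by (simp add: p)
  show "htpy_fun i x j (y \<oplus>\<^bsub>Und N j\<^esub> y') = htpy_fun i x j y \<oplus>\<^bsub>XY (i + j - 1)\<^esub> htpy_fun i x j y'"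
    if "y' \<in> carrier (Und N j)" for y' using x y that by (simp add: p)
  fix a assume "a \<in> carrier k"
  with x y show "htpy_fun i (a \<odot>\<^bsub>Und M i\<^esub> x) j y = a \<odot>\<^bsub>XY (i + j - 1)\<^esub> htpy_fun i x j y"
    "htpy_fun i x j (a \<odot>\<^bsub>Und N j\<^esub> y) = a \<odot>\<^bsub>XY (i + j - 1)\<^esub> htpy_fun i x j y"
    by (simp_all add: p)
qed

abbreviation (input) "htpy \<equiv> tens_lift k (Und M) (Und N) (\<lambda>n. XY (n - 1)) htpy_fun"

lemma htpy_target_obj [simp]: "gr_obj k (\<lambda>n. XY (n - 1))"
proof -
  have "module k (XY (n - 1))" for n by simp
  then show ?thesis by (simp add: gr_obj_def)
qed

lemma htpy_linear: "htpy n \<in> linmaps k (XY n) (XY (n - 1))"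
  using tens_lift_linear[OF K_obj_gr[OF M] K_obj_gr[OF N] htpy_target_obj htpy_bilinear] by simp

lemma htpy_ptens:
  assumes "i + j = n" "x \<in> carrier (Und M i)" "y \<in> carrier (Und N j)" "i' = i - 1" "j' = j - 1" "n' = n - 1"
  shows "htpy n (ptens k (Und M) (Und N) i x j y) = ptens k (Und M) (Und N) i' (h i x) j y \<oplus>\<^bsub>XY n'\<^esub>
     signed (XY n') i (ptens k (Und M) (Und N) i (harm M h i x) j' (h' j y))"
  using tens_lift_ptens[OF K_obj_gr[OF M] K_obj_gr[OF N] htpy_target_obj htpy_bilinear, OF assms(1-3)] assms by simp

abbreviation (input) "harm_tens \<equiv> tens_map k (Und M) (Und N) (Und M) (Und N) (harm M h) (harm N h')"

lemma harm_tens_linear: "harm_tens n \<in> linmaps k (XY n) (XY n)"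
  using tens_map_gmaps[OF _ _ _ _ harm_gmaps[OF M h] harm_gmaps[OF N h']] by (auto dest: gmapsD)

text \<open>With \<open>x = a + b + c\<close> split into projection, \<open>d h x\<close> and
  \<open>h d x\<close>, and \<open>y\<close> likewise, the terms with
  \<open>h x \<otimes> dy\<close> cancel between \<open>d H\<close> and \<open>H d\<close>. What is
  left, \<open>b \<otimes> y + c \<otimes> y + a \<otimes> b' + a \<otimes> c'\<close>, is
  \<open>x \<otimes> y - a \<otimes> a'\<close>.\<close>

lemma harm_tens_homotopy:
  assumes "t \<in> carrier (XY n)"
  shows "t \<ominus>\<^bsub>XY n\<^esub> harm_tens n t = Diff (ktens k M N) (n - 1) (htpy n t) \<oplus>\<^bsub>XY n\<^esub> htpy (n + 1) (Diff (ktens k M N) n t)"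
  using assms
proof (induction rule: gtens_induct[OF K_obj_gr[OF M] K_obj_gr[OF N], consumes 1])
  case (1 i x j y)
  note [simp] = 1(2,3)
  let ?p = "ptens k (Und M) (Und N)"
  have e: "i - 1 + j = n - 1" "i + (j - 1) = n - 1" "i - 1 + (j + 1) = n" "i + 1 + (j - 1) = n" "i + 1 + j = n + 1" "i + (j + 1) = n + 1"
    using 1 by simp_all
  define a where "a = harm M h i x" define b where "b = Diff M (i - 1) (h i x)" define c where "c = h (i + 1) (Diff M i x)"
  define a' where "a' = harm N h' j y" define b' where "b' = Diff N (j - 1) (h' j y)" define c' where "c' = h' (j + 1) (Diff N j y)"
  have hx [simp]: "h i x \<in> carrier (Und M (i - 1))" and hy [simp]: "h' j y \<in> carrier (Und N (j - 1))"
    by (auto intro!: contraction_closed[OF M h] contraction_closed[OF N h'])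
  have [simp]: "Diff N (j - 1) (h' j y) \<in> carrier (Und N j)" "h (i + 1) (Diff M i x) \<in> carrier (Und M i)"
    by (auto intro!: contraction_closed[OF M h])
  have [simp]: "a \<in> carrier (Und M i)" "b \<in> carrier (Und M i)" "c \<in> carrier (Und M i)"
    unfolding a_def b_def c_def by (auto intro!: contraction_closed[OF M h] lin_closed[OF harm_linear[OF M h]])
  have [simp]: "a' \<in> carrier (Und N j)" "b' \<in> carrier (Und N j)" "c' \<in> carrier (Und N j)"
    unfolding a'_def b'_def c'_def by (auto intro!: contraction_closed[OF N h'] lin_closed[OF harm_linear[OF N h']])
  have x: "x = a \<oplus>\<^bsub>Und M i\<^esub> (b \<oplus>\<^bsub>Und M i\<^esub> c)" unfolding a_def b_def c_def by (rule harm_decomp[OF M h]) simp_all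
  have y: "y = a' \<oplus>\<^bsub>Und N j\<^esub> (b' \<oplus>\<^bsub>Und N j\<^esub> c')" unfolding a'_def b'_def c'_def by (rule harm_decomp[OF N h']) simp_all
  have da: "Diff M i a = \<zero>\<^bsub>Und M (i + 1)\<^esub>" unfolding a_def by (rule cocycles_Diff[OF harm_cocycle[OF M h] refl]) simp
  have pd: "harm M h (i + 1) (Diff M i x) = \<zero>\<^bsub>Und M (i + 1)\<^esub>" by (rule harm_Diff[OF M h]) simp_all
  have T: "harm_tens n (?p i x j y) = ?p i a j a'"
    unfolding a_def a'_def using 1
    by (intro tens_map_ptens[OF _ _ _ _ harm_gmaps[OF M h] harm_gmaps[OF N h']]) simp_all
  \<comment> \<open>\<open>y\<close> is split only next to \<open>a\<close>; the parts with
    \<open>b\<close> and \<open>c\<close> keep it whole, as the homotopy treats them through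
    \<open>h \<otimes> 1\<close>.\<close>
  have "?p i x j y = ?p i (a \<oplus>\<^bsub>Und M i\<^esub> (b \<oplus>\<^bsub>Und M i\<^esub> c)) j y" using x by simp
  also have "\<dots> = ?p i a j y \<oplus>\<^bsub>XY n\<^esub> (?p i b j y \<oplus>\<^bsub>XY n\<^esub> ?p i c j y)" by (simp add: ptens_add_left[OF _ _ 1(1)])
  also have "?p i a j y = ?p i a j (a' \<oplus>\<^bsub>Und N j\<^esub> (b' \<oplus>\<^bsub>Und N j\<^esub> c'))" using y by simp
  also have "\<dots> = ?p i a j a' \<oplus>\<^bsub>XY n\<^esub> (?p i a j b' \<oplus>\<^bsub>XY n\<^esub> ?p i a j c')" by (simp add: ptens_add_right[OF _ _ 1(1)])
  finally have L: "?p i x j y = (?p i a j a' \<oplus>\<^bsub>XY n\<^esub> (?p i a j b' \<oplus>\<^bsub>XY n\<^esub> ?p i a j c')) \<oplus>\<^bsub>XY n\<^esub> (?p i b j y \<oplus>\<^bsub>XY n\<^esub> ?p i c j y)" .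
  have "Diff (ktens k M N) (n - 1) (?p (i - 1) (h i x) j y) =
      ?p i b j y \<oplus>\<^bsub>XY n\<^esub> signed (XY n) (i - 1) (?p (i - 1) (h i x) (j + 1) (Diff N j y))"
    unfolding b_def by (intro ktens_Diff_ptens[OF M N e(1)]) simp_all
  moreover have "Diff (ktens k M N) (n - 1) (?p i a (j - 1) (h' j y)) = signed (XY n) i (?p i a j b')"
    unfolding b'_def using ktens_Diff_ptens[OF M N e(2), of n "i + 1" j a "h' j y"]
    by (simp add: da ptens_zero_left[OF _ _ e(4)] 1(1))
  \<comment> \<open>The sign \<open>(-1)^i\<close> of the second summand of the homotopy meets the
    Leibniz sign \<open>(-1)^i\<close> for moving \<open>d\<close> past \<open>a\<close>, so
    \<open>a \<otimes> b'\<close> appears without a sign; \<open>da = 0\<close> removes its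
    companion.\<close>
  ultimately have D: "Diff (ktens k M N) (n - 1) (htpy n (?p i x j y)) =
      (?p i b j y \<oplus>\<^bsub>XY n\<^esub> signed (XY n) (i - 1) (?p (i - 1) (h i x) (j + 1) (Diff N j y))) \<oplus>\<^bsub>XY n\<^esub> ?p i a j b'"
    using Diff_add[of "ktens k M N" _ "n - 1" _ n] Diff_signed[of "ktens k M N" _ "n - 1" n] 1(1)
    by (simp add: htpy_ptens[OF 1 refl refl refl] a_def[symmetric] signed_signed e) (simp add: signed_def)
  have "htpy (n + 1) (?p (i + 1) (Diff M i x) j y) = ?p i c j y"
    unfolding c_def using htpy_ptens[OF e(5), of "Diff M i x" y i "j - 1" n]
    by (simp add: pd ptens_zero_left[OF _ _ e(4)] 1(1))
  moreover have "htpy (n + 1) (?p i x (j + 1) (Diff N j y)) =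
      ?p (i - 1) (h i x) (j + 1) (Diff N j y) \<oplus>\<^bsub>XY n\<^esub> signed (XY n) i (?p i a j c')"
    unfolding a_def c'_def by (intro htpy_ptens[OF e(6)]) simp_all
  ultimately have E: "htpy (n + 1) (Diff (ktens k M N) n (?p i x j y)) =
      ?p i c j y \<oplus>\<^bsub>XY n\<^esub> (signed (XY n) i (?p (i - 1) (h i x) (j + 1) (Diff N j y)) \<oplus>\<^bsub>XY n\<^esub> ?p i a j c')"
    using htpy_linear[of "n + 1"] 1(1)
    by (simp add: ktens_Diff_ptens[OF M N 1(1) refl refl refl] lin_add[OF htpy_linear[of "n + 1", simplified]]
       lin_signed[OF htpy_linear[of "n + 1", simplified]] signed_add signed_signed e) (simp add: signed_def)
  have cl: "?p i a j a' \<in> carrier (XY n)" "?p i a j b' \<in> carrier (XY n)" "?p i a j c' \<in> carrier (XY n)"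
    "?p i b j y \<in> carrier (XY n)" "?p i c j y \<in> carrier (XY n)" "?p (i - 1) (h i x) (j + 1) (Diff N j y) \<in> carrier (XY n)"
    using 1(1) by simp_all
  have s: "signed (XY n) (i - 1) z = \<ominus>\<^bsub>XY n\<^esub> signed (XY n) i z" if "z \<in> carrier (XY n)" for z
    using that by (simp add: signed_def)
  show ?case unfolding T D E s[OF cl(6)] unfolding L
    using cl by (simp add: m_cancel_left m_cancel_inner)
next
  case (2 s t)
  note l = htpy_linear[of n] htpy_linear[of "n + 1", simplified] ktens_Diff_linear[OF M N, of n] ktens_Diff_linear[OF M N, of "n - 1", simplified] harm_tens_linear[of n]
  note lc = lin_closed[OF l(1)] lin_closed[OF l(2)] lin_closed[OF l(3)] lin_closed[OF l(4)] lin_closed[OF l(5)]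
  have "(s \<oplus>\<^bsub>XY n\<^esub> t) \<ominus>\<^bsub>XY n\<^esub> harm_tens n (s \<oplus>\<^bsub>XY n\<^esub> t) = (s \<ominus>\<^bsub>XY n\<^esub> harm_tens n s) \<oplus>\<^bsub>XY n\<^esub> (t \<ominus>\<^bsub>XY n\<^esub> harm_tens n t)"
    using 2(1,2) lc by (simp add: lin_add[OF l(5)] m_group)
  also have "\<dots> = (Diff (ktens k M N) (n - 1) (htpy n s) \<oplus>\<^bsub>XY n\<^esub> htpy (n + 1) (Diff (ktens k M N) n s)) \<oplus>\<^bsub>XY n\<^esub>
     (Diff (ktens k M N) (n - 1) (htpy n t) \<oplus>\<^bsub>XY n\<^esub> htpy (n + 1) (Diff (ktens k M N) n t))"
    by (simp only: 2)
  also have "\<dots> = Diff (ktens k M N) (n - 1) (htpy n (s \<oplus>\<^bsub>XY n\<^esub> t)) \<oplus>\<^bsub>XY n\<^esub> htpy (n + 1) (Diff (ktens k M N) n (s \<oplus>\<^bsub>XY n\<^esub> t))"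
    using 2(1,2) lc by (simp add: lin_add[OF l(1)] lin_add[OF l(2)] lin_add[OF l(3)] lin_add[OF l(4)] m_ac)
  finally show ?case .
qed

text \<open>A pure tensor goes to a tensor of two cocycles, whose class is by definition a value of
  the Kuenneth map. The two claims are proved together because classes are additive on cocycles
  only.\<close>

lemma harm_tens_kunneth:
  assumes "t \<in> carrier (XY n)"
  shows "harm_tens n t \<in> cocycles (ktens k M N) n \<and>
    (\<exists>s\<in>carrier (gtens k (cohomology M) (cohomology N) n). Map (kunneth k M N) n s = coclass (ktens k M N) n (harm_tens n t))"
  using assms
proof (induction rule: gtens_induct[OF K_obj_gr[OF M] K_obj_gr[OF N], consumes 1])
  case (1 i x j y)
  have c: "harm M h i x \<in> cocycles M i" "harm N h' j y \<in> cocycles N j"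
    using 1 harm_cocycle[OF M h] harm_cocycle[OF N h'] by auto
  have T: "harm_tens n (ptens k (Und M) (Und N) i x j y) = ptens k (Und M) (Und N) i (harm M h i x) j (harm N h' j y)"
    using 1 by (intro tens_map_ptens[OF _ _ _ _ harm_gmaps[OF M h] harm_gmaps[OF N h']]) simp_all
  show ?case
    unfolding T
  proof (intro conjI bexI)
    show "ptens k (Und M) (Und N) i (harm M h i x) j (harm N h' j y) \<in> cocycles (ktens k M N) n"
      by (rule ptens_cocycle[OF M N c 1(1)])
    show "Map (kunneth k M N) n (ptens k (cohomology M) (cohomology N) i (coclass M i (harm M h i x)) j (coclass N j (harm N h' j y))) =
       coclass (ktens k M N) n (ptens k (Und M) (Und N) i (harm M h i x) j (harm N h' j y))"
      by (rule kunneth_ptens[OF M N c 1(1)])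
  qed (use c 1 in simp)
next
  case (2 s t)
  note kl = gmapsD[OF kunneth_gmaps[OF M N], of n]
  obtain u v where uv: "u \<in> carrier (gtens k (cohomology M) (cohomology N) n)" "v \<in> carrier (gtens k (cohomology M) (cohomology N) n)"
    "Map (kunneth k M N) n u = coclass (ktens k M N) n (harm_tens n s)"
    "Map (kunneth k M N) n v = coclass (ktens k M N) n (harm_tens n t)" using 2 by auto
  have z: "harm_tens n s \<in> cocycles (ktens k M N) n" "harm_tens n t \<in> cocycles (ktens k M N) n" using 2 by auto
  have T: "harm_tens n (s \<oplus>\<^bsub>XY n\<^esub> t) = harm_tens n s \<oplus>\<^bsub>Und (ktens k M N) n\<^esub> harm_tens n t"
    using 2(1,2) by (simp add: lin_add[OF harm_tens_linear])
  have "Map (kunneth k M N) n (u \<oplus>\<^bsub>gtens k (cohomology M) (cohomology N) n\<^esub> v) = coclass (ktens k M N) n (harm_tens n (s \<oplus>\<^bsub>XY n\<^esub> t))"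
    unfolding T using uv z by (simp add: lin_add[OF kl] coclass_add del: ktens_Und)
  moreover have "u \<oplus>\<^bsub>gtens k (cohomology M) (cohomology N) n\<^esub> v \<in> carrier (gtens k (cohomology M) (cohomology N) n)" using uv by simp
  moreover have "harm_tens n (s \<oplus>\<^bsub>XY n\<^esub> t) \<in> cocycles (ktens k M N) n" unfolding T by (rule coc_add) (simp_all add: z)
  ultimately show ?case by blast
qed

end

lemma kunneth_surj:
  assumes M [simp]: "K_obj k M" and N [simp]: "K_obj k N" and c: "c \<in> carrier (cohomology (ktens k M N) n)"
  obtains s where "s \<in> carrier (gtens k (cohomology M) (cohomology N) n)" "Map (kunneth k M N) n s = c"
proof -
  obtain h where h: "contraction k M h" using contraction_exists[OF M] .
  obtain h' where h': "contraction k N h'" using contraction_exists[OF N] .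
  obtain t where t: "t \<in> cocycles (ktens k M N) n" "c = coclass (ktens k M N) n t" using cohomologyE[OF c] .
  then have tc: "t \<in> carrier (gtens k (Und M) (Und N) n)" using cocycles_closed[OF t(1)] by simp
  note H = harm_tens_homotopy[OF M N h h' tc] and K = harm_tens_kunneth[OF M N h h' tc]
  note hl = htpy_linear[OF M N h h']
  \<comment> \<open>For a cocycle \<open>t\<close> the term \<open>H d t\<close> of the homotopy
    vanishes, so \<open>t\<close> differs from its projection by the boundary
    \<open>d H t\<close>.\<close>
  have "coclass (ktens k M N) n t = coclass (ktens k M N) n (tens_map k (Und M) (Und N) (Und M) (Und N) (harm M h) (harm N h') n t)"
  proof (rule coclass_eqI[OF _ t(1) conjunct1[OF K], of _ "n - 1"])
    show "t \<ominus>\<^bsub>Und (ktens k M N) n\<^esub> tens_map k (Und M) (Und N) (Und M) (Und N) (harm M h) (harm N h') n t =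
      Diff (ktens k M N) (n - 1) (tens_lift k (Und M) (Und N) (\<lambda>n. gtens k (Und M) (Und N) (n - 1))
        (\<lambda>i x j y. ptens k (Und M) (Und N) (i - 1) (h i x) j y \<oplus>\<^bsub>gtens k (Und M) (Und N) (i + j - 1)\<^esub>
          signed (gtens k (Und M) (Und N) (i + j - 1)) i (ptens k (Und M) (Und N) i (harm M h i x) (j - 1) (h' j y))) n t)"
      using H lin_closed[OF hl tc] lin_zero[OF hl[of "n + 1"]] cocycles_Diff[OF t(1) refl]
        lin_closed[OF ktens_Diff_linear[OF M N, of "n - 1"]]
      by simp
  qed (use lin_closed[OF hl tc] in simp_all)
  then show ?thesis using K t that by auto
qed

end

section \<open>The cohomology functor on morphisms\<close>

definition theta_arrow ::
  "'k ring \<Rightarrow> ('k, 'a) cochain \<Rightarrow> ('k, 'b) cochain \<Rightarrow>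
     ('k, (int \<Rightarrow> 'a \<Rightarrow> 'b) set, int \<Rightarrow> 'a set \<Rightarrow> 'b set) gr_arrow" where
  "theta_arrow k M N =
     \<lparr>Dom = cohomology (kihom k M N), Cod = gihom k (cohomology M) (cohomology N), Map = theta k M N\<rparr>"

text \<open>The classes in the cohomology of the unit complex are singletons, hence \<open>the_elem\<close>.\<close>

definition counit :: "'k ring \<Rightarrow> ('k, 'k set, 'k) gr_arrow" where
  "counit k = \<lparr>Dom = cohomology (kunit k), Cod = gunit k,
     Map = \<lambda>n. \<lambda>c\<in>carrier (cohomology (kunit k) n). the_elem c\<rparr>"

text \<open>The comparison \<open>[l] \<mapsto> ([x] \<mapsto> l x)\<close> from the cohomology of
  the dual complex to the dual of the cohomology.\<close>

definition delta_arrow ::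
  "'k ring \<Rightarrow> ('k, 'a) cochain \<Rightarrow> ('k, (int \<Rightarrow> 'a \<Rightarrow> 'k) set, int \<Rightarrow> 'a set \<Rightarrow> 'k) gr_arrow" where
  "delta_arrow k M = gr_ipost k (cohomology M) (counit k) \<cdot>\<^sub>g theta_arrow k M (kunit k)"

context ground_ring
begin

section \<open>Arrows between graded modules\<close>

lemma gr_homD:
  assumes "F \<in> gr_hom k X Y"
  shows "Dom F = X" "Cod F = Y" "Map F \<in> gmaps k X Y"
  using assms by (simp_all add: gr_hom_def)

lemma gr_homI: "Dom F = X \<Longrightarrow> Cod F = Y \<Longrightarrow> Map F \<in> gmaps k X Y \<Longrightarrow> F \<in> gr_hom k X Y"
  by (simp add: gr_hom_def)

lemma gr_hom_closed: "F \<in> gr_hom k X Y \<Longrightarrow> x \<in> carrier (X n) \<Longrightarrow> Map F n x \<in> carrier (Y n)"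
  by (rule gmaps_closed[OF gr_homD(3)])

lemma gr_hom_eqI:
  assumes "F \<in> gr_hom k X Y" "G \<in> gr_hom k X Y" "\<And>n x. x \<in> carrier (X n) \<Longrightarrow> Map F n x = Map G n x"
  shows "F = G"
  using gmaps_eqI[OF gr_homD(3)[OF assms(1)] gr_homD(3)[OF assms(2)] assms(3)] assms(1,2)
  by (cases F; cases G) (simp add: gr_hom_def)

lemma gr_tens_hom_eqI:
  assumes "gr_obj k X" "gr_obj k Y" "F \<in> gr_hom k (gtens k X Y) Z" "G \<in> gr_hom k (gtens k X Y) Z"
    "\<And>i x j y. x \<in> carrier (X i) \<Longrightarrow> y \<in> carrier (Y j) \<Longrightarrow>
      Map F (i + j) (ptens k X Y i x j y) = Map G (i + j) (ptens k X Y i x j y)"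
  shows "F = G"
  using gtens_gmaps_eqI[OF assms(1,2) gr_homD(3)[OF assms(3)] gr_homD(3)[OF assms(4)] assms(5)] assms(3,4)
  by (cases F; cases G) (simp add: gr_hom_def)

lemma gr_comp_apply: "x \<in> carrier (Dom F n) \<Longrightarrow> Map (G \<cdot>\<^sub>g F) n x = Map G n (Map F n x)"
  by (simp add: gr_comp_def gcomp_def)

lemma gr_comp_hom: "gr_obj k X \<Longrightarrow> F \<in> gr_hom k X Y \<Longrightarrow> G \<in> gr_hom k Y Z \<Longrightarrow> G \<cdot>\<^sub>g F \<in> gr_hom k X Z"
  by (auto simp: gr_hom_def gr_comp_def intro!: gcomp_gmaps)

lemma gr_comp_apply_hom: "F \<in> gr_hom k X Y \<Longrightarrow> x \<in> carrier (X n) \<Longrightarrow> Map (G \<cdot>\<^sub>g F) n x = Map G n (Map F n x)"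
  by (simp add: gr_comp_apply gr_homD)

lemma gr_comp_assoc:
  assumes "gr_obj k X" "gr_obj k Y" "F \<in> gr_hom k X Y" "G \<in> gr_hom k Y Z" "H \<in> gr_hom k Z W"
  shows "(H \<cdot>\<^sub>g G) \<cdot>\<^sub>g F = H \<cdot>\<^sub>g G \<cdot>\<^sub>g F"
proof (rule gr_hom_eqI)
  show "(H \<cdot>\<^sub>g G) \<cdot>\<^sub>g F \<in> gr_hom k X W" "H \<cdot>\<^sub>g G \<cdot>\<^sub>g F \<in> gr_hom k X W"
    using assms by (auto intro!: gr_comp_hom)
  fix n x assume "x \<in> carrier (X n)"
  then show "Map ((H \<cdot>\<^sub>g G) \<cdot>\<^sub>g F) n x = Map (H \<cdot>\<^sub>g G \<cdot>\<^sub>g F) n x"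
    using gr_comp_hom[OF assms(1,3,4)] gr_hom_closed[OF assms(3)]
    by (simp add: gr_comp_apply_hom[OF assms(3)] gr_comp_apply_hom[OF assms(4)] gr_comp_apply_hom[of "G \<cdot>\<^sub>g F" X Z])
qed

lemma gr_id_hom: "gr_obj k X \<Longrightarrow> gr_id X \<in> gr_hom k X X"
  by (simp add: gr_hom_def gr_id_def gid_gmaps)

lemma gr_id_apply: "x \<in> carrier (X n) \<Longrightarrow> Map (gr_id X) n x = x"
  by (simp add: gr_id_def gid_def)

lemma gr_id_left: "gr_obj k X \<Longrightarrow> gr_obj k Y \<Longrightarrow> F \<in> gr_hom k X Y \<Longrightarrow> gr_id Y \<cdot>\<^sub>g F = F"
  by (rule gr_hom_eqI[of _ X Y])
    (auto simp: gr_comp_apply_hom gr_id_apply gr_hom_closed intro: gr_comp_hom gr_id_hom)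

lemma gr_id_right: "gr_obj k X \<Longrightarrow> F \<in> gr_hom k X Y \<Longrightarrow> F \<cdot>\<^sub>g gr_id X = F"
  by (rule gr_hom_eqI[of _ X Y])
    (auto simp: gr_comp_apply_hom[OF gr_id_hom] gr_id_apply intro: gr_comp_hom gr_id_hom)

lemma gr_tens_hom:
  assumes "gr_obj k X" "gr_obj k Y" "gr_obj k X'" "gr_obj k Y'" "F \<in> gr_hom k X X'" "G \<in> gr_hom k Y Y'"
  shows "gr_tens k F G \<in> gr_hom k (gtens k X Y) (gtens k X' Y')"
  using tens_map_gmaps[OF assms(1-4) gr_homD(3)[OF assms(5)] gr_homD(3)[OF assms(6)]] assms(5,6)
  by (simp add: gr_hom_def gr_tens_def)

lemma gr_tens_apply:
  assumes "gr_obj k X" "gr_obj k Y" "gr_obj k X'" "gr_obj k Y'" "F \<in> gr_hom k X X'" "G \<in> gr_hom k Y Y'"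
    "i + j = n" "x \<in> carrier (X i)" "y \<in> carrier (Y j)"
  shows "Map (gr_tens k F G) n (ptens k X Y i x j y) = ptens k X' Y' i (Map F i x) j (Map G j y)"
  using tens_map_ptens[OF assms(1-4) gr_homD(3)[OF assms(5)] gr_homD(3)[OF assms(6)] assms(7-9)] assms(5,6)
  by (simp add: gr_hom_def gr_tens_def)

lemma gr_tens_comp:
  assumes [simp]: "gr_obj k X" "gr_obj k Y" "gr_obj k X'" "gr_obj k Y'" "gr_obj k X''" "gr_obj k Y''"
    and F: "F \<in> gr_hom k X X'" "F' \<in> gr_hom k X' X''" and G: "G \<in> gr_hom k Y Y'" "G' \<in> gr_hom k Y' Y''"
  shows "gr_tens k F' G' \<cdot>\<^sub>g gr_tens k F G = gr_tens k (F' \<cdot>\<^sub>g F) (G' \<cdot>\<^sub>g G)"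
proof (rule gr_tens_hom_eqI[of X Y _ "gtens k X'' Y''"])
  have c: "F' \<cdot>\<^sub>g F \<in> gr_hom k X X''" "G' \<cdot>\<^sub>g G \<in> gr_hom k Y Y''"
    using F G by (auto intro!: gr_comp_hom)
  have t: "gr_tens k F G \<in> gr_hom k (gtens k X Y) (gtens k X' Y')"
    "gr_tens k F' G' \<in> gr_hom k (gtens k X' Y') (gtens k X'' Y'')"
    using F G by (auto intro!: gr_tens_hom)
  show "gr_tens k F' G' \<cdot>\<^sub>g gr_tens k F G \<in> gr_hom k (gtens k X Y) (gtens k X'' Y'')"
    using t by (intro gr_comp_hom) simp_all
  show "gr_tens k (F' \<cdot>\<^sub>g F) (G' \<cdot>\<^sub>g G) \<in> gr_hom k (gtens k X Y) (gtens k X'' Y'')"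
    using c by (intro gr_tens_hom) simp_all
  fix i x j y assume "x \<in> carrier (X i)" "y \<in> carrier (Y j)"
  then show "Map (gr_tens k F' G' \<cdot>\<^sub>g gr_tens k F G) (i + j) (ptens k X Y i x j y) =
      Map (gr_tens k (F' \<cdot>\<^sub>g F) (G' \<cdot>\<^sub>g G)) (i + j) (ptens k X Y i x j y)"
    using gr_hom_closed[OF F(1)] gr_hom_closed[OF G(1)]
    by (simp add: gr_comp_apply_hom[OF t(1)] gr_tens_apply[OF _ _ _ _ F(1) G(1)] gr_tens_apply[OF _ _ _ _ F(2) G(2)]
      gr_tens_apply[OF _ _ _ _ c] gr_comp_apply_hom[OF F(1)] gr_comp_apply_hom[OF G(1)])
qed simp_all

lemma gr_assoc_hom:
  "gr_obj k X \<Longrightarrow> gr_obj k Y \<Longrightarrow> gr_obj k Z \<Longrightarrow>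
   gr_assoc k X Y Z \<in> gr_hom k (gtens k (gtens k X Y) Z) (gtens k X (gtens k Y Z))"
  by (simp add: gr_hom_def gr_assoc_def tens_assoc_gmaps)

lemma gr_sym_hom: "gr_obj k X \<Longrightarrow> gr_obj k Y \<Longrightarrow> gr_sym k X Y \<in> gr_hom k (gtens k X Y) (gtens k Y X)"
  by (simp add: gr_hom_def gr_sym_def tens_sym_gmaps)

lemma gr_sym_apply:
  "gr_obj k X \<Longrightarrow> gr_obj k Y \<Longrightarrow> i + j = n \<Longrightarrow> x \<in> carrier (X i) \<Longrightarrow> y \<in> carrier (Y j) \<Longrightarrow>
   Map (gr_sym k X Y) n (ptens k X Y i x j y) = signed (gtens k Y X n) (i * j) (ptens k Y X j y i x)"
  by (simp add: gr_sym_def tens_sym_ptens)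

lemma gr_linv_hom: "gr_obj k X \<Longrightarrow> gr_linv k X \<in> gr_hom k X (gtens k (gunit k) X)"
  by (simp add: gr_hom_def gr_linv_def tens_linv_gmaps)

lemma gr_linv_apply:
  "gr_obj k X \<Longrightarrow> x \<in> carrier (X n) \<Longrightarrow> Map (gr_linv k X) n x = ptens k (gunit k) X 0 \<one> n x"
  by (simp add: gr_linv_def)

lemma gr_rinv_hom: "gr_obj k X \<Longrightarrow> gr_rinv k X \<in> gr_hom k X (gtens k X (gunit k))"
  by (simp add: gr_hom_def gr_rinv_def tens_rinv_gmaps)

lemma gr_curry_hom:
  "gr_obj k X \<Longrightarrow> gr_obj k Y \<Longrightarrow> gr_obj k Z \<Longrightarrow> F \<in> gr_hom k (gtens k X Y) Z \<Longrightarrow>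
   gr_curry k X Y F \<in> gr_hom k X (gihom k Y Z)"
  by (simp add: gr_hom_def gr_curry_def gcurry_gmaps)

lemma gr_curry_apply:
  "x \<in> carrier (X n) \<Longrightarrow> y \<in> carrier (Y p) \<Longrightarrow>
   Map (gr_curry k X Y F) n x p y = Map F (n + p) (ptens k X Y n x p y)"
  by (simp add: gr_curry_def)

lemma gr_icomp_hom:
  "gr_obj k X \<Longrightarrow> gr_obj k Y \<Longrightarrow> gr_obj k Z \<Longrightarrow>
   gr_icomp k X Y Z \<in> gr_hom k (gtens k (gihom k Y Z) (gihom k X Y)) (gihom k X Z)"
  by (simp add: gr_hom_def gr_icomp_def gicomp_gmaps)

lemma gr_ipost_hom:
  "gr_obj k X \<Longrightarrow> gr_obj k Y \<Longrightarrow> gr_obj k Z \<Longrightarrow> G \<in> gr_hom k Y Z \<Longrightarrow>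
   gr_ipost k X G \<in> gr_hom k (gihom k X Y) (gihom k X Z)"
  by (simp add: gr_hom_def gr_ipost_def gipost_gmaps)

lemma gr_ipost_apply:
  "G \<in> gr_hom k Y Z \<Longrightarrow> h \<in> carrier (gihom k X Y n) \<Longrightarrow> x \<in> carrier (X p) \<Longrightarrow>
   Map (gr_ipost k X G) n h p x = Map G (p + n) (h p x)"
  by (simp add: gr_hom_def gr_ipost_def)

lemma gr_ipre_hom:
  "gr_obj k X \<Longrightarrow> gr_obj k Y \<Longrightarrow> gr_obj k Z \<Longrightarrow> F \<in> gr_hom k X Y \<Longrightarrow>
   gr_ipre k F Z \<in> gr_hom k (gihom k Y Z) (gihom k X Z)"
  by (simp add: gr_hom_def gr_ipre_def gipre_gmaps)

lemma gr_ipre_apply: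
  "F \<in> gr_hom k X Y \<Longrightarrow> h \<in> carrier (gihom k Y Z n) \<Longrightarrow> x \<in> carrier (X p) \<Longrightarrow>
   Map (gr_ipre k F Z) n h p x = h p (Map F p x)"
  by (simp add: gr_hom_def gr_ipre_def)

lemma gr_dualmor_hom:
  assumes [simp]: "gr_obj k X" "gr_obj k Y"
  shows "gr_dualmor k X Y \<in> gr_hom k (gihom k X Y) (gihom k (gihom k Y (gunit k)) (gihom k X (gunit k)))"
  unfolding gr_dualmor_def
  by (intro gr_curry_hom gr_comp_hom[OF _ gr_sym_hom gr_icomp_hom]) simp_all

text \<open>Dualizing sends \<open>u\<close> to precomposition with \<open>u\<close>. The
  composition of inner homs takes \<open>l\<close> before \<open>u\<close>, and the symmetry that
  exchanges them contributes the sign.\<close>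

lemma gr_dualmor_apply:
  assumes [simp]: "gr_obj k X" "gr_obj k Y" and u: "u \<in> carrier (gihom k X Y i)"
    and l: "l \<in> carrier (gihom k Y (gunit k) j)" and x: "x \<in> carrier (X p)"
  shows "Map (gr_dualmor k X Y) i u j l p x = signed (gunit k (p + (i + j))) (i * j) (l (p + i) (u p x))"
proof -
  have c: "ptens k (gihom k Y (gunit k)) (gihom k X Y) j l i u \<in>
      carrier (gtens k (gihom k Y (gunit k)) (gihom k X Y) (i + j))"
    using u l by simp
  have e: "j + i = i + j" by simp
  have cc: "(\<lambda>p. \<lambda>x\<in>carrier (X p). l (p + i) (u p x)) \<in> carrier (gihom k X (gunit k) (i + j))"
    using gihom_comp_closed[OF _ _ _ l u, of "i + j"] by simp
  note icl = gmapsD[OF gicomp_gmaps[of X Y "gunit k"], of "i + j"]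
  have "Map (gr_dualmor k X Y) i u j l = Map (gr_icomp k X Y (gunit k)) (i + j)
      (signed (gtens k (gihom k Y (gunit k)) (gihom k X Y) (i + j)) (i * j) (ptens k (gihom k Y (gunit k)) (gihom k X Y) j l i u))"
    unfolding gr_dualmor_def using u l
    by (simp add: gr_curry_apply gr_comp_apply_hom[OF gr_sym_hom] gr_sym_apply)
  also have "\<dots> = signed (gihom k X (gunit k) (i + j)) (i * j) (\<lambda>p. \<lambda>x\<in>carrier (X p). l (p + i) (u p x))"
    unfolding gr_icomp_def using c l u
    by (simp add: lin_signed[OF icl] gicomp_ptens[OF _ _ _ e])
  finally show ?thesis using x cc by simp
qed

section \<open>Isomorphisms of graded modules\<close>

lemma gr_iso_hom: "gr_iso k X Y F \<Longrightarrow> F \<in> gr_hom k X Y"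
  by (simp add: gr_iso_def)

lemma gr_iso_mono:
  assumes I: "gr_iso k Y Z I" and obj: "gr_obj k X" "gr_obj k Y" "gr_obj k Z"
    and F: "F \<in> gr_hom k X Y" and G: "G \<in> gr_hom k X Y" and eq: "I \<cdot>\<^sub>g F = I \<cdot>\<^sub>g G"
  shows "F = G"
proof -
  obtain J where J: "J \<in> gr_hom k Z Y" "J \<cdot>\<^sub>g I = gr_id Y" using I by (auto simp: gr_iso_def)
  have "J \<cdot>\<^sub>g I \<cdot>\<^sub>g F = J \<cdot>\<^sub>g I \<cdot>\<^sub>g G" using eq by simp
  then show ?thesis
    using gr_comp_assoc[OF obj(1,2) F gr_iso_hom[OF I] J(1)] gr_comp_assoc[OF obj(1,2) G gr_iso_hom[OF I] J(1)]
    by (simp add: J(2) gr_id_left[OF obj(1,2) F] gr_id_left[OF obj(1,2) G])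
qed

lemma gr_iso_epi:
  assumes I: "gr_iso k W X I" and obj: "gr_obj k W" "gr_obj k X"
    and F: "F \<in> gr_hom k X Y" and G: "G \<in> gr_hom k X Y" and eq: "F \<cdot>\<^sub>g I = G \<cdot>\<^sub>g I"
  shows "F = G"
proof -
  obtain J where J: "J \<in> gr_hom k X W" "I \<cdot>\<^sub>g J = gr_id X" using I by (auto simp: gr_iso_def)
  have "(F \<cdot>\<^sub>g I) \<cdot>\<^sub>g J = (G \<cdot>\<^sub>g I) \<cdot>\<^sub>g J" using eq by simp
  then show ?thesis
    using gr_comp_assoc[OF obj(2,1) J(1) gr_iso_hom[OF I] F] gr_comp_assoc[OF obj(2,1) J(1) gr_iso_hom[OF I] G]
    by (simp add: J(2) gr_id_right[OF obj(2) F] gr_id_right[OF obj(2) G])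
qed

lemma gr_iso_comp:
  assumes F: "gr_iso k X Y F" and G: "gr_iso k Y Z G" and [simp]: "gr_obj k X" "gr_obj k Y" "gr_obj k Z"
  shows "gr_iso k X Z (G \<cdot>\<^sub>g F)"
proof -
  obtain F' where F': "F' \<in> gr_hom k Y X" "F' \<cdot>\<^sub>g F = gr_id X" "F \<cdot>\<^sub>g F' = gr_id Y" using F by (auto simp: gr_iso_def)
  obtain G' where G': "G' \<in> gr_hom k Z Y" "G' \<cdot>\<^sub>g G = gr_id Y" "G \<cdot>\<^sub>g G' = gr_id Z" using G by (auto simp: gr_iso_def)
  note h = gr_iso_hom[OF F] gr_iso_hom[OF G] F'(1) G'(1)
  have FG: "G \<cdot>\<^sub>g F \<in> gr_hom k X Z" "F' \<cdot>\<^sub>g G' \<in> gr_hom k Z X" using h by (auto intro!: gr_comp_hom)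
  have "(F' \<cdot>\<^sub>g G') \<cdot>\<^sub>g G \<cdot>\<^sub>g F = F' \<cdot>\<^sub>g (G' \<cdot>\<^sub>g G) \<cdot>\<^sub>g F"
    using h FG by (simp add: gr_comp_assoc[OF _ _ FG(1) G'(1) F'(1)] gr_comp_assoc[OF _ _ h(1,2) G'(1)])
  also have "\<dots> = gr_id X" using h F' G' by (simp add: gr_id_left[OF _ _ h(1)])
  finally have 1: "(F' \<cdot>\<^sub>g G') \<cdot>\<^sub>g G \<cdot>\<^sub>g F = gr_id X" .
  have "(G \<cdot>\<^sub>g F) \<cdot>\<^sub>g F' \<cdot>\<^sub>g G' = G \<cdot>\<^sub>g (F \<cdot>\<^sub>g F') \<cdot>\<^sub>g G'"
    using h FG by (simp add: gr_comp_assoc[OF _ _ FG(2) h(1,2)] gr_comp_assoc[OF _ _ G'(1) F'(1) h(1)])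
  also have "\<dots> = gr_id Z" using h F' G' by (simp add: gr_id_left[OF _ _ h(4)])
  finally have 2: "(G \<cdot>\<^sub>g F) \<cdot>\<^sub>g F' \<cdot>\<^sub>g G' = gr_id Z" .
  from 1 2 FG show ?thesis by (auto simp: gr_iso_def)
qed

text \<open>The inverse is additive and homogeneous because \<open>F\<close> is and \<open>F\<close>
  is injective.\<close>

lemma gr_isoI_bij:
  assumes F: "F \<in> gr_hom k X Y" and [simp]: "gr_obj k X" "gr_obj k Y"
    and inj: "\<And>n x y. x \<in> carrier (X n) \<Longrightarrow> y \<in> carrier (X n) \<Longrightarrow> Map F n x = Map F n y \<Longrightarrow> x = y"
    and surj: "\<And>n y. y \<in> carrier (Y n) \<Longrightarrow> \<exists>x\<in>carrier (X n). Map F n x = y"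
  shows "gr_iso k X Y F"
proof -
  note lin = gmapsD[OF gr_homD(3)[OF F]]
  define g where "g n = (\<lambda>y\<in>carrier (Y n). SOME x. x \<in> carrier (X n) \<and> Map F n x = y)" for n
  have g: "g n y \<in> carrier (X n)" "Map F n (g n y) = y" if "y \<in> carrier (Y n)" for n y
    using someI_ex[of "\<lambda>x. x \<in> carrier (X n) \<and> Map F n x = y"] surj[OF that] that by (auto simp: g_def)
  have gm: "g \<in> gmaps k Y X"
  proof (intro gmapsI linmapsI)
    fix n y y' assume y: "y \<in> carrier (Y n)" "y' \<in> carrier (Y n)"
    then show "g n (y \<oplus>\<^bsub>Y n\<^esub> y') = g n y \<oplus>\<^bsub>X n\<^esub> g n y'"
      by (intro inj[of _ n]) (simp_all add: g lin_add[OF lin])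
  next
    fix n a y assume "a \<in> carrier k" "y \<in> carrier (Y n)"
    then show "g n (a \<odot>\<^bsub>Y n\<^esub> y) = a \<odot>\<^bsub>X n\<^esub> g n y"
      by (intro inj[of _ n]) (simp_all add: g lin_smult[OF lin])
  qed (simp_all add: g, simp add: g_def)
  let ?G = "\<lparr>Dom = Y, Cod = X, Map = g\<rparr>"
  have G: "?G \<in> gr_hom k Y X" using gm by (simp add: gr_hom_def)
  have "?G \<cdot>\<^sub>g F = gr_id X"
  proof (rule gr_hom_eqI[of _ X X])
    fix n x assume "x \<in> carrier (X n)"
    then show "Map (?G \<cdot>\<^sub>g F) n x = Map (gr_id X) n x"
      using gr_hom_closed[OF F] by (simp add: gr_comp_apply_hom[OF F] gr_id_apply) (intro inj[of _ n], simp_all add: g)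
  qed (use F G in \<open>auto intro!: gr_comp_hom gr_id_hom\<close>)
  moreover have "F \<cdot>\<^sub>g ?G = gr_id Y"
  proof (rule gr_hom_eqI[of _ Y Y])
    fix n x assume "x \<in> carrier (Y n)"
    then show "Map (F \<cdot>\<^sub>g ?G) n x = Map (gr_id Y) n x"
      by (simp add: gr_comp_apply_hom[OF G] gr_id_apply g)
  qed (use F G in \<open>auto intro!: gr_comp_hom gr_id_hom\<close>)
  ultimately show ?thesis using F G by (auto simp: gr_iso_def)
qed

lemma gr_ipost_iso:
  assumes I: "gr_iso k Y Z I" and [simp]: "gr_obj k X" "gr_obj k Y" "gr_obj k Z"
  shows "gr_iso k (gihom k X Y) (gihom k X Z) (gr_ipost k X I)"
proof -
  obtain J where J: "J \<in> gr_hom k Z Y" "J \<cdot>\<^sub>g I = gr_id Y" "I \<cdot>\<^sub>g J = gr_id Z" using I by (auto simp: gr_iso_def)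
  note h = gr_iso_hom[OF I] J(1)
  have hh: "gr_ipost k X I \<in> gr_hom k (gihom k X Y) (gihom k X Z)" "gr_ipost k X J \<in> gr_hom k (gihom k X Z) (gihom k X Y)"
    using h by (auto intro!: gr_ipost_hom)
  have JI: "Map J n (Map I n y) = y" if "y \<in> carrier (Y n)" for n y
    using gr_comp_apply_hom[OF h(1) that, of J] that by (simp add: J gr_id_apply)
  have IJ: "Map I n (Map J n y) = y" if "y \<in> carrier (Z n)" for n y
    using gr_comp_apply_hom[OF h(2) that, of I] that by (simp add: J gr_id_apply)
  have "gr_ipost k X J \<cdot>\<^sub>g gr_ipost k X I = gr_id (gihom k X Y)"
  proof (rule gr_hom_eqI[of _ "gihom k X Y" "gihom k X Y"])
    fix n f assume f: "f \<in> carrier (gihom k X Y n)"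
    then have c: "Map (gr_ipost k X I) n f \<in> carrier (gihom k X Z n)" by (rule gr_hom_closed[OF hh(1)])
    show "Map (gr_ipost k X J \<cdot>\<^sub>g gr_ipost k X I) n f = Map (gr_id (gihom k X Y)) n f"
      unfolding gr_comp_apply_hom[OF hh(1) f] gr_id_apply[where X = "gihom k X Y", OF f]
      using f c gihom_closed[OF f _ refl]
      by (intro gihom_eqI[OF gr_hom_closed[OF hh(2)] f]) (simp_all add: gr_ipost_apply[OF h(1)] gr_ipost_apply[OF h(2)] JI)
  qed (use hh in \<open>auto intro!: gr_comp_hom gr_id_hom\<close>)
  moreover have "gr_ipost k X I \<cdot>\<^sub>g gr_ipost k X J = gr_id (gihom k X Z)"
  proof (rule gr_hom_eqI[of _ "gihom k X Z" "gihom k X Z"])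
    fix n f assume f: "f \<in> carrier (gihom k X Z n)"
    then have c: "Map (gr_ipost k X J) n f \<in> carrier (gihom k X Y n)" by (rule gr_hom_closed[OF hh(2)])
    show "Map (gr_ipost k X I \<cdot>\<^sub>g gr_ipost k X J) n f = Map (gr_id (gihom k X Z)) n f"
      unfolding gr_comp_apply_hom[OF hh(2) f] gr_id_apply[where X = "gihom k X Z", OF f]
      using f c gihom_closed[OF f _ refl]
      by (intro gihom_eqI[OF gr_hom_closed[OF hh(1)] f]) (simp_all add: gr_ipost_apply[OF h(1)] gr_ipost_apply[OF h(2)] IJ)
  qed (use hh in \<open>auto intro!: gr_comp_hom gr_id_hom\<close>)
  ultimately show ?thesis using hh by (auto simp: gr_iso_def)
qed

section \<open>Representatives of homotopy classes\<close>

lemma chain_map_cocycle: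
  assumes "K_obj k M" "K_obj k N" "f \<in> chain_maps k M N" "x \<in> cocycles M n"
  shows "f n x \<in> cocycles N n"
  using assms chain_maps_cocycles[OF assms(1,2), of f] by (intro kihom_cocycle_cocycle[OF assms(1,2), of f 0]) simp_all

lemma chain_map_coclass_cong:
  assumes [simp]: "K_obj k M" "K_obj k N" and f: "f \<in> chain_maps k M N"
    and x: "x \<in> cocycles M n" "y \<in> cocycles M n" "coclass M n x = coclass M n y"
  shows "coclass N n (f n x) = coclass N n (f n y)"
proof -
  have z: "f \<in> cocycles (kihom k M N) 0" using f by (simp flip: chain_maps_cocycles)
  have "x \<ominus>\<^bsub>Und M n\<^esub> y \<in> coboundaries M n" using x by (simp add: coclass_eq_iff)
  then have "f n (x \<ominus>\<^bsub>Und M n\<^esub> y) \<in> coboundaries N n" by (rule kihom_cocycle_coboundary[OF assms(1,2) z]) simp_all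
  then show ?thesis using x chain_map_cocycle[OF _ _ f] by (simp add: coclass_eq_iff lin_minus[OF chain_maps_lin[OF f]])
qed

lemma K_class_sel [simp]: "Dom (K_class k M N f) = M" "Cod (K_class k M N f) = N"
  by (simp_all add: K_class_def)

lemma K_homE:
  assumes "F \<in> K_hom k M N"
  obtains f where "f \<in> chain_maps k M N" "F = K_class k M N f"
proof -
  obtain f where "f \<in> chain_maps k M N" "Map F = homotopy k M N `` {f}" "Dom F = M" "Cod F = N"
    using assms by (auto simp: K_hom_def quotient_def)
  then show ?thesis using that by (cases F) (simp add: K_class_def)
qed

lemma K_class_hom: "f \<in> chain_maps k M N \<Longrightarrow> K_class k M N f \<in> K_hom k M N"
  by (auto simp: K_hom_def K_class_def quotient_def)

end

context ground_field
begin

section \<open>Operations on homotopy classes\<close>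

text \<open>Injectivity of \<open>theta\<close> in degree \<open>0\<close>. From here on the
  well-definedness of an operation on classes, and every equation between classes, is a computation
  on cocycles.\<close>

lemma homotopy_iff:
  assumes [simp]: "K_obj k M" "K_obj k N"
  shows "(f, g) \<in> homotopy k M N \<longleftrightarrow> f \<in> chain_maps k M N \<and> g \<in> chain_maps k M N \<and>
     (\<forall>n. \<forall>x\<in>cocycles M n. coclass N n (f n x) = coclass N n (g n x))"
proof -
  have "coclass (kihom k M N) 0 f = coclass (kihom k M N) 0 g \<longleftrightarrow>
      (\<forall>n. \<forall>x\<in>cocycles M n. coclass N n (f n x) = coclass N n (g n x))"
    if fg: "f \<in> chain_maps k M N" "g \<in> chain_maps k M N"
  proof -
    have z: "f \<in> cocycles (kihom k M N) 0" "g \<in> cocycles (kihom k M N) 0" using fg by (simp_all flip: chain_maps_cocycles)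
    show ?thesis
    proof (intro iffI allI ballI)
      fix n x assume eq: "coclass (kihom k M N) 0 f = coclass (kihom k M N) 0 g" and x: "x \<in> cocycles M n"
      show "coclass N n (f n x) = coclass N n (g n x)"
        using theta_apply[OF assms z(1) x, of n] theta_apply[OF assms z(2) x, of n] by (simp add: eq)
    next
      assume "\<forall>n. \<forall>x\<in>cocycles M n. coclass N n (f n x) = coclass N n (g n x)"
      then show "coclass (kihom k M N) 0 f = coclass (kihom k M N) 0 g" by (intro theta_inj z) simp_all
    qed
  qed
  then show ?thesis unfolding homotopy_coclass[OF assms] by blast
qed

lemma homotopyI:
  "K_obj k M \<Longrightarrow> K_obj k N \<Longrightarrow> f \<in> chain_maps k M N \<Longrightarrow> g \<in> chain_maps k M N \<Longrightarrow>
   (\<And>n x. x \<in> cocycles M n \<Longrightarrow> coclass N n (f n x) = coclass N n (g n x)) \<Longrightarrow> (f, g) \<in> homotopy k M N"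
  by (simp add: homotopy_iff)

lemma homotopyD:
  "(f, g) \<in> homotopy k M N \<Longrightarrow> K_obj k M \<Longrightarrow> K_obj k N \<Longrightarrow> x \<in> cocycles M n \<Longrightarrow> coclass N n (f n x) = coclass N n (g n x)"
  by (simp add: homotopy_iff)

lemma homotopy_chain: "(f, g) \<in> homotopy k M N \<Longrightarrow> f \<in> chain_maps k M N" "(f, g) \<in> homotopy k M N \<Longrightarrow> g \<in> chain_maps k M N"
  by (simp_all add: homotopy_def)

text \<open>\<open>homotopy_iff\<close> exhibits the relation as equality of the induced maps on
  classes, so symmetry and transitivity are immediate.\<close>

lemma homotopy_class_eq:
  assumes "K_obj k M" "K_obj k N" "(f, g) \<in> homotopy k M N"
  shows "homotopy k M N `` {f} = homotopy k M N `` {g}"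
  using assms by (auto simp: homotopy_iff)

lemma homotopy_refl: "K_obj k M \<Longrightarrow> K_obj k N \<Longrightarrow> f \<in> chain_maps k M N \<Longrightarrow> (f, f) \<in> homotopy k M N"
  by (simp add: homotopy_iff)

text \<open>The union in \<open>K_lift1\<close> runs over all representatives of the argument. If
  \<open>op\<close> respects homotopy, each member is the class of \<open>op f\<close>, and the
  index set contains \<open>f\<close>.\<close>

lemma K_lift1_class:
  assumes [simp]: "K_obj k A" "K_obj k B" "K_obj k M" "K_obj k N" and f: "f \<in> chain_maps k A B"
    and op: "\<And>f'. (f, f') \<in> homotopy k A B \<Longrightarrow> (op f, op f') \<in> homotopy k M N"
  shows "K_lift1 k M N op (K_class k A B f) = K_class k M N (op f)"
proof -
  have "homotopy k M N `` {op f'} = homotopy k M N `` {op f}" if "f' \<in> homotopy k A B `` {f}" for f'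
    using homotopy_class_eq[OF _ _ op[of f']] that by simp
  moreover have "f \<in> homotopy k A B `` {f}" using f by (simp add: homotopy_refl)
  ultimately have "(\<Union>f'\<in>homotopy k A B `` {f}. homotopy k M N `` {op f'}) = homotopy k M N `` {op f}" by blast
  then show ?thesis by (simp add: K_lift1_def K_class_def)
qed

lemma K_lift2_class:
  assumes [simp]: "K_obj k A" "K_obj k B" "K_obj k A'" "K_obj k B'" "K_obj k M" "K_obj k N"
    and f: "f \<in> chain_maps k A B" and g: "g \<in> chain_maps k A' B'"
    and op: "\<And>f' g'. (f, f') \<in> homotopy k A B \<Longrightarrow> (g, g') \<in> homotopy k A' B' \<Longrightarrow> (op f g, op f' g') \<in> homotopy k M N"
  shows "K_lift2 k M N op (K_class k A B f) (K_class k A' B' g) = K_class k M N (op f g)"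
proof -
  have "homotopy k M N `` {op f' g'} = homotopy k M N `` {op f g}"
    if "f' \<in> homotopy k A B `` {f}" "g' \<in> homotopy k A' B' `` {g}" for f' g'
    using homotopy_class_eq[OF _ _ op[of f' g']] that by simp
  moreover have "f \<in> homotopy k A B `` {f}" "g \<in> homotopy k A' B' `` {g}" using f g by (simp_all add: homotopy_refl)
  ultimately have "(\<Union>f'\<in>homotopy k A B `` {f}. \<Union>g'\<in>homotopy k A' B' `` {g}. homotopy k M N `` {op f' g'}) =
    homotopy k M N `` {op f g}" by blast
  then show ?thesis by (simp add: K_lift2_def K_class_def)
qed

lemma K_class_eqI:
  "K_obj k M \<Longrightarrow> K_obj k N \<Longrightarrow> f \<in> chain_maps k M N \<Longrightarrow> g \<in> chain_maps k M N \<Longrightarrow>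
   (\<And>n x. x \<in> cocycles M n \<Longrightarrow> coclass N n (f n x) = coclass N n (g n x)) \<Longrightarrow> K_class k M N f = K_class k M N g"
  unfolding K_class_def by (subst homotopy_class_eq[OF _ _ homotopyI, of M N f g]) simp_all

text \<open>Not all cocycles of a tensor product are sums of tensors of cocycles, but their classes
  are, by surjectivity of the Kuenneth map; so tensors of cocycles suffice to compare two chain
  maps.\<close>

lemma ktens_homotopyI:
  assumes [simp]: "K_obj k M" "K_obj k N" "K_obj k P"
    and f: "f \<in> chain_maps k (ktens k M N) P" and g: "g \<in> chain_maps k (ktens k M N) P"
    and eq: "\<And>i x j y n. i + j = n \<Longrightarrow> x \<in> cocycles M i \<Longrightarrow> y \<in> cocycles N j \<Longrightarrow>
      coclass P n (f n (ptens k (Und M) (Und N) i x j y)) = coclass P n (g n (ptens k (Und M) (Und N) i x j y))"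
  shows "(f, g) \<in> homotopy k (ktens k M N) P"
proof (rule homotopyI)
  fix n t assume t: "t \<in> cocycles (ktens k M N) n"
  have z: "f \<in> cocycles (kihom k (ktens k M N) P) 0" "g \<in> cocycles (kihom k (ktens k M N) P) 0" using f g by (simp_all flip: chain_maps_cocycles)
  \<comment> \<open>The maps induced on cohomology, taken from \<open>theta\<close> because their
    linearity is then at hand; the induction over tensors needs it.\<close>
  define F where "F = theta k (ktens k M N) P 0 (coclass (kihom k (ktens k M N) P) 0 f) n"
  define G where "G = theta k (ktens k M N) P 0 (coclass (kihom k (ktens k M N) P) 0 g) n"
  have Fa: "F (coclass (ktens k M N) n t) = coclass P n (f n t)" if "t \<in> cocycles (ktens k M N) n" for t
    unfolding F_def using that by (intro theta_apply z) simp_all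
  have Ga: "G (coclass (ktens k M N) n t) = coclass P n (g n t)" if "t \<in> cocycles (ktens k M N) n" for t
    unfolding G_def using that by (intro theta_apply z) simp_all
  have lin: "F \<in> linmaps k (cohomology (ktens k M N) n) (cohomology P n)" "G \<in> linmaps k (cohomology (ktens k M N) n) (cohomology P n)"
    unfolding F_def G_def using gihomD[OF theta_closed[of "ktens k M N" P _ 0], of _ n] z by simp_all
  note kl = gmapsD[OF kunneth_gmaps[of M N]] 
  have K: "F (Map (kunneth k M N) n s) = G (Map (kunneth k M N) n s)" if "s \<in> carrier (gtens k (cohomology M) (cohomology N) n)" for s
    using that
  proof (induction rule: gtens_induct[OF cohomology_obj[OF assms(1)] cohomology_obj[OF assms(2)], consumes 1])
    case (1 i c j e)
    obtain x y where x: "x \<in> cocycles M i" "c = coclass M i x" and y: "y \<in> cocycles N j" "e = coclass N j y"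
      using 1 by (elim cohomologyE)
    then show ?case using 1(1) eq[OF 1(1) x(1) y(1)] ptens_cocycle[OF _ _ x(1) y(1) 1(1)]
      by (simp add: kunneth_ptens Fa Ga)
  next
    case (2 s t)
    then show ?case using lin_closed[OF kl]
      by (simp add: lin_add[OF kl] lin_add[OF lin(1)] lin_add[OF lin(2)])
  qed
  obtain s where "s \<in> carrier (gtens k (cohomology M) (cohomology N) n)" "Map (kunneth k M N) n s = coclass (ktens k M N) n t"
    using kunneth_surj[OF assms(1,2) coclass_closed[OF t]] .
  then show "coclass P n (f n t) = coclass P n (g n t)" using K Fa[OF t] Ga[OF t] by metis
qed (use f g in simp_all)

lemma K_comp_class:
  assumes [simp]: "K_obj k M" "K_obj k N" "K_obj k P" and f: "f \<in> chain_maps k M N" and g: "g \<in> chain_maps k N P"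
  shows "K_comp k (K_class k N P g) (K_class k M N f) = K_class k M P (gcomp (Und M) g f)"
proof -
  have "(gcomp (Und M) g f, gcomp (Und M) g' f') \<in> homotopy k M P"
    if h: "(g, g') \<in> homotopy k N P" "(f, f') \<in> homotopy k M N" for g' f'
  proof (rule homotopyI)
    note c = homotopy_chain[OF h(1)] homotopy_chain[OF h(2)]
    show "gcomp (Und M) g f \<in> chain_maps k M P" "gcomp (Und M) g' f' \<in> chain_maps k M P"
      using c by (auto intro!: gcomp_chain_map)
    fix n x assume x: "x \<in> cocycles M n"
    have z: "f n x \<in> cocycles N n" "f' n x \<in> cocycles N n"
      using chain_map_cocycle[OF _ _ c(3) x] chain_map_cocycle[OF _ _ c(4) x] by simp_all
    have "coclass P n (g n (f n x)) = coclass P n (g' n (f n x))" using homotopyD[OF h(1) _ _ z(1)] by simp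
    also have "\<dots> = coclass P n (g' n (f' n x))"
      using homotopyD[OF h(2) _ _ x] z c by (intro chain_map_coclass_cong[of N P]) simp_all
    finally show "coclass P n (gcomp (Und M) g f n x) = coclass P n (gcomp (Und M) g' f' n x)"
      using x by (simp add: gcomp_def)
  qed simp_all
  then show ?thesis unfolding K_comp_def K_class_sel by (intro K_lift2_class f g) simp_all
qed

lemma K_tens_class:
  assumes [simp]: "K_obj k M" "K_obj k N" "K_obj k M'" "K_obj k N'" and f: "f \<in> chain_maps k M M'" and g: "g \<in> chain_maps k N N'"
  shows "K_tens k (K_class k M M' f) (K_class k N N' g) =
    K_class k (ktens k M N) (ktens k M' N') (tens_map k (Und M) (Und N) (Und M') (Und N') f g)"
proof -
  have "(tens_map k (Und M) (Und N) (Und M') (Und N') f g, tens_map k (Und M) (Und N) (Und M') (Und N') f' g')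
      \<in> homotopy k (ktens k M N) (ktens k M' N')"
    if h: "(f, f') \<in> homotopy k M M'" "(g, g') \<in> homotopy k N N'" for f' g'
  proof (rule ktens_homotopyI)
    note c = homotopy_chain[OF h(1)] homotopy_chain[OF h(2)]
    show "tens_map k (Und M) (Und N) (Und M') (Und N') f g \<in> chain_maps k (ktens k M N) (ktens k M' N')"
      "tens_map k (Und M) (Und N) (Und M') (Und N') f' g' \<in> chain_maps k (ktens k M N) (ktens k M' N')"
      using c by (auto intro!: tens_map_chain_map)
    fix i x j y n assume n: "i + j = n" and x: "x \<in> cocycles M i" and y: "y \<in> cocycles N j"
    have z: "f i x \<in> cocycles M' i" "f' i x \<in> cocycles M' i" "g j y \<in> cocycles N' j" "g' j y \<in> cocycles N' j"
      using chain_map_cocycle[OF _ _ c(1) x] chain_map_cocycle[OF _ _ c(2) x]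
        chain_map_cocycle[OF _ _ c(3) y] chain_map_cocycle[OF _ _ c(4) y] by simp_all
    have "coclass (ktens k M' N') n (ptens k (Und M') (Und N') i (f i x) j (g j y)) =
      coclass (ktens k M' N') n (ptens k (Und M') (Und N') i (f' i x) j (g' j y))"
      using z homotopyD[OF h(1) _ _ x] homotopyD[OF h(2) _ _ y] by (intro ptens_coclass_cong n) simp_all
    then show "coclass (ktens k M' N') n (tens_map k (Und M) (Und N) (Und M') (Und N') f g n (ptens k (Und M) (Und N) i x j y)) =
      coclass (ktens k M' N') n (tens_map k (Und M) (Und N) (Und M') (Und N') f' g' n (ptens k (Und M) (Und N) i x j y))"
      using x y n by (simp add: tens_map_ptens[OF _ _ _ _ chain_maps_gmaps[OF c(1)] chain_maps_gmaps[OF c(3)]]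
        tens_map_ptens[OF _ _ _ _ chain_maps_gmaps[OF c(2)] chain_maps_gmaps[OF c(4)]])
  qed simp_all
  then show ?thesis unfolding K_tens_def K_class_sel by (intro K_lift2_class f g) simp_all
qed

text \<open>The values at \<open>x\<close> are themselves cocycles of an inner hom complex, so
  injectivity of \<open>theta\<close>, now in the degree of \<open>x\<close>, reduces the comparison
  to a second cocycle \<open>y\<close>. This uses \<open>theta\<close> outside degree
  \<open>0\<close>.\<close>

lemma kihom_homotopyI:
  assumes [simp]: "K_obj k M" "K_obj k N" "K_obj k P"
    and f: "f \<in> chain_maps k M (kihom k N P)" and g: "g \<in> chain_maps k M (kihom k N P)"
    and eq: "\<And>n x p y. x \<in> cocycles M n \<Longrightarrow> y \<in> cocycles N p \<Longrightarrow> coclass P (p + n) (f n x p y) = coclass P (p + n) (g n x p y)"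
  shows "(f, g) \<in> homotopy k M (kihom k N P)"
proof (rule homotopyI)
  fix n x assume x: "x \<in> cocycles M n"
  show "coclass (kihom k N P) n (f n x) = coclass (kihom k N P) n (g n x)"
    using x eq by (intro theta_inj chain_map_cocycle[OF _ _ f] chain_map_cocycle[OF _ _ g]) simp_all
qed (use f g in simp_all)

lemma K_curry_class:
  assumes [simp]: "K_obj k M" "K_obj k N" "K_obj k P" and f: "f \<in> chain_maps k (ktens k M N) P"
  shows "K_curry k M N (K_class k (ktens k M N) P f) = K_class k M (kihom k N P) (gcurry k (Und M) (Und N) f)"
proof -
  have "(gcurry k (Und M) (Und N) f, gcurry k (Und M) (Und N) f') \<in> homotopy k M (kihom k N P)"
    if h: "(f, f') \<in> homotopy k (ktens k M N) P" for f'
  proof (rule kihom_homotopyI)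
    show "gcurry k (Und M) (Und N) f \<in> chain_maps k M (kihom k N P)" "gcurry k (Und M) (Und N) f' \<in> chain_maps k M (kihom k N P)"
      using homotopy_chain[OF h] by (auto intro!: gcurry_chain_map)
    fix n x p y assume xy: "x \<in> cocycles M n" "y \<in> cocycles N p"
    have e: "n + p = p + n" by simp
    show "coclass P (p + n) (gcurry k (Und M) (Und N) f n x p y) = coclass P (p + n) (gcurry k (Und M) (Und N) f' n x p y)"
      using homotopyD[OF h _ _ ptens_cocycle[OF _ _ xy e]] xy by (simp add: e)
  qed simp_all
  then show ?thesis unfolding K_curry_def K_class_sel by (intro K_lift1_class f) simp_all
qed

lemma K_ipost_class:
  assumes [simp]: "K_obj k M" "K_obj k N" "K_obj k P" and g: "g \<in> chain_maps k N P"
  shows "K_ipost k M (K_class k N P g) = K_class k (kihom k M N) (kihom k M P) (gipost k (Und M) (Und N) g)"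
proof -
  have "(gipost k (Und M) (Und N) g, gipost k (Und M) (Und N) g') \<in> homotopy k (kihom k M N) (kihom k M P)"
    if h: "(g, g') \<in> homotopy k N P" for g'
  proof (rule kihom_homotopyI)
    show "gipost k (Und M) (Und N) g \<in> chain_maps k (kihom k M N) (kihom k M P)"
      "gipost k (Und M) (Und N) g' \<in> chain_maps k (kihom k M N) (kihom k M P)"
      using homotopy_chain[OF h] by (auto intro!: gipost_chain_map)
    fix n f p y assume f: "f \<in> cocycles (kihom k M N) n" and y: "y \<in> cocycles M p"
    show "coclass P (p + n) (gipost k (Und M) (Und N) g n f p y) = coclass P (p + n) (gipost k (Und M) (Und N) g' n f p y)"
      using homotopyD[OF h _ _ kihom_cocycle_cocycle[OF _ _ f y refl]] y cocycles_closed[OF f] by simp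
  qed simp_all
  then show ?thesis unfolding K_ipost_def K_class_sel by (intro K_lift1_class g) simp_all
qed

lemma K_ipre_class:
  assumes [simp]: "K_obj k M" "K_obj k N" "K_obj k P" and f: "f \<in> chain_maps k M N"
  shows "K_ipre k (K_class k M N f) P = K_class k (kihom k N P) (kihom k M P) (gipre k (Und M) (Und N) (Und P) f)"
proof -
  have "(gipre k (Und M) (Und N) (Und P) f, gipre k (Und M) (Und N) (Und P) f') \<in> homotopy k (kihom k N P) (kihom k M P)"
    if h: "(f, f') \<in> homotopy k M N" for f'
  proof (rule kihom_homotopyI)
    note c = homotopy_chain[OF h]
    show "gipre k (Und M) (Und N) (Und P) f \<in> chain_maps k (kihom k N P) (kihom k M P)"
      "gipre k (Und M) (Und N) (Und P) f' \<in> chain_maps k (kihom k N P) (kihom k M P)"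
      using c by (auto intro!: gipre_chain_map)
    fix n u p y assume u: "u \<in> cocycles (kihom k N P) n" and y: "y \<in> cocycles M p"
    have z: "f p y \<in> cocycles N p" "f' p y \<in> cocycles N p"
      using chain_map_cocycle[OF _ _ c(1) y] chain_map_cocycle[OF _ _ c(2) y] by simp_all
    have "coclass P (p + n) (u p (f p y)) = coclass P (p + n) (u p (f' p y))"
      using homotopyD[OF h _ _ y] theta_apply[OF _ _ u z(1) refl] theta_apply[OF _ _ u z(2) refl] by simp
    then show "coclass P (p + n) (gipre k (Und M) (Und N) (Und P) f n u p y) = coclass P (p + n) (gipre k (Und M) (Und N) (Und P) f' n u p y)"
      using y cocycles_closed[OF u] by simp
  qed simp_all
  then show ?thesis unfolding K_ipre_def K_class_sel by (intro K_lift1_class f) simp_all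
qed

section \<open>Cohomology is full and faithful\<close>

lemma H_map_sel [simp]: "Dom (H_map F) = cohomology (Dom F)" "Cod (H_map F) = cohomology (Cod F)"
  by (simp_all add: H_map_def)

lemma H_map_apply:
  assumes [simp]: "K_obj k M" "K_obj k N" and f: "f \<in> chain_maps k M N" and x: "x \<in> cocycles M n"
  shows "Map (H_map (K_class k M N f)) n (coclass M n x) = coclass N n (f n x)"
proof -
  have "(\<Union>x'\<in>coclass M n x. coclass N n (f' n x')) = coclass N n (f n x)" if h: "f' \<in> homotopy k M N `` {f}" for f'
  proof -
    have h': "(f, f') \<in> homotopy k M N" using h by simp
    have "(\<Union>x'\<in>coclass M n x. coclass N n (f' n x')) = coclass N n (f' n x)"
    proof (rule UN_coclass[OF _ x])
      fix y assume "y \<in> cocycles M n" "coclass M n y = coclass M n x"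
      then show "coclass N n (f' n y) = coclass N n (f' n x)"
        by (intro chain_map_coclass_cong[OF _ _ homotopy_chain(2)[OF h']] x) simp_all
    qed simp
    then show ?thesis using homotopyD[OF h' _ _ x] by simp
  qed
  then have "(\<Union>f'\<in>homotopy k M N `` {f}. \<Union>x'\<in>coclass M n x. coclass N n (f' n x')) = (\<Union>f'\<in>homotopy k M N `` {f}. coclass N n (f n x))"
    by (rule SUP_cong[OF refl])
  also have "\<dots> = coclass N n (f n x)" using homotopy_refl[OF assms(1,2) f] by auto
  finally show ?thesis using x by (simp add: H_map_def K_class_def)
qed

lemma H_map_hom:
  assumes [simp]: "K_obj k M" "K_obj k N" and F: "F \<in> K_hom k M N"
  shows "H_map F \<in> gr_hom k (cohomology M) (cohomology N)"
proof -
  obtain f where f: "f \<in> chain_maps k M N" "F = K_class k M N f" using K_homE[OF F] .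
  note a = H_map_apply[OF assms(1,2) f(1)] and z = chain_map_cocycle[OF assms(1,2) f(1)] and l = chain_maps_lin[OF f(1)]
  have "Map (H_map F) \<in> gmaps k (cohomology M) (cohomology N)"
    unfolding f(2)
  proof (intro gmapsI linmapsI)
    fix n c assume "c \<notin> carrier (cohomology M n)"
    then show "Map (H_map (K_class k M N f)) n c = undefined" by (simp add: H_map_def)
  next
    fix n c assume "c \<in> carrier (cohomology M n)"
    then obtain x where x: "x \<in> cocycles M n" "c = coclass M n x" by (rule cohomologyE)
    then show "Map (H_map (K_class k M N f)) n c \<in> carrier (cohomology N n)" by (simp add: a z)
    fix c' assume "c' \<in> carrier (cohomology M n)"
    then obtain x' where x': "x' \<in> cocycles M n" "c' = coclass M n x'" by (rule cohomologyE)
    show "Map (H_map (K_class k M N f)) n (c \<oplus>\<^bsub>cohomology M n\<^esub> c') =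
       Map (H_map (K_class k M N f)) n c \<oplus>\<^bsub>cohomology N n\<^esub> Map (H_map (K_class k M N f)) n c'"
      using x x' by (simp add: a z lin_add[OF l] flip: coclass_add)
  next
    fix n b c assume b: "b \<in> carrier k" and "c \<in> carrier (cohomology M n)"
    then obtain x where x: "x \<in> cocycles M n" "c = coclass M n x" by (elim cohomologyE)
    then show "Map (H_map (K_class k M N f)) n (b \<odot>\<^bsub>cohomology M n\<^esub> c) = b \<odot>\<^bsub>cohomology N n\<^esub> Map (H_map (K_class k M N f)) n c"
      using b by (simp add: a z lin_smult[OF l] flip: coclass_smult)
  qed
  then show ?thesis by (simp add: gr_hom_def f(2))
qed

lemma H_map_faithful:
  assumes [simp]: "K_obj k M" "K_obj k N" and F: "F \<in> K_hom k M N" and G: "G \<in> K_hom k M N" and eq: "H_map F = H_map G"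
  shows "F = G"
proof -
  obtain f where f: "f \<in> chain_maps k M N" "F = K_class k M N f" using K_homE[OF F] .
  obtain g where g: "g \<in> chain_maps k M N" "G = K_class k M N g" using K_homE[OF G] .
  show ?thesis unfolding f(2) g(2)
  proof (rule K_class_eqI)
    fix n x assume x: "x \<in> cocycles M n"
    show "coclass N n (f n x) = coclass N n (g n x)"
      using H_map_apply[OF assms(1,2) f(1) x] H_map_apply[OF assms(1,2) g(1) x] eq by (simp add: f(2) g(2))
  qed (use f g in simp_all)
qed

text \<open>A graded map is an element of degree \<open>0\<close> of the graded inner hom. Its
  preimage under \<open>theta\<close> is the class of a cocycle of degree \<open>0\<close>, that is,
  of a chain map.\<close>

lemma H_map_full:
  assumes [simp]: "K_obj k M" "K_obj k N" and \<Phi>: "\<Phi> \<in> gr_hom k (cohomology M) (cohomology N)"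
  obtains F where "F \<in> K_hom k M N" "H_map F = \<Phi>"
proof -
  have "Map \<Phi> \<in> carrier (gihom k (cohomology M) (cohomology N) 0)"
    using gr_homD(3)[OF \<Phi>] by (simp add: gihom_carrier gmapsD)
  then obtain f where f: "f \<in> cocycles (kihom k M N) 0" "theta k M N 0 (coclass (kihom k M N) 0 f) = Map \<Phi>"
    using theta_surj[OF assms(1,2)] by blast
  then have c: "f \<in> chain_maps k M N" by (simp add: chain_maps_cocycles)
  have "H_map (K_class k M N f) = \<Phi>"
  proof (rule gr_hom_eqI[OF H_map_hom[OF _ _ K_class_hom[OF c]] \<Phi>])
    fix n e assume "e \<in> carrier (cohomology M n)"
    then obtain x where x: "x \<in> cocycles M n" "e = coclass M n x" by (rule cohomologyE)
    then show "Map (H_map (K_class k M N f)) n e = Map \<Phi> n e"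
      using theta_apply[OF assms(1,2) f(1) x(1), of n] by (simp add: H_map_apply[OF _ _ c] f(2))
  qed simp_all
  then show ?thesis using that K_class_hom[OF c] by auto
qed

end

section \<open>Compatibility with the closed symmetric monoidal structures\<close>

context ground_field
begin

section \<open>Arrows of the homotopy category\<close>

lemma K_comp_hom:
  assumes "K_obj k M" "K_obj k N" "K_obj k P" "F \<in> K_hom k M N" "G \<in> K_hom k N P"
  shows "K_comp k G F \<in> K_hom k M P"
proof -
  obtain f where f: "f \<in> chain_maps k M N" "F = K_class k M N f" using K_homE[OF assms(4)] .
  obtain g where g: "g \<in> chain_maps k N P" "G = K_class k N P g" using K_homE[OF assms(5)] .
  show ?thesis unfolding f(2) g(2) K_comp_class[OF assms(1-3) f(1) g(1)]
    by (intro K_class_hom gcomp_chain_map[OF assms(1) f(1) g(1)])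
qed

lemma K_id_hom: "K_obj k M \<Longrightarrow> K_id k M \<in> K_hom k M M"
  unfolding K_id_def by (intro K_class_hom gid_chain_map)

lemma K_tens_hom:
  assumes "K_obj k M" "K_obj k N" "K_obj k M'" "K_obj k N'" "F \<in> K_hom k M M'" "G \<in> K_hom k N N'"
  shows "K_tens k F G \<in> K_hom k (ktens k M N) (ktens k M' N')"
proof -
  obtain f where f: "f \<in> chain_maps k M M'" "F = K_class k M M' f" using K_homE[OF assms(5)] .
  obtain g where g: "g \<in> chain_maps k N N'" "G = K_class k N N' g" using K_homE[OF assms(6)] .
  show ?thesis unfolding f(2) g(2) K_tens_class[OF assms(1-4) f(1) g(1)]
    by (intro K_class_hom tens_map_chain_map[OF assms(1-4) f(1) g(1)])
qed

lemma K_assoc_hom: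
  "K_obj k M \<Longrightarrow> K_obj k N \<Longrightarrow> K_obj k P \<Longrightarrow> K_assoc k M N P \<in> K_hom k (ktens k (ktens k M N) P) (ktens k M (ktens k N P))"
  unfolding K_assoc_def by (intro K_class_hom tens_assoc_chain_map)

lemma K_sym_hom: "K_obj k M \<Longrightarrow> K_obj k N \<Longrightarrow> K_sym k M N \<in> K_hom k (ktens k M N) (ktens k N M)"
  unfolding K_sym_def by (intro K_class_hom tens_sym_chain_map)

lemma K_linv_hom: "K_obj k M \<Longrightarrow> K_linv k M \<in> K_hom k M (ktens k (kunit k) M)"
  unfolding K_linv_def by (intro K_class_hom tens_linv_chain_map)

lemma K_rinv_hom: "K_obj k M \<Longrightarrow> K_rinv k M \<in> K_hom k M (ktens k M (kunit k))"
  unfolding K_rinv_def by (intro K_class_hom tens_rinv_chain_map)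

lemma K_icomp_hom:
  "K_obj k M \<Longrightarrow> K_obj k N \<Longrightarrow> K_obj k P \<Longrightarrow> K_icomp k M N P \<in> K_hom k (ktens k (kihom k N P) (kihom k M N)) (kihom k M P)"
  unfolding K_icomp_def by (intro K_class_hom gicomp_chain_map)

lemma K_curry_hom:
  assumes "K_obj k M" "K_obj k N" "K_obj k P" "F \<in> K_hom k (ktens k M N) P"
  shows "K_curry k M N F \<in> K_hom k M (kihom k N P)"
proof -
  obtain f where f: "f \<in> chain_maps k (ktens k M N) P" "F = K_class k (ktens k M N) P f" using K_homE[OF assms(4)] .
  show ?thesis unfolding f(2) K_curry_class[OF assms(1-3) f(1)]
    by (intro K_class_hom gcurry_chain_map[OF assms(1-3) f(1)])
qed

lemma K_ipost_hom:
  assumes "K_obj k M" "K_obj k N" "K_obj k P" "G \<in> K_hom k N P"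
  shows "K_ipost k M G \<in> K_hom k (kihom k M N) (kihom k M P)"
proof -
  obtain g where g: "g \<in> chain_maps k N P" "G = K_class k N P g" using K_homE[OF assms(4)] .
  show ?thesis unfolding g(2) K_ipost_class[OF assms(1-3) g(1)]
    by (intro K_class_hom gipost_chain_map[OF assms(1-3) g(1)])
qed

lemma K_ipre_hom:
  assumes "K_obj k M" "K_obj k N" "K_obj k P" "F \<in> K_hom k M N"
  shows "K_ipre k F P \<in> K_hom k (kihom k N P) (kihom k M P)"
proof -
  obtain f where f: "f \<in> chain_maps k M N" "F = K_class k M N f" using K_homE[OF assms(4)] .
  show ?thesis unfolding f(2) K_ipre_class[OF assms(1-3) f(1)]
    by (intro K_class_hom gipre_chain_map[OF assms(1-3) f(1)])
qed

lemma K_dualmor_hom: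
  "K_obj k M \<Longrightarrow> K_obj k N \<Longrightarrow>
   K_dualmor k M N \<in> K_hom k (kihom k M N) (kihom k (kihom k N (kunit k)) (kihom k M (kunit k)))"
  unfolding K_dualmor_def
  by (intro K_curry_hom K_comp_hom[OF _ _ _ K_sym_hom K_icomp_hom]) simp_all

section \<open>Compatibility with composition and tensor products\<close>

lemma H_map_comp:
  assumes [simp]: "K_obj k M" "K_obj k N" "K_obj k P" and F: "F \<in> K_hom k M N" and G: "G \<in> K_hom k N P"
  shows "H_map (K_comp k G F) = H_map G \<cdot>\<^sub>g H_map F"
proof (rule gr_hom_eqI[of _ "cohomology M" "cohomology P"])
  show "H_map (K_comp k G F) \<in> gr_hom k (cohomology M) (cohomology P)"
    by (intro H_map_hom K_comp_hom[OF _ _ _ F G]) simp_all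
  show "H_map G \<cdot>\<^sub>g H_map F \<in> gr_hom k (cohomology M) (cohomology P)"
    by (intro gr_comp_hom[OF _ H_map_hom[OF _ _ F] H_map_hom[OF _ _ G]]) simp_all
  fix n c assume "c \<in> carrier (cohomology M n)"
  then obtain x where x: "x \<in> cocycles M n" "c = coclass M n x" by (rule cohomologyE)
  obtain f where f: "f \<in> chain_maps k M N" "F = K_class k M N f" using K_homE[OF F] .
  obtain g where g: "g \<in> chain_maps k N P" "G = K_class k N P g" using K_homE[OF G] .
  show "Map (H_map (K_comp k G F)) n c = Map (H_map G \<cdot>\<^sub>g H_map F) n c"
    unfolding x(2) f(2) g(2) K_comp_class[OF assms(1-3) f(1) g(1)]
    using x H_map_apply[OF _ _ gcomp_chain_map[OF assms(1) f(1) g(1)] x(1)]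
    by (simp add: gr_comp_apply H_map_apply[OF _ _ f(1)] H_map_apply[OF _ _ g(1)] chain_map_cocycle[OF _ _ f(1)] gcomp_def)
qed

lemma H_map_id: "K_obj k M \<Longrightarrow> H_map (K_id k M) = gr_id (cohomology M)"
proof (rule gr_hom_eqI[of _ "cohomology M" "cohomology M"])
  assume M [simp]: "K_obj k M"
  show "H_map (K_id k M) \<in> gr_hom k (cohomology M) (cohomology M)" by (intro H_map_hom K_id_hom) simp_all
  show "gr_id (cohomology M) \<in> gr_hom k (cohomology M) (cohomology M)" by (intro gr_id_hom) simp
  fix n c assume c: "c \<in> carrier (cohomology M n)"
  then obtain x where x: "x \<in> cocycles M n" "c = coclass M n x" by (rule cohomologyE)
  show "Map (H_map (K_id k M)) n c = Map (gr_id (cohomology M)) n c"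
    unfolding K_id_def using H_map_apply[OF _ _ gid_chain_map x(1)] x(1) gr_id_apply[where X = "cohomology M", OF c]
    by (simp add: gid_def x(2))
qed

lemma kunneth_hom:
  "K_obj k M \<Longrightarrow> K_obj k N \<Longrightarrow> kunneth k M N \<in> gr_hom k (gtens k (cohomology M) (cohomology N)) (cohomology (ktens k M N))"
  by (intro gr_homI kunneth_gmaps) (simp_all add: kunneth_def)

lemma kunneth_epi:
  assumes [simp]: "K_obj k M" "K_obj k N"
    and F: "F \<in> gr_hom k (cohomology (ktens k M N)) Z" and G: "G \<in> gr_hom k (cohomology (ktens k M N)) Z"
    and eq: "F \<cdot>\<^sub>g kunneth k M N = G \<cdot>\<^sub>g kunneth k M N"
  shows "F = G"
proof (rule gr_hom_eqI[OF F G])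
  fix n c assume "c \<in> carrier (cohomology (ktens k M N) n)"
  then obtain s where s: "s \<in> carrier (gtens k (cohomology M) (cohomology N) n)" "Map (kunneth k M N) n s = c"
    using kunneth_surj[OF assms(1,2)] by blast
  have "Map (F \<cdot>\<^sub>g kunneth k M N) n s = Map (G \<cdot>\<^sub>g kunneth k M N) n s" using eq by simp
  then show "Map F n c = Map G n c" using s by (simp add: gr_comp_apply_hom[OF kunneth_hom])
qed

text \<open>Naturality of the Kuenneth map; both sides send \<open>[x] \<otimes> [y]\<close> to the
  class of \<open>f x \<otimes> g y\<close>. Together with \<open>H_map_assoc\<close> and
  \<open>H_map_sym\<close> this is the part of the lax symmetric monoidal structure that concerns
  products.\<close>

lemma H_map_tens:
  assumes [simp]: "K_obj k M" "K_obj k N" "K_obj k M'" "K_obj k N'" and F: "F \<in> K_hom k M M'" and G: "G \<in> K_hom k N N'"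
  shows "H_map (K_tens k F G) \<cdot>\<^sub>g kunneth k M N = kunneth k M' N' \<cdot>\<^sub>g gr_tens k (H_map F) (H_map G)"
proof (rule gr_tens_hom_eqI[of "cohomology M" "cohomology N" _ "cohomology (ktens k M' N')"])
  note HF = H_map_hom[OF assms(1,3) F] and HG = H_map_hom[OF assms(2,4) G]
  have HFG: "H_map (K_tens k F G) \<in> gr_hom k (cohomology (ktens k M N)) (cohomology (ktens k M' N'))"
    by (intro H_map_hom K_tens_hom F G) simp_all
  have T: "gr_tens k (H_map F) (H_map G) \<in> gr_hom k (gtens k (cohomology M) (cohomology N)) (gtens k (cohomology M') (cohomology N'))"
    by (intro gr_tens_hom HF HG) simp_all
  show "H_map (K_tens k F G) \<cdot>\<^sub>g kunneth k M N \<in> gr_hom k (gtens k (cohomology M) (cohomology N)) (cohomology (ktens k M' N'))"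
    by (intro gr_comp_hom[OF _ kunneth_hom HFG]) simp_all
  show "kunneth k M' N' \<cdot>\<^sub>g gr_tens k (H_map F) (H_map G) \<in> gr_hom k (gtens k (cohomology M) (cohomology N)) (cohomology (ktens k M' N'))"
    by (intro gr_comp_hom[OF _ T kunneth_hom]) simp_all
  fix i c j e assume "c \<in> carrier (cohomology M i)" "e \<in> carrier (cohomology N j)"
  then obtain x y where x: "x \<in> cocycles M i" "c = coclass M i x" and y: "y \<in> cocycles N j" "e = coclass N j y"
    by (elim cohomologyE)
  obtain f where f: "f \<in> chain_maps k M M'" "F = K_class k M M' f" using K_homE[OF F] .
  obtain g where g: "g \<in> chain_maps k N N'" "G = K_class k N N' g" using K_homE[OF G] .
  have L: "Map (H_map (K_tens k F G)) (i + j) (coclass (ktens k M N) (i + j) (ptens k (Und M) (Und N) i x j y)) =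
     coclass (ktens k M' N') (i + j) (ptens k (Und M') (Und N') i (f i x) j (g j y))"
    unfolding f(2) g(2) K_tens_class[OF assms(1-4) f(1) g(1)]
    using H_map_apply[OF _ _ tens_map_chain_map[OF assms(1-4) f(1) g(1)] ptens_cocycle[OF assms(1,2) x(1) y(1) refl]] x(1) y(1)
    by (simp add: tens_map_ptens[OF _ _ _ _ chain_maps_gmaps[OF f(1)] chain_maps_gmaps[OF g(1)]])
  have FX: "Map (H_map F) i (coclass M i x) = coclass M' i (f i x)" unfolding f(2) using x f by (intro H_map_apply) simp_all
  have GY: "Map (H_map G) j (coclass N j y) = coclass N' j (g j y)" unfolding g(2) using y g by (intro H_map_apply) simp_all
  have z: "f i x \<in> cocycles M' i" "g j y \<in> cocycles N' j"
    using chain_map_cocycle[OF _ _ f(1) x(1)] chain_map_cocycle[OF _ _ g(1) y(1)] by simp_all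
  show "Map (H_map (K_tens k F G) \<cdot>\<^sub>g kunneth k M N) (i + j) (ptens k (cohomology M) (cohomology N) i c j e) =
     Map (kunneth k M' N' \<cdot>\<^sub>g gr_tens k (H_map F) (H_map G)) (i + j) (ptens k (cohomology M) (cohomology N) i c j e)"
    using x y z by (simp add: gr_comp_apply_hom[OF kunneth_hom] gr_comp_apply_hom[OF T] kunneth_ptens L
        gr_tens_apply[OF _ _ _ _ HF HG refl] FX GY)
qed simp_all

text \<open>Both sides send \<open>([x] \<otimes> [y]) \<otimes> [z]\<close> to the class of
  \<open>x \<otimes> (y \<otimes> z)\<close>.\<close>

lemma H_map_assoc:
  assumes [simp]: "K_obj k M" "K_obj k N" "K_obj k P"
  shows "H_map (K_assoc k M N P) \<cdot>\<^sub>g kunneth k (ktens k M N) P \<cdot>\<^sub>g gr_tens k (kunneth k M N) (gr_id (cohomology P)) =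
    kunneth k M (ktens k N P) \<cdot>\<^sub>g gr_tens k (gr_id (cohomology M)) (kunneth k N P) \<cdot>\<^sub>g
      gr_assoc k (cohomology M) (cohomology N) (cohomology P)" (is "?L = ?R")
proof -
  let ?S = "gtens k (gtens k (cohomology M) (cohomology N)) (cohomology P)" and ?T = "cohomology (ktens k M (ktens k N P))"
  have H: "H_map (K_assoc k M N P) \<in> gr_hom k (cohomology (ktens k (ktens k M N) P)) ?T"
    by (intro H_map_hom K_assoc_hom) simp_all
  have k1: "kunneth k (ktens k M N) P \<in> gr_hom k (gtens k (cohomology (ktens k M N)) (cohomology P)) (cohomology (ktens k (ktens k M N) P))"
    by (intro kunneth_hom) simp_all
  have k2: "gr_tens k (kunneth k M N) (gr_id (cohomology P)) \<in> gr_hom k ?S (gtens k (cohomology (ktens k M N)) (cohomology P))"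
    by (intro gr_tens_hom kunneth_hom gr_id_hom) simp_all
  have k3: "kunneth k M (ktens k N P) \<in> gr_hom k (gtens k (cohomology M) (cohomology (ktens k N P))) ?T"
    by (intro kunneth_hom) simp_all
  have k4: "gr_tens k (gr_id (cohomology M)) (kunneth k N P) \<in> gr_hom k (gtens k (cohomology M) (gtens k (cohomology N) (cohomology P))) (gtens k (cohomology M) (cohomology (ktens k N P)))"
    by (intro gr_tens_hom kunneth_hom gr_id_hom) simp_all
  have k5: "gr_assoc k (cohomology M) (cohomology N) (cohomology P) \<in> gr_hom k ?S (gtens k (cohomology M) (gtens k (cohomology N) (cohomology P)))"
    by (intro gr_assoc_hom) simp_all
  have k12: "kunneth k (ktens k M N) P \<cdot>\<^sub>g gr_tens k (kunneth k M N) (gr_id (cohomology P)) \<in> gr_hom k ?S (cohomology (ktens k (ktens k M N) P))"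
    by (intro gr_comp_hom[OF _ k2 k1]) simp_all
  have k45: "gr_tens k (gr_id (cohomology M)) (kunneth k N P) \<cdot>\<^sub>g gr_assoc k (cohomology M) (cohomology N) (cohomology P) \<in> gr_hom k ?S (gtens k (cohomology M) (cohomology (ktens k N P)))"
    by (intro gr_comp_hom[OF _ k5 k4]) simp_all
  have L: "?L \<in> gr_hom k ?S ?T" by (intro gr_comp_hom[OF _ k12 H]) simp_all
  have R: "?R \<in> gr_hom k ?S ?T" by (intro gr_comp_hom[OF _ k45 k3]) simp_all
  have "Map ?L n = Map ?R n" for n
  proof (rule gtens_gtens_linmaps_eqI[OF _ _ _ _ gmapsD[OF gr_homD(3)[OF L]] gmapsD[OF gr_homD(3)[OF R]]])
    fix i c j e l d assume n: "i + j + l = n" and "c \<in> carrier (cohomology M i)" "e \<in> carrier (cohomology N j)" "d \<in> carrier (cohomology P l)"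
    then obtain x y z where x: "x \<in> cocycles M i" "c = coclass M i x" and y: "y \<in> cocycles N j" "e = coclass N j y"
      and z: "z \<in> cocycles P l" "d = coclass P l z" by (elim cohomologyE)
    have n': "i + (j + l) = n" using n by simp
    note [simp] = x(1) y(1) z(1)
    have xy: "ptens k (Und M) (Und N) i x j y \<in> cocycles (ktens k M N) (i + j)" by (intro ptens_cocycle) simp_all
    have yz: "ptens k (Und N) (Und P) j y l z \<in> cocycles (ktens k N P) (j + l)" by (intro ptens_cocycle) simp_all
    have xyz: "ptens k (gtens k (Und M) (Und N)) (Und P) (i + j) (ptens k (Und M) (Und N) i x j y) l z \<in> cocycles (ktens k (ktens k M N) P) n"
      using ptens_cocycle[OF _ _ xy z(1) n] by simp
    have hA: "Map (H_map (K_assoc k M N P)) n (coclass (ktens k (ktens k M N) P) n (ptens k (gtens k (Und M) (Und N)) (Und P) (i + j) (ptens k (Und M) (Und N) i x j y) l z)) =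
       coclass (ktens k M (ktens k N P)) n (ptens k (Und M) (gtens k (Und N) (Und P)) i x (j + l) (ptens k (Und N) (Und P) j y l z))"
      unfolding K_assoc_def using H_map_apply[OF _ _ tens_assoc_chain_map xyz] n by (simp add: tens_assoc_ptens)
    have kk: "Map (kunneth k (ktens k M N) P) n (ptens k (cohomology (ktens k M N)) (cohomology P) (i + j) (coclass (ktens k M N) (i + j) (ptens k (Und M) (Und N) i x j y)) l (coclass P l z)) =
       coclass (ktens k (ktens k M N) P) n (ptens k (gtens k (Und M) (Und N)) (Und P) (i + j) (ptens k (Und M) (Und N) i x j y) l z)"
      using kunneth_ptens[OF _ _ xy z(1) n] by simp
    have kk': "Map (kunneth k M (ktens k N P)) n (ptens k (cohomology M) (cohomology (ktens k N P)) i (coclass M i x) (j + l) (coclass (ktens k N P) (j + l) (ptens k (Und N) (Und P) j y l z))) =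
       coclass (ktens k M (ktens k N P)) n (ptens k (Und M) (gtens k (Und N) (Und P)) i x (j + l) (ptens k (Und N) (Und P) j y l z))"
      using kunneth_ptens[OF _ _ x(1) yz n'] by simp
    let ?p = "ptens k (gtens k (cohomology M) (cohomology N)) (cohomology P) (i + j) (ptens k (cohomology M) (cohomology N) i c j e) l d"
    have pc: "?p \<in> carrier (?S n)" using x y z n by simp
    have "Map ?L n ?p = coclass (ktens k M (ktens k N P)) n (ptens k (Und M) (gtens k (Und N) (Und P)) i x (j + l) (ptens k (Und N) (Und P) j y l z))"
      unfolding gr_comp_apply_hom[OF k12 pc] gr_comp_apply_hom[OF k2 pc]
      using n x y z by (simp add: gr_tens_apply[OF _ _ _ _ kunneth_hom gr_id_hom] kunneth_ptens gr_id_apply[where X = "cohomology P"] kk hA)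
    also have "\<dots> = Map ?R n ?p"
      unfolding gr_comp_apply_hom[OF k45 pc] gr_comp_apply_hom[OF k5 pc]
      using n n' x y z by (simp add: gr_assoc_def tens_assoc_ptens gr_tens_apply[OF _ _ _ _ gr_id_hom kunneth_hom] kunneth_ptens gr_id_apply[where X = "cohomology M"] kk')
    finally show "Map ?L n ?p = Map ?R n ?p" .
  qed simp_all
  then show ?thesis by (intro gr_hom_eqI[OF L R]) simp
qed

text \<open>The symmetry of graded modules and that of complexes carry the same sign, which passes
  through classes and through the linear Kuenneth map.\<close>

lemma H_map_sym:
  assumes [simp]: "K_obj k M" "K_obj k N"
  shows "H_map (K_sym k M N) \<cdot>\<^sub>g kunneth k M N = kunneth k N M \<cdot>\<^sub>g gr_sym k (cohomology M) (cohomology N)"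
proof (rule gr_tens_hom_eqI[of "cohomology M" "cohomology N" _ "cohomology (ktens k N M)"])
  have H: "H_map (K_sym k M N) \<in> gr_hom k (cohomology (ktens k M N)) (cohomology (ktens k N M))"
    by (intro H_map_hom K_sym_hom) simp_all
  have S: "gr_sym k (cohomology M) (cohomology N) \<in> gr_hom k (gtens k (cohomology M) (cohomology N)) (gtens k (cohomology N) (cohomology M))"
    by (intro gr_sym_hom) simp_all
  show "H_map (K_sym k M N) \<cdot>\<^sub>g kunneth k M N \<in> gr_hom k (gtens k (cohomology M) (cohomology N)) (cohomology (ktens k N M))"
    by (intro gr_comp_hom[OF _ kunneth_hom H]) simp_all
  show "kunneth k N M \<cdot>\<^sub>g gr_sym k (cohomology M) (cohomology N) \<in> gr_hom k (gtens k (cohomology M) (cohomology N)) (cohomology (ktens k N M))"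
    by (intro gr_comp_hom[OF _ S kunneth_hom]) simp_all
  fix i c j e assume "c \<in> carrier (cohomology M i)" "e \<in> carrier (cohomology N j)"
  then obtain x y where x: "x \<in> cocycles M i" "c = coclass M i x" and y: "y \<in> cocycles N j" "e = coclass N j y"
    by (elim cohomologyE)
  note [simp] = x(1) y(1)
  have e: "j + i = i + j" by simp
  note xy = ptens_cocycle[OF assms x(1) y(1) refl] and yx = ptens_cocycle[OF assms(2,1) y(1) x(1) e]
  have "Map (H_map (K_sym k M N)) (i + j) (coclass (ktens k M N) (i + j) (ptens k (Und M) (Und N) i x j y)) =
     coclass (ktens k N M) (i + j) (signed (gtens k (Und N) (Und M) (i + j)) (i * j) (ptens k (Und N) (Und M) j y i x))"
    unfolding K_sym_def using H_map_apply[OF _ _ tens_sym_chain_map xy] by (simp add: tens_sym_ptens)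
  also have "\<dots> = signed (cohomology (ktens k N M) (i + j)) (i * j) (coclass (ktens k N M) (i + j) (ptens k (Und N) (Und M) j y i x))"
    using coclass_signed[of "ktens k N M", OF _ yx] by simp
  also have "\<dots> = signed (cohomology (ktens k N M) (i + j)) (i * j) (Map (kunneth k N M) (i + j) (ptens k (cohomology N) (cohomology M) j (coclass N j y) i (coclass M i x)))"
    using kunneth_ptens[OF assms(2,1) y(1) x(1) e] by simp
  also have "\<dots> = Map (kunneth k N M) (i + j) (signed (gtens k (cohomology N) (cohomology M) (i + j)) (i * j) (ptens k (cohomology N) (cohomology M) j (coclass N j y) i (coclass M i x)))"
    using e by (intro lin_signed[OF gmapsD[OF kunneth_gmaps], symmetric]) simp_all
  finally show "Map (H_map (K_sym k M N) \<cdot>\<^sub>g kunneth k M N) (i + j) (ptens k (cohomology M) (cohomology N) i c j e) =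
     Map (kunneth k N M \<cdot>\<^sub>g gr_sym k (cohomology M) (cohomology N)) (i + j) (ptens k (cohomology M) (cohomology N) i c j e)"
    by (simp add: x y gr_comp_apply_hom[OF kunneth_hom] gr_comp_apply_hom[OF S] kunneth_ptens gr_sym_apply)
qed simp_all

section \<open>The unit complex\<close>

lemma cocycles_kunit: "cocycles (kunit k) n = carrier (gunit k n)"
  by (auto simp: cocycles_def)

text \<open>The differential is zero, so zero is the only boundary and classes are
  singletons.\<close>

lemma coclass_kunit: "a \<in> carrier (gunit k n) \<Longrightarrow> coclass (kunit k) n a = {a}"
proof -
  assume a: "a \<in> carrier (gunit k n)"
  have "coboundaries (kunit k) n = {\<zero>}" unfolding coboundaries_def by (auto intro!: image_eqI[of _ _ \<zero>])
  then show ?thesis using gunit_carrier_subset[OF a] by (simp add: coclass_def a_r_coset_def')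
qed

lemma kunneth_unit_hom: "kunneth_unit k \<in> gr_hom k (gunit k) (cohomology (kunit k))"
proof (intro gr_homI gmapsI)
  fix n
  show "Map (kunneth_unit k) n \<in> linmaps k (gunit k n) (cohomology (kunit k) n)"
    unfolding kunneth_unit_def using coclass_add[of "kunit k" _ n] coclass_smult[of "kunit k" _ _ n]
    by (auto simp: cocycles_kunit intro!: linmaps_restrictI coclass_closed)
qed (simp_all add: kunneth_unit_def)

lemma kunneth_unit_apply: "a \<in> carrier (gunit k n) \<Longrightarrow> Map (kunneth_unit k) n a = coclass (kunit k) n a"
  by (simp add: kunneth_unit_def)

lemma kunneth_unit_iso: "gr_iso k (gunit k) (cohomology (kunit k)) (kunneth_unit k)"
proof (rule gr_isoI_bij[OF kunneth_unit_hom])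
  fix n y assume "y \<in> carrier (cohomology (kunit k) n)"
  then show "\<exists>x\<in>carrier (gunit k n). Map (kunneth_unit k) n x = y"
    by (auto simp: kunneth_unit_apply cocycles_kunit elim!: cohomologyE)
qed (simp_all add: kunneth_unit_apply coclass_kunit)

lemma counit_apply: "a \<in> carrier (gunit k n) \<Longrightarrow> Map (counit k) n (coclass (kunit k) n a) = a"
  using coclass_closed[of a "kunit k" n] by (simp add: counit_def coclass_kunit cocycles_kunit)

lemma counit_hom: "counit k \<in> gr_hom k (cohomology (kunit k)) (gunit k)"
proof (intro gr_homI gmapsI linmapsI)
  fix n c assume "c \<in> carrier (cohomology (kunit k) n)"
  then obtain a where a: "a \<in> cocycles (kunit k) n" "c = coclass (kunit k) n a" by (rule cohomologyE)
  then have a': "a \<in> carrier (gunit k n)" by (simp add: cocycles_kunit)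
  then show "Map (counit k) n c \<in> carrier (gunit k n)" by (simp add: a(2) counit_apply)
  fix c' assume "c' \<in> carrier (cohomology (kunit k) n)"
  then obtain b where b: "b \<in> cocycles (kunit k) n" "c' = coclass (kunit k) n b" by (rule cohomologyE)
  then have b': "b \<in> carrier (gunit k n)" by (simp add: cocycles_kunit)
  have "c \<oplus>\<^bsub>cohomology (kunit k) n\<^esub> c' = coclass (kunit k) n (a \<oplus>\<^bsub>gunit k n\<^esub> b)"
    using a b coclass_add[of "kunit k" a n b] by simp
  moreover have "a \<oplus>\<^bsub>gunit k n\<^esub> b \<in> carrier (gunit k n)" using a' b' by (intro m_add_closed) simp_all
  ultimately show "Map (counit k) n (c \<oplus>\<^bsub>cohomology (kunit k) n\<^esub> c') = Map (counit k) n c \<oplus>\<^bsub>gunit k n\<^esub> Map (counit k) n c'"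
    using a' b' by (simp only: a(2) b(2) counit_apply)
next
  fix n r c assume r: "r \<in> carrier k" and "c \<in> carrier (cohomology (kunit k) n)"
  then obtain a where a: "a \<in> cocycles (kunit k) n" "c = coclass (kunit k) n a" by (elim cohomologyE)
  then have a': "a \<in> carrier (gunit k n)" by (simp add: cocycles_kunit)
  have "r \<odot>\<^bsub>cohomology (kunit k) n\<^esub> c = coclass (kunit k) n (r \<odot>\<^bsub>gunit k n\<^esub> a)"
    using a r coclass_smult[of "kunit k" r a n] by simp
  moreover have "r \<odot>\<^bsub>gunit k n\<^esub> a \<in> carrier (gunit k n)" using r a' by (intro m_smult_closed) simp_all
  ultimately show "Map (counit k) n (r \<odot>\<^bsub>cohomology (kunit k) n\<^esub> c) = r \<odot>\<^bsub>gunit k n\<^esub> Map (counit k) n c"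
    using a' by (simp only: a(2) counit_apply)
qed (simp_all add: counit_def)

lemma counit_iso: "gr_iso k (cohomology (kunit k)) (gunit k) (counit k)"
proof (rule gr_isoI_bij[OF counit_hom])
  fix n x y assume "x \<in> carrier (cohomology (kunit k) n)" "y \<in> carrier (cohomology (kunit k) n)"
    and eq: "Map (counit k) n x = Map (counit k) n y"
  then obtain a b where "a \<in> cocycles (kunit k) n" "x = coclass (kunit k) n a" "b \<in> cocycles (kunit k) n" "y = coclass (kunit k) n b"
    by (elim cohomologyE)
  then show "x = y" using eq by (simp add: cocycles_kunit counit_apply)
next
  fix n a assume "a \<in> carrier (gunit k n)"
  then show "\<exists>x\<in>carrier (cohomology (kunit k) n). Map (counit k) n x = a"
    by (intro bexI[of _ "coclass (kunit k) n a"]) (simp_all add: counit_apply cocycles_kunit)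
qed simp_all

section \<open>Translation of the composites in the enriched axioms\<close>

lemma H_map_linv_apply:
  assumes "K_obj k M" "x \<in> cocycles M n"
  shows "Map (H_map (K_linv k M)) n (coclass M n x) = coclass (ktens k (kunit k) M) n (ptens k (gunit k) (Und M) 0 \<one> n x)"
  unfolding K_linv_def using H_map_apply[OF _ _ tens_linv_chain_map assms(2)] assms by simp

lemma H_map_rinv_apply:
  assumes "K_obj k M" "x \<in> cocycles M n"
  shows "Map (H_map (K_rinv k M)) n (coclass M n x) = coclass (ktens k M (kunit k)) n (ptens k (Und M) (gunit k) n x 0 \<one>)"
  unfolding K_rinv_def using H_map_apply[OF _ _ tens_rinv_chain_map assms(2)] assms by simp

lemma H_map_tens_ptens:
  assumes [simp]: "K_obj k M" "K_obj k N" "K_obj k M'" "K_obj k N'" and F: "F \<in> K_hom k M M'" and G: "G \<in> K_hom k N N'"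
    and x: "x \<in> cocycles M i" and y: "y \<in> cocycles N j" and n: "i + j = n"
  shows "Map (H_map (K_tens k F G)) n (coclass (ktens k M N) n (ptens k (Und M) (Und N) i x j y)) =
    Map (kunneth k M' N') n (ptens k (cohomology M') (cohomology N') i (Map (H_map F) i (coclass M i x)) j (Map (H_map G) j (coclass N j y)))"
proof -
  let ?p = "ptens k (cohomology M) (cohomology N) i (coclass M i x) j (coclass N j y)"
  have p: "?p \<in> carrier (gtens k (cohomology M) (cohomology N) n)" using x y n by simp
  have T: "gr_tens k (H_map F) (H_map G) \<in> gr_hom k (gtens k (cohomology M) (cohomology N)) (gtens k (cohomology M') (cohomology N'))"
    by (intro gr_tens_hom H_map_hom F G) simp_all
  have "Map (H_map (K_tens k F G) \<cdot>\<^sub>g kunneth k M N) n ?p = Map (kunneth k M' N' \<cdot>\<^sub>g gr_tens k (H_map F) (H_map G)) n ?p"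
    using H_map_tens[OF assms(1-4) F G] by simp
  then show ?thesis using p x y n
    by (simp add: gr_comp_apply_hom[OF kunneth_hom] gr_comp_apply_hom[OF T] kunneth_ptens gr_tens_apply[OF _ _ _ _ H_map_hom[OF _ _ F] H_map_hom[OF _ _ G]])
qed

text \<open>Composition in \<open>H_cat\<close> is \<open>H_map\<close> of the composition followed
  by a Kuenneth map. This lemma and the following ones rewrite the composites that occur in axioms
  over \<open>\<K>\<close> into those of \<open>H_cat\<close>, with the Kuenneth map in its
  place.\<close>

lemma H_comp_kunneth:
  assumes [simp]: "K_obj k M" "K_obj k N" "K_obj k P" "K_obj k Q" and F: "F \<in> K_hom k (ktens k M N) P" and G: "G \<in> K_hom k P Q"
  shows "H_map (K_comp k G F) \<cdot>\<^sub>g kunneth k M N = H_map G \<cdot>\<^sub>g H_map F \<cdot>\<^sub>g kunneth k M N"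
  unfolding H_map_comp[OF ktens_obj[OF assms(1,2)] assms(3,4) F G]
  by (rule gr_comp_assoc[OF _ _ kunneth_hom H_map_hom[OF _ _ F] H_map_hom[OF _ _ G]]) simp_all

lemma H_comp_tens_kunneth:
  assumes [simp]: "K_obj k M" "K_obj k N" "K_obj k M'" "K_obj k N'" "K_obj k P"
    and F: "F \<in> K_hom k M M'" and F': "F' \<in> K_hom k N N'" and G: "G \<in> K_hom k (ktens k M' N') P"
  shows "H_map (K_comp k G (K_tens k F F')) \<cdot>\<^sub>g kunneth k M N = (H_map G \<cdot>\<^sub>g kunneth k M' N') \<cdot>\<^sub>g gr_tens k (H_map F) (H_map F')"
proof -
  have T: "K_tens k F F' \<in> K_hom k (ktens k M N) (ktens k M' N')" by (intro K_tens_hom F F') simp_all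
  have "H_map (K_comp k G (K_tens k F F')) \<cdot>\<^sub>g kunneth k M N = H_map G \<cdot>\<^sub>g H_map (K_tens k F F') \<cdot>\<^sub>g kunneth k M N"
    by (rule H_comp_kunneth[OF _ _ _ _ T G]) simp_all
  also have "\<dots> = H_map G \<cdot>\<^sub>g kunneth k M' N' \<cdot>\<^sub>g gr_tens k (H_map F) (H_map F')"
    unfolding H_map_tens[OF assms(1-4) F F'] ..
  also have "\<dots> = (H_map G \<cdot>\<^sub>g kunneth k M' N') \<cdot>\<^sub>g gr_tens k (H_map F) (H_map F')"
    by (rule gr_comp_assoc[symmetric, OF _ _ gr_tens_hom[OF _ _ _ _ H_map_hom[OF _ _ F] H_map_hom[OF _ _ F']] kunneth_hom H_map_hom[OF _ _ G]]) simp_all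
  finally show ?thesis .
qed

lemma H_comp_unit:
  assumes [simp]: "K_obj k P" "K_obj k Q" and F: "F \<in> K_hom k (kunit k) P" and G: "G \<in> K_hom k P Q"
  shows "H_map (K_comp k G F) \<cdot>\<^sub>g kunneth_unit k = H_map G \<cdot>\<^sub>g H_map F \<cdot>\<^sub>g kunneth_unit k"
  unfolding H_map_comp[OF kunit_obj assms(1,2) F G]
  by (rule gr_comp_assoc[OF _ _ kunneth_unit_hom H_map_hom[OF _ _ F] H_map_hom[OF _ _ G]]) simp_all

lemma H_unit_hom: "K_obj k M \<Longrightarrow> F \<in> K_hom k (kunit k) M \<Longrightarrow> H_map F \<cdot>\<^sub>g kunneth_unit k \<in> gr_hom k (gunit k) (cohomology M)"
  by (rule gr_comp_hom[OF _ kunneth_unit_hom H_map_hom]) simp_all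

text \<open>\<open>kunneth_unit\<close> is invertible, so an arrow out of \<open>gunit\<close> is
  one out of the cohomology of \<open>kunit\<close>, and fullness applies. This lifts units and
  components of transformations.\<close>

lemma H_unit_full:
  assumes [simp]: "K_obj k M" and \<phi>: "\<phi> \<in> gr_hom k (gunit k) (cohomology M)"
  obtains F where "F \<in> K_hom k (kunit k) M" "H_map F \<cdot>\<^sub>g kunneth_unit k = \<phi>"
proof -
  obtain u where u: "u \<in> gr_hom k (cohomology (kunit k)) (gunit k)" "u \<cdot>\<^sub>g kunneth_unit k = gr_id (gunit k)"
    using kunneth_unit_iso by (auto simp: gr_iso_def)
  have "\<phi> \<cdot>\<^sub>g u \<in> gr_hom k (cohomology (kunit k)) (cohomology M)" by (rule gr_comp_hom[OF _ u(1) \<phi>]) simp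
  then obtain F where F: "F \<in> K_hom k (kunit k) M" "H_map F = \<phi> \<cdot>\<^sub>g u" using H_map_full[OF kunit_obj assms(1)] by metis
  have "H_map F \<cdot>\<^sub>g kunneth_unit k = \<phi> \<cdot>\<^sub>g u \<cdot>\<^sub>g kunneth_unit k"
    unfolding F(2) by (rule gr_comp_assoc[OF _ _ kunneth_unit_hom u(1) \<phi>]) simp_all
  also have "\<dots> = \<phi>" unfolding u(2) by (rule gr_id_right[OF _ \<phi>]) simp
  finally show ?thesis using that F(1) by auto
qed

lemma H_unit_faithful:
  assumes [simp]: "K_obj k M" and F: "F \<in> K_hom k (kunit k) M" and G: "G \<in> K_hom k (kunit k) M"
    and eq: "H_map F \<cdot>\<^sub>g kunneth_unit k = H_map G \<cdot>\<^sub>g kunneth_unit k"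
  shows "F = G"
  by (rule H_map_faithful[OF _ _ F G gr_iso_epi[OF kunneth_unit_iso _ _ H_map_hom[OF _ _ F] H_map_hom[OF _ _ G] eq]]) simp_all

lemma K_tens_faithful:
  assumes [simp]: "K_obj k M" "K_obj k N" "K_obj k P" and F: "F \<in> K_hom k (ktens k M N) P" and G: "G \<in> K_hom k (ktens k M N) P"
    and eq: "H_map F \<cdot>\<^sub>g kunneth k M N = H_map G \<cdot>\<^sub>g kunneth k M N"
  shows "F = G"
  by (rule H_map_faithful[OF _ _ F G kunneth_epi[OF _ _ H_map_hom[OF _ _ F] H_map_hom[OF _ _ G] eq]]) simp_all

lemma one_gunit: "\<one> \<in> cocycles (kunit k) 0"
  by (simp add: cocycles_kunit)

text \<open>The shape of the left unit law, of one side of naturality and of composition in the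
  underlying category. At a class \<open>[x]\<close>, the class of \<open>\<one> \<otimes> x\<close>
  is the Kuenneth image of \<open>[\<one>] \<otimes> [x]\<close>, and \<open>[\<one>]\<close> is the
  value of \<open>kunneth_unit\<close> at \<open>\<one>\<close>.\<close>

lemma H_comp_tens_linv:
  assumes [simp]: "K_obj k M" "K_obj k N" "K_obj k N'" "K_obj k P" and A: "A \<in> K_hom k (kunit k) M" and F: "F \<in> K_hom k N N'"
    and G: "G \<in> K_hom k (ktens k M N') P"
  shows "H_map (K_comp k G (K_comp k (K_tens k A F) (K_linv k N))) =
    (H_map G \<cdot>\<^sub>g kunneth k M N') \<cdot>\<^sub>g gr_tens k (H_map A \<cdot>\<^sub>g kunneth_unit k) (H_map F) \<cdot>\<^sub>g gr_linv k (cohomology N)"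
proof -
  note HA = H_unit_hom[OF assms(1) A] and HF = H_map_hom[OF assms(2,3) F]
  have T: "K_tens k A F \<in> K_hom k (ktens k (kunit k) N) (ktens k M N')" by (intro K_tens_hom A F) simp_all
  have TL: "K_comp k (K_tens k A F) (K_linv k N) \<in> K_hom k N (ktens k M N')"
    by (intro K_comp_hom[OF _ _ _ K_linv_hom T]) simp_all
  have L: "gr_linv k (cohomology N) \<in> gr_hom k (cohomology N) (gtens k (gunit k) (cohomology N))" by (intro gr_linv_hom) simp
  have t: "gr_tens k (H_map A \<cdot>\<^sub>g kunneth_unit k) (H_map F) \<in> gr_hom k (gtens k (gunit k) (cohomology N)) (gtens k (cohomology M) (cohomology N'))"
    by (intro gr_tens_hom HA HF) simp_all
  have tl: "gr_tens k (H_map A \<cdot>\<^sub>g kunneth_unit k) (H_map F) \<cdot>\<^sub>g gr_linv k (cohomology N) \<in> gr_hom k (cohomology N) (gtens k (cohomology M) (cohomology N'))"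
    by (rule gr_comp_hom[OF _ L t]) simp
  have gk: "H_map G \<cdot>\<^sub>g kunneth k M N' \<in> gr_hom k (gtens k (cohomology M) (cohomology N')) (cohomology P)"
    by (rule gr_comp_hom[OF _ kunneth_hom H_map_hom[OF _ _ G]]) simp_all
  show ?thesis
  proof (rule gr_hom_eqI[of _ "cohomology N" "cohomology P"])
    show "H_map (K_comp k G (K_comp k (K_tens k A F) (K_linv k N))) \<in> gr_hom k (cohomology N) (cohomology P)"
      by (intro H_map_hom K_comp_hom[OF _ _ _ TL G]) simp_all
    show "(H_map G \<cdot>\<^sub>g kunneth k M N') \<cdot>\<^sub>g gr_tens k (H_map A \<cdot>\<^sub>g kunneth_unit k) (H_map F) \<cdot>\<^sub>g gr_linv k (cohomology N) \<in> gr_hom k (cohomology N) (cohomology P)"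
      by (rule gr_comp_hom[OF _ tl gk]) simp
    fix n c assume c: "c \<in> carrier (cohomology N n)"
    then obtain x where x: "x \<in> cocycles N n" "c = coclass N n x" by (rule cohomologyE)
    have Fx: "Map (H_map F) n (coclass N n x) \<in> carrier (cohomology N' n)" using x by (intro gr_hom_closed[OF HF]) simp
    have A1: "Map (H_map A) 0 (coclass (kunit k) 0 \<one>) \<in> carrier (cohomology M 0)"
      using gr_hom_closed[OF H_map_hom[OF _ _ A] coclass_closed[OF one_gunit]] by simp
    have 1: "Map (H_map (K_comp k G (K_comp k (K_tens k A F) (K_linv k N)))) n c =
      Map (H_map G) n (Map (kunneth k M N') n (ptens k (cohomology M) (cohomology N') 0 (Map (H_map A) 0 (coclass (kunit k) 0 \<one>)) n (Map (H_map F) n (coclass N n x))))"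
      unfolding H_map_comp[OF assms(2) ktens_obj[OF assms(1,3)] assms(4) TL G]
        H_map_comp[OF assms(2) ktens_obj[OF kunit_obj assms(2)] ktens_obj[OF assms(1,3)] K_linv_hom[OF assms(2)] T]
      using c x(1) H_map_tens_ptens[OF kunit_obj assms(2,1,3) A F one_gunit x(1), of n]
      by (simp add: gr_comp_apply_hom[OF gr_comp_hom[OF _ H_map_hom[OF _ _ K_linv_hom] H_map_hom[OF _ _ T]]] gr_comp_apply_hom[OF H_map_hom[OF _ _ K_linv_hom]] x(2) H_map_linv_apply)
    have kc: "ptens k (cohomology M) (cohomology N') 0 (Map (H_map A) 0 (coclass (kunit k) 0 \<one>)) n (Map (H_map F) n (coclass N n x)) \<in> carrier (gtens k (cohomology M) (cohomology N') n)"
      using A1 Fx by simp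
    show "Map (H_map (K_comp k G (K_comp k (K_tens k A F) (K_linv k N)))) n c =
      Map ((H_map G \<cdot>\<^sub>g kunneth k M N') \<cdot>\<^sub>g gr_tens k (H_map A \<cdot>\<^sub>g kunneth_unit k) (H_map F) \<cdot>\<^sub>g gr_linv k (cohomology N)) n c"
      unfolding 1 gr_comp_apply_hom[OF tl c] gr_comp_apply_hom[OF L c]
      using c x(1) kc by (simp add: gr_linv_def gr_tens_apply[OF _ _ _ _ HA HF] gr_comp_apply_hom[OF kunneth_unit_hom] kunneth_unit_apply gr_comp_apply_hom[OF kunneth_hom] x(2))
  qed
qed

lemma H_comp_tens_rinv:
  assumes [simp]: "K_obj k M" "K_obj k N" "K_obj k N'" "K_obj k P" and A: "A \<in> K_hom k (kunit k) M" and F: "F \<in> K_hom k N N'"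
    and G: "G \<in> K_hom k (ktens k N' M) P"
  shows "H_map (K_comp k G (K_comp k (K_tens k F A) (K_rinv k N))) =
    (H_map G \<cdot>\<^sub>g kunneth k N' M) \<cdot>\<^sub>g gr_tens k (H_map F) (H_map A \<cdot>\<^sub>g kunneth_unit k) \<cdot>\<^sub>g gr_rinv k (cohomology N)"
proof -
  note HA = H_unit_hom[OF assms(1) A] and HF = H_map_hom[OF assms(2,3) F]
  have T: "K_tens k F A \<in> K_hom k (ktens k N (kunit k)) (ktens k N' M)" by (intro K_tens_hom A F) simp_all
  have TL: "K_comp k (K_tens k F A) (K_rinv k N) \<in> K_hom k N (ktens k N' M)"
    by (intro K_comp_hom[OF _ _ _ K_rinv_hom T]) simp_all
  have L: "gr_rinv k (cohomology N) \<in> gr_hom k (cohomology N) (gtens k (cohomology N) (gunit k))" by (intro gr_rinv_hom) simp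
  have t: "gr_tens k (H_map F) (H_map A \<cdot>\<^sub>g kunneth_unit k) \<in> gr_hom k (gtens k (cohomology N) (gunit k)) (gtens k (cohomology N') (cohomology M))"
    by (intro gr_tens_hom HA HF) simp_all
  have tl: "gr_tens k (H_map F) (H_map A \<cdot>\<^sub>g kunneth_unit k) \<cdot>\<^sub>g gr_rinv k (cohomology N) \<in> gr_hom k (cohomology N) (gtens k (cohomology N') (cohomology M))"
    by (rule gr_comp_hom[OF _ L t]) simp
  have gk: "H_map G \<cdot>\<^sub>g kunneth k N' M \<in> gr_hom k (gtens k (cohomology N') (cohomology M)) (cohomology P)"
    by (rule gr_comp_hom[OF _ kunneth_hom H_map_hom[OF _ _ G]]) simp_all
  show ?thesis
  proof (rule gr_hom_eqI[of _ "cohomology N" "cohomology P"])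
    show "H_map (K_comp k G (K_comp k (K_tens k F A) (K_rinv k N))) \<in> gr_hom k (cohomology N) (cohomology P)"
      by (intro H_map_hom K_comp_hom[OF _ _ _ TL G]) simp_all
    show "(H_map G \<cdot>\<^sub>g kunneth k N' M) \<cdot>\<^sub>g gr_tens k (H_map F) (H_map A \<cdot>\<^sub>g kunneth_unit k) \<cdot>\<^sub>g gr_rinv k (cohomology N) \<in> gr_hom k (cohomology N) (cohomology P)"
      by (rule gr_comp_hom[OF _ tl gk]) simp
    fix n c assume c: "c \<in> carrier (cohomology N n)"
    then obtain x where x: "x \<in> cocycles N n" "c = coclass N n x" by (rule cohomologyE)
    have Fx: "Map (H_map F) n (coclass N n x) \<in> carrier (cohomology N' n)" using x by (intro gr_hom_closed[OF HF]) simp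
    have A1: "Map (H_map A) 0 (coclass (kunit k) 0 \<one>) \<in> carrier (cohomology M 0)"
      using gr_hom_closed[OF H_map_hom[OF _ _ A] coclass_closed[OF one_gunit]] by simp
    have 1: "Map (H_map (K_comp k G (K_comp k (K_tens k F A) (K_rinv k N)))) n c =
      Map (H_map G) n (Map (kunneth k N' M) n (ptens k (cohomology N') (cohomology M) n (Map (H_map F) n (coclass N n x)) 0 (Map (H_map A) 0 (coclass (kunit k) 0 \<one>))))"
      unfolding H_map_comp[OF assms(2) ktens_obj[OF assms(3,1)] assms(4) TL G]
        H_map_comp[OF assms(2) ktens_obj[OF assms(2) kunit_obj] ktens_obj[OF assms(3,1)] K_rinv_hom[OF assms(2)] T]
      using c x(1) H_map_tens_ptens[OF assms(2) kunit_obj assms(3,1) F A x(1) one_gunit, of n]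
      by (simp add: gr_comp_apply_hom[OF gr_comp_hom[OF _ H_map_hom[OF _ _ K_rinv_hom] H_map_hom[OF _ _ T]]] gr_comp_apply_hom[OF H_map_hom[OF _ _ K_rinv_hom]] x(2) H_map_rinv_apply)
    have kc: "ptens k (cohomology N') (cohomology M) n (Map (H_map F) n (coclass N n x)) 0 (Map (H_map A) 0 (coclass (kunit k) 0 \<one>)) \<in> carrier (gtens k (cohomology N') (cohomology M) n)"
      using A1 Fx by simp
    show "Map (H_map (K_comp k G (K_comp k (K_tens k F A) (K_rinv k N)))) n c =
      Map ((H_map G \<cdot>\<^sub>g kunneth k N' M) \<cdot>\<^sub>g gr_tens k (H_map F) (H_map A \<cdot>\<^sub>g kunneth_unit k) \<cdot>\<^sub>g gr_rinv k (cohomology N)) n c"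
      unfolding 1 gr_comp_apply_hom[OF tl c] gr_comp_apply_hom[OF L c]
      using c x(1) kc by (simp add: gr_rinv_def gr_tens_apply[OF _ _ _ _ HF HA] gr_comp_apply_hom[OF kunneth_unit_hom] kunneth_unit_apply gr_comp_apply_hom[OF kunneth_hom] x(2))
  qed
qed

section \<open>Inner homs and duals\<close>

lemma theta_arrow_hom:
  "K_obj k M \<Longrightarrow> K_obj k N \<Longrightarrow> theta_arrow k M N \<in> gr_hom k (cohomology (kihom k M N)) (gihom k (cohomology M) (cohomology N))"
  by (intro gr_homI) (simp_all add: theta_arrow_def theta_gmaps)

lemma theta_arrow_apply:
  assumes "K_obj k M" "K_obj k N" "f \<in> cocycles (kihom k M N) n" "x \<in> cocycles M p" "q = p + n"
  shows "Map (theta_arrow k M N) n (coclass (kihom k M N) n f) p (coclass M p x) = coclass N q (f p x)"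
  using theta_apply[OF assms] by (simp add: theta_arrow_def)

lemma theta_arrow_iso:
  assumes [simp]: "K_obj k M" "K_obj k N"
  shows "gr_iso k (cohomology (kihom k M N)) (gihom k (cohomology M) (cohomology N)) (theta_arrow k M N)"
proof (rule gr_isoI_bij[OF theta_arrow_hom])
  fix n \<phi> \<psi> assume "\<phi> \<in> carrier (cohomology (kihom k M N) n)" "\<psi> \<in> carrier (cohomology (kihom k M N) n)"
    and eq: "Map (theta_arrow k M N) n \<phi> = Map (theta_arrow k M N) n \<psi>"
  then obtain f g where f: "f \<in> cocycles (kihom k M N) n" "\<phi> = coclass (kihom k M N) n f"
    and g: "g \<in> cocycles (kihom k M N) n" "\<psi> = coclass (kihom k M N) n g" by (elim cohomologyE)
  show "\<phi> = \<psi>" unfolding f(2) g(2)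
  proof (rule theta_inj[OF assms f(1) g(1)])
    fix p x assume x: "x \<in> cocycles M p"
    show "coclass N (p + n) (f p x) = coclass N (p + n) (g p x)"
      using theta_arrow_apply[OF assms f(1) x refl] theta_arrow_apply[OF assms g(1) x refl] eq by (simp add: f(2) g(2))
  qed
next
  fix n y assume y: "y \<in> carrier (gihom k (cohomology M) (cohomology N) n)"
  show "\<exists>x\<in>carrier (cohomology (kihom k M N) n). Map (theta_arrow k M N) n x = y"
    using theta_surj[OF assms y] coclass_closed[of _ "kihom k M N" n] by (metis arrow.select_convs(3) theta_arrow_def)
qed simp_all

text \<open>Both sides take \<open>[x]\<close> and \<open>[y]\<close> to the class of
  \<open>f (x \<otimes> y)\<close>. Applied to compositions, this turns representable functors over
  \<open>\<K>\<close> into those of \<open>H_cat\<close>.\<close>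

lemma theta_curry:
  assumes [simp]: "K_obj k M" "K_obj k N" "K_obj k P" and F: "F \<in> K_hom k (ktens k M N) P"
  shows "theta_arrow k N P \<cdot>\<^sub>g H_map (K_curry k M N F) = gr_curry k (cohomology M) (cohomology N) (H_map F \<cdot>\<^sub>g kunneth k M N)"
proof (rule gr_hom_eqI[of _ "cohomology M" "gihom k (cohomology N) (cohomology P)"])
  have C: "H_map (K_curry k M N F) \<in> gr_hom k (cohomology M) (cohomology (kihom k N P))"
    by (intro H_map_hom K_curry_hom F) simp_all
  show L: "theta_arrow k N P \<cdot>\<^sub>g H_map (K_curry k M N F) \<in> gr_hom k (cohomology M) (gihom k (cohomology N) (cohomology P))"
    by (rule gr_comp_hom[OF _ C theta_arrow_hom]) simp_all
  show R: "gr_curry k (cohomology M) (cohomology N) (H_map F \<cdot>\<^sub>g kunneth k M N) \<in> gr_hom k (cohomology M) (gihom k (cohomology N) (cohomology P))"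
    by (intro gr_curry_hom gr_comp_hom[OF _ kunneth_hom H_map_hom[OF _ _ F]]) simp_all
  fix n c assume c: "c \<in> carrier (cohomology M n)"
  then obtain x where x: "x \<in> cocycles M n" "c = coclass M n x" by (rule cohomologyE)
  obtain f where f: "f \<in> chain_maps k (ktens k M N) P" "F = K_class k (ktens k M N) P f" using K_homE[OF F] .
  note gc = gcurry_chain_map[OF assms(1-3) f(1)]
  show "Map (theta_arrow k N P \<cdot>\<^sub>g H_map (K_curry k M N F)) n c = Map (gr_curry k (cohomology M) (cohomology N) (H_map F \<cdot>\<^sub>g kunneth k M N)) n c"
  proof (rule gihom_eqI[OF gr_hom_closed[OF L c] gr_hom_closed[OF R c]])
    fix p e assume e: "e \<in> carrier (cohomology N p)"
    then obtain y where y: "y \<in> cocycles N p" "e = coclass N p y" by (rule cohomologyE)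
    have i: "n + p = p + n" by simp
    have "Map (theta_arrow k N P \<cdot>\<^sub>g H_map (K_curry k M N F)) n c p e = coclass P (n + p) (f (n + p) (ptens k (Und M) (Und N) n x p y))"
      unfolding gr_comp_apply_hom[OF C c] unfolding x(2) y(2) f(2) K_curry_class[OF assms(1-3) f(1)]
      using x(1) y(1) chain_map_cocycle[OF _ _ gc x(1)] theta_arrow_apply[OF assms(2,3) _ y(1) i]
      by (simp add: H_map_apply[OF _ _ gc])
    also have "\<dots> = Map (gr_curry k (cohomology M) (cohomology N) (H_map F \<cdot>\<^sub>g kunneth k M N)) n c p e"
      unfolding x(2) y(2) f(2) using x(1) y(1) H_map_apply[OF _ _ f(1) ptens_cocycle[OF assms(1,2) x(1) y(1) refl]]
      by (simp add: gr_curry_apply gr_comp_apply_hom[OF kunneth_hom] kunneth_ptens)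
    finally show "Map (theta_arrow k N P \<cdot>\<^sub>g H_map (K_curry k M N F)) n c p e =
      Map (gr_curry k (cohomology M) (cohomology N) (H_map F \<cdot>\<^sub>g kunneth k M N)) n c p e" .
  qed
qed

lemma theta_ipost_apply:
  assumes [simp]: "K_obj k M" "K_obj k N" "K_obj k P" and G: "G \<in> K_hom k N P"
    and \<phi>: "\<phi> \<in> carrier (cohomology (kihom k M N) n)" and c: "c \<in> carrier (cohomology M p)"
  shows "Map (theta_arrow k M P) n (Map (H_map (K_ipost k M G)) n \<phi>) p c = Map (H_map G) (p + n) (Map (theta_arrow k M N) n \<phi> p c)"
proof -
  obtain x where x: "x \<in> cocycles M p" "c = coclass M p x" using cohomologyE[OF c] .
  obtain f where f: "f \<in> cocycles (kihom k M N) n" "\<phi> = coclass (kihom k M N) n f" using cohomologyE[OF \<phi>] .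
  obtain g where g: "g \<in> chain_maps k N P" "G = K_class k N P g" using K_homE[OF G] .
  note gc = gipost_chain_map[OF assms(1-3) g(1)]
  show ?thesis unfolding x(2) f(2) g(2) K_ipost_class[OF assms(1-3) g(1)]
    using x(1) f(1) cocycles_closed[OF f(1)] chain_map_cocycle[OF _ _ gc f(1)] kihom_cocycle_cocycle[OF _ _ f(1) x(1) refl]
    by (simp add: H_map_apply[OF _ _ gc] theta_arrow_apply[OF _ _ _ _ refl] H_map_apply[OF _ _ g(1)])
qed

lemma theta_ipre_apply:
  assumes [simp]: "K_obj k M" "K_obj k N" "K_obj k P" and F: "F \<in> K_hom k M N"
    and \<phi>: "\<phi> \<in> carrier (cohomology (kihom k N P) n)" and c: "c \<in> carrier (cohomology M p)"
  shows "Map (theta_arrow k M P) n (Map (H_map (K_ipre k F P)) n \<phi>) p c = Map (theta_arrow k N P) n \<phi> p (Map (H_map F) p c)"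
proof -
  obtain x where x: "x \<in> cocycles M p" "c = coclass M p x" using cohomologyE[OF c] .
  obtain u where u: "u \<in> cocycles (kihom k N P) n" "\<phi> = coclass (kihom k N P) n u" using cohomologyE[OF \<phi>] .
  obtain f where f: "f \<in> chain_maps k M N" "F = K_class k M N f" using K_homE[OF F] .
  note gc = gipre_chain_map[OF assms(1-3) f(1)]
  show ?thesis unfolding x(2) u(2) f(2) K_ipre_class[OF assms(1-3) f(1)]
    using x(1) u(1) cocycles_closed[OF u(1)] chain_map_cocycle[OF _ _ gc u(1)] chain_map_cocycle[OF _ _ f(1) x(1)]
    by (simp add: H_map_apply[OF _ _ gc] theta_arrow_apply[OF _ _ _ _ refl] H_map_apply[OF _ _ f(1)])
qed

lemma delta_iso:
  assumes [simp]: "K_obj k M"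
  shows "gr_iso k (cohomology (kihom k M (kunit k))) (gihom k (cohomology M) (gunit k)) (delta_arrow k M)"
  unfolding delta_arrow_def
  by (rule gr_iso_comp[OF theta_arrow_iso gr_ipost_iso[OF counit_iso]]) simp_all

lemma delta_apply:
  assumes [simp]: "K_obj k M" and l: "l \<in> cocycles (kihom k M (kunit k)) j" and x: "x \<in> cocycles M p"
  shows "Map (delta_arrow k M) j (coclass (kihom k M (kunit k)) j l) p (coclass M p x) = l p x"
proof -
  have t: "Map (theta_arrow k M (kunit k)) j (coclass (kihom k M (kunit k)) j l) \<in> carrier (gihom k (cohomology M) (cohomology (kunit k)) j)"
    using l by (intro gr_hom_closed[OF theta_arrow_hom]) simp_all
  have "l p x \<in> carrier (gunit k (p + j))" using kihom_cocycle_cocycle[OF _ _ l x refl] by (simp add: cocycles_kunit)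
  then show ?thesis unfolding delta_arrow_def using l x t
    by (simp add: gr_comp_apply_hom[OF theta_arrow_hom] gr_ipost_apply[OF counit_hom] theta_arrow_apply[OF _ _ l x refl] counit_apply)
qed

text \<open>For classes of \<open>u\<close> and \<open>l\<close>, both sides send \<open>[x]\<close>
  to \<open>(-1)^(i j) l (u x)\<close>: on the left as the value of a single cocycle of the dual
  complex, on the right by evaluating classes. The degree is written \<open>j + i\<close> because
  \<open>theta\<close> evaluates an element of degree \<open>i\<close> at one of degree
  \<open>j\<close>.\<close>

lemma delta_dualmor:
  assumes [simp]: "K_obj k M" "K_obj k N"
    and \<phi>: "\<phi> \<in> carrier (cohomology (kihom k M N) i)" and \<psi>: "\<psi> \<in> carrier (cohomology (kihom k N (kunit k)) j)"
  shows "Map (delta_arrow k M) (j + i)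
      (Map (theta_arrow k (kihom k N (kunit k)) (kihom k M (kunit k))) i (Map (H_map (K_dualmor k M N)) i \<phi>) j \<psi>) =
    Map (gr_dualmor k (cohomology M) (cohomology N)) i (Map (theta_arrow k M N) i \<phi>) j (Map (delta_arrow k N) j \<psi>)"
    (is "?L = ?R")
proof -
  let ?U = "kunit k" and ?MN = "kihom k M N"
  let ?NU = "kihom k N ?U" and ?MU = "kihom k M ?U"
  obtain u where u: "u \<in> cocycles ?MN i" "\<phi> = coclass ?MN i u" using cohomologyE[OF \<phi>] .
  obtain l where l: "l \<in> cocycles ?NU j" "\<psi> = coclass ?NU j l" using cohomologyE[OF \<psi>] .
  have uc: "u \<in> carrier (gihom k (Und M) (Und N) i)" using cocycles_closed[OF u(1)] by simp
  have lc: "l \<in> carrier (gihom k (Und N) (gunit k) j)" using cocycles_closed[OF l(1)] by simp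
  have th: "Map (theta_arrow k M N) i \<phi> \<in> carrier (gihom k (cohomology M) (cohomology N) i)"
    by (rule gr_hom_closed[OF theta_arrow_hom \<phi>]) simp_all
  have dl: "Map (delta_arrow k N) j \<psi> \<in> carrier (gihom k (cohomology N) (gunit k) j)"
    by (rule gr_hom_closed[OF gr_iso_hom[OF delta_iso] \<psi>]) simp
  let ?f = "gcomp (Und (ktens k ?MN ?NU)) (gicomp k (Und M) (Und N) (Und ?U)) (tens_sym k (Und ?MN) (Und ?NU))"
  have sc: "tens_sym k (Und ?MN) (Und ?NU) \<in> chain_maps k (ktens k ?MN ?NU) (ktens k ?NU ?MN)"
    by (rule tens_sym_chain_map) simp_all
  have ic: "gicomp k (Und M) (Und N) (Und ?U) \<in> chain_maps k (ktens k ?NU ?MN) ?MU"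
    by (rule gicomp_chain_map) simp_all
  have fc: "?f \<in> chain_maps k (ktens k ?MN ?NU) ?MU"
    by (rule gcomp_chain_map[OF _ sc ic]) simp
  have "K_dualmor k M N = K_curry k ?MN ?NU (K_class k (ktens k ?MN ?NU) ?MU ?f)"
    unfolding K_dualmor_def K_icomp_def K_sym_def by (subst K_comp_class[OF _ _ _ sc ic]) simp_all
  also have "\<dots> = K_class k ?MN (kihom k ?NU ?MU) (gcurry k (Und ?MN) (Und ?NU) ?f)"
    by (rule K_curry_class[OF _ _ _ fc]) simp_all
  finally have D: "K_dualmor k M N = K_class k ?MN (kihom k ?NU ?MU) (gcurry k (Und ?MN) (Und ?NU) ?f)" .
  have gc: "gcurry k (Und ?MN) (Und ?NU) ?f \<in> chain_maps k ?MN (kihom k ?NU ?MU)"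
    by (rule gcurry_chain_map[OF _ _ _ fc]) simp_all
  have e: "j + i = i + j" by simp
  let ?v = "gcurry k (Und ?MN) (Und ?NU) ?f i u j l"
  have ul: "ptens k (Und ?MN) (Und ?NU) i u j l \<in> carrier (gtens k (Und ?MN) (Und ?NU) (i + j))"
    using uc lc by simp
  have lu: "(\<lambda>p. \<lambda>x\<in>carrier (Und M p). l (p + i) (u p x)) \<in> carrier (gihom k (Und M) (gunit k) (i + j))"
    using gihom_comp_closed[OF _ _ _ lc uc, of "i + j"] by simp
  \<comment> \<open>The explicit cocycle: the symmetry contributes the sign, and composition of
    inner homs puts \<open>l\<close> after \<open>u\<close>.\<close>
  have v: "?v = signed (gihom k (Und M) (gunit k) (i + j)) (i * j) (\<lambda>p. \<lambda>x\<in>carrier (Und M p). l (p + i) (u p x))"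
    using uc lc ul lin_signed[OF chain_maps_lin[OF ic], of "i + j"] gicomp_ptens[OF _ _ _ e lc uc]
    by (simp add: gcomp_def tens_sym_ptens)
  have gu: "gcurry k (Und ?MN) (Und ?NU) ?f i u \<in> cocycles (kihom k ?NU ?MU) i"
    by (rule chain_map_cocycle[OF _ _ gc u(1)]) simp_all
  have vz: "?v \<in> cocycles ?MU (j + i)"
    by (rule kihom_cocycle_cocycle[OF _ _ gu l(1)]) simp_all
  have L: "?L = Map (delta_arrow k M) (j + i) (coclass ?MU (j + i) ?v)"
    unfolding u(2) l(2) D using H_map_apply[OF _ _ gc u(1)] theta_arrow_apply[OF _ _ gu l(1) refl] by simp
  have Rc: "?R \<in> carrier (gihom k (cohomology M) (gunit k) (j + i))"
    using gihom_closed[OF gr_hom_closed[OF gr_dualmor_hom th] dl refl] by simp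
  show ?thesis unfolding L
  proof (rule gihom_eqI[OF _ Rc])
    show "Map (delta_arrow k M) (j + i) (coclass ?MU (j + i) ?v) \<in> carrier (gihom k (cohomology M) (gunit k) (j + i))"
      by (rule gr_hom_closed[OF gr_iso_hom[OF delta_iso] coclass_closed[OF vz]]) simp
    fix p c assume c: "c \<in> carrier (cohomology M p)"
    then obtain x where x: "x \<in> cocycles M p" "c = coclass M p x" by (rule cohomologyE)
    have "Map (delta_arrow k M) (j + i) (coclass ?MU (j + i) ?v) p c = ?v p x"
      unfolding x(2) by (rule delta_apply[OF _ vz x(1)]) simp
    also have "\<dots> = signed (gunit k (p + (i + j))) (i * j) (l (p + i) (u p x))"
      unfolding v using x(1) lu by simp
    also have "l (p + i) (u p x) = Map (delta_arrow k N) j \<psi> (p + i) (Map (theta_arrow k M N) i \<phi> p c)"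
      unfolding l(2) u(2) x(2) theta_arrow_apply[OF assms(1,2) u(1) x(1) refl]
      by (rule delta_apply[OF _ l(1), symmetric]) (simp_all add: kihom_cocycle_cocycle[OF _ _ u(1) x(1) refl])
    also have "signed (gunit k (p + (i + j))) (i * j) \<dots> = ?R p c"
      using gr_dualmor_apply[OF _ _ th dl c] by simp
    finally show "Map (delta_arrow k M) (j + i) (coclass ?MU (j + i) ?v) p c = ?R p c" .
  qed
qed

end

section \<open>Enriched categories and functors\<close>

text \<open>
  Enriched functors are total functions, so a functor lifted from cohomology is determined only on
  the objects of the category: equality of functors is replaced by agreement there.
\<close>

definition fun_agree :: "'o set \<Rightarrow> ('o, 'p, 'm) efunctor \<Rightarrow> ('o, 'p, 'm) efunctor \<Rightarrow> bool" where
  "fun_agree A F G \<longleftrightarrow> (\<forall>X\<in>A. OMap F X = OMap G X \<and> (\<forall>Y\<in>A. HMap F X Y = HMap G X Y))"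

text \<open>
  The typing conditions of categories, functors and functors into complexes without the axioms:
  cohomology is compared on such data first, so that each axiom can be transported in both directions.
\<close>

definition K_graph :: "'k ring \<Rightarrow> ('o, 'k, 'a) K_cat \<Rightarrow> bool" where
  "K_graph k C \<longleftrightarrow>
     (\<forall>X\<in>Obj C. \<forall>Y\<in>Obj C. K_obj k (Hom C X Y)) \<and>
     (\<forall>X\<in>Obj C. \<forall>Y\<in>Obj C. \<forall>Z\<in>Obj C.
        Comp C X Y Z \<in> K_hom k (ktens k (Hom C Y Z) (Hom C X Y)) (Hom C X Z))"

definition K_prefunctor ::
  "'k ring \<Rightarrow> ('o, 'k, 'a) K_cat \<Rightarrow> ('p, 'k, 'b) K_cat \<Rightarrow> ('o, 'p, 'k, 'a, 'b) K_fun \<Rightarrow> bool" where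
  "K_prefunctor k C D F \<longleftrightarrow> (\<forall>X\<in>Obj C. OMap F X \<in> Obj D) \<and>
     (\<forall>X\<in>Obj C. \<forall>Y\<in>Obj C. HMap F X Y \<in> K_hom k (Hom C X Y) (Hom D (OMap F X) (OMap F Y)))"

definition K_module ::
  "'k ring \<Rightarrow> ('o \<Rightarrow> 'o \<Rightarrow> ('k, 'a) cochain) \<Rightarrow> 'o set \<Rightarrow>
     ('o, ('k, 'b) cochain, 'k, 'a, int \<Rightarrow> 'b \<Rightarrow> 'b) K_fun \<Rightarrow> bool" where
  "K_module k U A F \<longleftrightarrow> (\<forall>X\<in>A. K_obj k (OMap F X)) \<and>
     (\<forall>X\<in>A. \<forall>Y\<in>A. K_obj k (U X Y) \<and> HMap F X Y \<in> K_hom k (U X Y) (kihom k (OMap F X) (OMap F Y)))"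

text \<open>Cohomology of an inner hom is only isomorphic to the inner hom of cohomologies, so
  \<open>theta_arrow\<close> is inserted to obtain an action on graded modules.\<close>

definition H_module ::
  "'k ring \<Rightarrow> ('o, ('k, 'b) cochain, 'k, 'a, int \<Rightarrow> 'b \<Rightarrow> 'b) K_fun \<Rightarrow>
     ('o, ('k, 'b set) gmod, 'k, 'a set, int \<Rightarrow> 'b set \<Rightarrow> 'b set) gr_fun" where
  "H_module k F = \<lparr>OMap = \<lambda>X. cohomology (OMap F X),
     HMap = \<lambda>X Y. theta_arrow k (OMap F X) (OMap F Y) \<cdot>\<^sub>g H_map (HMap F X Y)\<rparr>"

section \<open>Functors that agree on the objects\<close>

lemma fun_agreeD:
  "fun_agree A F G \<Longrightarrow> X \<in> A \<Longrightarrow> OMap F X = OMap G X"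
  "fun_agree A F G \<Longrightarrow> X \<in> A \<Longrightarrow> Y \<in> A \<Longrightarrow> HMap F X Y = HMap G X Y"
  by (simp_all add: fun_agree_def)

lemma fun_agree_trans: "fun_agree A F G \<Longrightarrow> fun_agree A G H \<Longrightarrow> fun_agree A F H"
  by (simp add: fun_agree_def)

text \<open>The axioms evaluate the functor only at objects of its source. The congruences below
  share this reason; those with composites need in addition that objects go to objects.\<close>

lemma gr_functor_cong:
  assumes "fun_agree (Obj C) F G"
  shows "gr_functor k C D F \<longleftrightarrow> gr_functor k C D G"
  by (simp add: gr_functor_def fun_agreeD[OF assms] cong: ball_cong)

lemma gr_natiso_cong:
  assumes "fun_agree (Obj C) F F'" "fun_agree (Obj C) G G'"
  shows "gr_natiso k C D F G \<longleftrightarrow> gr_natiso k C D F' G'"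
  by (simp add: gr_natiso_def gr_nattrans_def fun_agreeD[OF assms(1)] fun_agreeD[OF assms(2)] cong: ball_cong)

lemma gr_funcomp_agree:
  assumes "fun_agree (Obj C) F F'" "fun_agree (Obj D) G G'" "\<And>X. X \<in> Obj C \<Longrightarrow> OMap F X \<in> Obj D"
  shows "fun_agree (Obj C) (gr_funcomp G F) (gr_funcomp G' F')"
  using assms by (simp add: fun_agree_def gr_funcomp_def)

lemma gr_equivalence_cong:
  assumes "fun_agree (Obj C) F F'"
  shows "gr_equivalence k C D F \<Longrightarrow> gr_equivalence k C D F'"
  unfolding gr_equivalence_def
proof (elim conjE exE, intro conjI exI)
  fix G assume F: "gr_functor k C D F" and G: "gr_functor k D C G"
    and 1: "gr_natiso k C C (gr_funcomp G F) (gr_idfun C)" and 2: "gr_natiso k D D (gr_funcomp F G) (gr_idfun D)"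
  have o: "OMap F X \<in> Obj D" if "X \<in> Obj C" for X using F that by (simp add: gr_functor_def)
  have o': "OMap G X \<in> Obj C" if "X \<in> Obj D" for X using G that by (simp add: gr_functor_def)
  have r: "fun_agree A H H" for A H by (simp add: fun_agree_def)
  show "gr_functor k C D F'" using F gr_functor_cong[OF assms] by blast
  show "gr_functor k D C G" by fact
  show "gr_natiso k C C (gr_funcomp G F') (gr_idfun C)"
    using 1 gr_natiso_cong[OF gr_funcomp_agree[OF assms r o] r] by blast
  show "gr_natiso k D D (gr_funcomp F' G) (gr_idfun D)"
    using 2 gr_natiso_cong[OF gr_funcomp_agree[OF r assms o'] r] by blast
qed

lemma gr_vnat_cong:
  assumes "fun_agree A F F'" "fun_agree A G G'" "\<And>X. X \<in> A \<Longrightarrow> \<alpha> X = \<alpha>' X"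
  shows "gr_vnat k A F G \<alpha> \<longleftrightarrow> gr_vnat k A F' G' \<alpha>'"
  by (simp add: gr_vnat_def fun_agreeD[OF assms(1)] fun_agreeD[OF assms(2)] assms(3) cong: ball_cong)

lemma gr_dual_agree:
  assumes "fun_agree A F F'"
  shows "fun_agree A (gr_dual k F) (gr_dual k F')"
  by (simp add: fun_agree_def gr_dual_def fun_agreeD[OF assms])

lemma gr_right_serre_cong:
  assumes "fun_agree (Obj C) S S'" and S: "gr_right_serre k C S"
  shows "gr_right_serre k C S'"
proof -
  have F: "gr_functor k C C S" using S by (simp add: gr_right_serre_def)
  have o: "OMap S X \<in> Obj C" if "X \<in> Obj C" for X using F that by (simp add: gr_functor_def)
  obtain \<psi> where \<psi>: "\<forall>X\<in>Obj C. \<forall>Y\<in>Obj C. gr_iso k (Hom C X (OMap S Y)) (gihom k (Hom C Y X) (gunit k)) (\<psi> X Y)"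
    "\<forall>Y\<in>Obj C. gr_vnat k (Obj C) (gr_rep k (gr_op k C) (OMap S Y)) (gr_dual k (gr_rep k C Y)) (\<lambda>X. \<psi> X Y)"
    "\<forall>X\<in>Obj C. gr_vnat k (Obj C) (gr_funcomp (gr_rep k C X) S) (gr_dual k (gr_rep k (gr_op k C) X)) (\<psi> X)"
    using S by (auto simp: gr_right_serre_def)
  have r: "fun_agree A H H" for A H by (simp add: fun_agree_def)
  show ?thesis unfolding gr_right_serre_def
  proof (intro conjI exI[of _ \<psi>] ballI)
    show "gr_functor k C C S'" using F gr_functor_cong[OF assms(1)] by blast
    fix X Y assume X: "X \<in> Obj C" and Y: "Y \<in> Obj C"
    then show "gr_iso k (Hom C X (OMap S' Y)) (gihom k (Hom C Y X) (gunit k)) (\<psi> X Y)"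
      using \<psi>(1) fun_agreeD(1)[OF assms(1)] by simp
  next
    fix Y assume "Y \<in> Obj C"
    then show "gr_vnat k (Obj C) (gr_rep k (gr_op k C) (OMap S' Y)) (gr_dual k (gr_rep k C Y)) (\<lambda>X. \<psi> X Y)"
      using \<psi>(2) fun_agreeD(1)[OF assms(1)] by simp
  next
    fix X assume X: "X \<in> Obj C"
    have "fun_agree (Obj C) (gr_funcomp (gr_rep k C X) S) (gr_funcomp (gr_rep k C X) S')"
      by (rule gr_funcomp_agree[OF assms(1) r o])
    then show "gr_vnat k (Obj C) (gr_funcomp (gr_rep k C X) S') (gr_dual k (gr_rep k (gr_op k C) X)) (\<psi> X)"
      using \<psi>(3) X gr_vnat_cong[OF _ r refl] by blast
  qed
qed

lemma H_cat_sel [simp]: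
  "Obj (H_cat k C) = Obj C" "Hom (H_cat k C) X Y = cohomology (Hom C X Y)"
  "Comp (H_cat k C) X Y Z = H_map (Comp C X Y Z) \<cdot>\<^sub>g kunneth k (Hom C Y Z) (Hom C X Y)"
  "Iden (H_cat k C) X = H_map (Iden C X) \<cdot>\<^sub>g kunneth_unit k"
  by (simp_all add: H_cat_def)

lemma H_fun_sel [simp]: "OMap (H_fun F) = OMap F" "HMap (H_fun F) X Y = H_map (HMap F X Y)"
  by (simp_all add: H_fun_def)

context ground_field
begin

section \<open>Base change of categories\<close>

lemma K_categoryD:
  assumes "K_category k C"
  shows K_category_graph: "K_graph k C"
    and K_category_Hom: "X \<in> Obj C \<Longrightarrow> Y \<in> Obj C \<Longrightarrow> K_obj k (Hom C X Y)"
    and K_category_Comp: "X \<in> Obj C \<Longrightarrow> Y \<in> Obj C \<Longrightarrow> Z \<in> Obj C \<Longrightarrow>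
      Comp C X Y Z \<in> K_hom k (ktens k (Hom C Y Z) (Hom C X Y)) (Hom C X Z)"
    and K_category_Iden: "X \<in> Obj C \<Longrightarrow> Iden C X \<in> K_hom k (kunit k) (Hom C X X)"
  using assms by (auto simp: K_category_def K_graph_def)

text \<open>Base change along a lax monoidal functor. The unit laws are images of those in
  \<open>C\<close> by the translation lemmas; associativity needs the naturality of the Kuenneth
  maps and their coherence \<open>H_map_assoc\<close>.\<close>

lemma H_cat_category:
  assumes C: "K_category k C"
  shows "gr_category k (H_cat k C)"
  unfolding gr_category_def H_cat_sel
proof (intro conjI ballI)
  note h = K_category_Hom[OF C] and c = K_category_Comp[OF C] and d = K_category_Iden[OF C]
  {
    fix X Y assume "X \<in> Obj C" "Y \<in> Obj C"
    then show "gr_obj k (cohomology (Hom C X Y))" using h by simp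
  next
    fix X Y Z assume "X \<in> Obj C" "Y \<in> Obj C" "Z \<in> Obj C"
    then show "H_map (Comp C X Y Z) \<cdot>\<^sub>g kunneth k (Hom C Y Z) (Hom C X Y) \<in>
        gr_hom k (gtens k (cohomology (Hom C Y Z)) (cohomology (Hom C X Y))) (cohomology (Hom C X Z))"
      using h by (intro gr_comp_hom[OF _ kunneth_hom H_map_hom[OF _ _ c]]) simp_all
  next
    fix X assume "X \<in> Obj C"
    then show "H_map (Iden C X) \<cdot>\<^sub>g kunneth_unit k \<in> gr_hom k (gunit k) (cohomology (Hom C X X))"
      using h by (intro H_unit_hom d) simp_all
  next
    fix X Y assume X: "X \<in> Obj C" and Y: "Y \<in> Obj C"
    note o = h[OF X X] h[OF X Y] h[OF Y Y]
    have "K_comp k (Comp C X Y Y) (K_comp k (K_tens k (Iden C Y) (K_id k (Hom C X Y))) (K_linv k (Hom C X Y))) = K_id k (Hom C X Y)"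
      using C X Y by (simp add: K_category_def)
    then show "(H_map (Comp C X Y Y) \<cdot>\<^sub>g kunneth k (Hom C Y Y) (Hom C X Y)) \<cdot>\<^sub>g
      gr_tens k (H_map (Iden C Y) \<cdot>\<^sub>g kunneth_unit k) (gr_id (cohomology (Hom C X Y))) \<cdot>\<^sub>g gr_linv k (cohomology (Hom C X Y)) =
      gr_id (cohomology (Hom C X Y))"
      using H_comp_tens_linv[OF o(3) o(2) o(2) o(2) d[OF Y] K_id_hom[OF o(2)] c[OF X Y Y]] by (simp add: H_map_id o)
    have "K_comp k (Comp C X X Y) (K_comp k (K_tens k (K_id k (Hom C X Y)) (Iden C X)) (K_rinv k (Hom C X Y))) = K_id k (Hom C X Y)"
      using C X Y by (simp add: K_category_def)
    then show "(H_map (Comp C X X Y) \<cdot>\<^sub>g kunneth k (Hom C X Y) (Hom C X X)) \<cdot>\<^sub>g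
      gr_tens k (gr_id (cohomology (Hom C X Y))) (H_map (Iden C X) \<cdot>\<^sub>g kunneth_unit k) \<cdot>\<^sub>g gr_rinv k (cohomology (Hom C X Y)) =
      gr_id (cohomology (Hom C X Y))"
      using H_comp_tens_rinv[OF o(1) o(2) o(2) o(2) d[OF X] K_id_hom[OF o(2)] c[OF X X Y]] by (simp add: H_map_id o)
  next
    fix W X Y Z assume W: "W \<in> Obj C" and X: "X \<in> Obj C" and Y: "Y \<in> Obj C" and Z: "Z \<in> Obj C"
    define A where "A = Hom C Y Z"
    define B where "B = Hom C X Y"
    define E where "E = Hom C W X"
    note o [simp] = h[OF Y Z, folded A_def] h[OF X Y, folded B_def] h[OF W X, folded E_def] h[OF X Z] h[OF W Z] h[OF W Y]
    let ?c1 = "Comp C X Y Z" and ?c2 = "Comp C W X Z" and ?c3 = "Comp C W X Y" and ?c4 = "Comp C W Y Z"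
    have c1: "?c1 \<in> K_hom k (ktens k A B) (Hom C X Z)" and c2: "?c2 \<in> K_hom k (ktens k (Hom C X Z) E) (Hom C W Z)"
      and c3: "?c3 \<in> K_hom k (ktens k B E) (Hom C W Y)" and c4: "?c4 \<in> K_hom k (ktens k A (Hom C W Y)) (Hom C W Z)"
      unfolding A_def B_def E_def using c W X Y Z by auto
    note H1 = H_map_hom[OF _ _ c1] and H2 = H_map_hom[OF _ _ c2] and H3 = H_map_hom[OF _ _ c3] and H4 = H_map_hom[OF _ _ c4]
    note iA = gr_id_hom[OF cohomology_obj[OF o(1)]] and iE = gr_id_hom[OF cohomology_obj[OF o(3)]]
    note kAB = kunneth_hom[OF o(1,2)] and kBE = kunneth_hom[OF o(2,3)]
    let ?K = "K_tens k (K_id k A) ?c3" and ?a = "K_assoc k A B E"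
    have K: "?K \<in> K_hom k (ktens k A (ktens k B E)) (ktens k A (Hom C W Y))" by (intro K_tens_hom K_id_hom c3) simp_all
    have a: "?a \<in> K_hom k (ktens k (ktens k A B) E) (ktens k A (ktens k B E))" by (intro K_assoc_hom) simp_all
    have cK: "K_comp k ?c4 ?K \<in> K_hom k (ktens k A (ktens k B E)) (Hom C W Z)" by (intro K_comp_hom[OF _ _ _ K c4]) simp_all
    have hcK: "H_map (K_comp k ?c4 ?K) \<in> gr_hom k (cohomology (ktens k A (ktens k B E))) (cohomology (Hom C W Z))" by (intro H_map_hom cK) simp_all
    have ha: "H_map ?a \<in> gr_hom k (cohomology (ktens k (ktens k A B) E)) (cohomology (ktens k A (ktens k B E)))" by (intro H_map_hom a) simp_all
    have tk: "gr_tens k (kunneth k A B) (gr_id (cohomology E)) \<in> gr_hom k (gtens k (gtens k (cohomology A) (cohomology B)) (cohomology E)) (gtens k (cohomology (ktens k A B)) (cohomology E))"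
      by (intro gr_tens_hom kAB iE) simp_all
    have kt: "gr_tens k (gr_id (cohomology A)) (kunneth k B E) \<in> gr_hom k (gtens k (cohomology A) (gtens k (cohomology B) (cohomology E))) (gtens k (cohomology A) (cohomology (ktens k B E)))"
      by (intro gr_tens_hom kBE iA) simp_all
    have t1: "gr_tens k (H_map ?c1) (gr_id (cohomology E)) \<in> gr_hom k (gtens k (cohomology (ktens k A B)) (cohomology E)) (gtens k (cohomology (Hom C X Z)) (cohomology E))"
      by (intro gr_tens_hom H1 iE) simp_all
    have t3: "gr_tens k (gr_id (cohomology A)) (H_map ?c3) \<in> gr_hom k (gtens k (cohomology A) (cohomology (ktens k B E))) (gtens k (cohomology A) (cohomology (Hom C W Y)))"
      by (intro gr_tens_hom H3 iA) simp_all
    have k2: "H_map ?c2 \<cdot>\<^sub>g kunneth k (Hom C X Z) E \<in> gr_hom k (gtens k (cohomology (Hom C X Z)) (cohomology E)) (cohomology (Hom C W Z))"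
      by (rule gr_comp_hom[OF _ kunneth_hom H2]) simp_all
    have k4: "H_map ?c4 \<cdot>\<^sub>g kunneth k A (Hom C W Y) \<in> gr_hom k (gtens k (cohomology A) (cohomology (Hom C W Y))) (cohomology (Hom C W Z))"
      by (rule gr_comp_hom[OF _ kunneth_hom H4]) simp_all
    have ga: "gr_assoc k (cohomology A) (cohomology B) (cohomology E) \<in> gr_hom k (gtens k (gtens k (cohomology A) (cohomology B)) (cohomology E)) (gtens k (cohomology A) (gtens k (cohomology B) (cohomology E)))"
      by (intro gr_assoc_hom) simp_all
    have k0: "kunneth k (ktens k A B) E \<in> gr_hom k (gtens k (cohomology (ktens k A B)) (cohomology E)) (cohomology (ktens k (ktens k A B) E))"
      by (intro kunneth_hom) simp_all
    have k5: "kunneth k A (ktens k B E) \<in> gr_hom k (gtens k (cohomology A) (cohomology (ktens k B E))) (cohomology (ktens k A (ktens k B E)))"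
      by (intro kunneth_hom) simp_all
    have eqK: "K_comp k ?c2 (K_tens k ?c1 (K_id k E)) = K_comp k ?c4 (K_comp k ?K ?a)"
      unfolding A_def B_def E_def using C W X Y Z by (simp add: K_category_def)
    \<comment> \<open>The Kuenneth map is pulled out of the inner tensor factor, so that two
      Kuenneth maps in a row stand before the image of a composite in \<open>C\<close>, to which
      \<open>eqK\<close> applies.\<close>
    have "(H_map ?c2 \<cdot>\<^sub>g kunneth k (Hom C X Z) E) \<cdot>\<^sub>g gr_tens k (H_map ?c1 \<cdot>\<^sub>g kunneth k A B) (gr_id (cohomology E)) =
      (H_map ?c2 \<cdot>\<^sub>g kunneth k (Hom C X Z) E) \<cdot>\<^sub>g gr_tens k (H_map ?c1) (gr_id (cohomology E)) \<cdot>\<^sub>g gr_tens k (kunneth k A B) (gr_id (cohomology E))"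
      using gr_tens_comp[OF _ _ _ _ _ _ kAB H1 iE iE] gr_id_right[OF _ iE] by simp
    also have "\<dots> = ((H_map ?c2 \<cdot>\<^sub>g kunneth k (Hom C X Z) E) \<cdot>\<^sub>g gr_tens k (H_map ?c1) (gr_id (cohomology E))) \<cdot>\<^sub>g gr_tens k (kunneth k A B) (gr_id (cohomology E))"
      by (rule gr_comp_assoc[OF _ _ tk t1 k2, symmetric]) simp_all
    also have "(H_map ?c2 \<cdot>\<^sub>g kunneth k (Hom C X Z) E) \<cdot>\<^sub>g gr_tens k (H_map ?c1) (gr_id (cohomology E)) =
      H_map (K_comp k ?c2 (K_tens k ?c1 (K_id k E))) \<cdot>\<^sub>g kunneth k (ktens k A B) E"
      using H_comp_tens_kunneth[OF _ _ _ _ _ c1 K_id_hom[OF o(3)] c2] by (simp add: H_map_id)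
    also have "H_map (K_comp k ?c2 (K_tens k ?c1 (K_id k E))) = H_map (K_comp k ?c4 ?K) \<cdot>\<^sub>g H_map ?a"
    proof -
      have "H_map (K_comp k ?c4 (K_comp k ?K ?a)) = H_map ?c4 \<cdot>\<^sub>g H_map (K_comp k ?K ?a)"
        by (rule H_map_comp[OF _ _ _ K_comp_hom[OF _ _ _ a K] c4]) simp_all
      also have "H_map (K_comp k ?K ?a) = H_map ?K \<cdot>\<^sub>g H_map ?a" by (rule H_map_comp[OF _ _ _ a K]) simp_all
      also have "H_map ?c4 \<cdot>\<^sub>g H_map ?K \<cdot>\<^sub>g H_map ?a = (H_map ?c4 \<cdot>\<^sub>g H_map ?K) \<cdot>\<^sub>g H_map ?a"
        by (rule gr_comp_assoc[OF _ _ ha H_map_hom[OF _ _ K] H4, symmetric]) simp_all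
      also have "H_map ?c4 \<cdot>\<^sub>g H_map ?K = H_map (K_comp k ?c4 ?K)" by (rule H_map_comp[OF _ _ _ K c4, symmetric]) simp_all
      finally show ?thesis unfolding eqK .
    qed
    also have "((H_map (K_comp k ?c4 ?K) \<cdot>\<^sub>g H_map ?a) \<cdot>\<^sub>g kunneth k (ktens k A B) E) \<cdot>\<^sub>g gr_tens k (kunneth k A B) (gr_id (cohomology E)) =
      (H_map (K_comp k ?c4 ?K) \<cdot>\<^sub>g H_map ?a \<cdot>\<^sub>g kunneth k (ktens k A B) E) \<cdot>\<^sub>g gr_tens k (kunneth k A B) (gr_id (cohomology E))"
      by (subst gr_comp_assoc[OF _ _ k0 ha hcK]) simp_all
    also have "\<dots> = H_map (K_comp k ?c4 ?K) \<cdot>\<^sub>g (H_map ?a \<cdot>\<^sub>g kunneth k (ktens k A B) E) \<cdot>\<^sub>g gr_tens k (kunneth k A B) (gr_id (cohomology E))"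
      by (rule gr_comp_assoc[OF _ _ tk gr_comp_hom[OF _ k0 ha] hcK]) simp_all
    also have "(H_map ?a \<cdot>\<^sub>g kunneth k (ktens k A B) E) \<cdot>\<^sub>g gr_tens k (kunneth k A B) (gr_id (cohomology E)) =
      H_map ?a \<cdot>\<^sub>g kunneth k (ktens k A B) E \<cdot>\<^sub>g gr_tens k (kunneth k A B) (gr_id (cohomology E))"
      by (rule gr_comp_assoc[OF _ _ tk k0 ha]) simp_all
    \<comment> \<open>The coherence exchanges the associativity of complexes for that of graded
      modules; what follows undoes, on the other side, the moves made so far.\<close>
    also have "\<dots> = kunneth k A (ktens k B E) \<cdot>\<^sub>g gr_tens k (gr_id (cohomology A)) (kunneth k B E) \<cdot>\<^sub>g gr_assoc k (cohomology A) (cohomology B) (cohomology E)"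
      by (rule H_map_assoc) simp_all
    also have "H_map (K_comp k ?c4 ?K) \<cdot>\<^sub>g \<dots> = (H_map (K_comp k ?c4 ?K) \<cdot>\<^sub>g kunneth k A (ktens k B E)) \<cdot>\<^sub>g gr_tens k (gr_id (cohomology A)) (kunneth k B E) \<cdot>\<^sub>g gr_assoc k (cohomology A) (cohomology B) (cohomology E)"
      by (rule gr_comp_assoc[OF _ _ gr_comp_hom[OF _ ga kt] k5 hcK, symmetric]) simp_all
    also have "H_map (K_comp k ?c4 ?K) \<cdot>\<^sub>g kunneth k A (ktens k B E) =
      (H_map ?c4 \<cdot>\<^sub>g kunneth k A (Hom C W Y)) \<cdot>\<^sub>g gr_tens k (gr_id (cohomology A)) (H_map ?c3)"
      using H_comp_tens_kunneth[OF _ _ _ _ _ K_id_hom[OF o(1)] c3 c4] by (simp add: H_map_id)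
    also have "\<dots> \<cdot>\<^sub>g gr_tens k (gr_id (cohomology A)) (kunneth k B E) \<cdot>\<^sub>g gr_assoc k (cohomology A) (cohomology B) (cohomology E) =
      (H_map ?c4 \<cdot>\<^sub>g kunneth k A (Hom C W Y)) \<cdot>\<^sub>g gr_tens k (gr_id (cohomology A)) (H_map ?c3) \<cdot>\<^sub>g
        gr_tens k (gr_id (cohomology A)) (kunneth k B E) \<cdot>\<^sub>g gr_assoc k (cohomology A) (cohomology B) (cohomology E)"
      by (rule gr_comp_assoc[OF _ _ gr_comp_hom[OF _ ga kt] t3 k4]) simp_all
    also have "gr_tens k (gr_id (cohomology A)) (H_map ?c3) \<cdot>\<^sub>g
        gr_tens k (gr_id (cohomology A)) (kunneth k B E) \<cdot>\<^sub>g gr_assoc k (cohomology A) (cohomology B) (cohomology E) =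
       (gr_tens k (gr_id (cohomology A)) (H_map ?c3) \<cdot>\<^sub>g gr_tens k (gr_id (cohomology A)) (kunneth k B E)) \<cdot>\<^sub>g gr_assoc k (cohomology A) (cohomology B) (cohomology E)"
      by (rule gr_comp_assoc[OF _ _ ga kt t3, symmetric]) simp_all
    also have "gr_tens k (gr_id (cohomology A)) (H_map ?c3) \<cdot>\<^sub>g gr_tens k (gr_id (cohomology A)) (kunneth k B E) =
      gr_tens k (gr_id (cohomology A)) (H_map ?c3 \<cdot>\<^sub>g kunneth k B E)"
      using gr_tens_comp[OF _ _ _ _ _ _ iA iA kBE H3] gr_id_right[OF _ iA] by simp
    finally show "(H_map (Comp C W X Z) \<cdot>\<^sub>g kunneth k (Hom C X Z) (Hom C W X)) \<cdot>\<^sub>g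
        gr_tens k (H_map (Comp C X Y Z) \<cdot>\<^sub>g kunneth k (Hom C Y Z) (Hom C X Y)) (gr_id (cohomology (Hom C W X))) =
      (H_map (Comp C W Y Z) \<cdot>\<^sub>g kunneth k (Hom C Y Z) (Hom C W Y)) \<cdot>\<^sub>g
        gr_tens k (gr_id (cohomology (Hom C Y Z))) (H_map (Comp C W X Y) \<cdot>\<^sub>g kunneth k (Hom C X Y) (Hom C W X)) \<cdot>\<^sub>g
        gr_assoc k (cohomology (Hom C Y Z)) (cohomology (Hom C X Y)) (cohomology (Hom C W X))"
      unfolding A_def B_def E_def .
  }
qed

section \<open>Base change of functors\<close>

lemma K_functor_prefunctor: "K_functor k C D F \<Longrightarrow> K_prefunctor k C D F"
  by (simp add: K_functor_def K_prefunctor_def)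

lemma K_prefunctorD:
  assumes "K_prefunctor k C D F"
  shows K_prefunctor_OMap: "X \<in> Obj C \<Longrightarrow> OMap F X \<in> Obj D"
    and K_prefunctor_HMap: "X \<in> Obj C \<Longrightarrow> Y \<in> Obj C \<Longrightarrow> HMap F X Y \<in> K_hom k (Hom C X Y) (Hom D (OMap F X) (OMap F Y))"
  using assms by (simp_all add: K_prefunctor_def)

lemma H_functor_iff:
  assumes C: "K_category k C" and D: "K_category k D" and F: "K_prefunctor k C D F"
  shows "K_functor k C D F \<longleftrightarrow> gr_functor k (H_cat k C) (H_cat k D) (H_fun F)"
proof -
  note hC = K_category_Hom[OF C] and cC = K_category_Comp[OF C] and dC = K_category_Iden[OF C]
  note hD = K_category_Hom[OF D] and cD = K_category_Comp[OF D] and dD = K_category_Iden[OF D]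
  note oF = K_prefunctor_OMap[OF F] and mF = K_prefunctor_HMap[OF F]
  have 1: "K_comp k (HMap F X Z) (Comp C X Y Z) = K_comp k (Comp D (OMap F X) (OMap F Y) (OMap F Z)) (K_tens k (HMap F Y Z) (HMap F X Y)) \<longleftrightarrow>
     H_map (HMap F X Z) \<cdot>\<^sub>g H_map (Comp C X Y Z) \<cdot>\<^sub>g kunneth k (Hom C Y Z) (Hom C X Y) =
     (H_map (Comp D (OMap F X) (OMap F Y) (OMap F Z)) \<cdot>\<^sub>g kunneth k (Hom D (OMap F Y) (OMap F Z)) (Hom D (OMap F X) (OMap F Y))) \<cdot>\<^sub>g
       gr_tens k (H_map (HMap F Y Z)) (H_map (HMap F X Y))" (is "?L = ?R \<longleftrightarrow> ?L' = ?R'")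
    if XYZ: "X \<in> Obj C" "Y \<in> Obj C" "Z \<in> Obj C" for X Y Z
  proof -
    note o = hC[OF XYZ(2,3)] hC[OF XYZ(1,2)] hC[OF XYZ(1,3)] hD[OF oF[OF XYZ(2)] oF[OF XYZ(3)]]
      hD[OF oF[OF XYZ(1)] oF[OF XYZ(2)]] hD[OF oF[OF XYZ(1)] oF[OF XYZ(3)]]
    note m = mF[OF XYZ(1,3)] mF[OF XYZ(2,3)] mF[OF XYZ(1,2)] and c = cC[OF XYZ] cD[OF oF[OF XYZ(1)] oF[OF XYZ(2)] oF[OF XYZ(3)]]
    have L: "H_map ?L \<cdot>\<^sub>g kunneth k (Hom C Y Z) (Hom C X Y) = ?L'"
      by (rule H_comp_kunneth[OF o(1,2,3,6) c(1) m(1)])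
    have R: "H_map ?R \<cdot>\<^sub>g kunneth k (Hom C Y Z) (Hom C X Y) = ?R'"
      by (rule H_comp_tens_kunneth[OF o(1,2,4,5,6) m(2,3) c(2)])
    have "?L \<in> K_hom k (ktens k (Hom C Y Z) (Hom C X Y)) (Hom D (OMap F X) (OMap F Z))"
      by (rule K_comp_hom[OF _ o(3,6) c(1) m(1)]) (simp add: o)
    moreover have "?R \<in> K_hom k (ktens k (Hom C Y Z) (Hom C X Y)) (Hom D (OMap F X) (OMap F Z))"
      by (rule K_comp_hom[OF _ _ o(6) K_tens_hom[OF o(1,2,4,5) m(2,3)] c(2)]) (simp_all add: o)
    \<comment> \<open>Both directions at once: \<open>L\<close> and \<open>R\<close> identify the
      images of the two sides, and precomposition with the Kuenneth map is faithful.\<close>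
    ultimately show ?thesis using K_tens_faithful[OF o(1,2,6), of ?L ?R] L R by metis
  qed
  have 2: "K_comp k (HMap F X X) (Iden C X) = Iden D (OMap F X) \<longleftrightarrow>
     H_map (HMap F X X) \<cdot>\<^sub>g H_map (Iden C X) \<cdot>\<^sub>g kunneth_unit k = H_map (Iden D (OMap F X)) \<cdot>\<^sub>g kunneth_unit k" (is "?L = ?R \<longleftrightarrow> ?L' = ?R'")
    if X: "X \<in> Obj C" for X
  proof -
    note o = hC[OF X X] hD[OF oF[OF X] oF[OF X]]
    have L: "H_map ?L \<cdot>\<^sub>g kunneth_unit k = ?L'" by (rule H_comp_unit[OF o dC[OF X] mF[OF X X]])
    have "?L \<in> K_hom k (kunit k) (Hom D (OMap F X) (OMap F X))" by (rule K_comp_hom[OF _ o dC[OF X] mF[OF X X]]) simp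
    then show ?thesis using H_unit_faithful[OF o(2), of ?L ?R] L dD[OF oF[OF X]] by metis
  qed
  have 3: "H_map (HMap F X Y) \<in> gr_hom k (cohomology (Hom C X Y)) (cohomology (Hom D (OMap F X) (OMap F Y)))"
    if "X \<in> Obj C" "Y \<in> Obj C" for X Y
    using that by (intro H_map_hom mF hC hD oF)
  show ?thesis unfolding K_functor_def gr_functor_def
    using C D H_cat_category[OF C] H_cat_category[OF D] by (simp add: 1 2 3 oF mF cong: ball_cong)
qed

text \<open>Only typed data are lifted, arrow by arrow through fullness. That they form a functor is
  left to \<open>H_functor_iff\<close>, once the given functor is exchanged for the one that agrees
  with it on objects.\<close>

lemma H_functor_lift:
  assumes C: "K_category k C" and D: "K_category k D" and S: "gr_functor k (H_cat k C) (H_cat k D) S"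
  obtains F where "K_prefunctor k C D F" "fun_agree (Obj C) S (H_fun F)"
proof -
  have o: "OMap S X \<in> Obj D" if "X \<in> Obj C" for X using S that by (simp add: gr_functor_def)
  have m: "HMap S X Y \<in> gr_hom k (cohomology (Hom C X Y)) (cohomology (Hom D (OMap S X) (OMap S Y)))"
    if "X \<in> Obj C" "Y \<in> Obj C" for X Y using S that by (simp add: gr_functor_def)
  let ?P = "\<lambda>X Y F. F \<in> K_hom k (Hom C X Y) (Hom D (OMap S X) (OMap S Y)) \<and> H_map F = HMap S X Y"
  have "\<exists>F. ?P X Y F" if "X \<in> Obj C" "Y \<in> Obj C" for X Y
    using H_map_full[OF K_category_Hom[OF C that] K_category_Hom[OF D o[OF that(1)] o[OF that(2)]] m[OF that]] by metis
  then have P: "?P X Y (SOME F. ?P X Y F)" if "X \<in> Obj C" "Y \<in> Obj C" for X Y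
    using that someI_ex[of "?P X Y"] by blast
  let ?F = "\<lparr>OMap = OMap S, HMap = \<lambda>X Y. SOME F. ?P X Y F\<rparr>"
  have "K_prefunctor k C D ?F" using P o by (simp add: K_prefunctor_def)
  moreover have "fun_agree (Obj C) S (H_fun ?F)" using P by (simp add: fun_agree_def)
  ultimately show ?thesis by (rule that)
qed

section \<open>Natural isomorphisms\<close>

text \<open>The functor \<open>H_map\<close>, preceded by \<open>kunneth_unit\<close>, respects
  composition in the underlying categories. The translation of the unit map leaves it at the
  cohomology of \<open>kunit\<close>, and it has to be moved to \<open>gunit\<close>.\<close>

lemma H_ucomp:
  assumes C: "K_category k C" and X: "X \<in> Obj C" "Y \<in> Obj C" "Z \<in> Obj C"
    and g: "g \<in> K_hom k (kunit k) (Hom C Y Z)" and f: "f \<in> K_hom k (kunit k) (Hom C X Y)"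
  shows "H_map (K_ucomp k C X Y Z g f) \<cdot>\<^sub>g kunneth_unit k =
    gr_ucomp k (H_cat k C) X Y Z (H_map g \<cdot>\<^sub>g kunneth_unit k) (H_map f \<cdot>\<^sub>g kunneth_unit k)"
proof -
  note o [simp] = K_category_Hom[OF C X(2,3)] K_category_Hom[OF C X(1,2)] K_category_Hom[OF C X(1,3)]
  note c = K_category_Comp[OF C X]
  let ?U = "cohomology (kunit k)" and ?e = "kunneth_unit k"
  note g' = H_unit_hom[OF o(1) g] and f' = H_map_hom[OF kunit_obj o(2) f]
  have ck: "H_map (Comp C X Y Z) \<cdot>\<^sub>g kunneth k (Hom C Y Z) (Hom C X Y) \<in> gr_hom k (gtens k (cohomology (Hom C Y Z)) (cohomology (Hom C X Y))) (cohomology (Hom C X Z))"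
    by (rule gr_comp_hom[OF _ kunneth_hom H_map_hom[OF _ _ c]]) simp_all
  have t: "gr_tens k (H_map g \<cdot>\<^sub>g ?e) (H_map f) \<in> gr_hom k (gtens k (gunit k) ?U) (gtens k (cohomology (Hom C Y Z)) (cohomology (Hom C X Y)))"
    by (rule gr_tens_hom[OF _ _ _ _ g' f']) simp_all
  have l: "gr_linv k ?U \<in> gr_hom k ?U (gtens k (gunit k) ?U)" by (rule gr_linv_hom) simp
  have l': "gr_linv k (gunit k) \<in> gr_hom k (gunit k) (gtens k (gunit k) (gunit k))" by (rule gr_linv_hom) simp
  have i: "gr_id (gunit k) \<in> gr_hom k (gunit k) (gunit k)" by (rule gr_id_hom) simp
  have t': "gr_tens k (gr_id (gunit k)) ?e \<in> gr_hom k (gtens k (gunit k) (gunit k)) (gtens k (gunit k) ?U)"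
    by (rule gr_tens_hom[OF _ _ _ _ i kunneth_unit_hom]) simp_all
  \<comment> \<open>Naturality of \<open>X \<rightarrow> 1 \<otimes> X\<close> along
    \<open>kunneth_unit\<close>.\<close>
  have nat: "gr_linv k ?U \<cdot>\<^sub>g ?e = gr_tens k (gr_id (gunit k)) ?e \<cdot>\<^sub>g gr_linv k (gunit k)"
  proof (rule gr_hom_eqI[OF gr_comp_hom[OF _ kunneth_unit_hom l] gr_comp_hom[OF _ l' t']])
    fix n a assume a: "a \<in> carrier (gunit k n)"
    then have "Map ?e n a \<in> carrier (?U n)" by (rule gr_hom_closed[OF kunneth_unit_hom])
    then show "Map (gr_linv k ?U \<cdot>\<^sub>g ?e) n a = Map (gr_tens k (gr_id (gunit k)) ?e \<cdot>\<^sub>g gr_linv k (gunit k)) n a"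
      using a by (simp add: gr_comp_apply_hom[OF kunneth_unit_hom] gr_comp_apply_hom[OF l'] gr_linv_apply
        gr_tens_apply[OF _ _ _ _ i kunneth_unit_hom] gr_id_apply[where X = "gunit k"])
  qed simp_all
  have "H_map (K_ucomp k C X Y Z g f) = (H_map (Comp C X Y Z) \<cdot>\<^sub>g kunneth k (Hom C Y Z) (Hom C X Y)) \<cdot>\<^sub>g
      gr_tens k (H_map g \<cdot>\<^sub>g ?e) (H_map f) \<cdot>\<^sub>g gr_linv k ?U"
    unfolding K_ucomp_def by (rule H_comp_tens_linv[OF _ _ _ _ g f c]) simp_all
  then have "H_map (K_ucomp k C X Y Z g f) \<cdot>\<^sub>g ?e = (H_map (Comp C X Y Z) \<cdot>\<^sub>g kunneth k (Hom C Y Z) (Hom C X Y)) \<cdot>\<^sub>g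
      (gr_tens k (H_map g \<cdot>\<^sub>g ?e) (H_map f) \<cdot>\<^sub>g gr_linv k ?U) \<cdot>\<^sub>g ?e"
    by (simp add: gr_comp_assoc[OF _ _ kunneth_unit_hom gr_comp_hom[OF _ l t] ck])
  also have "(gr_tens k (H_map g \<cdot>\<^sub>g ?e) (H_map f) \<cdot>\<^sub>g gr_linv k ?U) \<cdot>\<^sub>g ?e = gr_tens k (H_map g \<cdot>\<^sub>g ?e) (H_map f) \<cdot>\<^sub>g gr_linv k ?U \<cdot>\<^sub>g ?e"
    by (rule gr_comp_assoc[OF _ _ kunneth_unit_hom l t]) simp_all
  also have "\<dots> = (gr_tens k (H_map g \<cdot>\<^sub>g ?e) (H_map f) \<cdot>\<^sub>g gr_tens k (gr_id (gunit k)) ?e) \<cdot>\<^sub>g gr_linv k (gunit k)"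
    unfolding nat by (rule gr_comp_assoc[OF _ _ l' t' t, symmetric]) simp_all
  also have "gr_tens k (H_map g \<cdot>\<^sub>g ?e) (H_map f) \<cdot>\<^sub>g gr_tens k (gr_id (gunit k)) ?e = gr_tens k (H_map g \<cdot>\<^sub>g ?e) (H_map f \<cdot>\<^sub>g ?e)"
    using gr_tens_comp[OF _ _ _ _ _ _ i g' kunneth_unit_hom f'] gr_id_right[OF _ g'] by simp
  finally show ?thesis by (simp add: gr_ucomp_def)
qed

text \<open>An inverse on cohomology is lifted by \<open>H_unit_full\<close>. The two equations
  between arrows out of the unit are then reflected by \<open>u\<close>.\<close>

lemma H_uiso_iff:
  assumes C: "K_category k C" and X: "X \<in> Obj C" "Y \<in> Obj C" and f: "f \<in> K_hom k (kunit k) (Hom C X Y)"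
  shows "K_uiso k C X Y f \<longleftrightarrow> gr_uiso k (H_cat k C) X Y (H_map f \<cdot>\<^sub>g kunneth_unit k)"
proof -
  note o = K_category_Hom[OF C]
  have u: "K_ucomp k C X Y Z g f = h \<longleftrightarrow> gr_ucomp k (H_cat k C) X Y Z (H_map g \<cdot>\<^sub>g kunneth_unit k) (H_map f \<cdot>\<^sub>g kunneth_unit k) = H_map h \<cdot>\<^sub>g kunneth_unit k"
    if XYZ: "X \<in> Obj C" "Y \<in> Obj C" "Z \<in> Obj C" and g: "g \<in> K_hom k (kunit k) (Hom C Y Z)" and f: "f \<in> K_hom k (kunit k) (Hom C X Y)"
      and h: "h \<in> K_hom k (kunit k) (Hom C X Z)" for X Y Z f g h
  proof -
    have "K_ucomp k C X Y Z g f \<in> K_hom k (kunit k) (Hom C X Z)"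
      unfolding K_ucomp_def
      by (rule K_comp_hom[OF _ _ _ K_comp_hom[OF _ _ _ K_linv_hom K_tens_hom[OF _ _ _ _ g f]] K_category_Comp[OF C XYZ]])
        (simp_all add: o XYZ)
    then show ?thesis
      using H_unit_faithful[OF o[OF XYZ(1,3)] _ h] H_ucomp[OF C XYZ g f] by metis
  qed
  show ?thesis
  proof
    assume "K_uiso k C X Y f"
    then obtain g where g: "g \<in> K_hom k (kunit k) (Hom C Y X)" "K_ucomp k C X Y X g f = Iden C X" "K_ucomp k C Y X Y f g = Iden C Y"
      by (auto simp: K_uiso_def)
    then show "gr_uiso k (H_cat k C) X Y (H_map f \<cdot>\<^sub>g kunneth_unit k)"
      unfolding gr_uiso_def H_cat_sel
      using u[OF X(1,2,1) g(1) f K_category_Iden[OF C X(1)]] u[OF X(2,1,2) f g(1) K_category_Iden[OF C X(2)]]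
        H_unit_hom[OF o[OF X] f] H_unit_hom[OF o[OF X(2,1)] g(1)] by blast
  next
    assume "gr_uiso k (H_cat k C) X Y (H_map f \<cdot>\<^sub>g kunneth_unit k)"
    then obtain \<gamma> where \<gamma>: "\<gamma> \<in> gr_hom k (gunit k) (cohomology (Hom C Y X))"
      "gr_ucomp k (H_cat k C) X Y X \<gamma> (H_map f \<cdot>\<^sub>g kunneth_unit k) = H_map (Iden C X) \<cdot>\<^sub>g kunneth_unit k"
      "gr_ucomp k (H_cat k C) Y X Y (H_map f \<cdot>\<^sub>g kunneth_unit k) \<gamma> = H_map (Iden C Y) \<cdot>\<^sub>g kunneth_unit k"
      by (auto simp: gr_uiso_def)
    obtain g where g: "g \<in> K_hom k (kunit k) (Hom C Y X)" "H_map g \<cdot>\<^sub>g kunneth_unit k = \<gamma>"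
      using H_unit_full[OF o[OF X(2,1)] \<gamma>(1)] .
    have "K_ucomp k C X Y X g f = Iden C X" "K_ucomp k C Y X Y f g = Iden C Y"
      using u[OF X(1,2,1) g(1) f K_category_Iden[OF C X(1)]] u[OF X(2,1,2) f g(1) K_category_Iden[OF C X(2)]] \<gamma> g(2) by simp_all
    then show "K_uiso k C X Y f" using f g(1) by (auto simp: K_uiso_def)
  qed
qed

text \<open>The components are arrows out of the unit, so they correspond to their images after
  \<open>kunneth_unit\<close>. Both sides of naturality start at a hom complex, so faithfulness of
  \<open>H_map\<close> alone decides them.\<close>

lemma H_natiso_iff:
  assumes C: "K_category k C" and D: "K_category k D" and F: "K_prefunctor k C D F" and G: "K_prefunctor k C D G"
  shows "K_natiso k C D F G \<longleftrightarrow> gr_natiso k (H_cat k C) (H_cat k D) (H_fun F) (H_fun G)"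
proof -
  note hC = K_category_Hom[OF C] and hD = K_category_Hom[OF D] and cD = K_category_Comp[OF D]
  note oF = K_prefunctor_OMap[OF F] and mF = K_prefunctor_HMap[OF F] and oG = K_prefunctor_OMap[OF G] and mG = K_prefunctor_HMap[OF G]
  let ?e = "kunneth_unit k"
  have nat: "K_nattrans k C D F G \<alpha> \<longleftrightarrow> gr_nattrans k (H_cat k C) (H_cat k D) (H_fun F) (H_fun G) (\<lambda>X. H_map (\<alpha> X) \<cdot>\<^sub>g ?e)"
    if \<alpha>: "\<And>X. X \<in> Obj C \<Longrightarrow> \<alpha> X \<in> K_hom k (kunit k) (Hom D (OMap F X) (OMap G X))" for \<alpha>
  proof -
    have "K_comp k (Comp D (OMap F X) (OMap F Y) (OMap G Y)) (K_comp k (K_tens k (\<alpha> Y) (HMap F X Y)) (K_linv k (Hom C X Y))) =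
        K_comp k (Comp D (OMap F X) (OMap G X) (OMap G Y)) (K_comp k (K_tens k (HMap G X Y) (\<alpha> X)) (K_rinv k (Hom C X Y))) \<longleftrightarrow>
      (H_map (Comp D (OMap F X) (OMap F Y) (OMap G Y)) \<cdot>\<^sub>g kunneth k (Hom D (OMap F Y) (OMap G Y)) (Hom D (OMap F X) (OMap F Y))) \<cdot>\<^sub>g
        gr_tens k (H_map (\<alpha> Y) \<cdot>\<^sub>g ?e) (H_map (HMap F X Y)) \<cdot>\<^sub>g gr_linv k (cohomology (Hom C X Y)) =
      (H_map (Comp D (OMap F X) (OMap G X) (OMap G Y)) \<cdot>\<^sub>g kunneth k (Hom D (OMap G X) (OMap G Y)) (Hom D (OMap F X) (OMap G X))) \<cdot>\<^sub>g
        gr_tens k (H_map (HMap G X Y)) (H_map (\<alpha> X) \<cdot>\<^sub>g ?e) \<cdot>\<^sub>g gr_rinv k (cohomology (Hom C X Y))" (is "?L = ?R \<longleftrightarrow> ?L' = ?R'")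
      if X: "X \<in> Obj C" and Y: "Y \<in> Obj C" for X Y
    proof -
      note o [simp] = hC[OF X Y] hD[OF oF[OF Y] oG[OF Y]] hD[OF oF[OF X] oF[OF Y]] hD[OF oF[OF X] oG[OF Y]]
        hD[OF oG[OF X] oG[OF Y]] hD[OF oF[OF X] oG[OF X]]
      note c = cD[OF oF[OF X] oF[OF Y] oG[OF Y]] cD[OF oF[OF X] oG[OF X] oG[OF Y]]
      note a = \<alpha>[OF X] \<alpha>[OF Y] and m = mF[OF X Y] mG[OF X Y]
      have L: "H_map ?L = ?L'" by (rule H_comp_tens_linv[OF o(2,1,3,4) a(2) m(1) c(1)])
      have R: "H_map ?R = ?R'" by (rule H_comp_tens_rinv[OF o(6,1,5,4) a(1) m(2) c(2)])
      have "?L \<in> K_hom k (Hom C X Y) (Hom D (OMap F X) (OMap G Y))"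
        by (rule K_comp_hom[OF _ _ _ K_comp_hom[OF _ _ _ K_linv_hom K_tens_hom[OF _ _ _ _ a(2) m(1)]] c(1)]) simp_all
      moreover have "?R \<in> K_hom k (Hom C X Y) (Hom D (OMap F X) (OMap G Y))"
        by (rule K_comp_hom[OF _ _ _ K_comp_hom[OF _ _ _ K_rinv_hom K_tens_hom[OF _ _ _ _ m(2) a(1)]] c(2)]) simp_all
      ultimately show ?thesis using H_map_faithful[OF o(1,4), of ?L ?R] L R by metis
    qed
    moreover have "H_map (\<alpha> X) \<cdot>\<^sub>g ?e \<in> gr_hom k (gunit k) (cohomology (Hom D (OMap F X) (OMap G X)))" if "X \<in> Obj C" for X
      using that by (intro H_unit_hom hD oF oG \<alpha>)
    ultimately show ?thesis unfolding K_nattrans_def gr_nattrans_def by (simp add: \<alpha> cong: ball_cong)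
  qed
  show ?thesis
  proof
    assume "K_natiso k C D F G"
    then obtain \<alpha> where \<alpha>: "K_nattrans k C D F G \<alpha>" "\<forall>X\<in>Obj C. K_uiso k D (OMap F X) (OMap G X) (\<alpha> X)"
      by (auto simp: K_natiso_def)
    then have h: "X \<in> Obj C \<Longrightarrow> \<alpha> X \<in> K_hom k (kunit k) (Hom D (OMap F X) (OMap G X))" for X by (simp add: K_nattrans_def)
    have "gr_uiso k (H_cat k D) (OMap F X) (OMap G X) (H_map (\<alpha> X) \<cdot>\<^sub>g ?e)" if "X \<in> Obj C" for X
      using H_uiso_iff[OF D oF[OF that] oG[OF that] h[OF that]] \<alpha>(2) that by blast
    then show "gr_natiso k (H_cat k C) (H_cat k D) (H_fun F) (H_fun G)"
      unfolding gr_natiso_def using nat[of \<alpha>, OF h] \<alpha>(1) by (intro exI[of _ "\<lambda>X. H_map (\<alpha> X) \<cdot>\<^sub>g ?e"]) simp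
  next
    assume "gr_natiso k (H_cat k C) (H_cat k D) (H_fun F) (H_fun G)"
    then obtain \<beta> where \<beta>: "gr_nattrans k (H_cat k C) (H_cat k D) (H_fun F) (H_fun G) \<beta>"
      "\<forall>X\<in>Obj C. gr_uiso k (H_cat k D) (OMap F X) (OMap G X) (\<beta> X)"
      by (auto simp: gr_natiso_def)
    then have h: "\<beta> X \<in> gr_hom k (gunit k) (cohomology (Hom D (OMap F X) (OMap G X)))" if "X \<in> Obj C" for X
      using that by (simp add: gr_nattrans_def)
    have "\<exists>a. a \<in> K_hom k (kunit k) (Hom D (OMap F X) (OMap G X)) \<and> H_map a \<cdot>\<^sub>g ?e = \<beta> X" if "X \<in> Obj C" for X
      using H_unit_full[OF hD[OF oF[OF that] oG[OF that]] h[OF that]] by metis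
    then have "\<forall>X\<in>Obj C. \<exists>a. a \<in> K_hom k (kunit k) (Hom D (OMap F X) (OMap G X)) \<and> H_map a \<cdot>\<^sub>g ?e = \<beta> X" by simp
    from bchoice[OF this] obtain \<alpha> where \<alpha>: "\<And>X. X \<in> Obj C \<Longrightarrow> \<alpha> X \<in> K_hom k (kunit k) (Hom D (OMap F X) (OMap G X))"
      "\<And>X. X \<in> Obj C \<Longrightarrow> H_map (\<alpha> X) \<cdot>\<^sub>g ?e = \<beta> X" by auto
    \<comment> \<open>The images of the chosen lifts equal the given components at objects only, and
      naturality mentions no others.\<close>
    have "gr_nattrans k (H_cat k C) (H_cat k D) (H_fun F) (H_fun G) (\<lambda>X. H_map (\<alpha> X) \<cdot>\<^sub>g ?e)"
      using \<beta>(1) by (simp add: gr_nattrans_def \<alpha>(2) cong: ball_cong)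
    then have "K_nattrans k C D F G \<alpha>" using nat[of \<alpha>, OF \<alpha>(1)] by simp
    moreover have "K_uiso k D (OMap F X) (OMap G X) (\<alpha> X)" if "X \<in> Obj C" for X
      using H_uiso_iff[OF D oF[OF that] oG[OF that] \<alpha>(1)[OF that]] \<beta>(2) \<alpha>(2) that by simp
    ultimately show "K_natiso k C D F G" by (auto simp: K_natiso_def)
  qed
qed

section \<open>Equivalences\<close>

lemma K_funcomp_prefunctor:
  assumes C: "K_category k C" and D: "K_category k D" and E: "K_category k E"
    and F: "K_prefunctor k C D F" and G: "K_prefunctor k D E G"
  shows "K_prefunctor k C E (K_funcomp k G F)"
    and "fun_agree (Obj C) (H_fun (K_funcomp k G F)) (gr_funcomp (H_fun G) (H_fun F))"
proof -
  note o = K_category_Hom[OF C] K_category_Hom[OF D] K_category_Hom[OF E]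
  note f = K_prefunctorD[OF F] and g = K_prefunctorD[OF G]
  show "K_prefunctor k C E (K_funcomp k G F)"
    unfolding K_prefunctor_def K_funcomp_def using f g o by (auto intro!: K_comp_hom)
  show "fun_agree (Obj C) (H_fun (K_funcomp k G F)) (gr_funcomp (H_fun G) (H_fun F))"
    unfolding fun_agree_def K_funcomp_def gr_funcomp_def
    using H_map_comp[OF o(1) o(2) o(3) f(2) g(2)] f g by simp
qed

lemma K_idfun_prefunctor:
  assumes C: "K_category k C"
  shows "K_prefunctor k C C (K_idfun k C)"
    and "fun_agree (Obj C) (H_fun (K_idfun k C)) (gr_idfun (H_cat k C))"
  using K_category_Hom[OF C] by (simp_all add: K_prefunctor_def K_idfun_def K_id_hom fun_agree_def gr_idfun_def H_map_id)

text \<open>A quasi-inverse on cohomology has to be lifted as well. Its lift has an image that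
  agrees with it on objects, and the composites with it are exchanged by congruence.\<close>

lemma H_equivalence_iff:
  assumes C: "K_category k C" and D: "K_category k D" and F: "K_prefunctor k C D F"
  shows "K_equivalence k C D F \<longleftrightarrow> gr_equivalence k (H_cat k C) (H_cat k D) (H_fun F)"
proof -
  have main: "K_natiso k C C (K_funcomp k G F) (K_idfun k C) \<longleftrightarrow> gr_natiso k (H_cat k C) (H_cat k C) (gr_funcomp (H_fun G) (H_fun F)) (gr_idfun (H_cat k C))"
    "K_natiso k D D (K_funcomp k F G) (K_idfun k D) \<longleftrightarrow> gr_natiso k (H_cat k D) (H_cat k D) (gr_funcomp (H_fun F) (H_fun G)) (gr_idfun (H_cat k D))"
    if G: "K_prefunctor k D C G" for G
    using H_natiso_iff[OF C C K_funcomp_prefunctor(1)[OF C D C F G] K_idfun_prefunctor(1)[OF C]]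
      H_natiso_iff[OF D D K_funcomp_prefunctor(1)[OF D C D G F] K_idfun_prefunctor(1)[OF D]]
      gr_natiso_cong[of "H_cat k C", unfolded H_cat_sel, OF K_funcomp_prefunctor(2)[OF C D C F G] K_idfun_prefunctor(2)[OF C]]
      gr_natiso_cong[of "H_cat k D", unfolded H_cat_sel, OF K_funcomp_prefunctor(2)[OF D C D G F] K_idfun_prefunctor(2)[OF D]]
    by blast+
  show ?thesis
  proof
    assume "K_equivalence k C D F"
    then obtain G where G: "K_functor k C D F" "K_functor k D C G" "K_natiso k C C (K_funcomp k G F) (K_idfun k C)"
      "K_natiso k D D (K_funcomp k F G) (K_idfun k D)" by (auto simp: K_equivalence_def)
    note G' = K_functor_prefunctor[OF G(2)]
    show "gr_equivalence k (H_cat k C) (H_cat k D) (H_fun F)"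
      unfolding gr_equivalence_def
      using G main[OF G'] H_functor_iff[OF C D F] H_functor_iff[OF D C G'] by blast
  next
    assume "gr_equivalence k (H_cat k C) (H_cat k D) (H_fun F)"
    then obtain G where G: "gr_functor k (H_cat k C) (H_cat k D) (H_fun F)" "gr_functor k (H_cat k D) (H_cat k C) G"
      "gr_natiso k (H_cat k C) (H_cat k C) (gr_funcomp G (H_fun F)) (gr_idfun (H_cat k C))"
      "gr_natiso k (H_cat k D) (H_cat k D) (gr_funcomp (H_fun F) G) (gr_idfun (H_cat k D))" by (auto simp: gr_equivalence_def)
    obtain G' where G': "K_prefunctor k D C G'" "fun_agree (Obj D) G (H_fun G')" using H_functor_lift[OF D C G(2)] .
    have r: "fun_agree A H H" for A H by (simp add: fun_agree_def)
    have "fun_agree (Obj C) (gr_funcomp G (H_fun F)) (gr_funcomp (H_fun G') (H_fun F))"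
      using gr_funcomp_agree[OF r, of D G "H_fun G'" C "H_fun F"] G'(2) K_prefunctor_OMap[OF F] by simp
    then have 1: "K_natiso k C C (K_funcomp k G' F) (K_idfun k C)"
      using G(3) main(1)[OF G'(1)] gr_natiso_cong[of "H_cat k C", unfolded H_cat_sel, OF _ r] by blast
    have "OMap G X \<in> Obj C" if "X \<in> Obj D" for X
      using that K_prefunctor_OMap[OF G'(1)] fun_agreeD(1)[OF G'(2)] by simp
    then have "fun_agree (Obj D) (gr_funcomp (H_fun F) G) (gr_funcomp (H_fun F) (H_fun G'))"
      by (intro gr_funcomp_agree[OF G'(2) r])
    then have 2: "K_natiso k D D (K_funcomp k F G') (K_idfun k D)"
      using G(4) main(2)[OF G'(1)] gr_natiso_cong[of "H_cat k D", unfolded H_cat_sel, OF _ r] by blast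
    have "gr_functor k (H_cat k D) (H_cat k C) (H_fun G')"
      using G(2) gr_functor_cong[of "H_cat k D", unfolded H_cat_sel, OF G'(2)] by blast
    then show "K_equivalence k C D F"
      unfolding K_equivalence_def
      using G(1) 1 2 H_functor_iff[OF C D F] H_functor_iff[OF D C G'(1)] by blast
  qed
qed

end

section \<open>Serre functors\<close>

context ground_field
begin

section \<open>Naturality of maps between functors into complexes\<close>

text \<open>Enriched naturality at elements: acting by \<open>u\<close> and then applying the
  component gives the same as the reverse order. In this form an injective map can be cancelled
  value by value.\<close>

lemma gr_post_pre_iff:
  assumes [simp]: "gr_obj k W" "gr_obj k X" "gr_obj k Y" "gr_obj k V" "gr_obj k Z"
    and \<beta>: "\<beta> \<in> gr_hom k Y Z" and P: "P \<in> gr_hom k W (gihom k X Y)"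
    and \<alpha>: "\<alpha> \<in> gr_hom k X V" and Q: "Q \<in> gr_hom k W (gihom k V Z)"
  shows "gr_ipost k X \<beta> \<cdot>\<^sub>g P = gr_ipre k \<alpha> Z \<cdot>\<^sub>g Q \<longleftrightarrow>
    (\<forall>n. \<forall>u\<in>carrier (W n). \<forall>p. \<forall>c\<in>carrier (X p). Map \<beta> (p + n) (Map P n u p c) = Map Q n u p (Map \<alpha> p c))"
proof -
  have b: "gr_ipost k X \<beta> \<in> gr_hom k (gihom k X Y) (gihom k X Z)" by (intro gr_ipost_hom \<beta>) simp_all
  have a: "gr_ipre k \<alpha> Z \<in> gr_hom k (gihom k V Z) (gihom k X Z)" by (intro gr_ipre_hom \<alpha>) simp_all
  have L: "gr_ipost k X \<beta> \<cdot>\<^sub>g P \<in> gr_hom k W (gihom k X Z)" by (rule gr_comp_hom[OF _ P b]) simp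
  have R: "gr_ipre k \<alpha> Z \<cdot>\<^sub>g Q \<in> gr_hom k W (gihom k X Z)" by (rule gr_comp_hom[OF _ Q a]) simp
  have l: "Map (gr_ipost k X \<beta> \<cdot>\<^sub>g P) n u p c = Map \<beta> (p + n) (Map P n u p c)"
    if "u \<in> carrier (W n)" "c \<in> carrier (X p)" for n u p c
    using that gr_hom_closed[OF P that(1)] by (simp add: gr_comp_apply_hom[OF P] gr_ipost_apply[OF \<beta>])
  have r: "Map (gr_ipre k \<alpha> Z \<cdot>\<^sub>g Q) n u p c = Map Q n u p (Map \<alpha> p c)"
    if "u \<in> carrier (W n)" "c \<in> carrier (X p)" for n u p c
    using that gr_hom_closed[OF Q that(1)] by (simp add: gr_comp_apply_hom[OF Q] gr_ipre_apply[OF \<alpha>])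
  show ?thesis
  proof (intro iffI allI ballI)
    fix n u p c assume eq: "gr_ipost k X \<beta> \<cdot>\<^sub>g P = gr_ipre k \<alpha> Z \<cdot>\<^sub>g Q" and uc: "u \<in> carrier (W n)" "c \<in> carrier (X p)"
    show "Map \<beta> (p + n) (Map P n u p c) = Map Q n u p (Map \<alpha> p c)"
      using l[OF uc] r[OF uc] eq by simp
  next
    assume eq: "\<forall>n. \<forall>u\<in>carrier (W n). \<forall>p. \<forall>c\<in>carrier (X p). Map \<beta> (p + n) (Map P n u p c) = Map Q n u p (Map \<alpha> p c)"
    show "gr_ipost k X \<beta> \<cdot>\<^sub>g P = gr_ipre k \<alpha> Z \<cdot>\<^sub>g Q"
    proof (rule gr_hom_eqI[OF L R])
      fix n u assume u: "u \<in> carrier (W n)"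
      show "Map (gr_ipost k X \<beta> \<cdot>\<^sub>g P) n u = Map (gr_ipre k \<alpha> Z \<cdot>\<^sub>g Q) n u"
        by (rule gihom_eqI[OF gr_hom_closed[OF L u] gr_hom_closed[OF R u]]) (simp add: l r u eq)
    qed
  qed
qed

text \<open>The equation ends in an inner hom complex. Cohomology followed by the isomorphism
  \<open>theta_arrow\<close> detects it, and \<open>theta_arrow\<close> carries composition with an
  arrow of \<open>\<K>\<close> to composition with its image.\<close>

lemma K_post_pre_iff:
  assumes o [simp]: "K_obj k W" "K_obj k M" "K_obj k N" "K_obj k V" "K_obj k P"
    and \<beta>: "\<beta> \<in> K_hom k N P" and F: "F \<in> K_hom k W (kihom k M N)"
    and \<alpha>: "\<alpha> \<in> K_hom k M V" and G: "G \<in> K_hom k W (kihom k V P)"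
  shows "K_comp k (K_ipost k M \<beta>) F = K_comp k (K_ipre k \<alpha> P) G \<longleftrightarrow>
    gr_ipost k (cohomology M) (H_map \<beta>) \<cdot>\<^sub>g theta_arrow k M N \<cdot>\<^sub>g H_map F =
    gr_ipre k (H_map \<alpha>) (cohomology P) \<cdot>\<^sub>g theta_arrow k V P \<cdot>\<^sub>g H_map G" (is "?L = ?R \<longleftrightarrow> ?L' = ?R'")
proof -
  have b: "K_ipost k M \<beta> \<in> K_hom k (kihom k M N) (kihom k M P)" by (intro K_ipost_hom \<beta>) simp_all
  have a: "K_ipre k \<alpha> P \<in> K_hom k (kihom k V P) (kihom k M P)" by (intro K_ipre_hom \<alpha>) simp_all
  have L: "?L \<in> K_hom k W (kihom k M P)" by (rule K_comp_hom[OF _ _ _ F b]) simp_all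
  have R: "?R \<in> K_hom k W (kihom k M P)" by (rule K_comp_hom[OF _ _ _ G a]) simp_all
  have hF: "H_map F \<in> gr_hom k (cohomology W) (cohomology (kihom k M N))" by (intro H_map_hom F) simp_all
  have hG: "H_map G \<in> gr_hom k (cohomology W) (cohomology (kihom k V P))" by (intro H_map_hom G) simp_all
  have hL: "H_map ?L \<in> gr_hom k (cohomology W) (cohomology (kihom k M P))" by (intro H_map_hom L) simp_all
  have hR: "H_map ?R \<in> gr_hom k (cohomology W) (cohomology (kihom k M P))" by (intro H_map_hom R) simp_all
  have tF: "theta_arrow k M N \<cdot>\<^sub>g H_map F \<in> gr_hom k (cohomology W) (gihom k (cohomology M) (cohomology N))"
    by (rule gr_comp_hom[OF _ hF theta_arrow_hom]) simp_all
  have tG: "theta_arrow k V P \<cdot>\<^sub>g H_map G \<in> gr_hom k (cohomology W) (gihom k (cohomology V) (cohomology P))"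
    by (rule gr_comp_hom[OF _ hG theta_arrow_hom]) simp_all
  have gb: "gr_ipost k (cohomology M) (H_map \<beta>) \<in> gr_hom k (gihom k (cohomology M) (cohomology N)) (gihom k (cohomology M) (cohomology P))"
    by (intro gr_ipost_hom H_map_hom \<beta>) simp_all
  have ga: "gr_ipre k (H_map \<alpha>) (cohomology P) \<in> gr_hom k (gihom k (cohomology V) (cohomology P)) (gihom k (cohomology M) (cohomology P))"
    by (intro gr_ipre_hom H_map_hom \<alpha>) simp_all
  have tl: "theta_arrow k M P \<cdot>\<^sub>g H_map ?L = ?L'"
  proof (rule gr_hom_eqI)
    show "theta_arrow k M P \<cdot>\<^sub>g H_map ?L \<in> gr_hom k (cohomology W) (gihom k (cohomology M) (cohomology P))"
      by (rule gr_comp_hom[OF _ hL theta_arrow_hom]) simp_all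
    show "?L' \<in> gr_hom k (cohomology W) (gihom k (cohomology M) (cohomology P))"
      by (rule gr_comp_hom[OF _ tF gb]) simp_all
    fix n u assume u: "u \<in> carrier (cohomology W n)"
    have Fu: "Map (H_map F) n u \<in> carrier (cohomology (kihom k M N) n)" by (rule gr_hom_closed[OF hF u])
    have tFu: "Map (theta_arrow k M N) n (Map (H_map F) n u) \<in> carrier (gihom k (cohomology M) (cohomology N) n)"
      by (rule gr_hom_closed[OF theta_arrow_hom Fu]) simp_all
    have e: "Map (H_map ?L) n u = Map (H_map (K_ipost k M \<beta>)) n (Map (H_map F) n u)"
      using H_map_comp[OF _ _ _ F b] u by (simp add: gr_comp_apply_hom[OF hF])
    have bu: "Map (H_map (K_ipost k M \<beta>)) n (Map (H_map F) n u) \<in> carrier (cohomology (kihom k M P) n)"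
      by (rule gr_hom_closed[OF H_map_hom[OF _ _ b] Fu]) simp_all
    show "Map (theta_arrow k M P \<cdot>\<^sub>g H_map ?L) n u = Map ?L' n u"
      unfolding gr_comp_apply_hom[OF hL u] gr_comp_apply_hom[OF tF u] gr_comp_apply_hom[OF hF u] e
    proof (rule gihom_eqI)
      show "Map (theta_arrow k M P) n (Map (H_map (K_ipost k M \<beta>)) n (Map (H_map F) n u)) \<in> carrier (gihom k (cohomology M) (cohomology P) n)"
        by (rule gr_hom_closed[OF theta_arrow_hom bu]) simp_all
      show "Map (gr_ipost k (cohomology M) (H_map \<beta>)) n (Map (theta_arrow k M N) n (Map (H_map F) n u)) \<in> carrier (gihom k (cohomology M) (cohomology P) n)"
        by (rule gr_hom_closed[OF gb tFu])
      fix p c assume c: "c \<in> carrier (cohomology M p)"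
      show "Map (theta_arrow k M P) n (Map (H_map (K_ipost k M \<beta>)) n (Map (H_map F) n u)) p c =
        Map (gr_ipost k (cohomology M) (H_map \<beta>)) n (Map (theta_arrow k M N) n (Map (H_map F) n u)) p c"
        unfolding gr_ipost_apply[OF H_map_hom[OF o(3,5) \<beta>] tFu c] by (rule theta_ipost_apply[OF _ _ _ \<beta> Fu c]) simp_all
    qed
  qed
  have tr: "theta_arrow k M P \<cdot>\<^sub>g H_map ?R = ?R'"
  proof (rule gr_hom_eqI)
    show "theta_arrow k M P \<cdot>\<^sub>g H_map ?R \<in> gr_hom k (cohomology W) (gihom k (cohomology M) (cohomology P))"
      by (rule gr_comp_hom[OF _ hR theta_arrow_hom]) simp_all
    show "?R' \<in> gr_hom k (cohomology W) (gihom k (cohomology M) (cohomology P))"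
      by (rule gr_comp_hom[OF _ tG ga]) simp_all
    fix n u assume u: "u \<in> carrier (cohomology W n)"
    have Gu: "Map (H_map G) n u \<in> carrier (cohomology (kihom k V P) n)" by (rule gr_hom_closed[OF hG u])
    have tGu: "Map (theta_arrow k V P) n (Map (H_map G) n u) \<in> carrier (gihom k (cohomology V) (cohomology P) n)"
      by (rule gr_hom_closed[OF theta_arrow_hom Gu]) simp_all
    have e: "Map (H_map ?R) n u = Map (H_map (K_ipre k \<alpha> P)) n (Map (H_map G) n u)"
      using H_map_comp[OF _ _ _ G a] u by (simp add: gr_comp_apply_hom[OF hG])
    have au: "Map (H_map (K_ipre k \<alpha> P)) n (Map (H_map G) n u) \<in> carrier (cohomology (kihom k M P) n)"
      by (rule gr_hom_closed[OF H_map_hom[OF _ _ a] Gu]) simp_all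
    show "Map (theta_arrow k M P \<cdot>\<^sub>g H_map ?R) n u = Map ?R' n u"
      unfolding gr_comp_apply_hom[OF hR u] gr_comp_apply_hom[OF tG u] gr_comp_apply_hom[OF hG u] e
    proof (rule gihom_eqI)
      show "Map (theta_arrow k M P) n (Map (H_map (K_ipre k \<alpha> P)) n (Map (H_map G) n u)) \<in> carrier (gihom k (cohomology M) (cohomology P) n)"
        by (rule gr_hom_closed[OF theta_arrow_hom au]) simp_all
      show "Map (gr_ipre k (H_map \<alpha>) (cohomology P)) n (Map (theta_arrow k V P) n (Map (H_map G) n u)) \<in> carrier (gihom k (cohomology M) (cohomology P) n)"
        by (rule gr_hom_closed[OF ga tGu])
      fix p c assume c: "c \<in> carrier (cohomology M p)"
      show "Map (theta_arrow k M P) n (Map (H_map (K_ipre k \<alpha> P)) n (Map (H_map G) n u)) p c =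
        Map (gr_ipre k (H_map \<alpha>) (cohomology P)) n (Map (theta_arrow k V P) n (Map (H_map G) n u)) p c"
        unfolding gr_ipre_apply[OF H_map_hom[OF o(2,4) \<alpha>] tGu c] by (rule theta_ipre_apply[OF _ _ _ \<alpha> Gu c]) simp_all
    qed
  qed
  have inj: "H_map ?L = H_map ?R" if "theta_arrow k M P \<cdot>\<^sub>g H_map ?L = theta_arrow k M P \<cdot>\<^sub>g H_map ?R"
    by (rule gr_iso_mono[OF theta_arrow_iso[OF o(2,5)] _ _ _ hL hR that]) simp_all
  have "?L = ?R" if "?L' = ?R'"
    by (rule H_map_faithful[OF _ _ L R inj]) (simp_all add: tl tr that)
  then show ?thesis using tl tr by metis
qed

lemma H_vnat_iff:
  assumes F: "K_module k U A F" and G: "K_module k U A G"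
    and \<alpha>: "\<And>X. X \<in> A \<Longrightarrow> \<alpha> X \<in> K_hom k (OMap F X) (OMap G X)"
  shows "K_vnat k A F G \<alpha> \<longleftrightarrow> gr_vnat k A (H_module k F) (H_module k G) (\<lambda>X. H_map (\<alpha> X))"
proof -
  have "K_comp k (K_ipost k (OMap F X) (\<alpha> Y)) (HMap F X Y) = K_comp k (K_ipre k (\<alpha> X) (OMap G Y)) (HMap G X Y) \<longleftrightarrow>
    gr_ipost k (cohomology (OMap F X)) (H_map (\<alpha> Y)) \<cdot>\<^sub>g theta_arrow k (OMap F X) (OMap F Y) \<cdot>\<^sub>g H_map (HMap F X Y) =
    gr_ipre k (H_map (\<alpha> X)) (cohomology (OMap G Y)) \<cdot>\<^sub>g theta_arrow k (OMap G X) (OMap G Y) \<cdot>\<^sub>g H_map (HMap G X Y)"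
    if "X \<in> A" "Y \<in> A" for X Y
    using F G \<alpha> that by (intro K_post_pre_iff[of "U X Y"]) (simp_all add: K_module_def)
  moreover have "H_map (\<alpha> X) \<in> gr_hom k (cohomology (OMap F X)) (cohomology (OMap G X))" if "X \<in> A" for X
    using F G \<alpha> that by (intro H_map_hom) (simp_all add: K_module_def)
  ultimately show ?thesis
    unfolding K_vnat_def gr_vnat_def by (simp add: \<alpha> H_module_def cong: ball_cong)
qed

text \<open>Dualizing reverses the variance; for functors into complexes the variance is recorded by
  the order of the arguments of \<open>U\<close>.\<close>

lemma K_dual_module:
  assumes "K_module k (\<lambda>X Y. U Y X) A G"
  shows "K_module k U A (K_dual k G)"
  using assms unfolding K_module_def K_dual_def
  by (auto intro!: K_comp_hom[OF _ _ _ _ K_dualmor_hom])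

text \<open>The cohomology of the dual and the dual of the cohomology are different functors,
  compared by \<open>delta_arrow\<close>. Their actions on morphisms correspond by
  \<open>delta_dualmor\<close>, and \<open>delta_arrow\<close> is injective.\<close>

lemma H_dual_vnat_iff:
  assumes F: "K_module k U A F" and G: "K_module k (\<lambda>X Y. U Y X) A G"
    and \<alpha>: "\<And>X. X \<in> A \<Longrightarrow> \<alpha> X \<in> gr_hom k (cohomology (OMap F X)) (cohomology (kihom k (OMap G X) (kunit k)))"
  shows "gr_vnat k A (H_module k F) (H_module k (K_dual k G)) \<alpha> \<longleftrightarrow>
    gr_vnat k A (H_module k F) (gr_dual k (H_module k G)) (\<lambda>X. delta_arrow k (OMap G X) \<cdot>\<^sub>g \<alpha> X)"
proof -
  have oF: "K_obj k (OMap F X)" and oG: "K_obj k (OMap G X)" if "X \<in> A" for X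
    using F G that by (auto simp: K_module_def)
  have \<delta>\<alpha>: "delta_arrow k (OMap G X) \<cdot>\<^sub>g \<alpha> X \<in> gr_hom k (cohomology (OMap F X)) (gihom k (cohomology (OMap G X)) (gunit k))"
    if X: "X \<in> A" for X
    by (rule gr_comp_hom[OF _ \<alpha>[OF X] gr_iso_hom[OF delta_iso]]) (simp_all add: oF oG X)
  have "gr_ipost k (cohomology (OMap F X)) (\<alpha> Y) \<cdot>\<^sub>g theta_arrow k (OMap F X) (OMap F Y) \<cdot>\<^sub>g H_map (HMap F X Y) =
     gr_ipre k (\<alpha> X) (cohomology (kihom k (OMap G Y) (kunit k))) \<cdot>\<^sub>g
       theta_arrow k (kihom k (OMap G X) (kunit k)) (kihom k (OMap G Y) (kunit k)) \<cdot>\<^sub>g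
       H_map (K_comp k (K_dualmor k (OMap G Y) (OMap G X)) (HMap G Y X)) \<longleftrightarrow>
     gr_ipost k (cohomology (OMap F X)) (delta_arrow k (OMap G Y) \<cdot>\<^sub>g \<alpha> Y) \<cdot>\<^sub>g theta_arrow k (OMap F X) (OMap F Y) \<cdot>\<^sub>g H_map (HMap F X Y) =
     gr_ipre k (delta_arrow k (OMap G X) \<cdot>\<^sub>g \<alpha> X) (gihom k (cohomology (OMap G Y)) (gunit k)) \<cdot>\<^sub>g
       gr_dualmor k (cohomology (OMap G Y)) (cohomology (OMap G X)) \<cdot>\<^sub>g
       theta_arrow k (OMap G Y) (OMap G X) \<cdot>\<^sub>g H_map (HMap G Y X)" (is "?E1 \<longleftrightarrow> ?E2")
    if X: "X \<in> A" and Y: "Y \<in> A" for X Y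
  proof -
    note o [simp] = oF[OF X] oF[OF Y] oG[OF X] oG[OF Y]
    let ?W = "cohomology (U X Y)"
    have u [simp]: "K_obj k (U X Y)" and hF: "HMap F X Y \<in> K_hom k (U X Y) (kihom k (OMap F X) (OMap F Y))"
      and hG: "HMap G Y X \<in> K_hom k (U X Y) (kihom k (OMap G Y) (OMap G X))"
      using F G X Y by (auto simp: K_module_def)
    have P: "theta_arrow k (OMap F X) (OMap F Y) \<cdot>\<^sub>g H_map (HMap F X Y) \<in> gr_hom k ?W (gihom k (cohomology (OMap F X)) (cohomology (OMap F Y)))"
      by (rule gr_comp_hom[OF _ H_map_hom[OF _ _ hF] theta_arrow_hom]) simp_all
    note dm = K_dualmor_hom[OF o(4,3)]
    have Qm: "H_map (K_comp k (K_dualmor k (OMap G Y) (OMap G X)) (HMap G Y X)) \<in>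
        gr_hom k ?W (cohomology (kihom k (kihom k (OMap G X) (kunit k)) (kihom k (OMap G Y) (kunit k))))"
      by (intro H_map_hom K_comp_hom[OF _ _ _ hG dm]) simp_all
    have Q: "theta_arrow k (kihom k (OMap G X) (kunit k)) (kihom k (OMap G Y) (kunit k)) \<cdot>\<^sub>g
       H_map (K_comp k (K_dualmor k (OMap G Y) (OMap G X)) (HMap G Y X)) \<in>
       gr_hom k ?W (gihom k (cohomology (kihom k (OMap G X) (kunit k))) (cohomology (kihom k (OMap G Y) (kunit k))))"
      by (rule gr_comp_hom[OF _ Qm theta_arrow_hom]) simp_all
    have hG': "H_map (HMap G Y X) \<in> gr_hom k ?W (cohomology (kihom k (OMap G Y) (OMap G X)))"
      by (intro H_map_hom hG) simp_all
    have T: "theta_arrow k (OMap G Y) (OMap G X) \<cdot>\<^sub>g H_map (HMap G Y X) \<in> gr_hom k ?W (gihom k (cohomology (OMap G Y)) (cohomology (OMap G X)))"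
      by (rule gr_comp_hom[OF _ hG' theta_arrow_hom]) simp_all
    have D: "gr_dualmor k (cohomology (OMap G Y)) (cohomology (OMap G X)) \<in>
        gr_hom k (gihom k (cohomology (OMap G Y)) (cohomology (OMap G X)))
          (gihom k (gihom k (cohomology (OMap G X)) (gunit k)) (gihom k (cohomology (OMap G Y)) (gunit k)))"
      by (rule gr_dualmor_hom) simp_all
    have Q': "gr_dualmor k (cohomology (OMap G Y)) (cohomology (OMap G X)) \<cdot>\<^sub>g theta_arrow k (OMap G Y) (OMap G X) \<cdot>\<^sub>g H_map (HMap G Y X) \<in>
        gr_hom k ?W (gihom k (gihom k (cohomology (OMap G X)) (gunit k)) (gihom k (cohomology (OMap G Y)) (gunit k)))"
      by (rule gr_comp_hom[OF _ T D]) simp_all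
    have E1: "?E1 \<longleftrightarrow> (\<forall>n. \<forall>w\<in>carrier (?W n). \<forall>p. \<forall>c\<in>carrier (cohomology (OMap F X) p).
        Map (\<alpha> Y) (p + n) (Map (theta_arrow k (OMap F X) (OMap F Y) \<cdot>\<^sub>g H_map (HMap F X Y)) n w p c) =
        Map (theta_arrow k (kihom k (OMap G X) (kunit k)) (kihom k (OMap G Y) (kunit k)) \<cdot>\<^sub>g
           H_map (K_comp k (K_dualmor k (OMap G Y) (OMap G X)) (HMap G Y X))) n w p (Map (\<alpha> X) p c))"
      by (rule gr_post_pre_iff[OF _ _ _ _ _ \<alpha>[OF Y] P \<alpha>[OF X] Q]) simp_all
    have E2: "?E2 \<longleftrightarrow> (\<forall>n. \<forall>w\<in>carrier (?W n). \<forall>p. \<forall>c\<in>carrier (cohomology (OMap F X) p).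
        Map (delta_arrow k (OMap G Y) \<cdot>\<^sub>g \<alpha> Y) (p + n) (Map (theta_arrow k (OMap F X) (OMap F Y) \<cdot>\<^sub>g H_map (HMap F X Y)) n w p c) =
        Map (gr_dualmor k (cohomology (OMap G Y)) (cohomology (OMap G X)) \<cdot>\<^sub>g theta_arrow k (OMap G Y) (OMap G X) \<cdot>\<^sub>g H_map (HMap G Y X)) n w p
          (Map (delta_arrow k (OMap G X) \<cdot>\<^sub>g \<alpha> X) p c))"
      by (rule gr_post_pre_iff[OF _ _ _ _ _ \<delta>\<alpha>[OF Y] P \<delta>\<alpha>[OF X] Q']) simp_all
    \<comment> \<open>The right equation is the left one with \<open>delta_arrow\<close> applied to
      both sides; a left inverse of it gives the converse.\<close>
    have pt: "Map (\<alpha> Y) (p + n) (Map (theta_arrow k (OMap F X) (OMap F Y) \<cdot>\<^sub>g H_map (HMap F X Y)) n w p c) =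
        Map (theta_arrow k (kihom k (OMap G X) (kunit k)) (kihom k (OMap G Y) (kunit k)) \<cdot>\<^sub>g
           H_map (K_comp k (K_dualmor k (OMap G Y) (OMap G X)) (HMap G Y X))) n w p (Map (\<alpha> X) p c) \<longleftrightarrow>
      Map (delta_arrow k (OMap G Y) \<cdot>\<^sub>g \<alpha> Y) (p + n) (Map (theta_arrow k (OMap F X) (OMap F Y) \<cdot>\<^sub>g H_map (HMap F X Y)) n w p c) =
        Map (gr_dualmor k (cohomology (OMap G Y)) (cohomology (OMap G X)) \<cdot>\<^sub>g theta_arrow k (OMap G Y) (OMap G X) \<cdot>\<^sub>g H_map (HMap G Y X)) n w p
          (Map (delta_arrow k (OMap G X) \<cdot>\<^sub>g \<alpha> X) p c)" (is "?a = ?b \<longleftrightarrow> ?a' = ?b'")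
      if w: "w \<in> carrier (?W n)" and c: "c \<in> carrier (cohomology (OMap F X) p)" for n w p c
    proof -
      have Pc: "Map (theta_arrow k (OMap F X) (OMap F Y) \<cdot>\<^sub>g H_map (HMap F X Y)) n w p c \<in> carrier (cohomology (OMap F Y) (p + n))"
        by (rule gihom_closed[OF gr_hom_closed[OF P w] c refl])
      have a: "?a \<in> carrier (cohomology (kihom k (OMap G Y) (kunit k)) (p + n))" by (rule gr_hom_closed[OF \<alpha>[OF Y] Pc])
      have \<alpha>c: "Map (\<alpha> X) p c \<in> carrier (cohomology (kihom k (OMap G X) (kunit k)) p)" by (rule gr_hom_closed[OF \<alpha>[OF X] c])
      have b: "?b \<in> carrier (cohomology (kihom k (OMap G Y) (kunit k)) (p + n))"
        by (rule gihom_closed[OF gr_hom_closed[OF Q w] \<alpha>c refl])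
      have Gw: "Map (H_map (HMap G Y X)) n w \<in> carrier (cohomology (kihom k (OMap G Y) (OMap G X)) n)" by (rule gr_hom_closed[OF hG' w])
      have a': "?a' = Map (delta_arrow k (OMap G Y)) (p + n) ?a" by (rule gr_comp_apply_hom[OF \<alpha>[OF Y] Pc])
      have "Map (H_map (K_comp k (K_dualmor k (OMap G Y) (OMap G X)) (HMap G Y X))) n w =
          Map (H_map (K_dualmor k (OMap G Y) (OMap G X))) n (Map (H_map (HMap G Y X)) n w)"
        using H_map_comp[OF _ _ _ hG dm] w by (simp add: gr_comp_apply_hom[OF hG'])
      then have b': "?b' = Map (delta_arrow k (OMap G Y)) (p + n) ?b"
        unfolding gr_comp_apply_hom[OF T w] gr_comp_apply_hom[OF hG' w] gr_comp_apply_hom[OF \<alpha>[OF X] c] gr_comp_apply_hom[OF Qm w]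
        using delta_dualmor[OF o(4,3) Gw \<alpha>c] by simp
      obtain \<delta>' where \<delta>': "\<delta>' \<in> gr_hom k (gihom k (cohomology (OMap G Y)) (gunit k)) (cohomology (kihom k (OMap G Y) (kunit k)))"
        "\<delta>' \<cdot>\<^sub>g delta_arrow k (OMap G Y) = gr_id (cohomology (kihom k (OMap G Y) (kunit k)))"
        using delta_iso[OF o(4)] by (auto simp: gr_iso_def)
      have "Map \<delta>' (p + n) (Map (delta_arrow k (OMap G Y)) (p + n) z) = z"
        if z: "z \<in> carrier (cohomology (kihom k (OMap G Y) (kunit k)) (p + n))" for z
        using gr_comp_apply_hom[OF gr_iso_hom[OF delta_iso[OF o(4)]] z, of \<delta>'] \<delta>'(2)
          gr_id_apply[where X = "cohomology (kihom k (OMap G Y) (kunit k))", OF z] by simp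
      then show ?thesis unfolding a' b' using a b by metis
    qed
    show ?thesis unfolding E1 E2 by (simp only: pt cong: ball_cong)
  qed
  then show ?thesis
    unfolding gr_vnat_def by (simp add: \<alpha> \<delta>\<alpha> H_module_def K_dual_def gr_dual_def cong: ball_cong)
qed

section \<open>Representable functors\<close>

lemma K_rep_module: "K_graph k C \<Longrightarrow> X \<in> Obj C \<Longrightarrow> K_module k (Hom C) (Obj C) (K_rep k C X)"
  unfolding K_module_def K_rep_def K_graph_def by (auto intro!: K_curry_hom)

lemma K_op_graph:
  assumes "K_graph k C"
  shows "K_graph k (K_op k C)"
  using assms unfolding K_graph_def K_op_def by (auto intro!: K_comp_hom[OF _ _ _ K_sym_hom])

lemma H_module_rep_agree:
  assumes C: "K_graph k C" and X: "X \<in> Obj C"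
  shows "fun_agree (Obj C) (H_module k (K_rep k C X)) (gr_rep k (H_cat k C) X)"
  using C X unfolding K_graph_def fun_agree_def
  by (simp add: H_module_def K_rep_def gr_rep_def theta_curry)

text \<open>Base change commutes with passage to the opposite category because the Kuenneth map
  respects symmetries. The compositions are compared at objects only, where they are typed.\<close>

lemma gr_rep_op_agree:
  assumes C: "K_graph k C" and X: "X \<in> Obj C"
  shows "fun_agree (Obj C) (gr_rep k (H_cat k (K_op k C)) X) (gr_rep k (gr_op k (H_cat k C)) X)"
proof -
  have "H_map (K_comp k (Comp C Z Y X) (K_sym k (Hom C Z Y) (Hom C Y X))) \<cdot>\<^sub>g kunneth k (Hom C Z Y) (Hom C Y X) =
     (H_map (Comp C Z Y X) \<cdot>\<^sub>g kunneth k (Hom C Y X) (Hom C Z Y)) \<cdot>\<^sub>g gr_sym k (cohomology (Hom C Z Y)) (cohomology (Hom C Y X))"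
    if "X \<in> Obj C" "Y \<in> Obj C" "Z \<in> Obj C" for X Y Z
  proof -
    have o [simp]: "K_obj k (Hom C Z Y)" "K_obj k (Hom C Y X)" "K_obj k (Hom C Z X)" and
      c: "Comp C Z Y X \<in> K_hom k (ktens k (Hom C Y X) (Hom C Z Y)) (Hom C Z X)"
      using C that by (auto simp: K_graph_def)
    have "H_map (K_comp k (Comp C Z Y X) (K_sym k (Hom C Z Y) (Hom C Y X))) \<cdot>\<^sub>g kunneth k (Hom C Z Y) (Hom C Y X) =
      H_map (Comp C Z Y X) \<cdot>\<^sub>g kunneth k (Hom C Y X) (Hom C Z Y) \<cdot>\<^sub>g gr_sym k (cohomology (Hom C Z Y)) (cohomology (Hom C Y X))"
      using H_comp_kunneth[OF _ _ _ _ K_sym_hom c] H_map_sym[OF o(1,2)] by simp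
    also have "\<dots> = (H_map (Comp C Z Y X) \<cdot>\<^sub>g kunneth k (Hom C Y X) (Hom C Z Y)) \<cdot>\<^sub>g gr_sym k (cohomology (Hom C Z Y)) (cohomology (Hom C Y X))"
      by (rule gr_comp_assoc[symmetric, OF _ _ gr_sym_hom kunneth_hom H_map_hom[OF _ _ c]]) simp_all
    finally show ?thesis .
  qed
  then show ?thesis using X by (simp add: fun_agree_def gr_rep_def gr_op_def K_op_def)
qed

lemma H_module_rep_op_agree:
  assumes C: "K_graph k C" and X: "X \<in> Obj C"
  shows "fun_agree (Obj C) (H_module k (K_rep k (K_op k C) X)) (gr_rep k (gr_op k (H_cat k C)) X)"
proof -
  have "Obj (K_op k C) = Obj C" by (simp add: K_op_def)
  then have "fun_agree (Obj C) (H_module k (K_rep k (K_op k C) X)) (gr_rep k (H_cat k (K_op k C)) X)"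
    using H_module_rep_agree[OF K_op_graph[OF C], of X] X by simp
  then show ?thesis using gr_rep_op_agree[OF C X] by (rule fun_agree_trans)
qed

lemma K_rep_op_module:
  assumes "K_graph k C" "X \<in> Obj C"
  shows "K_module k (\<lambda>Y Z. Hom C Z Y) (Obj C) (K_rep k (K_op k C) X)"
proof -
  have "Obj (K_op k C) = Obj C" "Hom (K_op k C) = (\<lambda>Y Z. Hom C Z Y)" by (simp_all add: K_op_def)
  then show ?thesis using K_rep_module[OF K_op_graph[OF assms(1)], of X] assms(2) by simp
qed

lemma K_rep_funcomp_module:
  assumes C: "K_category k C" and S: "K_prefunctor k C C S" and X: "X \<in> Obj C"
  shows "K_module k (Hom C) (Obj C) (K_funcomp k (K_rep k C X) S)"
    and "fun_agree (Obj C) (H_module k (K_funcomp k (K_rep k C X) S)) (gr_funcomp (gr_rep k (H_cat k C) X) (H_fun S))"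
proof -
  note o = K_category_Hom[OF C] and s = K_prefunctorD[OF S]
  have r: "HMap (K_rep k C X) Y Z \<in> K_hom k (Hom C Y Z) (kihom k (Hom C X Y) (Hom C X Z))" if "Y \<in> Obj C" "Z \<in> Obj C" for Y Z
    using K_rep_module[OF K_category_graph[OF C] X] that by (simp add: K_module_def K_rep_def)
  have m: "K_comp k (HMap (K_rep k C X) (OMap S Y) (OMap S Z)) (HMap S Y Z) \<in>
      K_hom k (Hom C Y Z) (kihom k (Hom C X (OMap S Y)) (Hom C X (OMap S Z)))"
    if "Y \<in> Obj C" "Z \<in> Obj C" for Y Z
    by (rule K_comp_hom[OF _ _ _ s(2)[OF that] r]) (simp_all add: o s X that)
  have omap: "OMap (K_rep k C X) = Hom C X" by (simp add: K_rep_def)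
  show "K_module k (Hom C) (Obj C) (K_funcomp k (K_rep k C X) S)"
    unfolding K_module_def using m by (simp add: K_funcomp_def omap o s X)
  show "fun_agree (Obj C) (H_module k (K_funcomp k (K_rep k C X) S)) (gr_funcomp (gr_rep k (H_cat k C) X) (H_fun S))"
    unfolding fun_agree_def
  proof (intro ballI conjI)
    fix Y assume Y: "Y \<in> Obj C"
    show "OMap (H_module k (K_funcomp k (K_rep k C X) S)) Y = OMap (gr_funcomp (gr_rep k (H_cat k C) X) (H_fun S)) Y"
      by (simp add: H_module_def K_funcomp_def K_rep_def gr_funcomp_def gr_rep_def)
    fix Z assume Z: "Z \<in> Obj C"
    note oo [simp] = o[OF Y Z] o[OF s(1)[OF Y] s(1)[OF Z]] o[OF X s(1)[OF Y]] o[OF X s(1)[OF Z]]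
    note rr = r[OF s(1)[OF Y] s(1)[OF Z]] and ss = s(2)[OF Y Z]
    have "theta_arrow k (Hom C X (OMap S Y)) (Hom C X (OMap S Z)) \<cdot>\<^sub>g
        H_map (K_comp k (HMap (K_rep k C X) (OMap S Y) (OMap S Z)) (HMap S Y Z)) =
      theta_arrow k (Hom C X (OMap S Y)) (Hom C X (OMap S Z)) \<cdot>\<^sub>g
        H_map (HMap (K_rep k C X) (OMap S Y) (OMap S Z)) \<cdot>\<^sub>g H_map (HMap S Y Z)"
      by (subst H_map_comp[OF _ _ _ ss rr]) simp_all
    also have "\<dots> = (theta_arrow k (Hom C X (OMap S Y)) (Hom C X (OMap S Z)) \<cdot>\<^sub>g
        H_map (HMap (K_rep k C X) (OMap S Y) (OMap S Z))) \<cdot>\<^sub>g H_map (HMap S Y Z)"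
      by (rule gr_comp_assoc[symmetric, OF _ _ H_map_hom[OF _ _ ss] H_map_hom[OF _ _ rr] theta_arrow_hom]) simp_all
    also have "theta_arrow k (Hom C X (OMap S Y)) (Hom C X (OMap S Z)) \<cdot>\<^sub>g
        H_map (HMap (K_rep k C X) (OMap S Y) (OMap S Z)) = HMap (gr_rep k (H_cat k C) X) (OMap S Y) (OMap S Z)"
      using fun_agreeD(2)[OF H_module_rep_agree[OF K_category_graph[OF C] X] s(1)[OF Y] s(1)[OF Z]]
      by (simp add: H_module_def omap)
    finally show "HMap (H_module k (K_funcomp k (K_rep k C X) S)) Y Z = HMap (gr_funcomp (gr_rep k (H_cat k C) X) (H_fun S)) Y Z"
      by (simp add: H_module_def K_funcomp_def gr_funcomp_def omap)
  qed
qed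

section \<open>Right Serre functors\<close>

lemma H_iso_iff:
  assumes [simp]: "K_obj k M" "K_obj k N" and F: "F \<in> K_hom k M N"
  shows "K_iso k M N F \<longleftrightarrow> gr_iso k (cohomology M) (cohomology N) (H_map F)"
proof -
  note hF = H_map_hom[OF assms]
  have eq: "K_comp k G F = K_id k M \<longleftrightarrow> H_map G \<cdot>\<^sub>g H_map F = gr_id (cohomology M)"
    "K_comp k F G = K_id k N \<longleftrightarrow> H_map F \<cdot>\<^sub>g H_map G = gr_id (cohomology N)" if G: "G \<in> K_hom k N M" for G
  proof -
    have c: "K_comp k G F \<in> K_hom k M M" "K_comp k F G \<in> K_hom k N N"
      by (rule K_comp_hom[OF _ _ _ F G], simp_all) (rule K_comp_hom[OF _ _ _ G F], simp_all)
    show "K_comp k G F = K_id k M \<longleftrightarrow> H_map G \<cdot>\<^sub>g H_map F = gr_id (cohomology M)"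
      using H_map_faithful[OF _ _ c(1) K_id_hom[OF assms(1)]] H_map_comp[OF assms(1,2,1) F G] H_map_id[OF assms(1)] by auto
    show "K_comp k F G = K_id k N \<longleftrightarrow> H_map F \<cdot>\<^sub>g H_map G = gr_id (cohomology N)"
      using H_map_faithful[OF _ _ c(2) K_id_hom[OF assms(2)]] H_map_comp[OF assms(2,1,2) G F] H_map_id[OF assms(2)] by auto
  qed
  show ?thesis
  proof
    assume "K_iso k M N F"
    then show "gr_iso k (cohomology M) (cohomology N) (H_map F)"
      using eq hF H_map_hom[OF assms(2,1)] unfolding K_iso_def gr_iso_def by metis
  next
    assume "gr_iso k (cohomology M) (cohomology N) (H_map F)"
    then obtain \<Gamma> where \<Gamma>: "\<Gamma> \<in> gr_hom k (cohomology N) (cohomology M)" "\<Gamma> \<cdot>\<^sub>g H_map F = gr_id (cohomology M)"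
      "H_map F \<cdot>\<^sub>g \<Gamma> = gr_id (cohomology N)" by (auto simp: gr_iso_def)
    obtain G where G: "G \<in> K_hom k N M" "H_map G = \<Gamma>" using H_map_full[OF assms(2,1) \<Gamma>(1)] .
    then show "K_iso k M N F" using eq[OF G(1)] \<Gamma> F unfolding K_iso_def by auto
  qed
qed

lemma K_dual_OMap: "OMap (K_dual k G) X = kihom k (OMap G X) (kunit k)"
  by (simp add: K_dual_def)

text \<open>The families \<open>\<psi>\<close> over \<open>\<K>\<close> and \<open>\<phi>\<close>
  over \<open>gr\<close> correspond by \<open>\<phi> = delta_arrow \<cdot> H_map \<psi>\<close>.
  Invertibility and naturality in each variable are transported one by one.\<close>

lemma H_right_serre_iff:
  assumes C: "K_category k C" and S: "K_prefunctor k C C S"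
  shows "K_right_serre k C S \<longleftrightarrow> gr_right_serre k (H_cat k C) (H_fun S)"
proof -
  note o = K_category_Hom[OF C] and s = K_prefunctor_OMap[OF S] and g = K_category_graph[OF C]
  let ?\<delta>\<psi> = "\<lambda>\<psi> X Y. delta_arrow k (Hom C Y X) \<cdot>\<^sub>g H_map (\<psi> X Y)"
  have r: "fun_agree A H H" for A H by (simp add: fun_agree_def)
  have oop: "OMap (K_rep k (K_op k C) Z) X = Hom C X Z" "OMap (K_rep k C Z) X = Hom C Z X"
    "OMap (K_funcomp k (K_rep k C Z) S) X = Hom C Z (OMap S X)" for Z X
    by (simp_all add: K_rep_def K_op_def K_funcomp_def)
  have iso: "K_iso k (Hom C X (OMap S Y)) (kihom k (Hom C Y X) (kunit k)) (\<psi> X Y) \<longleftrightarrow>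
      gr_iso k (cohomology (Hom C X (OMap S Y))) (gihom k (cohomology (Hom C Y X)) (gunit k)) (?\<delta>\<psi> \<psi> X Y)"
    if \<psi>: "\<psi> X Y \<in> K_hom k (Hom C X (OMap S Y)) (kihom k (Hom C Y X) (kunit k))" and X: "X \<in> Obj C" and Y: "Y \<in> Obj C" for \<psi> X Y
  proof -
    note oo [simp] = o[OF X s[OF Y]] o[OF Y X]
    note h = H_map_hom[OF _ _ \<psi>, simplified]
    \<comment> \<open>Composition with the inverse of \<open>delta_arrow\<close> recovers
      \<open>H_map\<close> of \<open>\<psi>\<close>, so both are isomorphisms or neither is.\<close>
    obtain \<delta>' where \<delta>': "gr_iso k (gihom k (cohomology (Hom C Y X)) (gunit k)) (cohomology (kihom k (Hom C Y X) (kunit k))) \<delta>'"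
      "\<delta>' \<cdot>\<^sub>g delta_arrow k (Hom C Y X) = gr_id (cohomology (kihom k (Hom C Y X) (kunit k)))"
      using delta_iso[OF oo(2)] unfolding gr_iso_def by blast
    have "H_map (\<psi> X Y) = \<delta>' \<cdot>\<^sub>g ?\<delta>\<psi> \<psi> X Y"
      using gr_comp_assoc[OF _ _ h gr_iso_hom[OF delta_iso] gr_iso_hom[OF \<delta>'(1)]] gr_id_left[OF _ _ h] \<delta>'(2) by simp
    then have "gr_iso k (cohomology (Hom C X (OMap S Y))) (gihom k (cohomology (Hom C Y X)) (gunit k)) (?\<delta>\<psi> \<psi> X Y) \<longleftrightarrow>
       gr_iso k (cohomology (Hom C X (OMap S Y))) (cohomology (kihom k (Hom C Y X) (kunit k))) (H_map (\<psi> X Y))"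
      using gr_iso_comp[OF _ delta_iso[OF oo(2)], where X = "cohomology (Hom C X (OMap S Y))" and F = "H_map (\<psi> X Y)"]
        gr_iso_comp[OF _ \<delta>'(1), where X = "cohomology (Hom C X (OMap S Y))" and F = "?\<delta>\<psi> \<psi> X Y"] by auto
    then show ?thesis using H_iso_iff[OF _ _ \<psi>] by simp
  qed
  have nat1: "K_vnat k (Obj C) (K_rep k (K_op k C) (OMap S Y)) (K_dual k (K_rep k C Y)) (\<lambda>X. \<psi> X Y) \<longleftrightarrow>
      gr_vnat k (Obj C) (gr_rep k (gr_op k (H_cat k C)) (OMap S Y)) (gr_dual k (gr_rep k (H_cat k C) Y)) (\<lambda>X. ?\<delta>\<psi> \<psi> X Y)"
    if \<psi>: "\<And>X Y. X \<in> Obj C \<Longrightarrow> Y \<in> Obj C \<Longrightarrow> \<psi> X Y \<in> K_hom k (Hom C X (OMap S Y)) (kihom k (Hom C Y X) (kunit k))" and Y: "Y \<in> Obj C" for \<psi> Y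
  proof -
    note F = K_rep_op_module[OF g s[OF Y]]
    \<comment> \<open>The represented functor is contravariant, so its \<open>U\<close> is the
      flipped hom; the dual of a covariant functor asks for the flip of that flip.\<close>
    have G: "K_module k (\<lambda>X Y. (\<lambda>Y Z. Hom C Z Y) Y X) (Obj C) (K_rep k C Y)" using K_rep_module[OF g Y] by simp
    have "K_vnat k (Obj C) (K_rep k (K_op k C) (OMap S Y)) (K_dual k (K_rep k C Y)) (\<lambda>X. \<psi> X Y) \<longleftrightarrow>
       gr_vnat k (Obj C) (H_module k (K_rep k (K_op k C) (OMap S Y))) (H_module k (K_dual k (K_rep k C Y))) (\<lambda>X. H_map (\<psi> X Y))"
      by (rule H_vnat_iff[OF F K_dual_module[OF G]]) (simp add: oop K_dual_OMap \<psi> Y)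
    also have "\<dots> \<longleftrightarrow> gr_vnat k (Obj C) (H_module k (K_rep k (K_op k C) (OMap S Y))) (gr_dual k (H_module k (K_rep k C Y)))
        (\<lambda>X. delta_arrow k (OMap (K_rep k C Y) X) \<cdot>\<^sub>g H_map (\<psi> X Y))"
      by (rule H_dual_vnat_iff[OF F G]) (simp add: oop K_dual_OMap H_map_hom o s \<psi> Y)
    also have "\<dots> \<longleftrightarrow> gr_vnat k (Obj C) (gr_rep k (gr_op k (H_cat k C)) (OMap S Y)) (gr_dual k (gr_rep k (H_cat k C) Y)) (\<lambda>X. ?\<delta>\<psi> \<psi> X Y)"
      by (rule gr_vnat_cong[OF H_module_rep_op_agree[OF g s[OF Y]] gr_dual_agree[OF H_module_rep_agree[OF g Y]]]) (simp add: oop K_dual_OMap)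
    finally show ?thesis .
  qed
  have nat2: "K_vnat k (Obj C) (K_funcomp k (K_rep k C X) S) (K_dual k (K_rep k (K_op k C) X)) (\<psi> X) \<longleftrightarrow>
      gr_vnat k (Obj C) (gr_funcomp (gr_rep k (H_cat k C) X) (H_fun S)) (gr_dual k (gr_rep k (gr_op k (H_cat k C)) X)) (?\<delta>\<psi> \<psi> X)"
    if \<psi>: "\<And>X Y. X \<in> Obj C \<Longrightarrow> Y \<in> Obj C \<Longrightarrow> \<psi> X Y \<in> K_hom k (Hom C X (OMap S Y)) (kihom k (Hom C Y X) (kunit k))" and X: "X \<in> Obj C" for \<psi> X
  proof -
    note F = K_rep_funcomp_module(1)[OF C S X] and G = K_rep_op_module[OF g X]
    have "K_vnat k (Obj C) (K_funcomp k (K_rep k C X) S) (K_dual k (K_rep k (K_op k C) X)) (\<psi> X) \<longleftrightarrow>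
       gr_vnat k (Obj C) (H_module k (K_funcomp k (K_rep k C X) S)) (H_module k (K_dual k (K_rep k (K_op k C) X))) (\<lambda>Y. H_map (\<psi> X Y))"
      by (rule H_vnat_iff[OF F K_dual_module[OF G]]) (simp add: oop K_dual_OMap \<psi> X)
    also have "\<dots> \<longleftrightarrow> gr_vnat k (Obj C) (H_module k (K_funcomp k (K_rep k C X) S)) (gr_dual k (H_module k (K_rep k (K_op k C) X)))
        (\<lambda>Y. delta_arrow k (OMap (K_rep k (K_op k C) X) Y) \<cdot>\<^sub>g H_map (\<psi> X Y))"
      by (rule H_dual_vnat_iff[OF F G]) (simp add: oop K_dual_OMap H_map_hom o s \<psi> X)
    also have "\<dots> \<longleftrightarrow> gr_vnat k (Obj C) (gr_funcomp (gr_rep k (H_cat k C) X) (H_fun S)) (gr_dual k (gr_rep k (gr_op k (H_cat k C)) X)) (?\<delta>\<psi> \<psi> X)"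
      by (rule gr_vnat_cong[OF K_rep_funcomp_module(2)[OF C S X] gr_dual_agree[OF H_module_rep_op_agree[OF g X]]]) (simp add: oop K_dual_OMap)
    finally show ?thesis .
  qed
  show ?thesis
  proof
    assume "K_right_serre k C S"
    then obtain \<psi> where F: "K_functor k C C S"
      and 1: "\<forall>X\<in>Obj C. \<forall>Y\<in>Obj C. K_iso k (Hom C X (OMap S Y)) (kihom k (Hom C Y X) (kunit k)) (\<psi> X Y)"
      and 2: "\<forall>Y\<in>Obj C. K_vnat k (Obj C) (K_rep k (K_op k C) (OMap S Y)) (K_dual k (K_rep k C Y)) (\<lambda>X. \<psi> X Y)"
      and 3: "\<forall>X\<in>Obj C. K_vnat k (Obj C) (K_funcomp k (K_rep k C X) S) (K_dual k (K_rep k (K_op k C) X)) (\<psi> X)"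
      by (auto simp: K_right_serre_def)
    have \<psi>: "\<psi> X Y \<in> K_hom k (Hom C X (OMap S Y)) (kihom k (Hom C Y X) (kunit k))" if "X \<in> Obj C" "Y \<in> Obj C" for X Y
      using 1 that by (simp add: K_iso_def)
    show "gr_right_serre k (H_cat k C) (H_fun S)"
      unfolding gr_right_serre_def H_cat_sel H_fun_sel
    proof (intro conjI exI[of _ "?\<delta>\<psi> \<psi>"] ballI)
      show "gr_functor k (H_cat k C) (H_cat k C) (H_fun S)" using F H_functor_iff[OF C C S] by simp
      show "gr_iso k (cohomology (Hom C X (OMap S Y))) (gihom k (cohomology (Hom C Y X)) (gunit k)) (?\<delta>\<psi> \<psi> X Y)"
        if "X \<in> Obj C" "Y \<in> Obj C" for X Y using iso[of \<psi> X Y, OF \<psi>[OF that] that] 1 that by simp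
      show "gr_vnat k (Obj C) (gr_rep k (gr_op k (H_cat k C)) (OMap S Y)) (gr_dual k (gr_rep k (H_cat k C) Y)) (\<lambda>X. ?\<delta>\<psi> \<psi> X Y)"
        if "Y \<in> Obj C" for Y using nat1[of \<psi> Y, OF \<psi> that] 2 that by simp
      show "gr_vnat k (Obj C) (gr_funcomp (gr_rep k (H_cat k C) X) (H_fun S)) (gr_dual k (gr_rep k (gr_op k (H_cat k C)) X)) (?\<delta>\<psi> \<psi> X)"
        if "X \<in> Obj C" for X using nat2[of \<psi> X, OF \<psi> that] 3 that by simp
    qed
  next
    assume "gr_right_serre k (H_cat k C) (H_fun S)"
    then obtain \<phi> where F: "gr_functor k (H_cat k C) (H_cat k C) (H_fun S)"
      and 1: "\<forall>X\<in>Obj C. \<forall>Y\<in>Obj C. gr_iso k (cohomology (Hom C X (OMap S Y))) (gihom k (cohomology (Hom C Y X)) (gunit k)) (\<phi> X Y)"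
      and 2: "\<forall>Y\<in>Obj C. gr_vnat k (Obj C) (gr_rep k (gr_op k (H_cat k C)) (OMap S Y)) (gr_dual k (gr_rep k (H_cat k C) Y)) (\<lambda>X. \<phi> X Y)"
      and 3: "\<forall>X\<in>Obj C. gr_vnat k (Obj C) (gr_funcomp (gr_rep k (H_cat k C) X) (H_fun S)) (gr_dual k (gr_rep k (gr_op k (H_cat k C)) X)) (\<phi> X)"
      by (auto simp: gr_right_serre_def)
    \<comment> \<open>The component \<open>\<phi> X Y\<close> is carried back along
      \<open>delta_arrow\<close> to a map between cohomologies of complexes, where fullness
      applies.\<close>
    have "\<exists>f. f \<in> K_hom k (Hom C X (OMap S Y)) (kihom k (Hom C Y X) (kunit k)) \<and> delta_arrow k (Hom C Y X) \<cdot>\<^sub>g H_map f = \<phi> X Y"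
      if X: "X \<in> Obj C" and Y: "Y \<in> Obj C" for X Y
    proof -
      note oo [simp] = o[OF X s[OF Y]] o[OF Y X]
      have \<phi>: "\<phi> X Y \<in> gr_hom k (cohomology (Hom C X (OMap S Y))) (gihom k (cohomology (Hom C Y X)) (gunit k))"
        using 1 X Y gr_iso_hom by blast
      obtain \<delta>' where \<delta>': "\<delta>' \<in> gr_hom k (gihom k (cohomology (Hom C Y X)) (gunit k)) (cohomology (kihom k (Hom C Y X) (kunit k)))"
        "delta_arrow k (Hom C Y X) \<cdot>\<^sub>g \<delta>' = gr_id (gihom k (cohomology (Hom C Y X)) (gunit k))"
        using delta_iso[OF oo(2)] by (auto simp: gr_iso_def)
      have "\<delta>' \<cdot>\<^sub>g \<phi> X Y \<in> gr_hom k (cohomology (Hom C X (OMap S Y))) (cohomology (kihom k (Hom C Y X) (kunit k)))"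
        by (rule gr_comp_hom[OF _ \<phi> \<delta>'(1)]) simp
      then obtain f where f: "f \<in> K_hom k (Hom C X (OMap S Y)) (kihom k (Hom C Y X) (kunit k))" "H_map f = \<delta>' \<cdot>\<^sub>g \<phi> X Y"
        using H_map_full[OF oo(1) kihom_obj[OF oo(2) kunit_obj]] by metis
      have "delta_arrow k (Hom C Y X) \<cdot>\<^sub>g H_map f = (delta_arrow k (Hom C Y X) \<cdot>\<^sub>g \<delta>') \<cdot>\<^sub>g \<phi> X Y"
        unfolding f(2) by (rule gr_comp_assoc[symmetric, OF _ _ \<phi> \<delta>'(1) gr_iso_hom[OF delta_iso]]) simp_all
      also have "\<dots> = \<phi> X Y" unfolding \<delta>'(2) by (rule gr_id_left[OF _ _ \<phi>]) simp_all
      finally show ?thesis using f(1) by blast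
    qed
    then obtain \<psi> where \<psi>: "\<And>X Y. X \<in> Obj C \<Longrightarrow> Y \<in> Obj C \<Longrightarrow> \<psi> X Y \<in> K_hom k (Hom C X (OMap S Y)) (kihom k (Hom C Y X) (kunit k))"
      and \<psi>\<phi>: "\<And>X Y. X \<in> Obj C \<Longrightarrow> Y \<in> Obj C \<Longrightarrow> ?\<delta>\<psi> \<psi> X Y = \<phi> X Y" by metis
    show "K_right_serre k C S"
      unfolding K_right_serre_def
    proof (intro conjI exI[of _ \<psi>] ballI)
      show "K_functor k C C S" using F H_functor_iff[OF C C S] by simp
      show "K_iso k (Hom C X (OMap S Y)) (kihom k (Hom C Y X) (kunit k)) (\<psi> X Y)"
        if "X \<in> Obj C" "Y \<in> Obj C" for X Y using iso[of \<psi> X Y, OF \<psi>[OF that] that] 1 that \<psi>\<phi> by simp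
      show "K_vnat k (Obj C) (K_rep k (K_op k C) (OMap S Y)) (K_dual k (K_rep k C Y)) (\<lambda>X. \<psi> X Y)" if Y: "Y \<in> Obj C" for Y
        using nat1[of \<psi> Y, OF \<psi> Y] 2 Y gr_vnat_cong[OF r r, of "Obj C" "\<lambda>X. ?\<delta>\<psi> \<psi> X Y" "\<lambda>X. \<phi> X Y"] \<psi>\<phi> by blast
      show "K_vnat k (Obj C) (K_funcomp k (K_rep k C X) S) (K_dual k (K_rep k (K_op k C) X)) (\<psi> X)" if X: "X \<in> Obj C" for X
        using nat2[of \<psi> X, OF \<psi> X] 3 X gr_vnat_cong[OF r r, of "Obj C" "?\<delta>\<psi> \<psi> X" "\<phi> X"] \<psi>\<phi> by blast
    qed
  qed
qed

end

theorem corollary2p16: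
  fixes k :: "'k ring" and C :: "('o, 'k, 'a) K_cat"
  assumes "field k" and "K_category k C"
  shows "(\<forall>S. K_right_serre k C S \<longrightarrow> gr_right_serre k (H_cat k C) (H_fun S)) \<and>
         (\<forall>S. K_serre k C S \<longrightarrow> gr_serre k (H_cat k C) (H_fun S)) \<and>
         ((\<exists>S. gr_right_serre k (H_cat k C) S) \<longrightarrow> (\<exists>S. K_right_serre k C S)) \<and>
         ((\<exists>S. gr_serre k (H_cat k C) S) \<longrightarrow> (\<exists>S. K_serre k C S))"
proof -
  interpret field k by fact
  interpret ground_field k by unfold_locales
  note C = assms(2)
  have pre: "K_prefunctor k C C S" if "K_right_serre k C S" for S
    using that K_functor_prefunctor by (auto simp: K_right_serre_def)
  have right: "gr_right_serre k (H_cat k C) (H_fun S)" if "K_right_serre k C S" for S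
    using that H_right_serre_iff[OF C pre[OF that]] by blast
  have serre: "gr_serre k (H_cat k C) (H_fun S)" if "K_serre k C S" for S
  proof -
    have S: "K_right_serre k C S" using that by (simp add: K_serre_def)
    then show ?thesis
      using that right H_equivalence_iff[OF C C pre[OF S]] by (simp add: K_serre_def gr_serre_def)
  qed
  \<comment> \<open>The Serre functor on cohomology is exchanged for the image of its lift, which
    agrees with it on objects.\<close>
  have lift: "\<exists>F. K_prefunctor k C C F \<and> fun_agree (Obj C) S (H_fun F) \<and> K_right_serre k C F"
    if S: "gr_right_serre k (H_cat k C) S" for S
  proof -
    have "gr_functor k (H_cat k C) (H_cat k C) S" using S by (simp add: gr_right_serre_def)
    then obtain F where F: "K_prefunctor k C C F" "fun_agree (Obj C) S (H_fun F)" using H_functor_lift[OF C C] by blast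
    then have "gr_right_serre k (H_cat k C) (H_fun F)" using gr_right_serre_cong[of "H_cat k C", OF _ S] by simp
    then show ?thesis using F H_right_serre_iff[OF C F(1)] by blast
  qed
  have "\<exists>F. K_serre k C F" if S: "gr_serre k (H_cat k C) S" for S
  proof -
    have "gr_right_serre k (H_cat k C) S" using S by (simp add: gr_serre_def)
    then obtain F where F: "K_prefunctor k C C F" "fun_agree (Obj C) S (H_fun F)" "K_right_serre k C F" using lift by blast
    \<comment> \<open>The lift that serves for the right Serre property also serves here, since
      being an equivalence depends on the values at objects only.\<close>
    have "gr_equivalence k (H_cat k C) (H_cat k C) (H_fun F)"
      using S gr_equivalence_cong[of "H_cat k C" S "H_fun F"] F(2) by (simp add: gr_serre_def)
    then show ?thesis using F H_equivalence_iff[OF C C F(1)] by (auto simp: K_serre_def)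
  qed
  then show ?thesis using right serre lift by blast
qed

end
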